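(* Consider the impulse control problem described in the context with $Y_t=x+\sigma w_t+N_t$ and $\phi(x)=(x-\rho)^2$. Suppose there exist constants $L_1\le0$, $L_2\le0$, $L_3\le0$ and $a<\alpha\le\beta<b$ such that, with $$f(x)=k_1(x-\rho)^2+k_2(x-\rho)+k_3+L_1e^{(\theta+c_1)x}+L_2e^{(\theta+c_2)x}+L_3e^{(\theta+c_3)x},$$ the following seven equations hold: $f'(a)=-c$, $f'(\alpha)=-c$, $f'(b)=d$, $f'(\beta)=d$, $f(a)=f(\alpha)+C+c(\alpha-a)$, $f(b)=f(\beta)+D+d(b-\beta)$, and $\tfrac12\sigma^2f''(b)+(b-\rho)^2-(1+\lambda)f(b)+e^{\theta b}\zeta=0$ where $\zeta=\int_b^\infty[f(b)+d(z-b)]\theta e^{-\theta z}dz$. Define $h(x)=f(a)-c(x-a)$ for $x\le a$, $h(x)=f(x)$ for $a\le x\le b$, $h(x)=f(b)+d(x-b)$ for $x\ge b$. Then $h=V$, and the control band policy $(T^*,\Xi^* )$ with parameters $(a,\alpha,\beta,b)$ is optimal.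
   Context: $Y_t=x+\sigma w_t+N_t$ under $P_x$, where $w$ is a standard Wiener process and $N$ is an independent compound Poisson process with jump rate $1$ and jump sizes exponentially distributed with rate $\theta>0$ (Lévy measure $\nu(dy)=\theta e^{-\theta y}dy$ on $y\ge0$). Its generator is $\mathcal Af(x)=\tfrac{\sigma^2}{2}f''(x)+\int_0^\infty[f(x+y)-f(x)]\nu(dy)$. An impulse control $(T,\Xi)$ consists of stopping times $0\le\tau_1<\tau_2<\cdots$ and $\mathcal F_{\tau_n}$-measurable $\xi_n\ne0$ (if only finitely many interventions, later $\tau=\infty$, $\xi=0$); the controlled process is $X_t=Y_t+\sum_i1_{\{\tau_i\le t\}}\xi_i$. Fix $\lambda>0$; a control is admissible if $e^{-\lambda t}|X_t|<K$ a.s. for all $t$, for some constant $K$. Let $g(\xi)=C+c\xi$ for $\xi>0$, $g(0)=0$, $g(\xi)=D-d\xi$ for $\xi<0$ ($C,D>0$, $c,d\ge0$), $\rho\in\mathbb R$, $I(x,T,\Xi)=E_x[\int_0^\infty e^{-\lambda t}(X_t-\rho)^2dt+\sum_ne^{-\lambda\tau_n}g(\xi_n)]$ and $V(x)=\inf$ of $I$ over admissible controls. Constants: $k_1=1/\lambda$, $k_2=2/(\theta\lambda^2)$, $k_3=(2\lambda+2+\theta^2\lambda\sigma^2)/(\lambda^3\theta^2)$; $c_1<-\theta<c_2<0<c_3$ are the three roots of $P(y)=\tfrac12\sigma^2y^3+\sigma^2\theta y^2+(\tfrac12\sigma^2\theta^2-\lambda-1)y-\theta$. The control band policy with parameters $a<\alpha\le\beta<b$: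 $\tau^*_1=\inf\{t\ge0:X_{t-}+\Delta Y_t\notin(a,b)\}$, $\tau^*_n=\inf\{t>\tau^*_{n-1}:X_{t-}+\Delta Y_t\notin(a,b)\}$ for $n\ge2$ ($X_{0-}=x$, $\Delta Y_0=0$), with $\xi^*_n=\beta-(X_{\tau^*_n-}+\Delta Y_{\tau^*_n})$ if $X_{\tau^*_n-}+\Delta Y_{\tau^*_n}\ge b$ and $\xi^*_n=\alpha-(X_{\tau^*_n-}+\Delta Y_{\tau^*_n})$ if $X_{\tau^*_n-}+\Delta Y_{\tau^*_n}\le a$. *)

theory Defs
  imports "HOL-Probability.Probability"
begin

definition std_wiener :: "'a measure \<Rightarrow> (real \<Rightarrow> 'a \<Rightarrow> real) \<Rightarrow> bool" where
  "std_wiener M w \<longleftrightarrow>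
     (\<forall>t. w t \<in> borel_measurable M) \<and>
     (\<forall>\<omega>\<in>space M. w 0 \<omega> = 0 \<and> continuous_on {0..} (\<lambda>t. w t \<omega>)) \<and>
     (\<forall>s t. 0 \<le> s \<and> s < t \<longrightarrow>
        distributed M lborel (\<lambda>\<omega>. w t \<omega> - w s \<omega>) (normal_density 0 (sqrt (t - s)))) \<and>
     (\<forall>(ts::nat \<Rightarrow> real) n. 0 \<le> ts 0 \<and> (\<forall>i<n. ts i < ts (Suc i)) \<longrightarrow>
        prob_space.indep_vars M (\<lambda>_. borel) (\<lambda>i \<omega>. w (ts (Suc i)) \<omega> - w (ts i) \<omega>) {..<n})"

definition arrival :: "(nat \<Rightarrow> 'a \<Rightarrow> real) \<Rightarrow> nat \<Rightarrow> 'a \<Rightarrow> real" where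
  "arrival E k \<omega> = (\<Sum>i\<le>k. E i \<omega>)"

definition cpoisson :: "(nat \<Rightarrow> 'a \<Rightarrow> real) \<Rightarrow> (nat \<Rightarrow> 'a \<Rightarrow> real) \<Rightarrow> real \<Rightarrow> 'a \<Rightarrow> real" where
  "cpoisson E J t \<omega> = (\<Sum>k\<in>{k. arrival E k \<omega> \<le> t}. J k \<omega>)"

definition noise_model ::
  "'a measure \<Rightarrow> real \<Rightarrow> (real \<Rightarrow> 'a \<Rightarrow> real) \<Rightarrow> (nat \<Rightarrow> 'a \<Rightarrow> real) \<Rightarrow> (nat \<Rightarrow> 'a \<Rightarrow> real) \<Rightarrow> bool" where
  "noise_model M \<theta> w E J \<longleftrightarrow>
     prob_space M \<and> std_wiener M w \<and>
     (\<forall>k. distributed M lborel (E k) (exponential_density 1)) \<and>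
     (\<forall>k. distributed M lborel (J k) (exponential_density \<theta>)) \<and>
     prob_space.indep_vars M (\<lambda>_. borel) E UNIV \<and>
     prob_space.indep_vars M (\<lambda>_. borel) J UNIV \<and>
     prob_space.indep_var M (PiM UNIV (\<lambda>_::nat. borel)) (\<lambda>\<omega> k. E k \<omega>)
               (PiM UNIV (\<lambda>_::nat. borel)) (\<lambda>\<omega> k. J k \<omega>) \<and>
     (\<lambda>\<omega> t. w t \<omega>) \<in> measurable M (PiM UNIV (\<lambda>_::real. borel)) \<and>
     prob_space.indep_set M
       (sets (vimage_algebra (space M) (\<lambda>\<omega> t. w t \<omega>) (PiM UNIV (\<lambda>_::real. borel))))
       (sets (vimage_algebra (space M) (\<lambda>\<omega> k. (E k \<omega>, J k \<omega>))
                (PiM UNIV (\<lambda>_::nat. borel \<Otimes>\<^sub>M borel))))"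

definition complete_space_measure :: "'a measure \<Rightarrow> bool" where
  "complete_space_measure M \<longleftrightarrow> (\<forall>A\<in>null_sets M. \<forall>B. B \<subseteq> A \<longrightarrow> B \<in> sets M)"

section \<open>Filtration (natural filtration of (w,N), augmented by null sets, right-continuous)\<close>

definition nat_gen :: "'a measure \<Rightarrow> (real \<Rightarrow> 'a \<Rightarrow> real) \<Rightarrow> (real \<Rightarrow> 'a \<Rightarrow> real) \<Rightarrow> real \<Rightarrow> 'a set set" where
  "nat_gen M w N t =
     {{\<omega>\<in>space M. w s \<omega> \<in> B} | s B. 0 \<le> s \<and> s \<le> t \<and> B \<in> sets borel} \<union>
     {{\<omega>\<in>space M. N s \<omega> \<in> B} | s B. 0 \<le> s \<and> s \<le> t \<and> B \<in> sets borel}"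

definition filt :: "'a measure \<Rightarrow> (real \<Rightarrow> 'a \<Rightarrow> real) \<Rightarrow> (real \<Rightarrow> 'a \<Rightarrow> real) \<Rightarrow> real \<Rightarrow> 'a set set" where
  "filt M w N t = {A \<in> sets M. \<forall>s>t. \<exists>B\<in>sigma_sets (space M) (nat_gen M w N s).
                      (A - B) \<union> (B - A) \<in> null_sets M}"

definition is_stopping_time :: "'a measure \<Rightarrow> (real \<Rightarrow> 'a set set) \<Rightarrow> ('a \<Rightarrow> ennreal) \<Rightarrow> bool" where
  "is_stopping_time M F \<tau> \<longleftrightarrow> (\<forall>t\<ge>0. {\<omega>\<in>space M. \<tau> \<omega> \<le> ennreal t} \<in> F t)"

definition stopped_sets :: "'a measure \<Rightarrow> (real \<Rightarrow> 'a set set) \<Rightarrow> ('a \<Rightarrow> ennreal) \<Rightarrow> 'a set set" where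
  "stopped_sets M F \<tau> = {A \<in> sets M. \<forall>t\<ge>0. A \<inter> {\<omega>\<in>space M. \<tau> \<omega> \<le> ennreal t} \<in> F t}"

text \<open>Index n = 0,1,2,... corresponds to the paper's tau_1, tau_2, ...; tau n = top means "no n-th intervention".\<close>
definition impulse_control ::
  "'a measure \<Rightarrow> (real \<Rightarrow> 'a set set) \<Rightarrow> (nat \<Rightarrow> 'a \<Rightarrow> ennreal) \<Rightarrow> (nat \<Rightarrow> 'a \<Rightarrow> real) \<Rightarrow> bool" where
  "impulse_control M F \<tau> \<xi> \<longleftrightarrow>
     (\<forall>n. is_stopping_time M F (\<tau> n)) \<and>
     (\<forall>n B. B \<in> sets borel \<longrightarrow> {\<omega>\<in>space M. \<xi> n \<omega> \<in> B} \<in> stopped_sets M F (\<tau> n)) \<and>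
     (AE \<omega> in M. (\<forall>n. \<tau> n \<omega> \<le> \<tau> (Suc n) \<omega> \<and>
                       (\<tau> n \<omega> < \<top> \<longrightarrow> \<tau> n \<omega> < \<tau> (Suc n) \<omega> \<and> \<xi> n \<omega> \<noteq> 0) \<and>
                       (\<tau> n \<omega> = \<top> \<longrightarrow> \<xi> n \<omega> = 0)) \<and>
                  (\<forall>t. finite {n. \<tau> n \<omega> \<le> ennreal t}))"

definition ctrl_X :: "(real \<Rightarrow> 'a \<Rightarrow> real) \<Rightarrow> (nat \<Rightarrow> 'a \<Rightarrow> ennreal) \<Rightarrow> (nat \<Rightarrow> 'a \<Rightarrow> real) \<Rightarrow> real \<Rightarrow> 'a \<Rightarrow> real" where
  "ctrl_X Y \<tau> \<xi> t \<omega> = Y t \<omega> + (\<Sum>n\<in>{n. \<tau> n \<omega> \<le> ennreal t}. \<xi> n \<omega>)"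

definition admissible ::
  "'a measure \<Rightarrow> (real \<Rightarrow> 'a set set) \<Rightarrow> real \<Rightarrow> (real \<Rightarrow> 'a \<Rightarrow> real) \<Rightarrow> (nat \<Rightarrow> 'a \<Rightarrow> ennreal) \<Rightarrow> (nat \<Rightarrow> 'a \<Rightarrow> real) \<Rightarrow> bool" where
  "admissible M F lam Y \<tau> \<xi> \<longleftrightarrow> impulse_control M F \<tau> \<xi> \<and>
     (\<exists>K. AE \<omega> in M. \<forall>t\<ge>0. exp (- lam * t) * \<bar>ctrl_X Y \<tau> \<xi> t \<omega>\<bar> < K)"

definition imp_cost :: "real \<Rightarrow> real \<Rightarrow> real \<Rightarrow> real \<Rightarrow> real \<Rightarrow> real" where
  "imp_cost C c D d \<xi> = (if \<xi> > 0 then C + c * \<xi> else if \<xi> < 0 then D - d * \<xi> else 0)"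

definition cost ::
  "'a measure \<Rightarrow> real \<Rightarrow> real \<Rightarrow> (real \<Rightarrow> real) \<Rightarrow> (real \<Rightarrow> 'a \<Rightarrow> real) \<Rightarrow> (nat \<Rightarrow> 'a \<Rightarrow> ennreal) \<Rightarrow> (nat \<Rightarrow> 'a \<Rightarrow> real) \<Rightarrow> ennreal" where
  "cost M lam \<rho> g Y \<tau> \<xi> =
     (\<integral>\<^sup>+ \<omega>. (\<integral>\<^sup>+ t. indicator {0..} t * ennreal (exp (- lam * t) * (ctrl_X Y \<tau> \<xi> t \<omega> - \<rho>)\<^sup>2) \<partial>lborel)
             + (\<Sum>n. if \<tau> n \<omega> = \<top> then 0 else ennreal (exp (- lam * enn2real (\<tau> n \<omega>)) * g (\<xi> n \<omega>))) \<partial>M)"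

definition value_fn ::
  "'a measure \<Rightarrow> (real \<Rightarrow> 'a set set) \<Rightarrow> real \<Rightarrow> real \<Rightarrow> (real \<Rightarrow> real) \<Rightarrow> (real \<Rightarrow> 'a \<Rightarrow> real) \<Rightarrow> ennreal" where
  "value_fn M F lam \<rho> g Y = Inf {cost M lam \<rho> g Y \<tau> \<xi> | \<tau> \<xi>. admissible M F lam Y \<tau> \<xi>}"

text \<open>First time t \<ge> 0 satisfying P t at which y t + S leaves (a,b); top if none.
  Between interventions X(t-) + Delta Y(t) = y t + S where S is the accumulated shift.\<close>
definition band_time :: "real \<Rightarrow> real \<Rightarrow> (real \<Rightarrow> real) \<Rightarrow> (real \<Rightarrow> bool) \<Rightarrow> real \<Rightarrow> ennreal" where
  "band_time a b y P S = Inf {ennreal t | t. 0 \<le> t \<and> P t \<and> y t + S \<notin> {a<..<b}}"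

definition band_jump :: "real \<Rightarrow> real \<Rightarrow> real \<Rightarrow> (real \<Rightarrow> real) \<Rightarrow> ennreal \<Rightarrow> real \<Rightarrow> real" where
  "band_jump \<alpha> \<beta> b y \<tau> S =
     (if \<tau> = \<top> then 0 else
        (let z = y (enn2real \<tau>) + S in if z \<ge> b then \<beta> - z else \<alpha> - z))"

text \<open>band ... n = (tau_{n+1}, xi_{n+1}, accumulated shift xi_1 + ... + xi_{n+1}).\<close>
primrec band :: "real \<Rightarrow> real \<Rightarrow> real \<Rightarrow> real \<Rightarrow> (real \<Rightarrow> real) \<Rightarrow> nat \<Rightarrow> ennreal \<times> real \<times> real" where
  "band a \<alpha> \<beta> b y 0 =
     (let \<tau> = band_time a b y (\<lambda>t. True) 0; \<xi> = band_jump \<alpha> \<beta> b y \<tau> 0 in (\<tau>, \<xi>, \<xi>))"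
| "band a \<alpha> \<beta> b y (Suc n) =
     (let (\<tau>p, _, S) = band a \<alpha> \<beta> b y n;
          \<tau> = band_time a b y (\<lambda>t. \<tau>p < ennreal t) S;
          \<xi> = band_jump \<alpha> \<beta> b y \<tau> S in (\<tau>, \<xi>, S + \<xi>))"

definition band_tau :: "real \<Rightarrow> real \<Rightarrow> real \<Rightarrow> real \<Rightarrow> (real \<Rightarrow> 'a \<Rightarrow> real) \<Rightarrow> nat \<Rightarrow> 'a \<Rightarrow> ennreal" where
  "band_tau a \<alpha> \<beta> b Y n \<omega> = fst (band a \<alpha> \<beta> b (\<lambda>t. Y t \<omega>) n)"

definition band_xi :: "real \<Rightarrow> real \<Rightarrow> real \<Rightarrow> real \<Rightarrow> (real \<Rightarrow> 'a \<Rightarrow> real) \<Rightarrow> nat \<Rightarrow> 'a \<Rightarrow> real" where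
  "band_xi a \<alpha> \<beta> b Y n \<omega> = fst (snd (band a \<alpha> \<beta> b (\<lambda>t. Y t \<omega>) n))"

end

theory Submission
  imports Defs
begin

text \<open>
  The function \<open>h\<close> solves the quasi-variational inequality of the problem: it is Lipschitz and continuously
  differentiable, it satisfies \<open>h z \<le> h (z + \<xi>) + g \<xi>\<close> with equality for the interventions of the band policy,
  and \<open>A h - lam h + (x - \<rho>)\<^sup>2\<close> is nonnegative everywhere and zero on \<open>(a, b)\<close>.

  Ito calculus is replaced by time discretisation. A second-order Taylor expansion together with the law of
  the increment over a step of length \<open>\<epsilon>\<close> turns the inequality for the generator into
  \<open>h y - \<epsilon> (y - \<rho>)\<^sup>2 - o(\<epsilon>) \<le> exp (- lam \<epsilon>) E h (y + Y\<^sub>\<epsilon>)\<close>, uniformly for bounded \<open>y\<close>; independence of increments lets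
  one apply this along a grid, and refining the grid gives the lower bound for every admissible control.
  For the band policy the reverse estimate holds while the state is in \<open>[a, b]\<close>, for smooth approximations of \<open>h\<close> that
  remove the jump of \<open>h''\<close> at the ends of the band. Interventions between grid points cost an error that is linear in the
  increment of \<open>Y\<close> from the intervention time to the next grid point; by independence its mean
  tends to zero with the mesh. Stopping at the \<open>L\<close>-th intervention keeps the number of errors bounded,
  and \<open>L \<rightarrow> \<infinity>\<close> is taken by Fatou's lemma.
\<close>

section \<open>The candidate value function\<close>

text \<open>Three obstacles shape the argument. The sign of the generator term outside
  \<open>[a, b]\<close> is not assumed: it comes from \<open>L1\<close>, \<open>L2\<close>,
  \<open>L3\<close> being nonpositive, through the sign of the fourth derivative of \<open>f\<close>
  and the monotonicity of an auxiliary function \<open>R\<close>. Next, admissibility bounds only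
  the discounted state, so the terminal term with \<open>exp (- lam * T)\<close> and the mean of
  \<open>h\<close> at time \<open>T\<close> need not vanish. But \<open>h\<close> grows at most
  linearly and is dominated by a quadratic: a terminal term bounded away from 0 at all horizons
  would make the expected running cost infinite. Finally, the filtration is augmented and
  right-continuous and interventions happen at stopping times, whereas the model gives independence
  at fixed times of the natural filtration. Increments are started slightly later and the gap is
  closed by a limit; stopping times are rounded up to fine grids, split into their countably many
  values, and recovered by Fatou. Path formulas hold only on a set of full measure, so completeness
  of the measure is used whenever they are turned into measurability.\<close>

definition expo :: "real \<Rightarrow> real measure" where
 "expo \<theta> = density lborel (\<lambda>x. ennreal (exponential_density \<theta> x))"

definition jump_mean :: "real \<Rightarrow> (real \<Rightarrow> real) \<Rightarrow> real \<Rightarrow> real" where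
 "jump_mean \<theta> v y = (\<integral>z. v (y + z) \<partial>expo \<theta>)"

lemma sets_expo [simp, measurable_cong]: "sets (expo \<theta>) = sets borel"
 and space_expo [simp]: "space (expo \<theta>) = UNIV"
 by (simp_all add: expo_def)

lemma prob_space_expo: "0 < \<theta> \<Longrightarrow> prob_space (expo \<theta>)"
 unfolding expo_def by (rule prob_space_exponential_density)

lemma distributed_id_expo: "0 < \<theta> \<Longrightarrow> distributed (expo \<theta>) lborel (\<lambda>x. x) (exponential_density \<theta>)"
 unfolding expo_def distributed_def
 by (auto simp: exponential_density_nonneg intro!: measure_eqI simp: emeasure_distr)

lemma integrable_expo_id: "0 < \<theta> \<Longrightarrow> integrable (expo \<theta>) (\<lambda>x. x)"
proof -
 assume \<theta>: "0 < \<theta>"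
 interpret prob_space "expo \<theta>" using \<theta> by (rule prob_space_expo)
 show ?thesis
  using erlang_ith_moment_integrable[OF \<theta> distributed_id_expo[OF \<theta>], of 1] by simp
qed

lemma integral_expo_id: "0 < \<theta> \<Longrightarrow> (\<integral>x. x \<partial>expo \<theta>) = 1 / \<theta>"
proof -
 assume \<theta>: "0 < \<theta>"
 interpret prob_space "expo \<theta>" using \<theta> by (rule prob_space_expo)
 show ?thesis
  using exponential_distributed_expectation[OF \<theta> distributed_id_expo[OF \<theta>]] by simp
qed

lemma lipschitz_borel:
 fixes v :: "real \<Rightarrow> real"
 assumes "\<And>x y. \<bar>v x - v y\<bar> \<le> L * \<bar>x - y\<bar>"
 shows "v \<in> borel_measurable borel"
proof -
 have "L \<ge> 0" using assms[of 1 0] abs_ge_zero[of "v 1 - v 0"] by simp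
 then have "L-lipschitz_on UNIV v"
  using assms by (auto simp: lipschitz_on_def dist_real_def)
 then show ?thesis
  by (intro borel_measurable_continuous_onI lipschitz_on_continuous_on)
qed

lemma integrable_expo_lipschitz:
 fixes v :: "real \<Rightarrow> real"
 assumes \<theta>: "0 < \<theta>" and L: "\<And>x y. \<bar>v x - v y\<bar> \<le> L * \<bar>x - y\<bar>"
 shows "integrable (expo \<theta>) (\<lambda>z. v (y + z))"
proof -
 interpret prob_space "expo \<theta>" using \<theta> by (rule prob_space_expo)
 have [measurable]: "v \<in> borel_measurable borel" by (rule lipschitz_borel[OF L])
 have "L \<ge> 0" using L[of 1 0] abs_ge_zero[of "v 1 - v 0"] by simp
 have i: "integrable (expo \<theta>) (\<lambda>z. \<bar>v y\<bar> + L * \<bar>z\<bar>)"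
  using integrable_expo_id[OF \<theta>] by auto
 show ?thesis
 proof (rule Bochner_Integration.integrable_bound[OF i])
  show "AE z in expo \<theta>. norm (v (y + z)) \<le> norm (\<bar>v y\<bar> + L * \<bar>z\<bar>)"
   using L[of "y + _" y] \<open>L \<ge> 0\<close> by (intro AE_I2) (smt (verit, best) add_diff_cancel_left' mult_nonneg_nonneg abs_ge_zero real_norm_def)
 qed measurable
qed

lemma jump_mean_lipschitz:
 assumes \<theta>: "0 < \<theta>" and L: "\<And>x y. \<bar>v x - v y\<bar> \<le> L * \<bar>x - y\<bar>"
 shows "\<bar>jump_mean \<theta> v y - jump_mean \<theta> v y'\<bar> \<le> L * \<bar>y - y'\<bar>"
proof -
 interpret prob_space "expo \<theta>" using \<theta> by (rule prob_space_expo)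
 note i = integrable_expo_lipschitz[OF \<theta> L]
 have "\<bar>jump_mean \<theta> v y - jump_mean \<theta> v y'\<bar> = \<bar>\<integral>z. v (y + z) - v (y' + z) \<partial>expo \<theta>\<bar>"
  unfolding jump_mean_def by (simp add: i)
 also have "\<dots> \<le> (\<integral>z. \<bar>v (y + z) - v (y' + z)\<bar> \<partial>expo \<theta>)"
  by (rule integral_abs_bound)
 also have "\<dots> \<le> (\<integral>z. L * \<bar>y - y'\<bar> \<partial>expo \<theta>)"
 proof (rule integral_mono)
  show "\<bar>v (y + z) - v (y' + z)\<bar> \<le> L * \<bar>y - y'\<bar>" for z
   using L[of "y + z" "y' + z"] by simp
 qed (auto intro!: i)
 finally show ?thesis by (simp add: prob_space[simplified])
qed

lemma jump_mean_minus_bound: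
 assumes \<theta>: "0 < \<theta>" and L: "\<And>x y. \<bar>v x - v y\<bar> \<le> L * \<bar>x - y\<bar>"
 shows "\<bar>jump_mean \<theta> v y - v y\<bar> \<le> L / \<theta>"
proof -
 interpret prob_space "expo \<theta>" using \<theta> by (rule prob_space_expo)
 note i = integrable_expo_lipschitz[OF \<theta> L]
 have "L \<ge> 0" using L[of 1 0] abs_ge_zero[of "v 1 - v 0"] by simp
 have pos: "AE z in expo \<theta>. 0 \<le> z"
  unfolding expo_def by (subst AE_density) (auto simp: exponential_density_def)
 have "\<bar>jump_mean \<theta> v y - v y\<bar> = \<bar>\<integral>z. v (y + z) - v y \<partial>expo \<theta>\<bar>"
  unfolding jump_mean_def by (simp add: i prob_space[simplified])
 also have "\<dots> \<le> (\<integral>z. \<bar>v (y + z) - v y\<bar> \<partial>expo \<theta>)"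
  by (rule integral_abs_bound)
 also have "\<dots> \<le> (\<integral>z. L * z \<partial>expo \<theta>)"
 proof (rule integral_mono_AE)
  show "AE z in expo \<theta>. \<bar>v (y + z) - v y\<bar> \<le> L * z"
   using pos
  proof eventually_elim
   case (elim z)
   then show ?case using L[of "y + z" y] by simp
  qed
 qed (auto intro!: i integrable_expo_id \<theta>)
 finally show ?thesis using integral_expo_id[OF \<theta>] by simp
qed

lemma jump_mean_close:
 assumes \<theta>: "0 < \<theta>" and L: "\<And>x y. \<bar>v x - v y\<bar> \<le> L * \<bar>x - y\<bar>"
  and L': "\<And>x y. \<bar>u x - u y\<bar> \<le> L' * \<bar>x - y\<bar>"
  and close: "\<And>x. \<bar>v x - u x\<bar> \<le> \<eta>"
 shows "\<bar>jump_mean \<theta> v y - jump_mean \<theta> u y\<bar> \<le> \<eta>"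
proof -
 interpret prob_space "expo \<theta>" using \<theta> by (rule prob_space_expo)
 note i = integrable_expo_lipschitz[OF \<theta> L] integrable_expo_lipschitz[OF \<theta> L']
 have "\<bar>jump_mean \<theta> v y - jump_mean \<theta> u y\<bar> = \<bar>\<integral>z. v (y + z) - u (y + z) \<partial>expo \<theta>\<bar>"
  unfolding jump_mean_def by (simp add: i)
 also have "\<dots> \<le> (\<integral>z. \<bar>v (y + z) - u (y + z)\<bar> \<partial>expo \<theta>)"
  by (rule integral_abs_bound)
 also have "\<dots> \<le> (\<integral>z. \<eta> \<partial>expo \<theta>)"
  by (rule integral_mono) (auto intro!: i close)
 finally show ?thesis by (simp add: prob_space[simplified])
qed

text \<open>The shift by \<open>x\<close> absorbs the density into a tail integral. This is the form
  in which the seventh equation states its integral, and it reduces the dependence on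
  \<open>x\<close> to a prefactor and a moving lower limit.\<close>

lemma jump_mean_tail:
 assumes [measurable]: "g \<in> borel_measurable borel" and \<theta>: "0 < \<theta>"
 shows "jump_mean \<theta> g x = exp (\<theta> * x) * (LBINT z:{x..}. g z * \<theta> * exp (- \<theta> * z))"
proof -
 have "jump_mean \<theta> g x = (\<integral>z. exponential_density \<theta> z * g (x + z) \<partial>lborel)"
  unfolding jump_mean_def expo_def using \<theta>
  by (subst integral_density) (auto simp: exponential_density_nonneg)
 also have "\<dots> = (\<integral>z. exp (\<theta> * x) * (indicator {x..} (x + 1 * z) *\<^sub>R (g (x + 1 * z) * \<theta> * exp (- \<theta> * (x + 1 * z)))) \<partial>lborel)"
 proof (rule Bochner_Integration.integral_cong)
  fix z
  have "exp (- z * \<theta>) = exp (\<theta> * x) * exp (- \<theta> * (x + 1 * z))"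
   by (simp add: exp_add[symmetric] algebra_simps)
  then show "exponential_density \<theta> z * g (x + z) = exp (\<theta> * x) * (indicator {x..} (x + 1 * z) *\<^sub>R (g (x + 1 * z) * \<theta> * exp (- \<theta> * (x + 1 * z))))"
   by (auto simp: exponential_density_def split: split_indicator)
 qed simp
 also have "\<dots> = exp (\<theta> * x) * (\<integral>z. indicator {x..} (x + 1 * z) *\<^sub>R (g (x + 1 * z) * \<theta> * exp (- \<theta> * (x + 1 * z))) \<partial>lborel)"
  by simp
 also have "(\<integral>z. indicator {x..} (x + 1 * z) *\<^sub>R (g (x + 1 * z) * \<theta> * exp (- \<theta> * (x + 1 * z))) \<partial>lborel)
   = (LBINT z:{x..}. g z * \<theta> * exp (- \<theta> * z))"
  unfolding set_lebesgue_integral_def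
  by (subst lborel_integral_real_affine[where c=1 and t=x]) simp_all
 finally show ?thesis .
qed

text \<open>As a function of \<open>x\<close>, \<open>jump_mean \<theta> g\<close> solves
  \<open>u' = \<theta> * (u - g)\<close>, and the hypothesis on \<open>F\<close> is the same
  equation with an integrating factor. Two solutions differ by a multiple of
  \<open>exp (\<theta> * x)\<close>, which gives the factor in front of the difference at
  \<open>y\<close>. Used with \<open>F\<close> the local part of the generator on the band, and with
  an affine \<open>F\<close> to the left of it.\<close>

lemma jump_mean_split:
 fixes g F :: "real \<Rightarrow> real"
 assumes \<theta>: "0 < \<theta>" and L: "\<And>x y. \<bar>g x - g y\<bar> \<le> L * \<bar>x - y\<bar>" and xy: "x \<le> y"
  and F: "\<And>z. x \<le> z \<Longrightarrow> z \<le> y \<Longrightarrow> ((\<lambda>z. F z * exp (- \<theta> * z)) has_real_derivative - (g z * \<theta> * exp (- \<theta> * z))) (at z)"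
 shows "jump_mean \<theta> g x = F x + exp (- \<theta> * (y - x)) * (jump_mean \<theta> g y - F y)"
proof -
 have [measurable]: "g \<in> borel_measurable borel" by (rule lipschitz_borel[OF L])
 have "L-lipschitz_on UNIV g"
  using L L[of 1 0] abs_ge_zero[of "g 1 - g 0"] by (auto simp: lipschitz_on_def dist_real_def)
 then have cont: "continuous_on UNIV g" by (rule lipschitz_on_continuous_on)
 have int: "set_integrable lborel {r..} (\<lambda>z. g z * \<theta> * exp (- \<theta> * z))" for r
 proof -
  have "integrable lborel (\<lambda>z. exponential_density \<theta> z *\<^sub>R g (r + z))"
   using integrable_expo_lipschitz[OF \<theta> L, of r] \<theta> unfolding expo_def
   by (subst (asm) integrable_density) (auto simp: exponential_density_nonneg)
  then have "integrable lborel (\<lambda>z. exp (- \<theta> * r) * (exponential_density \<theta> z *\<^sub>R g (r + z)))"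
   by (rule integrable_mult_right)
  also have "(\<lambda>z. exp (- \<theta> * r) * (exponential_density \<theta> z *\<^sub>R g (r + z))) =
   (\<lambda>z. indicator {r..} (r + 1 * z) *\<^sub>R (g (r + 1 * z) * \<theta> * exp (- \<theta> * (r + 1 * z))))"
  proof
   fix z
   have "exp (- \<theta> * (r + 1 * z)) = exp (- \<theta> * r) * exp (- z * \<theta>)"
    by (simp add: exp_add[symmetric] algebra_simps)
   then show "exp (- \<theta> * r) * (exponential_density \<theta> z *\<^sub>R g (r + z)) =
     indicator {r..} (r + 1 * z) *\<^sub>R (g (r + 1 * z) * \<theta> * exp (- \<theta> * (r + 1 * z)))"
    by (auto simp: exponential_density_def split: split_indicator)
  qed
  finally show ?thesis
   unfolding set_integrable_def by (subst (asm) lborel_integrable_real_affine_iff) simp_all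
 qed
 have "(LBINT z:{x..}. g z * \<theta> * exp (- \<theta> * z)) = (LBINT z:{x..y}\<union>{y<..}. g z * \<theta> * exp (- \<theta> * z))"
  using xy by (intro arg_cong[where f="\<lambda>A. set_lebesgue_integral lborel A _"]) auto
 also have "\<dots> = (LBINT z:{x..y}. g z * \<theta> * exp (- \<theta> * z)) + (LBINT z:{y<..}. g z * \<theta> * exp (- \<theta> * z))"
 proof (rule set_integral_Un)
  show "set_integrable lborel {x..y} (\<lambda>z. g z * \<theta> * exp (- \<theta> * z))"
   by (rule set_integrable_subset[OF int[of x]]) auto
  show "set_integrable lborel {y<..} (\<lambda>z. g z * \<theta> * exp (- \<theta> * z))"
   by (rule set_integrable_subset[OF int[of x]]) (use xy in auto)
 qed auto
 also have "(LBINT z:{y<..}. g z * \<theta> * exp (- \<theta> * z)) = (LBINT z:{y..}. g z * \<theta> * exp (- \<theta> * z))"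
  unfolding set_lebesgue_integral_def
  by (intro integral_cong_AE) (auto intro!: AE_I[where N="{y}"] split: split_indicator)
 also have "(LBINT z:{x..y}. g z * \<theta> * exp (- \<theta> * z)) = - (F y * exp (- \<theta> * y)) - - (F x * exp (- \<theta> * x))"
  unfolding set_lebesgue_integral_def
 proof (rule integral_FTC_Icc)
  fix z assume z: "x \<le> z" "z \<le> y"
  show "((\<lambda>z. - (F z * exp (- \<theta> * z))) has_vector_derivative g z * \<theta> * exp (- \<theta> * z)) (at z within {x..y})"
   using DERIV_minus[OF F[OF z]] by (auto simp: has_real_derivative_iff_has_vector_derivative intro: has_vector_derivative_at_within)
 next
  show "continuous_on {x..y} (\<lambda>z. g z * \<theta> * exp (- \<theta> * z))"
   by (intro continuous_intros continuous_on_subset[OF cont]) auto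
 qed (rule xy)
 finally have e: "(LBINT z:{x..}. g z * \<theta> * exp (- \<theta> * z)) = F x * exp (- \<theta> * x) - F y * exp (- \<theta> * y) + (LBINT z:{y..}. g z * \<theta> * exp (- \<theta> * z))"
  by simp
 show ?thesis
  unfolding jump_mean_tail[OF \<open>g \<in> borel_measurable borel\<close> \<theta>] e
  by (simp add: algebra_simps exp_add[symmetric])
qed

section \<open>Antiderivatives, Lipschitz bounds, and a Taylor bound without second
  derivatives\<close>

lemma continuous_antiderivative:
 fixes g :: "real \<Rightarrow> real"
 assumes "continuous_on UNIV g"
 obtains F where "F p = q" "\<And>x. (F has_real_derivative g x) (at x)"
proof -
 have "\<exists>F. \<forall>x::real. (-\<infinity>::ereal) < ereal x \<longrightarrow> ereal x < \<infinity> \<longrightarrow> (F has_vector_derivative g x) (at x)"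
  by (rule einterval_antiderivative) (use assms in \<open>auto simp: continuous_on_eq_continuous_at\<close>)
 then obtain F where "\<And>x. (F has_real_derivative g x) (at x)"
  by (auto simp: has_real_derivative_iff_has_vector_derivative)
 then show thesis
  by (intro that[of "\<lambda>x. F x - F p + q"]) (auto intro!: derivative_eq_intros)
qed

text \<open>Mean value theorem for \<open>F - G\<close>. With \<open>e = 0\<close> it identifies
  functions with equal derivatives, with \<open>G = 0\<close> it is a Lipschitz bound; both uses
  recur below.\<close>

lemma deriv_diff_bound:
 fixes F G :: "real \<Rightarrow> real"
 assumes "\<And>x. x \<in> {p..q} \<Longrightarrow> (F has_real_derivative F' x) (at x)"
  and "\<And>x. x \<in> {p..q} \<Longrightarrow> (G has_real_derivative G' x) (at x)"
  and "\<And>x. x \<in> {p..q} \<Longrightarrow> \<bar>F' x - G' x\<bar> \<le> e"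
  and xy: "x \<in> {p..q}" "y \<in> {p..q}"
 shows "\<bar>(F x - G x) - (F y - G y)\<bar> \<le> e * \<bar>x - y\<bar>"
 using xy
proof (induction x y rule: linorder_wlog)
 case (le x y)
 show ?case
 proof (cases "x = y")
  case False
  with le have "x < y" by simp
  have "\<exists>z. x < z \<and> z < y \<and> (F y - G y) - (F x - G x) = (y - x) * (F' z - G' z)"
   by (rule MVT2[OF \<open>x < y\<close>]) (use le in \<open>auto intro!: DERIV_diff assms(1,2)\<close>)
  then obtain z where z: "x < z" "z < y" "(F y - G y) - (F x - G x) = (y - x) * (F' z - G' z)" by blast
  then have "\<bar>(F x - G x) - (F y - G y)\<bar> = (y - x) * \<bar>F' z - G' z\<bar>"
   using le by (metis abs_minus_commute abs_mult abs_of_nonneg diff_ge_0_iff_ge)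
  also have "\<dots> \<le> (y - x) * e"
   using assms(3)[of z] z le by (intro mult_left_mono) auto
  finally show ?thesis using le by (simp add: mult.commute)
 qed simp
next
 case (sym x y) then show ?case by (simp add: abs_minus_commute)
qed

text \<open>The projection of the line onto \<open>[p, q]\<close>. Composing a slope with it
  continues the slope by constants outside the interval without increasing its Lipschitz
  constant.\<close>

definition clamp1 :: "real \<Rightarrow> real \<Rightarrow> real \<Rightarrow> real" where
 "clamp1 p q x = max p (min x q)"

lemma clamp1_in: "p \<le> q \<Longrightarrow> clamp1 p q x \<in> {p..q}"
 by (auto simp: clamp1_def)

lemma clamp1_lip: "\<bar>clamp1 p q x - clamp1 p q y\<bar> \<le> \<bar>x - y\<bar>"
 by (auto simp: clamp1_def max_def min_def)

lemma clamp1_compose_lip: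
 assumes "p \<le> q" "\<And>x. x \<in> {p..q} \<Longrightarrow> (g has_real_derivative g' x) (at x)"
  "\<And>x. x \<in> {p..q} \<Longrightarrow> \<bar>g' x\<bar> \<le> K"
 shows "\<bar>g (clamp1 p q x) - g (clamp1 p q y)\<bar> \<le> K * \<bar>x - y\<bar>"
proof -
 have "K \<ge> 0" using assms(1) assms(3)[of p] abs_ge_zero[of "g' p"] by simp
 have "\<bar>g (clamp1 p q x) - 0 - (g (clamp1 p q y) - 0)\<bar> \<le> K * \<bar>clamp1 p q x - clamp1 p q y\<bar>"
  by (rule deriv_diff_bound[where G="\<lambda>_. 0" and G'="\<lambda>_. 0" and p=p and q=q and F'=g']) (use assms clamp1_in in auto)
 also have "\<dots> \<le> K * \<bar>x - y\<bar>"
  by (intro mult_left_mono clamp1_lip \<open>K \<ge> 0\<close>)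
 finally show ?thesis by simp
qed

text \<open>The bound \<open>m\<close> on the second derivative enters only as a secant condition on
  \<open>vd\<close> at the base point, because the slope of \<open>h\<close> has kinks at
  \<open>a\<close> and \<open>b\<close>. After subtraction of the quadratic, the derivative of the
  remainder \<open>u\<close> has the sign of its argument, so \<open>u\<close> is minimal at
  0.\<close>

lemma taylor_lower:
 fixes v vd :: "real \<Rightarrow> real"
 assumes d: "\<And>s. \<bar>s - y\<bar> \<le> \<delta> \<Longrightarrow> (v has_real_derivative vd s) (at s)"
  and m: "\<And>s. \<bar>s - y\<bar> \<le> \<delta> \<Longrightarrow> m * (s - y)\<^sup>2 \<le> (s - y) * (vd s - vd y)"
  and z: "\<bar>z\<bar> \<le> \<delta>"
 shows "v y + vd y * z + m * z\<^sup>2 / 2 \<le> v (y + z)"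
proof -
 define u where "u s = v (y + s) - vd y * s - m * s\<^sup>2 / 2" for s
 have du: "(u has_real_derivative (vd (y + s) - vd y - m * s)) (at s)" if "\<bar>s\<bar> \<le> \<delta>" for s
  unfolding u_def
  by (rule derivative_eq_intros DERIV_chain2[where f=v, OF d] refl | use that in simp)+
 have sgn: "0 \<le> s * (vd (y + s) - vd y - m * s)" if "\<bar>s\<bar> \<le> \<delta>" for s
  using m[of "y + s"] that by (simp add: algebra_simps power2_eq_square)
 consider "z = 0" | "z > 0" | "z < 0" by linarith
 then have "u 0 \<le> u z"
 proof cases
  case 2
  then obtain s where s: "0 < s" "s < z" "u z - u 0 = (z - 0) * (vd (y + s) - vd y - m * s)"
   using MVT2[OF 2, of u "\<lambda>s. vd (y + s) - vd y - m * s"] du z by force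
  then have "0 \<le> vd (y + s) - vd y - m * s"
   using sgn[of s] z by (simp add: zero_le_mult_iff)
  then show ?thesis using s 2 by (smt (verit) mult_nonneg_nonneg)
 next
  case 3
  then obtain s where s: "z < s" "s < 0" "u 0 - u z = (0 - z) * (vd (y + s) - vd y - m * s)"
   using MVT2[OF 3, of u "\<lambda>s. vd (y + s) - vd y - m * s"] du z by force
  then have "vd (y + s) - vd y - m * s \<le> 0"
   using sgn[of s] z by (simp add: zero_le_mult_iff)
  then show ?thesis using s 3 by (smt (verit) mult_nonneg_nonpos)
 qed simp
 then show ?thesis by (simp add: u_def)
qed

section \<open>The equations for \<open>f\<close> and the shape of its first derivative\<close>

locale band_equations =
 fixes \<sigma> \<theta> lam \<rho> C D c d L1 L2 L3 a \<alpha> \<beta> b c1 c2 c3 :: real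
  and f h :: "real \<Rightarrow> real"
 assumes lam: "lam > 0" and theta: "\<theta> > 0"
  and CD: "C > 0" "D > 0" "c \<ge> 0" "d \<ge> 0"
  and roots: "\<And>y. y \<in> {c1, c2, c3} \<Longrightarrow>
    1/2 * \<sigma>\<^sup>2 * y ^ 3 + \<sigma>\<^sup>2 * \<theta> * y\<^sup>2 + (1/2 * \<sigma>\<^sup>2 * \<theta>\<^sup>2 - lam - 1) * y - \<theta> = 0"
  and root_order: "c1 < - \<theta>" "- \<theta> < c2" "c2 < 0" "0 < c3"
  and L: "L1 \<le> 0" "L2 \<le> 0" "L3 \<le> 0"
  and band_par: "a < \<alpha>" "\<alpha> \<le> \<beta>" "\<beta> < b"
  and f_def: "f = (\<lambda>x. (1 / lam) * (x - \<rho>)\<^sup>2 + (2 / (\<theta> * lam\<^sup>2)) * (x - \<rho>)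
         + (2 * lam + 2 + \<theta>\<^sup>2 * lam * \<sigma>\<^sup>2) / (lam ^ 3 * \<theta>\<^sup>2)
         + L1 * exp ((\<theta> + c1) * x) + L2 * exp ((\<theta> + c2) * x) + L3 * exp ((\<theta> + c3) * x))"
  and eq1: "deriv f a = - c" and eq2: "deriv f \<alpha> = - c"
  and eq3: "deriv f b = d" and eq4: "deriv f \<beta> = d"
  and eq5: "f a = f \<alpha> + C + c * (\<alpha> - a)"
  and eq6: "f b = f \<beta> + D + d * (b - \<beta>)"
  and eq7: "1/2 * \<sigma>\<^sup>2 * deriv (deriv f) b + (b - \<rho>)\<^sup>2 - (1 + lam) * f b
       + exp (\<theta> * b) * (LBINT z:{b..}. (f b + d * (z - b)) * \<theta> * exp (- \<theta> * z)) = 0"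
  and h_def: "h = (\<lambda>x. if x \<le> a then f a - c * (x - a) else if x \<le> b then f x else f b + d * (x - b))"
begin

abbreviation m1 where "m1 \<equiv> \<theta> + c1"
abbreviation m2 where "m2 \<equiv> \<theta> + c2"
abbreviation m3 where "m3 \<equiv> \<theta> + c3"

definition f1 where "f1 x = 2 / lam * (x - \<rho>) + 2 / (\<theta> * lam\<^sup>2)
 + L1 * m1 * exp (m1 * x) + L2 * m2 * exp (m2 * x) + L3 * m3 * exp (m3 * x)"
definition f2 where "f2 x = 2 / lam
 + L1 * m1^2 * exp (m1 * x) + L2 * m2^2 * exp (m2 * x) + L3 * m3^2 * exp (m3 * x)"
definition f3 where "f3 x =
 L1 * m1^3 * exp (m1 * x) + L2 * m2^3 * exp (m2 * x) + L3 * m3^3 * exp (m3 * x)"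
definition f4 where "f4 x =
 L1 * m1^4 * exp (m1 * x) + L2 * m2^4 * exp (m2 * x) + L3 * m3^4 * exp (m3 * x)"

lemma f_deriv: "(f has_real_derivative f1 x) (at x)"
 unfolding f_def f1_def using lam theta by (auto intro!: derivative_eq_intros)

lemma f1_deriv: "(f1 has_real_derivative f2 x) (at x)"
 unfolding f1_def[abs_def] f2_def using lam theta by (auto intro!: derivative_eq_intros simp: power2_eq_square)

lemma f2_deriv: "(f2 has_real_derivative f3 x) (at x)"
 unfolding f2_def[abs_def] f3_def by (auto intro!: derivative_eq_intros simp: power2_eq_square power3_eq_cube)

lemma f3_deriv: "(f3 has_real_derivative f4 x) (at x)"
 unfolding f3_def[abs_def] f4_def by (auto intro!: derivative_eq_intros simp: power3_eq_cube power4_eq_xxxx)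

lemma deriv_f: "deriv f = f1" and deriv_f1: "deriv f1 = f2"
 using f_deriv f1_deriv by (auto intro!: ext DERIV_imp_deriv)

lemma f1_values: "f1 a = - c" "f1 \<alpha> = - c" "f1 b = d" "f1 \<beta> = d"
 using eq1 eq2 eq3 eq4 by (simp_all add: deriv_f)

lemma f_cont: "continuous_on A f" and f1_cont: "continuous_on A f1"
 and f2_cont: "continuous_on A f2" and f3_cont: "continuous_on A f3"
 by (meson DERIV_continuous continuous_at_imp_continuous_on f_deriv f1_deriv f2_deriv f3_deriv)+

text \<open>The fourth power removes the sign of the exponents, so only the signs of
  \<open>L1\<close>, \<open>L2\<close>, \<open>L3\<close> matter. The concavity of
  \<open>f2\<close>, and with it the shape of \<open>f1\<close>, rests on this.\<close>

lemma f4_nonpos: "f4 x \<le> 0"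
proof -
 have "L * m^4 * exp y \<le> 0" if "L \<le> 0" for L m y :: real
  using that by (simp add: mult_le_0_iff)
 from this[OF L(1)] this[OF L(2)] this[OF L(3)] show ?thesis
  unfolding f4_def by (intro add_nonpos_nonpos) auto
qed

lemma f3_antimono: "x \<le> y \<Longrightarrow> f3 y \<le> f3 x"
 by (rule DERIV_nonpos_imp_nonincreasing[of x y f3]) (auto intro!: exI f3_deriv f4_nonpos)

text \<open>For \<open>\<sigma> = 0\<close> the cubic degenerates to a linear equation, which cannot
  have the two different roots \<open>c1\<close> and \<open>c2\<close>. Nondegeneracy is needed
  later to solve the generator inequality for the second derivative.\<close>

lemma sigma_nz: "\<sigma> \<noteq> 0"
proof
 assume "\<sigma> = 0"
 then have "(- lam - 1) * c1 = \<theta>" "(- lam - 1) * c2 = \<theta>"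
  using roots[of c1] roots[of c2] by auto
 then have "(- lam - 1) * (c1 - c2) = 0" by (simp add: algebra_simps)
 then show False using root_order lam by auto
qed

text \<open>The cubic rewritten in the exponent \<open>m = \<theta> + y\<close>: it is the
  characteristic polynomial of the differential equation in \<open>ode\<close>.\<close>

lemma ode_term:
 assumes "y \<in> {c1, c2, c3}"
 shows "1/2 * \<sigma>\<^sup>2 * ((\<theta> + y)^3 - \<theta> * (\<theta> + y)^2) - (1 + lam) * (\<theta> + y) + lam * \<theta> = 0"
 using roots[OF assms] by (simp add: algebra_simps power2_eq_square power3_eq_cube)

text \<open>Applying \<open>d/dx - \<theta>\<close> to the integro-differential equation expected on
  the band removes the jump integral and leaves this third-order equation. The polynomial part of
  \<open>f\<close> is a particular solution, the exponentials solve the homogeneous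
  equation.\<close>

lemma ode:
 "1/2 * \<sigma>\<^sup>2 * (f3 x - \<theta> * f2 x) - (1 + lam) * (f1 x - \<theta> * f x) + 2 * (x - \<rho>) - \<theta> * (x - \<rho>)\<^sup>2 - \<theta> * f x = 0"
proof -
 let ?q = "\<lambda>m. 1/2 * \<sigma>\<^sup>2 * (m^3 - \<theta> * m^2) - (1 + lam) * m + lam * \<theta>"
 let ?P = "(1 / lam) * (x - \<rho>)\<^sup>2 + (2 / (\<theta> * lam\<^sup>2)) * (x - \<rho>) + (2 * lam + 2 + \<theta>\<^sup>2 * lam * \<sigma>\<^sup>2) / (lam ^ 3 * \<theta>\<^sup>2)"
 let ?P1 = "2 / lam * (x - \<rho>) + 2 / (\<theta> * lam\<^sup>2)"
 have P: "1/2 * \<sigma>\<^sup>2 * (0 - \<theta> * (2 / lam)) - (1 + lam) * (?P1 - \<theta> * ?P) + 2 * (x - \<rho>) - \<theta> * (x - \<rho>)\<^sup>2 - \<theta> * ?P = 0"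
  using lam theta by (simp add: field_simps power2_eq_square power3_eq_cube)
 have "1/2 * \<sigma>\<^sup>2 * (f3 x - \<theta> * f2 x) - (1 + lam) * (f1 x - \<theta> * f x) + 2 * (x - \<rho>) - \<theta> * (x - \<rho>)\<^sup>2 - \<theta> * f x
  = (1/2 * \<sigma>\<^sup>2 * (0 - \<theta> * (2 / lam)) - (1 + lam) * (?P1 - \<theta> * ?P) + 2 * (x - \<rho>) - \<theta> * (x - \<rho>)\<^sup>2 - \<theta> * ?P)
   + (L1 * exp (m1 * x) * ?q m1 + L2 * exp (m2 * x) * ?q m2 + L3 * exp (m3 * x) * ?q m3)"
  unfolding f3_def f2_def f1_def f_def by (simp add: algebra_simps)
 also have "\<dots> = 0" unfolding P using ode_term by simp
 finally show ?thesis .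
qed

text \<open>This is \<open>\<theta> * lam * f1 x + 2 - 2 * \<theta> * (x - \<rho>)\<close>, the
  combination that appears when \<open>ode\<close> is differentiated. Its linear parts cancel, and
  the remaining constant and exponentials are monotone; its value at \<open>a\<close> is the slope
  needed in \<open>gen_le_a\<close>.\<close>

definition R where "R x = 2 * (1 + lam) / lam
 + \<theta> * lam * (L1 * m1 * exp (m1 * x) + L2 * m2 * exp (m2 * x) + L3 * m3 * exp (m3 * x))"

lemma R_eq: "R x = (1 + lam) * f2 x - 1/2 * \<sigma>\<^sup>2 * (f4 x - \<theta> * f3 x)"
proof -
 let ?q = "\<lambda>m. 1/2 * \<sigma>\<^sup>2 * (m^3 - \<theta> * m^2) - (1 + lam) * m + lam * \<theta>"
 have "R x - ((1 + lam) * f2 x - 1/2 * \<sigma>\<^sup>2 * (f4 x - \<theta> * f3 x)) =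
  L1 * m1 * exp (m1 * x) * ?q m1 + L2 * m2 * exp (m2 * x) * ?q m2 + L3 * m3 * exp (m3 * x) * ?q m3"
  unfolding R_def f2_def f3_def f4_def using lam by (simp add: algebra_simps power2_eq_square power3_eq_cube power4_eq_xxxx)
 also have "\<dots> = 0" using ode_term by simp
 finally show ?thesis by simp
qed

text \<open>Each summand has derivative \<open>L * m^2 * exp (m * x)\<close>, which is nonpositive
  whatever the sign of \<open>m\<close>.\<close>

lemma R_antimono: "x \<le> y \<Longrightarrow> R y \<le> R x"
proof -
 assume "x \<le> y"
 have "L * m * exp (m * y) \<le> L * m * exp (m * x)" if "L \<le> 0" for L m :: real
 proof (cases "m \<ge> 0")
  case True
  then show ?thesis using that \<open>x \<le> y\<close> by (intro mult_left_mono_neg) (auto simp: mult_left_mono mult_le_0_iff)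
 next
  case False
  then show ?thesis using that \<open>x \<le> y\<close> by (intro mult_left_mono) (auto simp: mult_left_mono_neg zero_le_mult_iff)
 qed
 from this[OF L(1), of m1] this[OF L(2), of m2] this[OF L(3), of m3]
 show "R y \<le> R x"
  unfolding R_def using lam theta by (intro add_left_mono mult_left_mono) auto
qed

text \<open>Since the fourth derivative of \<open>f\<close> is nonpositive, \<open>f2\<close> is concave, so it is
 nonnegative exactly on an interval; this fixes the shape of \<open>f1\<close>.\<close>

lemma f2_concave:
 assumes "x < y" "y < z" "f2 x > 0" "f2 z > 0"
 shows "f2 y > 0"
proof (rule ccontr)
 assume "\<not> f2 y > 0"
 obtain p where p: "x < p" "p < y" "f2 y - f2 x = (y - x) * f3 p"
  using MVT2[OF assms(1), of f2 f3] f2_deriv by blast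
 obtain q where q: "y < q" "q < z" "f2 z - f2 y = (z - y) * f3 q"
  using MVT2[OF assms(2), of f2 f3] f2_deriv by blast
 have "f3 p < 0" using p assms \<open>\<not> f2 y > 0\<close> by (smt (verit) mult_nonneg_nonneg)
 moreover have "f3 q > 0" using q assms \<open>\<not> f2 y > 0\<close> by (smt (verit) mult_nonneg_nonpos)
 ultimately show False using f3_antimono[of p q] p q by linarith
qed

lemma f1_less_imp: "x < y \<Longrightarrow> f1 x < f1 y \<Longrightarrow> \<exists>z. x < z \<and> z < y \<and> f2 z > 0"
 and f1_gr_imp: "x < y \<Longrightarrow> f1 x > f1 y \<Longrightarrow> \<exists>z. x < z \<and> z < y \<and> f2 z < 0"
 using MVT2[of x y f1 f2] f1_deriv
 by (smt (verit, ccfv_threshold) mult_nonneg_nonneg mult_nonneg_nonpos)+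

text \<open>Because of the fixed costs \<open>C\<close> and \<open>D\<close>, the mean slope of
  \<open>f\<close> is below \<open>- c\<close> over \<open>[a, \<alpha>]\<close> and above
  \<open>d\<close> over \<open>[\<beta>, b]\<close>. The slopes at the ends of these intervals are
  exactly \<open>- c\<close> and \<open>d\<close>, so \<open>f1\<close> has a dip in the first and a
  hump in the second, and these supply the signs of \<open>f2\<close> at four points.\<close>

lemma shape_points:
 obtains p p1 p2 q q1 q2 where "a < p1" "p1 < p" "p < p2" "p2 < \<alpha>" "f1 p < - c" "f2 p1 < 0" "f2 p2 > 0"
  "\<beta> < q1" "q1 < q" "q < q2" "q2 < b" "f1 q > d" "f2 q1 > 0" "f2 q2 < 0"
proof -
 obtain p where p: "a < p" "p < \<alpha>" "f \<alpha> - f a = (\<alpha> - a) * f1 p"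
  using MVT2[OF band_par(1), of f f1] f_deriv by blast
 have "(\<alpha> - a) * (f1 p + c) < 0" using p eq5 CD by (simp add: algebra_simps)
 then have fp: "f1 p < - c" using band_par by (simp add: mult_less_0_iff)
 obtain q where q: "\<beta> < q" "q < b" "f b - f \<beta> = (b - \<beta>) * f1 q"
  using MVT2[OF band_par(3), of f f1] f_deriv by blast
 have "(b - \<beta>) * (f1 q - d) > 0" using q eq6 CD by (simp add: algebra_simps)
 then have fq: "f1 q > d" using band_par by (simp add: zero_less_mult_iff)
 obtain p1 where "a < p1" "p1 < p" "f2 p1 < 0" using f1_gr_imp[OF p(1)] fp f1_values by auto
 moreover obtain p2 where "p < p2" "p2 < \<alpha>" "f2 p2 > 0" using f1_less_imp[OF p(2)] fp f1_values by auto
 moreover obtain q1 where "\<beta> < q1" "q1 < q" "f2 q1 > 0" using f1_less_imp[OF q(1)] fq f1_values by auto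
 moreover obtain q2 where "q < q2" "q2 < b" "f2 q2 < 0" using f1_gr_imp[OF q(2)] fq f1_values by auto
 ultimately show thesis using that fp fq by blast
qed

text \<open>The claims on \<open>f1\<close> and \<open>f2\<close> are all refuted in one way: a
  violation forces \<open>f2\<close> to be negative between two points where it is positive, some of
  them supplied by \<open>shape_points\<close>, against \<open>f2_concave\<close>. The signs of
  \<open>f3\<close> at the ends follow by the mean value theorem, and the last claim locates the
  maximum of \<open>f2\<close>.\<close>

lemma shape_a: "x \<in> {a..\<alpha>} \<Longrightarrow> f1 x \<le> - c"
 and shape_ab: "x \<in> {\<alpha>..b} \<Longrightarrow> f1 x \<ge> - c"
 and shape_b: "x \<in> {\<beta>..b} \<Longrightarrow> f1 x \<ge> d"
 and shape_ba: "x \<in> {a..\<beta>} \<Longrightarrow> f1 x \<le> d"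
 and f2_a: "f2 a \<le> 0" and f2_b: "f2 b \<le> 0" and f3_a: "f3 a \<ge> 0" and f3_b: "f3 b \<le> 0"
 and f3_zero: "\<exists>s. a \<le> s \<and> f3 s = 0 \<and> f2 s \<ge> 0"
proof -
 obtain p p1 p2 q q1 q2 where pq: "a < p1" "p1 < p" "p < p2" "p2 < \<alpha>" "f1 p < - c" "f2 p1 < 0" "f2 p2 > 0"
  "\<beta> < q1" "q1 < q" "q < q2" "q2 < b" "f1 q > d" "f2 q1 > 0" "f2 q2 < 0" by (rule shape_points)
 note par = band_par CD f1_values
 show "f1 x \<le> - c" if x: "x \<in> {a..\<alpha>}"
 proof (rule ccontr)
  assume n: "\<not> f1 x \<le> - c"
  then have "x \<noteq> a" "x \<noteq> \<alpha>" "x \<noteq> p" using f1_values pq by auto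
  then consider "a < x" "x < p" | "p < x" "x < \<alpha>" using x by force
  then show False
  proof cases
   case 1
   obtain u v where "a < u" "u < x" "f2 u > 0" "x < v" "v < p" "f2 v < 0"
    using f1_less_imp[OF 1(1)] f1_gr_imp[OF 1(2)] n pq par by auto
   then show False using f2_concave[of u v p2] pq by auto
  next
   case 2
   obtain u v where "p < u" "u < x" "f2 u > 0" "x < v" "v < \<alpha>" "f2 v < 0"
    using f1_less_imp[OF 2(1)] f1_gr_imp[OF 2(2)] n pq par by auto
   then show False using f2_concave[of u v q1] pq par by auto
  qed
 qed
 show "f1 x \<ge> - c" if x: "x \<in> {\<alpha>..b}"
 proof (rule ccontr)
  assume n: "\<not> f1 x \<ge> - c"
  then have "x \<noteq> b" "x \<noteq> \<alpha>" using par by auto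
  then have x': "\<alpha> < x" "x < b" using x by auto
  obtain u v where "\<alpha> < u" "u < x" "f2 u < 0" "x < v" "v < b" "f2 v > 0"
   using f1_gr_imp[OF x'(1)] f1_less_imp[OF x'(2)] n pq par by auto
  then show False using f2_concave[of p2 u v] pq by auto
 qed
 show "f1 x \<ge> d" if x: "x \<in> {\<beta>..b}"
 proof (rule ccontr)
  assume n: "\<not> f1 x \<ge> d"
  then have "x \<noteq> b" "x \<noteq> \<beta>" "x \<noteq> q" using f1_values pq by auto
  then consider "\<beta> < x" "x < q" | "q < x" "x < b" using x by force
  then show False
  proof cases
   case 1
   obtain u v where "\<beta> < u" "u < x" "f2 u < 0" "x < v" "v < q" "f2 v > 0"
    using f1_gr_imp[OF 1(1)] f1_less_imp[OF 1(2)] n pq par by auto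
   then show False using f2_concave[of p2 u v] pq par by auto
  next
   case 2
   obtain u v where "q < u" "u < x" "f2 u < 0" "x < v" "v < b" "f2 v > 0"
    using f1_gr_imp[OF 2(1)] f1_less_imp[OF 2(2)] n pq par by auto
   then show False using f2_concave[of q1 u v] pq par by auto
  qed
 qed
 show "f1 x \<le> d" if x: "x \<in> {a..\<beta>}"
 proof (rule ccontr)
  assume n: "\<not> f1 x \<le> d"
  then have "x \<noteq> a" "x \<noteq> \<beta>" using par by auto
  then have x': "a < x" "x < \<beta>" using x by auto
  obtain u v where "a < u" "u < x" "f2 u > 0" "x < v" "v < \<beta>" "f2 v < 0"
   using f1_less_imp[OF x'(1)] f1_gr_imp[OF x'(2)] n pq par by auto
  then show False using f2_concave[of u v q1] pq by auto
 qed
 show a2: "f2 a \<le> 0" using f2_concave[of a p1 p2] pq by force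
 show b2: "f2 b \<le> 0" using f2_concave[of q1 q2 b] pq by force
 show a3: "f3 a \<ge> 0"
 proof -
  obtain z where z: "a < z" "f2 p2 - f2 a = (p2 - a) * f3 z"
   using MVT2[of a p2 f2 f3] f2_deriv pq by force
  then have "f3 z \<ge> 0" using a2 pq by (smt (verit) mult_nonneg_nonpos)
  then show ?thesis using f3_antimono[of a z] z by linarith
 qed
 show b3: "f3 b \<le> 0"
 proof -
  obtain z where z: "z < b" "f2 b - f2 q1 = (b - q1) * f3 z"
   using MVT2[of q1 b f2 f3] f2_deriv pq by force
  then have "f3 z \<le> 0" using b2 pq by (smt (verit) mult_nonneg_nonneg)
  then show ?thesis using f3_antimono[of z b] z by linarith
 qed
 obtain s where s: "a \<le> s" "s \<le> b" "f3 s = 0"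
  using IVT2'[of f3 b 0 a] a3 b3 par f3_cont by auto
 \<comment> \<open>\<open>f3\<close> is antimonotone, so \<open>f2\<close> increases up to its
   critical point \<open>s\<close> and decreases after it; the comparison with \<open>p2\<close>
   makes the value at \<open>s\<close> positive.\<close>
 have "f2 p2 \<le> f2 s"
 proof (cases "p2 \<le> s")
  case True
  then show ?thesis
   by (intro DERIV_nonneg_imp_nondecreasing[of p2 s f2]) (use f2_deriv f3_antimono s(3) in fastforce)+
 next
  case False
  then show ?thesis
   by (intro DERIV_nonpos_imp_nonincreasing[of s p2 f2]) (use f2_deriv f3_antimono s(3) in fastforce)+
 qed
 then show "\<exists>s. a \<le> s \<and> f3 s = 0 \<and> f2 s \<ge> 0" using s pq by force
qed

section \<open>The candidate \<open>h\<close>: smooth fit and the intervention inequality\<close>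

text \<open>By the first and third equations the slopes of the two affine pieces of \<open>h\<close>
  are the end slopes of \<open>f\<close>. Clamping the argument of \<open>f1\<close> therefore gives
  the derivative of \<open>h\<close> on the whole line.\<close>

definition hder where "hder x = f1 (clamp1 a b x)"

text \<open>One constant for three derivatives. The margin 2 around the band leaves room for the
  smooth approximation of \<open>h\<close>, whose slope is modified only up to distance 2 from the
  band.\<close>

definition KK where "KK = (SOME K. 0 < K \<and> (\<forall>x\<in>{a-2..b+2}. \<bar>f1 x\<bar> \<le> K \<and> \<bar>f2 x\<bar> \<le> K \<and> \<bar>f3 x\<bar> \<le> K))"

lemma KK: "0 < KK" "x \<in> {a-2..b+2} \<Longrightarrow> \<bar>f1 x\<bar> \<le> KK" "x \<in> {a-2..b+2} \<Longrightarrow> \<bar>f2 x\<bar> \<le> KK"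
 "x \<in> {a-2..b+2} \<Longrightarrow> \<bar>f3 x\<bar> \<le> KK"
proof -
 have b: "\<exists>K. \<forall>x\<in>{a-2..b+2}. \<bar>g x\<bar> \<le> K" if "continuous_on {a-2..b+2} g" for g :: "real \<Rightarrow> real"
 proof -
  have "bounded (g ` {a-2..b+2})"
   by (intro compact_imp_bounded compact_continuous_image that) auto
  then show ?thesis by (auto simp: bounded_iff)
 qed
 obtain K where K: "\<forall>x\<in>{a-2..b+2}. \<bar>\<bar>f1 x\<bar> + \<bar>f2 x\<bar> + \<bar>f3 x\<bar>\<bar> \<le> K"
 proof -
  have "continuous_on {a-2..b+2} (\<lambda>x. \<bar>f1 x\<bar> + \<bar>f2 x\<bar> + \<bar>f3 x\<bar>)"
   by (intro continuous_intros f1_cont f2_cont f3_cont)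
  from b[OF this] show ?thesis using that by blast
 qed
 have "0 < \<bar>K\<bar> + 1 \<and> (\<forall>x\<in>{a-2..b+2}. \<bar>f1 x\<bar> \<le> \<bar>K\<bar> + 1 \<and> \<bar>f2 x\<bar> \<le> \<bar>K\<bar> + 1 \<and> \<bar>f3 x\<bar> \<le> \<bar>K\<bar> + 1)"
 proof (intro conjI ballI)
  fix x assume "x \<in> {a-2..b+2}"
  with K have "\<bar>\<bar>f1 x\<bar> + \<bar>f2 x\<bar> + \<bar>f3 x\<bar>\<bar> \<le> K" by blast
  then show "\<bar>f1 x\<bar> \<le> \<bar>K\<bar> + 1" "\<bar>f2 x\<bar> \<le> \<bar>K\<bar> + 1" "\<bar>f3 x\<bar> \<le> \<bar>K\<bar> + 1" by linarith+
 qed simp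
 then have *: "0 < KK \<and> (\<forall>x\<in>{a-2..b+2}. \<bar>f1 x\<bar> \<le> KK \<and> \<bar>f2 x\<bar> \<le> KK \<and> \<bar>f3 x\<bar> \<le> KK)"
  unfolding KK_def
  by (rule someI[where P="\<lambda>K. 0 < K \<and> (\<forall>x\<in>{a-2..b+2}. \<bar>f1 x\<bar> \<le> K \<and> \<bar>f2 x\<bar> \<le> K \<and> \<bar>f3 x\<bar> \<le> K)"])
 show "0 < KK" "x \<in> {a-2..b+2} \<Longrightarrow> \<bar>f1 x\<bar> \<le> KK" "x \<in> {a-2..b+2} \<Longrightarrow> \<bar>f2 x\<bar> \<le> KK"
  "x \<in> {a-2..b+2} \<Longrightarrow> \<bar>f3 x\<bar> \<le> KK"
  using * by blast+
qed

lemma ab: "a < b" using band_par by simp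

lemma hder_bound: "\<bar>hder x\<bar> \<le> KK"
 unfolding hder_def using clamp1_in[of a b x] ab by (intro KK) auto

lemma hder_lip: "\<bar>hder x - hder y\<bar> \<le> KK * \<bar>x - y\<bar>"
 unfolding hder_def using ab by (intro clamp1_compose_lip[where g'=f2] f1_deriv KK) auto

lemma hder_le_a: "x \<le> a \<Longrightarrow> hder x = - c" and hder_ge_b: "x \<ge> b \<Longrightarrow> hder x = d"
 and hder_in: "x \<in> {a..b} \<Longrightarrow> hder x = f1 x"
 using ab f1_values by (auto simp: hder_def clamp1_def)

lemma hder_cont: "continuous_on UNIV hder"
proof -
 have "KK-lipschitz_on UNIV hder" using hder_lip KK(1) by (auto simp: lipschitz_on_def dist_real_def)
 then show ?thesis by (rule lipschitz_on_continuous_on)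
qed

lemma h_in: "x \<in> {a..b} \<Longrightarrow> h x = f x" and h_le_a: "x \<le> a \<Longrightarrow> h x = f a - c * (x - a)"
 and h_ge_b: "x \<ge> b \<Longrightarrow> h x = f b + d * (x - b)"
 using ab by (auto simp: h_def)

text \<open>Instead of differentiating a case distinction at \<open>a\<close> and \<open>b\<close>,
  the three pieces of \<open>h\<close> are compared with one antiderivative of the continuous slope
  \<open>hder\<close>.\<close>

lemma h_deriv: "(h has_real_derivative hder x) (at x)"
proof -
 obtain H where H: "H a = f a" "\<And>x. (H has_real_derivative hder x) (at x)"
  using continuous_antiderivative[OF hder_cont, where p=a and q="f a"] by blast
 have in_ab: "H x = f x" if "x \<in> {a..b}" for x
 proof -
  have "\<bar>(H x - f x) - (H a - f a)\<bar> \<le> 0 * \<bar>x - a\<bar>"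
   by (rule deriv_diff_bound[of a b H hder f f1, OF H(2) f_deriv]) (use hder_in that ab in auto)
  then show ?thesis using H by simp
 qed
 have "H x = h x" for x
 proof -
  consider "x \<le> a" | "x \<in> {a..b}" | "x \<ge> b" by force
  then show ?thesis
  proof cases
   case 1
   have "\<bar>(H x - (f a - c * (x - a))) - (H a - (f a - c * (a - a)))\<bar> \<le> 0 * \<bar>x - a\<bar>"
    by (rule deriv_diff_bound[of x a H hder _ "\<lambda>_. - c", OF H(2)]) (use 1 hder_le_a in \<open>auto intro!: derivative_eq_intros\<close>)
   then show ?thesis using 1 H h_le_a by simp
  next
   case 2 then show ?thesis using in_ab h_in by simp
  next
   case 3
   have "\<bar>(H x - (f b + d * (x - b))) - (H b - (f b + d * (b - b)))\<bar> \<le> 0 * \<bar>x - b\<bar>"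
    by (rule deriv_diff_bound[of b x H hder _ "\<lambda>_. d", OF H(2)]) (use 3 hder_ge_b in \<open>auto intro!: derivative_eq_intros\<close>)
   then show ?thesis using 3 in_ab[of b] ab h_ge_b by simp
  qed
 qed
 then have "H = h" by auto
 then show ?thesis using H by simp
qed

lemma lip_of_deriv:
 assumes "\<And>x. (v has_real_derivative vd x) (at x)" "\<And>x. \<bar>vd x\<bar> \<le> K"
 shows "\<bar>v x - v y\<bar> \<le> K * \<bar>x - y\<bar>"
 using deriv_diff_bound[of "min x y" "max x y" v vd "\<lambda>_. 0" "\<lambda>_. 0" K x y] assms by auto

lemma h_lip: "\<bar>h x - h y\<bar> \<le> KK * \<bar>x - y\<bar>"
 by (rule lip_of_deriv[OF h_deriv hder_bound])

lemma h_measurable [measurable]: "h \<in> borel_measurable borel"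
 by (rule lipschitz_borel[OF h_lip])

text \<open>The outer slopes \<open>- c\<close> and \<open>d\<close> make \<open>h\<close> grow away
  from the band, so the compact band decides. The bound controls the terminal value that remains
  when the band policy is cut off at a finite horizon.\<close>

lemma h_bounded_below: "\<exists>B\<ge>0. \<forall>x. - B \<le> h x"
proof -
 have "bounded (f ` {a..b})"
  by (intro compact_imp_bounded compact_continuous_image f_cont) auto
 then obtain B where "\<forall>x\<in>{a..b}. \<bar>f x\<bar> \<le> B" by (auto simp: bounded_iff)
 then have B: "\<And>x. x \<in> {a..b} \<Longrightarrow> \<bar>f x\<bar> \<le> B" by blast
 have "- B \<le> h x" for x
 proof -
  consider "x \<le> a" | "x \<in> {a..b}" | "x \<ge> b" by force
  then show ?thesis
  proof cases
   case 1
   then have "c * (x - a) \<le> 0" using CD by (simp add: mult_le_0_iff)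
   then show ?thesis using B[of a] ab h_le_a[OF 1] by simp
  next
   case 2 then show ?thesis using B[of x] h_in by simp
  next
   case 3
   then have "d * (x - b) \<ge> 0" using CD by simp
   then show ?thesis using B[of b] ab h_ge_b[OF 3] by simp
  qed
 qed
 moreover have "B \<ge> 0" using B[of a] ab by simp
 ultimately show ?thesis by auto
qed

text \<open>The shape of \<open>f1\<close> carried over to \<open>h\<close>: \<open>\<alpha>\<close>
  minimises \<open>h x + c * x\<close> and \<open>\<beta>\<close> minimises
  \<open>h x - d * x\<close>, so they are the best targets of upward and downward impulses.\<close>

lemma h_plus_c_dec: "x \<le> y \<Longrightarrow> y \<le> \<alpha> \<Longrightarrow> h y + c * y \<le> h x + c * x"
 and h_plus_c_inc: "\<alpha> \<le> x \<Longrightarrow> x \<le> y \<Longrightarrow> h x + c * x \<le> h y + c * y"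
 and h_minus_d_dec: "x \<le> y \<Longrightarrow> y \<le> \<beta> \<Longrightarrow> h y - d * y \<le> h x - d * x"
 and h_minus_d_inc: "\<beta> \<le> x \<Longrightarrow> x \<le> y \<Longrightarrow> h x - d * x \<le> h y - d * y"
proof -
 have dc: "((\<lambda>x. h x + c * x) has_real_derivative hder x + c) (at x)" for x
  by (auto intro!: derivative_eq_intros h_deriv)
 have dd: "((\<lambda>x. h x - d * x) has_real_derivative hder x - d) (at x)" for x
  by (auto intro!: derivative_eq_intros h_deriv)
 have A: "hder x + c \<le> 0" if "x \<le> \<alpha>" for x
  using hder_le_a[of x] hder_in[of x] shape_a[of x] band_par that by (cases "x \<le> a") auto
 have B: "hder x + c \<ge> 0" if "x \<ge> \<alpha>" for x
  using hder_ge_b[of x] hder_in[of x] shape_ab[of x] band_par CD that by (cases "x \<ge> b") auto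
 have E: "hder x - d \<le> 0" if "x \<le> \<beta>" for x
  using hder_le_a[of x] hder_in[of x] shape_ba[of x] band_par CD that by (cases "x \<le> a") auto
 have G: "hder x - d \<ge> 0" if "x \<ge> \<beta>" for x
  using hder_ge_b[of x] hder_in[of x] shape_b[of x] band_par CD that by (cases "x \<ge> b") auto
 have dec: "u y \<le> u x" if "x \<le> y" "\<And>z. (u has_real_derivative u' z) (at z)" "\<And>z. z \<le> y \<Longrightarrow> u' z \<le> 0" for u u' :: "real \<Rightarrow> real" and x y
  using DERIV_nonpos_imp_nonincreasing[of x y u] that by blast
 have inc: "u x \<le> u y" if "x \<le> y" "\<And>z. (u has_real_derivative u' z) (at z)" "\<And>z. z \<ge> x \<Longrightarrow> u' z \<ge> 0" for u u' :: "real \<Rightarrow> real" and x y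
  using DERIV_nonneg_imp_nondecreasing[of x y u] that by blast
 show "x \<le> y \<Longrightarrow> y \<le> \<alpha> \<Longrightarrow> h y + c * y \<le> h x + c * x"
  by (rule dec[OF _ dc]) (assumption, rule A, linarith)
 show "\<alpha> \<le> x \<Longrightarrow> x \<le> y \<Longrightarrow> h x + c * x \<le> h y + c * y"
  by (rule inc[OF _ dc]) (assumption, rule B, linarith)
 show "x \<le> y \<Longrightarrow> y \<le> \<beta> \<Longrightarrow> h y - d * y \<le> h x - d * x"
  by (rule dec[OF _ dd]) (assumption, rule E, linarith)
 show "\<beta> \<le> x \<Longrightarrow> x \<le> y \<Longrightarrow> h x - d * x \<le> h y - d * y"
  by (rule inc[OF _ dd]) (assumption, rule G, linarith)
qed

lemma h_intervene_b: "z \<ge> b \<Longrightarrow> h z = h \<beta> + imp_cost C c D d (\<beta> - z)"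
 using eq6 h_ge_b[of z] h_in[of \<beta>] band_par by (simp add: imp_cost_def algebra_simps)

lemma h_intervene_a: "z \<le> a \<Longrightarrow> h z = h \<alpha> + imp_cost C c D d (\<alpha> - z)"
 using eq5 h_le_a[of z] h_in[of \<alpha>] band_par by (simp add: imp_cost_def algebra_simps)

text \<open>For an upward impulse the most favourable target is the minimiser
  \<open>\<alpha>\<close> of \<open>h x + c * x\<close>. The drop from \<open>x\<close> to that
  minimum is at most the drop from \<open>a\<close>, which equals \<open>C\<close> by the fifth
  equation. Downward impulses are symmetric with \<open>\<beta>\<close>, \<open>b\<close> and
  \<open>D\<close>.\<close>

lemma h_quasi: "h x \<le> h (x + \<xi>) + imp_cost C c D d \<xi>"
proof -
 consider "\<xi> = 0" | "\<xi> > 0" | "\<xi> < 0" by linarith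
 then show ?thesis
 proof cases
  case 1 then show ?thesis by (simp add: imp_cost_def)
 next
  case 2
  have "h x + c * x \<le> h (x + \<xi>) + c * (x + \<xi>) + C"
  proof (cases "x \<ge> \<alpha>")
   case True then show ?thesis using h_plus_c_inc[of x "x + \<xi>"] 2 CD by simp
  next
   case False
   have 1: "h \<alpha> + c * \<alpha> \<le> h (x + \<xi>) + c * (x + \<xi>)"
    using h_plus_c_inc[of \<alpha> "x + \<xi>"] h_plus_c_dec[of "x + \<xi>" \<alpha>] by linarith
   have "h x + c * x \<le> h \<alpha> + c * \<alpha> + C"
   proof (cases "x \<le> a")
    case True then show ?thesis using h_intervene_a[of x] False by (simp add: imp_cost_def algebra_simps)
   next
    case F: False
    then have "h x + c * x \<le> h a + c * a" using h_plus_c_dec[of a x] False by simp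
    then show ?thesis using h_intervene_a[of a] band_par by (simp add: imp_cost_def algebra_simps)
   qed
   then show ?thesis using 1 by linarith
  qed
  then show ?thesis using 2 by (simp add: imp_cost_def algebra_simps)
 next
  case 3
  have "h x - d * x \<le> h (x + \<xi>) - d * (x + \<xi>) + D"
  proof (cases "x \<le> \<beta>")
   case True then show ?thesis using h_minus_d_dec[of "x + \<xi>" x] 3 CD by simp
  next
   case False
   have 1: "h \<beta> - d * \<beta> \<le> h (x + \<xi>) - d * (x + \<xi>)"
    using h_minus_d_inc[of \<beta> "x + \<xi>"] h_minus_d_dec[of "x + \<xi>" \<beta>] by linarith
   have "h x - d * x \<le> h \<beta> - d * \<beta> + D"
   proof (cases "x \<ge> b")
    case True then show ?thesis using h_intervene_b[of x] False by (simp add: imp_cost_def algebra_simps)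
   next
    case F: False
    then have "h x - d * x \<le> h b - d * b" using h_minus_d_inc[of x b] False by simp
    then show ?thesis using h_intervene_b[of b] band_par by (simp add: imp_cost_def algebra_simps)
   qed
   then show ?thesis using 1 by linarith
  qed
  then show ?thesis using 3 by (simp add: imp_cost_def algebra_simps)
 qed
qed

section \<open>The generator applied to \<open>h\<close>, inside and outside the band\<close>

lemma jump_mean_linear:
 assumes "\<And>z. z \<ge> x \<Longrightarrow> v z = p + q * (z - x)" and [measurable]: "v \<in> borel_measurable borel"
 shows "jump_mean \<theta> v x = p + q / \<theta>"
proof -
 interpret prob_space "expo \<theta>" using theta by (rule prob_space_expo)
 have pos: "AE z in expo \<theta>. 0 \<le> z"
  unfolding expo_def by (subst AE_density) (auto simp: exponential_density_def)
 have "jump_mean \<theta> v x = (\<integral>z. p + q * z \<partial>expo \<theta>)"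
  unfolding jump_mean_def by (rule integral_cong_AE) (use pos assms(1) in auto)
 then show ?thesis
  using integrable_expo_id[OF theta] integral_expo_id[OF theta] by (simp add: prob_space[simplified])
qed

lemma jump_mean_ge_b: "x \<ge> b \<Longrightarrow> jump_mean \<theta> h x = h x + d / \<theta>"
 by (rule jump_mean_linear) (auto simp: h_ge_b algebra_simps)

text \<open>The seventh equation is the generator equation at the right end, where the jump integral
  sees only the affine piece of \<open>h\<close>.\<close>

lemma gen_at_b: "1/2 * \<sigma>\<^sup>2 * f2 b + d / \<theta> - lam * f b + (b - \<rho>)\<^sup>2 = 0"
proof -
 have "exp (\<theta> * b) * (LBINT z:{b..}. (f b + d * (z - b)) * \<theta> * exp (- \<theta> * z)) = jump_mean \<theta> (\<lambda>z. f b + d * (z - b)) b"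
  by (rule jump_mean_tail[symmetric]) (use theta in auto)
 also have "\<dots> = f b + d / \<theta>" by (rule jump_mean_linear) auto
 finally show ?thesis using eq7 by (simp add: deriv_f deriv_f1 algebra_simps)
qed

text \<open>\<open>F\<close> is the value the jump integral would need to have. By
  \<open>ode\<close> it solves the same first-order equation as the jump integral, and
  \<open>gen_at_b\<close> makes the two agree at \<open>b\<close>, so the homogeneous term in
  \<open>jump_mean_split\<close> vanishes.\<close>

lemma gen_in: "x \<in> {a..b} \<Longrightarrow> 1/2 * \<sigma>\<^sup>2 * f2 x + jump_mean \<theta> h x - (1 + lam) * h x + (x - \<rho>)\<^sup>2 = 0"
proof -
 assume x: "x \<in> {a..b}"
 define F where "F z = - (1/2 * \<sigma>\<^sup>2 * f2 z - (1 + lam) * f z + (z - \<rho>)\<^sup>2)" for z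
 have "jump_mean \<theta> h x = F x + exp (- \<theta> * (b - x)) * (jump_mean \<theta> h b - F b)"
 proof (rule jump_mean_split[OF theta h_lip])
  fix z assume z: "x \<le> z" "z \<le> b"
  have dF: "(F has_real_derivative - (1/2 * \<sigma>\<^sup>2 * f3 z - (1 + lam) * f1 z + 2 * (z - \<rho>))) (at z)"
   unfolding F_def[abs_def] by (auto intro!: derivative_eq_intros f_deriv f2_deriv)
  have dE: "((\<lambda>z. exp (- \<theta> * z)) has_real_derivative - \<theta> * exp (- \<theta> * z)) (at z)"
   by (auto intro!: derivative_eq_intros)
  have e: "- (1/2 * \<sigma>\<^sup>2 * f3 z - (1 + lam) * f1 z + 2 * (z - \<rho>)) = \<theta> * F z - \<theta> * f z"
   using ode[of z] unfolding F_def by (simp add: algebra_simps)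
  have hz: "h z = f z" using z x h_in[of z] by simp
  show "((\<lambda>z. F z * exp (- \<theta> * z)) has_real_derivative - (h z * \<theta> * exp (- \<theta> * z))) (at z)"
   using DERIV_mult[OF dF dE] unfolding e hz by (simp add: algebra_simps)
 qed (use x in auto)
 moreover have "jump_mean \<theta> h b = F b"
  using gen_at_b jump_mean_ge_b[of b] h_in[of b] ab unfolding F_def by (simp add: algebra_simps)
 ultimately show ?thesis using x h_in[of x] unfolding F_def by (simp add: algebra_simps)
qed

text \<open>Beyond \<open>b\<close> the expression is a quadratic polynomial in \<open>x - b\<close>
  with leading coefficient 1. Its constant term is \<open>- 1/2 * \<sigma>^2 * f2 b\<close> and its
  linear coefficient \<open>- 1/2 * \<sigma>^2 * f3 b\<close>, both nonnegative by the shape of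
  \<open>f\<close>.\<close>

lemma gen_ge_b: "x \<ge> b \<Longrightarrow> jump_mean \<theta> h x - (1 + lam) * h x + (x - \<rho>)\<^sup>2 \<ge> 0"
proof -
 assume x: "x \<ge> b"
 have "1/2 * \<sigma>\<^sup>2 * f3 b - lam * d + 2 * (b - \<rho>) = 0"
 proof -
  have "1/2 * \<sigma>\<^sup>2 * f3 b - lam * d + 2 * (b - \<rho>)
   = (1/2 * \<sigma>\<^sup>2 * (f3 b - \<theta> * f2 b) - (1 + lam) * (f1 b - \<theta> * f b) + 2 * (b - \<rho>) - \<theta> * (b - \<rho>)\<^sup>2 - \<theta> * f b)
    + \<theta> * (1/2 * \<sigma>\<^sup>2 * f2 b + d / \<theta> - lam * f b + (b - \<rho>)\<^sup>2)"
   using theta f1_values by (simp add: algebra_simps)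
  then show ?thesis using ode[of b] gen_at_b by simp
 qed
 moreover have "1/2 * \<sigma>\<^sup>2 * f3 b \<le> 0" using f3_b by (simp add: mult_le_0_iff)
 ultimately have 1: "2 * (b - \<rho>) \<ge> lam * d" by linarith
 have "1/2 * \<sigma>\<^sup>2 * f2 b \<le> 0" using f2_b by (simp add: mult_le_0_iff)
 then have 2: "d / \<theta> - lam * f b + (b - \<rho>)\<^sup>2 \<ge> 0" using gen_at_b by linarith
 have "jump_mean \<theta> h x - (1 + lam) * h x + (x - \<rho>)\<^sup>2
   = (d / \<theta> - lam * f b + (b - \<rho>)\<^sup>2) + (2 * (b - \<rho>) - lam * d) * (x - b) + (x - b)\<^sup>2"
  using x by (simp add: jump_mean_ge_b h_ge_b algebra_simps power2_eq_square)
 moreover have "(2 * (b - \<rho>) - lam * d) * (x - b) \<ge> 0" using 1 x by (intro mult_nonneg_nonneg) auto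
 ultimately show ?thesis using 2 zero_le_power2[of "x - b"] by linarith
qed

text \<open>Multiplication by \<open>exp (- \<theta> * z)\<close> turns the expression into
  \<open>W\<close>, whose derivative is \<open>q z * exp (- \<theta> * z)\<close> with a concave
  quadratic \<open>q\<close>. To the left of \<open>a\<close> this \<open>q\<close> is nonpositive,
  so \<open>W\<close> decreases towards its nonnegative value at \<open>a\<close>.\<close>

lemma gen_le_a: "x \<le> a \<Longrightarrow> jump_mean \<theta> h x - (1 + lam) * h x + (x - \<rho>)\<^sup>2 \<ge> 0"
proof -
 assume x: "x \<le> a"
 define l where "l z = f a - c * (z - a)" for z
 define q where "q z = lam * \<theta> * l z + (1 + lam) * c + 2 * (z - \<rho>) - \<theta> * (z - \<rho>)\<^sup>2" for z
 define W where "W z = (- lam * l z - c / \<theta> + (z - \<rho>)\<^sup>2) * exp (- \<theta> * z) + exp (- \<theta> * a) * (jump_mean \<theta> h a - (l a - c / \<theta>))" for z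
 have W: "W z = exp (- \<theta> * z) * (jump_mean \<theta> h z - (1 + lam) * h z + (z - \<rho>)\<^sup>2)" if z: "z \<le> a" for z
 proof -
  have "jump_mean \<theta> h z = (l z - c / \<theta>) + exp (- \<theta> * (a - z)) * (jump_mean \<theta> h a - (l a - c / \<theta>))"
  proof (rule jump_mean_split[OF theta h_lip z])
   fix y assume "y \<le> a"
   then show "((\<lambda>z. (l z - c / \<theta>) * exp (- \<theta> * z)) has_real_derivative - (h y * \<theta> * exp (- \<theta> * y))) (at y)"
    unfolding l_def h_le_a[OF \<open>y \<le> a\<close>] using theta
    by (auto intro!: derivative_eq_intros simp: algebra_simps)
  qed
  moreover have "exp (- \<theta> * z) * exp (- \<theta> * (a - z)) = exp (- \<theta> * a)"
   by (simp add: exp_add[symmetric] algebra_simps)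
  ultimately have "exp (- \<theta> * z) * jump_mean \<theta> h z = exp (- \<theta> * z) * (l z - c / \<theta>) + exp (- \<theta> * a) * (jump_mean \<theta> h a - (l a - c / \<theta>))"
   by (simp add: distrib_left flip: mult.assoc)
  moreover have "h z = l z" using h_le_a[OF z] l_def by simp
  ultimately show ?thesis
   unfolding W_def by (simp add: algebra_simps)
 qed
 have dW: "(W has_real_derivative q z * exp (- \<theta> * z)) (at z)" for z
  unfolding W_def q_def l_def using theta
  by (auto intro!: derivative_eq_intros simp: algebra_simps)
 \<comment> \<open>At \<open>a\<close> the equation \<open>ode\<close> turns \<open>q\<close> into
   an expression in \<open>f2\<close> and \<open>f3\<close> whose signs are known.\<close>
 have qa: "q a \<le> 0"
 proof -
  have "q a = - (1/2 * \<sigma>\<^sup>2 * (f3 a - \<theta> * f2 a))"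
   using ode[of a] f1_values unfolding q_def l_def by (simp add: algebra_simps)
  moreover have "f3 a - \<theta> * f2 a \<ge> 0" using f3_a f2_a theta by (simp add: mult_le_0_iff order_trans[of _ 0])
  ultimately show ?thesis by (simp add: mult_nonneg_nonneg)
 qed
 \<comment> \<open>This number is the derivative of \<open>q\<close> at \<open>a\<close>, and it
   equals \<open>R a\<close>. At the maximum \<open>s\<close> of \<open>f2\<close> all terms of
   \<open>R_eq\<close> are nonnegative, and \<open>R\<close> only grows to the left.\<close>
 have q'a: "- lam * \<theta> * c + 2 - 2 * \<theta> * (a - \<rho>) \<ge> 0"
 proof -
  obtain s where s: "a \<le> s" "f3 s = 0" "f2 s \<ge> 0" using f3_zero by auto
  have "\<sigma>\<^sup>2 * f4 s \<le> 0" using f4_nonpos[of s] by (simp add: mult_le_0_iff)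
  moreover have "(1 + lam) * f2 s \<ge> 0" using s lam by (intro mult_nonneg_nonneg) auto
  ultimately have "R s \<ge> 0" unfolding R_eq using s by simp
  then have "R a \<ge> 0" using R_antimono[OF s(1)] by linarith
  moreover have "R a = - lam * \<theta> * c + 2 - 2 * \<theta> * (a - \<rho>)"
  proof -
   define s where "s = L1 * m1 * exp (m1 * a) + L2 * m2 * exp (m2 * a) + L3 * m3 * exp (m3 * a)"
   have "s = - c - 2 / lam * (a - \<rho>) - 2 / (\<theta> * lam\<^sup>2)"
    using f1_values(1) unfolding f1_def s_def by simp
   then have "R a = 2 * (1 + lam) / lam + \<theta> * lam * (- c - 2 / lam * (a - \<rho>) - 2 / (\<theta> * lam\<^sup>2))"
    unfolding R_def s_def[symmetric] by simp
   also have "\<dots> = - lam * \<theta> * c + 2 - 2 * \<theta> * (a - \<rho>)"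
    using lam theta by (simp add: field_simps power2_eq_square)
   finally show ?thesis .
  qed
  ultimately show ?thesis by simp
 qed
 have q: "q z \<le> 0" if "z \<le> a" for z
 proof -
  have "q z = q a + (- lam * \<theta> * c + 2 - 2 * \<theta> * (a - \<rho>)) * (z - a) - \<theta> * (z - a)\<^sup>2"
   unfolding q_def l_def by (simp add: algebra_simps power2_eq_square)
  moreover have "(- lam * \<theta> * c + 2 - 2 * \<theta> * (a - \<rho>)) * (z - a) \<le> 0"
   using q'a that by (simp add: mult_nonneg_nonpos)
  moreover have "\<theta> * (z - a)\<^sup>2 \<ge> 0" using theta by simp
  ultimately show ?thesis using qa by linarith
 qed
 have "1/2 * \<sigma>\<^sup>2 * f2 a \<le> 0" using f2_a by (simp add: mult_le_0_iff)
 then have "jump_mean \<theta> h a - (1 + lam) * h a + (a - \<rho>)\<^sup>2 \<ge> 0"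
  using gen_in[of a] ab by simp
 then have "0 \<le> W a" using W[of a] by simp
 also have "W a \<le> W x"
 proof (rule DERIV_nonpos_imp_nonincreasing[OF x])
  fix z assume "x \<le> z" "z \<le> a"
  then show "\<exists>y. (W has_real_derivative y) (at z) \<and> y \<le> 0"
   using dW[of z] q[of z] by (auto simp: mult_le_0_iff intro!: exI)
 qed
 finally show ?thesis unfolding W[OF x] by (simp add: zero_le_mult_iff)
qed

lemma gen_ineq: "0 \<le> 1/2 * \<sigma>\<^sup>2 * (if x \<in> {a..b} then f2 x else 0) + jump_mean \<theta> h x - (1 + lam) * h x + (x - \<rho>)\<^sup>2"
 using gen_in[of x] gen_le_a[of x] gen_ge_b[of x] by force

section \<open>Local second-order bounds for \<open>h\<close> and its approximations, with uniform
  constants\<close>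

text \<open>The jump of the second derivative at \<open>a\<close> and \<open>b\<close> is bypassed:
  \<open>gen_ineq\<close> bounds the second derivative at each \<open>s\<close> below by
  \<open>- 2 * \<Psi> s / \<sigma>^2\<close>, and \<open>\<Psi>\<close> is Lipschitz on bounded
  sets. So one number \<open>m\<close>, computed from \<open>\<Psi> y\<close> alone, lies below the
  second derivative near \<open>y\<close> and at the same time almost satisfies the generator
  inequality at \<open>y\<close>.\<close>

lemma lower_step:
 assumes \<eta>: "\<eta> > 0"
 shows "\<exists>\<delta>>0. \<forall>y. \<bar>y\<bar> \<le> Kb \<longrightarrow> (\<exists>m. \<bar>m\<bar> \<le> KK \<and> (\<forall>z. \<bar>z\<bar> \<le> \<delta> \<longrightarrow> h y + hder y * z + m * z\<^sup>2 / 2 \<le> h (y + z)) \<and>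
  - \<eta> \<le> \<sigma>\<^sup>2 / 2 * m + (jump_mean \<theta> h y - h y) - lam * h y + (y - \<rho>)\<^sup>2)"
proof -
 define \<Psi> where "\<Psi> y = jump_mean \<theta> h y - (1 + lam) * h y + (y - \<rho>)\<^sup>2" for y
 define p where "p x = (if x \<in> {a..b} then f2 x else 0)" for x
 \<comment> \<open>A Lipschitz constant of \<open>\<Psi>\<close> for pairs at distance at most 1
   with one point in the ball of radius \<open>Kb\<close>: the three summands belong to the jump
   term, to \<open>h\<close> and to the quadratic cost.\<close>
 define \<kappa> where "\<kappa> = KK + (1 + lam) * KK + (2 * \<bar>Kb\<bar> + 1 + 2 * \<bar>\<rho>\<bar>)"
 have \<kappa>: "\<kappa> > 0" using KK(1) lam unfolding \<kappa>_def by (auto intro!: add_pos_pos add_pos_nonneg)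
 define \<delta> where "\<delta> = min 1 (\<eta> / \<kappa>)"
 have \<delta>: "0 < \<delta>" "\<delta> \<le> 1" "\<kappa> * \<delta> \<le> \<eta>" using \<kappa> \<eta> by (auto simp: \<delta>_def min_def field_simps)
 have p_bound: "\<bar>p x\<bar> \<le> KK" for x using KK(3)[of x] KK(1) unfolding p_def by auto
 have gen: "- \<Psi> x \<le> \<sigma>\<^sup>2 / 2 * p x" for x
  using gen_ineq[of x] unfolding \<Psi>_def p_def by linarith
 have \<Psi>_lip: "\<Psi> s \<le> \<Psi> y + \<eta>" if y: "\<bar>y\<bar> \<le> Kb" and s: "\<bar>s - y\<bar> \<le> \<delta>" for y s
 proof -
  have 1: "jump_mean \<theta> h s - jump_mean \<theta> h y \<le> KK * \<bar>s - y\<bar>"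
   using jump_mean_lipschitz[OF theta h_lip, of s y] by linarith
  have "(1 + lam) * (h y - h s) \<le> (1 + lam) * (KK * \<bar>s - y\<bar>)"
   using h_lip[of y s] lam by (intro mult_left_mono) (auto simp: abs_minus_commute)
  then have 2: "- (1 + lam) * h s + (1 + lam) * h y \<le> (1 + lam) * KK * \<bar>s - y\<bar>" by (simp add: algebra_simps)
  have "(s - \<rho>)\<^sup>2 - (y - \<rho>)\<^sup>2 = (s + y - 2 * \<rho>) * (s - y)" by (simp add: power2_eq_square algebra_simps)
  also have "\<dots> \<le> \<bar>s + y - 2 * \<rho>\<bar> * \<bar>s - y\<bar>" by (metis abs_ge_self abs_mult)
  also have "\<dots> \<le> (2 * \<bar>Kb\<bar> + 1 + 2 * \<bar>\<rho>\<bar>) * \<bar>s - y\<bar>"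
   using y s \<delta> by (intro mult_right_mono) auto
  finally have "\<Psi> s - \<Psi> y \<le> \<kappa> * \<bar>s - y\<bar>"
   using 1 2 unfolding \<Psi>_def \<kappa>_def by (simp add: algebra_simps)
  also have "\<dots> \<le> \<kappa> * \<delta>" using s \<kappa> by (intro mult_left_mono) auto
  finally show ?thesis using \<delta> by linarith
 qed
 have "\<exists>m. \<bar>m\<bar> \<le> KK \<and> (\<forall>z. \<bar>z\<bar> \<le> \<delta> \<longrightarrow> h y + hder y * z + m * z\<^sup>2 / 2 \<le> h (y + z)) \<and>
  - \<eta> \<le> \<sigma>\<^sup>2 / 2 * m + (jump_mean \<theta> h y - h y) - lam * h y + (y - \<rho>)\<^sup>2" if y: "\<bar>y\<bar> \<le> Kb" for y
 proof -
  \<comment> \<open>The maximum with \<open>- KK\<close> only keeps \<open>m\<close> bounded;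
    \<open>m \<le> p s\<close> survives because \<open>p\<close> itself is bounded by
    \<open>KK\<close>.\<close>
  define m where "m = max (- KK) (2 / \<sigma>\<^sup>2 * (- \<Psi> y - \<eta>))"
  have s2: "\<sigma>\<^sup>2 > 0" using sigma_nz by simp
  have m_le: "m \<le> p s" if s: "\<bar>s - y\<bar> \<le> \<delta>" for s
  proof -
   have "- \<Psi> y - \<eta> \<le> \<sigma>\<^sup>2 / 2 * p s" using gen[of s] \<Psi>_lip[OF y s] by linarith
   then have "2 / \<sigma>\<^sup>2 * (- \<Psi> y - \<eta>) \<le> p s" using s2 by (simp add: field_simps)
   then show ?thesis using p_bound[of s] unfolding m_def by auto
  qed
  have "\<bar>m\<bar> \<le> KK" using m_le[of y] p_bound[of y] \<delta> unfolding m_def by auto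
  moreover have "h y + hder y * z + m * z\<^sup>2 / 2 \<le> h (y + z)" if "\<bar>z\<bar> \<le> \<delta>" for z
  proof (rule taylor_lower[where \<delta>=\<delta>, OF h_deriv _ that])
   have mono: "m * (t - r) \<le> hder t - hder r" if "r < t" "\<bar>r - y\<bar> \<le> \<delta>" "\<bar>t - y\<bar> \<le> \<delta>" for r t
   proof (cases "r < a \<or> t > b")
    case True
    \<comment> \<open>A point outside the band has second derivative 0, which forces
      \<open>m \<le> 0\<close>; then clamping, which shortens the interval over which the slope
      changes, goes in the right direction.\<close>
    then have "p r = 0 \<or> p t = 0" by (auto simp: p_def)
    then have m0: "m \<le> 0" using m_le[of r] m_le[of t] that by auto
    let ?r = "clamp1 a b r" and ?t = "clamp1 a b t"
    show ?thesis
    proof (cases "?r = ?t")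
     case True
     then show ?thesis using m0 that by (simp add: hder_def mult_nonpos_nonneg)
    next
     case False
     then have rt: "?r < ?t" "r \<le> ?r" "?t \<le> t" "?t - ?r \<le> t - r"
      using that ab by (auto simp: clamp1_def max_def min_def split: if_splits)
     obtain z where z: "?r < z" "z < ?t" "f1 ?t - f1 ?r = (?t - ?r) * f2 z"
      using MVT2[OF rt(1), of f1 f2] f1_deriv by blast
     have "z \<in> {a..b}" using z clamp1_in[of a b r] clamp1_in[of a b t] ab by auto
     then have "m \<le> f2 z" using m_le[of z] z rt that by (auto simp: p_def)
     then have "(?t - ?r) * m \<le> (?t - ?r) * f2 z" using rt by (intro mult_left_mono) auto
     moreover have "(t - r) * m \<le> (?t - ?r) * m" using rt m0 by (intro mult_right_mono_neg) auto
     ultimately have "(t - r) * m \<le> f1 ?t - f1 ?r" unfolding z(3) by linarith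
     then show ?thesis unfolding hder_def by (simp add: mult.commute)
    qed
   next
    case False
    then have rt: "r \<in> {a..b}" "t \<in> {a..b}" using that by auto
    obtain z where z: "r < z" "z < t" "f1 t - f1 r = (t - r) * f2 z"
     using MVT2[OF \<open>r < t\<close>, of f1 f2] f1_deriv by blast
    have "m \<le> f2 z" using m_le[of z] z rt that by (auto simp: p_def split: if_splits)
    then have "(t - r) * m \<le> (t - r) * f2 z" using that by (intro mult_left_mono) auto
    then show ?thesis using z rt by (simp add: hder_in mult.commute)
   qed
   fix s assume s: "\<bar>s - y\<bar> \<le> \<delta>"
   consider "s = y" | "s < y" | "y < s" by linarith
   then show "m * (s - y)\<^sup>2 \<le> (s - y) * (hder s - hder y)"
   proof cases
    case 2
    have "(y - s) * (m * (y - s)) \<le> (y - s) * (hder y - hder s)"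
     using mono[of s y] 2 s \<delta> by (intro mult_left_mono) auto
    then show ?thesis by (simp add: power2_eq_square algebra_simps)
   next
    case 3
    have "(s - y) * (m * (s - y)) \<le> (s - y) * (hder s - hder y)"
     using mono[of y s] 3 s \<delta> by (intro mult_left_mono) auto
    then show ?thesis by (simp add: power2_eq_square algebra_simps)
   qed simp
  qed
  moreover have "- \<eta> \<le> \<sigma>\<^sup>2 / 2 * m + (jump_mean \<theta> h y - h y) - lam * h y + (y - \<rho>)\<^sup>2"
  proof -
   have "\<sigma>\<^sup>2 / 2 * (2 / \<sigma>\<^sup>2 * (- \<Psi> y - \<eta>)) \<le> \<sigma>\<^sup>2 / 2 * m"
    unfolding m_def by (intro mult_left_mono) auto
   then have "- \<Psi> y - \<eta> \<le> \<sigma>\<^sup>2 / 2 * m" using s2 by simp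
   then show ?thesis unfolding \<Psi>_def by (simp add: algebra_simps)
  qed
  ultimately show ?thesis by blast
 qed
 then show ?thesis using \<delta>(1) by blast
qed

text \<open>A function that agrees with \<open>f\<close> slightly beyond the band and with \<open>h\<close> up to a small
 constant everywhere: the slope \<open>f1\<close> is continued past the band and then brought back to
 \<open>- c\<close> and \<open>d\<close> by linear ramps of length one. In contrast to \<open>h\<close> it has a continuous second
 derivative near the boundary of the band.\<close>

lemma upper_step:
 assumes \<eta>: "\<eta> > 0"
 obtains v vd K \<delta> where "\<And>x. (v has_real_derivative vd x) (at x)" "\<And>x. \<bar>vd x\<bar> \<le> K"
  "\<And>x y. \<bar>vd x - vd y\<bar> \<le> K * \<bar>x - y\<bar>" "\<And>x. \<bar>v x - h x\<bar> \<le> \<eta>" "\<And>x. x \<in> {a..b} \<Longrightarrow> v x = h x"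
  "\<delta> > 0" "\<And>y. y \<in> {a..b} \<Longrightarrow> (\<exists>m. \<bar>m\<bar> \<le> K \<and> (\<forall>z. \<bar>z\<bar> \<le> \<delta> \<longrightarrow> v (y + z) \<le> v y + vd y * z + m * z\<^sup>2 / 2) \<and>
   \<sigma>\<^sup>2 / 2 * m + (jump_mean \<theta> v y - v y) - lam * v y + (y - \<rho>)\<^sup>2 \<le> \<eta>)"
proof -
 \<comment> \<open>The slopes of \<open>v\<close> and \<open>h\<close> will differ by at most
   \<open>3 * KK * \<delta>0\<close>, and only within distance 2 of the band. The functions then
   differ by at most \<open>6 * KK * \<delta>0\<close>, and the factor 12 makes this at most
   \<open>\<eta> / 2\<close>.\<close>
 define \<delta>0 where "\<delta>0 = min 1 (\<eta> / (12 * KK))"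
 have \<delta>0: "0 < \<delta>0" "\<delta>0 \<le> 1" "12 * KK * \<delta>0 \<le> \<eta>" using \<eta> KK(1) by (auto simp: \<delta>0_def min_def field_simps)
 define rb where "rb = d - f1 (b + \<delta>0)"
 define ra where "ra = - c - f1 (a - \<delta>0)"
 define vd where "vd x = f1 (clamp1 (a - \<delta>0) (b + \<delta>0) x) + rb * clamp1 0 1 (x - b - \<delta>0) + ra * clamp1 0 1 (a - \<delta>0 - x)" for x
 define K where "K = 3 * KK + \<eta>"
 have f1l: "\<bar>f1 x - f1 y\<bar> \<le> KK * \<bar>x - y\<bar>" if "x \<in> {a-2..b+2}" "y \<in> {a-2..b+2}" for x y
  using deriv_diff_bound[of "a-2" "b+2" f1 f2 "\<lambda>_. 0" "\<lambda>_. 0" KK x y] that f1_deriv KK(3) by auto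
 have rab: "\<bar>ra\<bar> \<le> KK * \<delta>0" "\<bar>rb\<bar> \<le> KK * \<delta>0"
  using f1l[of a "a - \<delta>0"] f1l[of b "b + \<delta>0"] \<delta>0 ab f1_values by (auto simp: ra_def rb_def)
 have KKd: "KK * \<delta>0 \<le> KK" using \<delta>0 KK(1) by (simp add: mult_left_le)
 have c01: "0 \<le> clamp1 0 1 x" "clamp1 0 1 x \<le> 1" for x by (auto simp: clamp1_def)
 have prod: "\<bar>r * clamp1 0 1 x\<bar> \<le> KK * \<delta>0" if "\<bar>r\<bar> \<le> KK * \<delta>0" for r x
 proof -
  have "\<bar>r * clamp1 0 1 x\<bar> = \<bar>r\<bar> * clamp1 0 1 x" using c01 by (simp add: abs_mult)
  also have "\<dots> \<le> \<bar>r\<bar> * 1" using c01 by (intro mult_left_mono) auto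
  finally show ?thesis using that by simp
 qed
 have vd_b: "\<bar>vd x\<bar> \<le> 3 * KK" for x
 proof -
  have "\<bar>f1 (clamp1 (a - \<delta>0) (b + \<delta>0) x)\<bar> \<le> KK"
   using clamp1_in[of "a - \<delta>0" "b + \<delta>0" x] \<delta>0 ab by (intro KK) auto
  then show ?thesis using prod[OF rab(1), of "a - \<delta>0 - x"] prod[OF rab(2), of "x - b - \<delta>0"] KKd unfolding vd_def by linarith
 qed
 have vd_l: "\<bar>vd x - vd y\<bar> \<le> 3 * KK * \<bar>x - y\<bar>" for x y
 proof -
  have 1: "\<bar>f1 (clamp1 (a - \<delta>0) (b + \<delta>0) x) - f1 (clamp1 (a - \<delta>0) (b + \<delta>0) y)\<bar> \<le> KK * \<bar>x - y\<bar>"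
   using \<delta>0 ab by (intro clamp1_compose_lip[where g'=f2] f1_deriv KK) auto
  have 2: "\<bar>r * clamp1 0 1 x' - r * clamp1 0 1 y'\<bar> \<le> KK * \<bar>x' - y'\<bar>" if "\<bar>r\<bar> \<le> KK * \<delta>0" for r x' y'
  proof -
   have "\<bar>r * clamp1 0 1 x' - r * clamp1 0 1 y'\<bar> = \<bar>r\<bar> * \<bar>clamp1 0 1 x' - clamp1 0 1 y'\<bar>"
    by (simp add: abs_mult flip: right_diff_distrib)
   also have "\<dots> \<le> KK * \<bar>x' - y'\<bar>" using order_trans[OF that KKd] KK(1) by (intro mult_mono clamp1_lip) auto
   finally show ?thesis .
  qed
  show ?thesis
   using 1 2[OF rab(1), of "a - \<delta>0 - x" "a - \<delta>0 - y"] 2[OF rab(2), of "x - b - \<delta>0" "y - b - \<delta>0"]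
   unfolding vd_def by (simp add: abs_minus_commute)
 qed
 have vd_h: "\<bar>vd x - hder x\<bar> \<le> 3 * KK * \<delta>0" for x
 proof -
  have "\<bar>clamp1 (a - \<delta>0) (b + \<delta>0) x - clamp1 a b x\<bar> \<le> \<delta>0" using \<delta>0 ab by (auto simp: clamp1_def max_def min_def)
  moreover have "\<bar>f1 (clamp1 (a - \<delta>0) (b + \<delta>0) x) - hder x\<bar> \<le> KK * \<bar>clamp1 (a - \<delta>0) (b + \<delta>0) x - clamp1 a b x\<bar>"
   unfolding hder_def using clamp1_in[of "a - \<delta>0" "b + \<delta>0" x] clamp1_in[of a b x] \<delta>0 ab by (intro f1l) auto
  ultimately have "\<bar>f1 (clamp1 (a - \<delta>0) (b + \<delta>0) x) - hder x\<bar> \<le> KK * \<delta>0"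
   using KK(1) by (meson order_trans mult_left_mono less_imp_le)
  then show ?thesis using prod[OF rab(1), of "a - \<delta>0 - x"] prod[OF rab(2), of "x - b - \<delta>0"] unfolding vd_def by linarith
 qed
 have vd_far: "vd x = hder x" if "x \<le> a - 2 \<or> x \<ge> b + 2" for x
  using that
 proof
  assume x: "x \<le> a - 2"
  then have "clamp1 0 1 (a - \<delta>0 - x) = 1" "clamp1 0 1 (x - b - \<delta>0) = 0" "clamp1 (a - \<delta>0) (b + \<delta>0) x = a - \<delta>0"
   using \<delta>0 ab by (auto simp: clamp1_def)
  then show ?thesis using hder_le_a[of x] x unfolding vd_def ra_def by simp
 next
  assume x: "x \<ge> b + 2"
  then have "clamp1 0 1 (a - \<delta>0 - x) = 0" "clamp1 0 1 (x - b - \<delta>0) = 1" "clamp1 (a - \<delta>0) (b + \<delta>0) x = b + \<delta>0"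
   using \<delta>0 ab by (auto simp: clamp1_def)
  then show ?thesis using hder_ge_b[of x] x unfolding vd_def rb_def by simp
 qed
 have vd_near: "vd x = f1 x" if "x \<in> {a - \<delta>0..b + \<delta>0}" for x
  using that \<delta>0 ab unfolding vd_def clamp1_def by auto
 have "continuous_on UNIV vd"
 proof -
  have "(3 * KK)-lipschitz_on UNIV vd" using vd_l KK(1) by (auto simp: lipschitz_on_def dist_real_def)
  then show ?thesis by (rule lipschitz_on_continuous_on)
 qed
 then obtain v where v: "v a = f a" "\<And>x. (v has_real_derivative vd x) (at x)"
  using continuous_antiderivative[of vd a "f a"] by blast
 have v_f: "v x = f x" if "x \<in> {a - \<delta>0..b + \<delta>0}" for x
 proof -
  have "\<bar>(v x - f x) - (v a - f a)\<bar> \<le> 0 * \<bar>x - a\<bar>"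
   by (rule deriv_diff_bound[of "a - \<delta>0" "b + \<delta>0" v vd f f1, OF v(2) f_deriv]) (use vd_near that ab \<delta>0 in auto)
  then show ?thesis using v by simp
 qed
 have v_in: "v x = h x" if "x \<in> {a..b}" for x using v_f[of x] h_in[of x] that \<delta>0 by auto
 have close: "\<bar>v x - h x\<bar> \<le> 6 * KK * \<delta>0" for x
 proof -
  have near: "\<bar>v y - h y\<bar> \<le> 6 * KK * \<delta>0" if y: "y \<in> {a - 2..b + 2}" for y
  proof -
   have "\<bar>(v y - h y) - (v (clamp1 a b y) - h (clamp1 a b y))\<bar> \<le> (3 * KK * \<delta>0) * \<bar>y - clamp1 a b y\<bar>"
    by (rule deriv_diff_bound[of "a - 2" "b + 2" v vd h hder, OF v(2) h_deriv vd_h])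
      (use y clamp1_in[of a b y] ab in auto)
   also have "\<dots> \<le> (3 * KK * \<delta>0) * 2"
    using y ab KK(1) \<delta>0 by (intro mult_left_mono) (auto simp: clamp1_def max_def min_def)
   finally show ?thesis using v_in[of "clamp1 a b y"] clamp1_in[of a b y] ab by simp
  qed
  consider "x \<in> {a - 2..b + 2}" | "x < a - 2" | "x > b + 2" by force
  then show ?thesis
  proof cases
   case 2
   have "\<bar>(v x - h x) - (v (a - 2) - h (a - 2))\<bar> \<le> 0 * \<bar>x - (a - 2)\<bar>"
    by (rule deriv_diff_bound[of x "a - 2" v vd h hder, OF v(2) h_deriv]) (use vd_far 2 in auto)
   then show ?thesis using near[of "a - 2"] ab by simp
  next
   case 3
   have "\<bar>(v x - h x) - (v (b + 2) - h (b + 2))\<bar> \<le> 0 * \<bar>x - (b + 2)\<bar>"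
    by (rule deriv_diff_bound[of "b + 2" x v vd h hder, OF v(2) h_deriv]) (use vd_far 3 in auto)
   then show ?thesis using near[of "b + 2"] ab by simp
  qed (rule near)
 qed
 have close2: "\<bar>v x - h x\<bar> \<le> \<eta> / 2" for x using close[of x] \<delta>0(3) by simp
 \<comment> \<open>The quadratic coefficient will be \<open>f2 y + \<eta>'\<close>. Division by
   \<open>\<sigma>^2 + 1\<close> limits its cost in the generator to \<open>\<eta> / 2\<close>; the
   other half pays for replacing \<open>h\<close> by \<open>v\<close> in the jump integral.\<close>
 define \<eta>' where "\<eta>' = \<eta> / (\<sigma>\<^sup>2 + 1)"
 have \<eta>': "0 < \<eta>'" "\<eta>' \<le> \<eta>" "\<sigma>\<^sup>2 / 2 * \<eta>' \<le> \<eta> / 2"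
 proof -
  have p: "0 < \<sigma>\<^sup>2 + 1" by (rule add_nonneg_pos) auto
  then show "0 < \<eta>'" using \<eta> by (simp add: \<eta>'_def)
  have e: "\<eta>' * (\<sigma>\<^sup>2 + 1) = \<eta>" using p by (simp add: \<eta>'_def)
  moreover have "0 \<le> \<eta>' * \<sigma>\<^sup>2" using \<open>0 < \<eta>'\<close> by simp
  ultimately show "\<eta>' \<le> \<eta>" unfolding distrib_left by linarith
  show "\<sigma>\<^sup>2 / 2 * \<eta>' \<le> \<eta> / 2" using e \<open>0 < \<eta>'\<close> by (simp add: algebra_simps)
 qed
 define \<delta> where "\<delta> = min \<delta>0 (\<eta>' / KK)"
 have \<delta>: "0 < \<delta>" "\<delta> \<le> \<delta>0" "KK * \<delta> \<le> \<eta>'" using \<delta>0 \<eta>' KK(1) by (auto simp: \<delta>_def min_def field_simps)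
 show thesis
 proof (rule that[OF v(2), of K \<delta>])
  show "\<bar>vd x\<bar> \<le> K" for x using vd_b[of x] \<eta> by (simp add: K_def)
  show "\<bar>vd x - vd y\<bar> \<le> K * \<bar>x - y\<bar>" for x y
   using vd_l[of x y] mult_nonneg_nonneg[of \<eta> "\<bar>x - y\<bar>"] \<eta> unfolding K_def distrib_right by linarith
  show "\<bar>v x - h x\<bar> \<le> \<eta>" for x using close2[of x] \<eta> by simp
  show "x \<in> {a..b} \<Longrightarrow> v x = h x" for x by (rule v_in)
  show "0 < \<delta>" by (rule \<delta>)
  fix y assume y: "y \<in> {a..b}"
  have ynear: "s \<in> {a - \<delta>0..b + \<delta>0}" if "\<bar>s - y\<bar> \<le> \<delta>" for s using that y \<delta> by auto
  show "\<exists>m. \<bar>m\<bar> \<le> K \<and> (\<forall>z. \<bar>z\<bar> \<le> \<delta> \<longrightarrow> v (y + z) \<le> v y + vd y * z + m * z\<^sup>2 / 2) \<and>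
   \<sigma>\<^sup>2 / 2 * m + (jump_mean \<theta> v y - v y) - lam * v y + (y - \<rho>)\<^sup>2 \<le> \<eta>"
  proof (intro exI[of _ "f2 y + \<eta>'"] conjI allI impI)
   show "\<bar>f2 y + \<eta>'\<bar> \<le> K" using KK(1) KK(3)[of y] y \<eta>' by (auto simp: K_def)
  next
   fix z assume z: "\<bar>z\<bar> \<le> \<delta>"
   have "- v y + - vd y * z + - (f2 y + \<eta>') * z\<^sup>2 / 2 \<le> - v (y + z)"
   proof (rule taylor_lower[where v="\<lambda>x. - v x" and vd="\<lambda>x. - vd x" and \<delta>=\<delta>, OF DERIV_minus[OF v(2)] _ z])
    fix s assume s: "\<bar>s - y\<bar> \<le> \<delta>"
    have f2b: "f2 r \<le> f2 y + \<eta>'" if "\<bar>r - y\<bar> \<le> \<delta>" for r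
    proof -
     have "\<bar>(f2 r - 0) - (f2 y - 0)\<bar> \<le> KK * \<bar>r - y\<bar>"
      by (rule deriv_diff_bound[of "a - 2" "b + 2" f2 f3 "\<lambda>_. 0" "\<lambda>_. 0", OF f2_deriv])
        (use that y \<delta> \<delta>0 KK(4) in auto)
     also have "\<dots> \<le> KK * \<delta>" using that KK(1) by (intro mult_left_mono) auto
     finally show ?thesis using \<delta> by simp
    qed
    have e: "vd s = f1 s" "vd y = f1 y" using vd_near[OF ynear[OF s]] vd_near[OF ynear[of y]] \<delta> by auto
    consider "s = y" | "s < y" | "y < s" by linarith
    then have "(s - y) * (f1 s - f1 y) \<le> (f2 y + \<eta>') * (s - y)\<^sup>2"
    proof cases
     case 2
     then obtain r where r: "s < r" "r < y" "f1 y - f1 s = (y - s) * f2 r"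
      using MVT2[of s y f1 f2] f1_deriv by blast
     have "(y - s)\<^sup>2 * f2 r \<le> (y - s)\<^sup>2 * (f2 y + \<eta>')" using f2b[of r] r s by (intro mult_left_mono) auto
     moreover have "(s - y) * (f1 s - f1 y) = (y - s) * (f1 y - f1 s)" by (simp add: algebra_simps)
     ultimately show ?thesis unfolding r(3) by (simp add: power2_eq_square algebra_simps)
    next
     case 3
     then obtain r where r: "y < r" "r < s" "f1 s - f1 y = (s - y) * f2 r"
      using MVT2[of y s f1 f2] f1_deriv by blast
     have "(s - y)\<^sup>2 * f2 r \<le> (s - y)\<^sup>2 * (f2 y + \<eta>')" using f2b[of r] r s by (intro mult_left_mono) auto
     then show ?thesis unfolding r(3) by (simp add: power2_eq_square algebra_simps)
    qed simp
    then show "- (f2 y + \<eta>') * (s - y)\<^sup>2 \<le> (s - y) * (- vd s - - vd y)"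
     unfolding e by (simp add: algebra_simps)
   qed
   then show "v (y + z) \<le> v y + vd y * z + (f2 y + \<eta>') * z\<^sup>2 / 2" by (simp only: mult_minus_left)
  next
   have "\<bar>jump_mean \<theta> v y - jump_mean \<theta> h y\<bar> \<le> \<eta> / 2"
    by (rule jump_mean_close[OF theta lip_of_deriv[OF v(2) vd_b] h_lip close2])
   moreover have "\<sigma>\<^sup>2 / 2 * (f2 y + \<eta>') = 1/2 * \<sigma>\<^sup>2 * f2 y + \<sigma>\<^sup>2 / 2 * \<eta>'" by (simp add: algebra_simps)
   ultimately show "\<sigma>\<^sup>2 / 2 * (f2 y + \<eta>') + (jump_mean \<theta> v y - v y) - lam * v y + (y - \<rho>)\<^sup>2 \<le> \<eta>"
    using gen_in[OF y] \<eta>'(3) unfolding v_in[OF y] distrib_right by linarith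
  qed
 qed
qed

end

section \<open>Short-time behaviour of the noise\<close>

text \<open>The compound Poisson sum as a function of two plain sequences, restricted to jumps with
  index at least \<open>j\<close>. The restriction serves the short-time estimate, where later jumps
  are negligible, and the renewal argument, where the first \<open>k\<close> jumps belong to the
  past.\<close>

definition cpf :: "nat \<Rightarrow> real \<Rightarrow> (nat \<Rightarrow> real) \<Rightarrow> (nat \<Rightarrow> real) \<Rightarrow> real" where
 "cpf j t e q = (\<Sum>k\<in>{k. j \<le> k \<and> (\<Sum>i\<le>k. e i) \<le> t}. q k)"

lemma cpoisson_cpf: "cpoisson E J t om = cpf 0 t (\<lambda>k. E k om) (\<lambda>k. J k om)"
 by (simp add: cpoisson_def cpf_def arrival_def)

text \<open>A sum over an infinite index set has the value 0, hence the case distinction. The limit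
  form yields measurability although the index set depends on the argument.\<close>

lemma cpf_limit:
 "cpf j t e q = (if \<exists>n. \<forall>k\<ge>n. \<not> (j \<le> k \<and> (\<Sum>i\<le>k. e i) \<le> t)
   then lim (\<lambda>n. \<Sum>k<n. if j \<le> k \<and> (\<Sum>i\<le>k. e i) \<le> t then q k else 0) else 0)"
proof (cases "\<exists>n. \<forall>k\<ge>n. \<not> (j \<le> k \<and> (\<Sum>i\<le>k. e i) \<le> t)")
 case True
 then obtain n where n: "\<forall>k\<ge>n. \<not> (j \<le> k \<and> (\<Sum>i\<le>k. e i) \<le> t)" by blast
 let ?A = "{k. j \<le> k \<and> (\<Sum>i\<le>k. e i) \<le> t}"
 have sub: "?A \<subseteq> {..<m}" if "m \<ge> n" for m using n that by (auto simp: not_le[symmetric])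
 have "(\<Sum>k<m. if j \<le> k \<and> (\<Sum>i\<le>k. e i) \<le> t then q k else 0) = cpf j t e q" if "m \<ge> n" for m
  unfolding cpf_def by (subst sum.inter_filter[symmetric]) (use sub[OF that] in \<open>auto intro!: sum.cong\<close>)
 then have "(\<lambda>m. \<Sum>k<m. if j \<le> k \<and> (\<Sum>i\<le>k. e i) \<le> t then q k else 0) \<longlonglongrightarrow> cpf j t e q"
  by (intro tendsto_eventually) (auto simp: eventually_sequentially)
 then have "lim (\<lambda>m. \<Sum>k<m. if j \<le> k \<and> (\<Sum>i\<le>k. e i) \<le> t then q k else 0) = cpf j t e q"
  by (rule limI)
 then show ?thesis using True by simp
next
 case False
 then have "infinite {k. j \<le> k \<and> (\<Sum>i\<le>k. e i) \<le> t}"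
  unfolding infinite_nat_iff_unbounded_le by auto
 then have "cpf j t e q = 0" by (simp add: cpf_def)
 then show ?thesis by (subst if_not_P[OF False])
qed

lemma cpf_measurable [measurable (raw)]:
 assumes [measurable]: "\<And>k. (\<lambda>x. e x k) \<in> borel_measurable N" "\<And>k. (\<lambda>x. q x k) \<in> borel_measurable N"
 shows "(\<lambda>x. cpf j t (e x) (q x)) \<in> borel_measurable N"
 unfolding cpf_limit by measurable

section \<open>Laws and moments of the Wiener and Poisson parts\<close>

locale noise =
 fixes M :: "'a measure" and \<theta> :: real and w :: "real \<Rightarrow> 'a \<Rightarrow> real" and E J :: "nat \<Rightarrow> 'a \<Rightarrow> real"
 assumes model: "noise_model M \<theta> w E J" and theta_pos: "0 < \<theta>"
begin

sublocale prob_space M using model by (simp add: noise_model_def)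

abbreviation N where "N \<equiv> cpoisson E J"

lemma wiener: "std_wiener M w" using model by (simp add: noise_model_def)

lemma w_measurable [measurable]: "w t \<in> borel_measurable M"
 using wiener by (simp add: std_wiener_def)

lemma w_0: "om \<in> space M \<Longrightarrow> w 0 om = 0" and w_cont: "om \<in> space M \<Longrightarrow> continuous_on {0..} (\<lambda>t. w t om)"
 using wiener by (auto simp: std_wiener_def)

lemma w_incr: "0 \<le> s \<Longrightarrow> s < t \<Longrightarrow> distributed M lborel (\<lambda>om. w t om - w s om) (normal_density 0 (sqrt (t - s)))"
 using wiener by (auto simp: std_wiener_def)

lemma E_dist: "distributed M lborel (E k) (exponential_density 1)"
 and J_dist: "distributed M lborel (J k) (exponential_density \<theta>)"
 and E_indep: "indep_vars (\<lambda>_. borel) E UNIV"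
 and J_indep: "indep_vars (\<lambda>_. borel) J UNIV"
 and EJ_indep: "indep_var (PiM UNIV (\<lambda>_::nat. borel)) (\<lambda>om k. E k om) (PiM UNIV (\<lambda>_::nat. borel)) (\<lambda>om k. J k om)"
 using model by (auto simp: noise_model_def)

lemma E_measurable [measurable]: "E k \<in> borel_measurable M" and J_measurable [measurable]: "J k \<in> borel_measurable M"
 using distributed_measurable[OF E_dist, of k] distributed_measurable[OF J_dist, of k] by simp_all

lemma N_measurable [measurable]: "N t \<in> borel_measurable M"
 unfolding cpoisson_cpf[abs_def] by measurable

lemma distr_E: "distr M borel (E k) = expo 1" and distr_J: "distr M borel (J k) = expo \<theta>"
 using distributed_distr_eq_density[OF E_dist, of k] distributed_distr_eq_density[OF J_dist, of k]
 by (simp_all add: expo_def cong: distr_cong)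

lemma AE_exponential_pos:
 assumes "distributed M lborel X (exponential_density l)" "0 < l"
 shows "AE om in M. 0 < X om"
proof -
 have [measurable]: "X \<in> borel_measurable M" using distributed_measurable[OF assms(1)] by simp
 have "prob {x \<in> space M. X x \<le> 0} = 0"
  using exponential_distributedD_le[OF assms(1), of 0] assms(2) by simp
 then have "AE om in M. om \<notin> {x \<in> space M. X x \<le> 0}"
  by (subst prob_eq_0[symmetric]) simp_all
 then show ?thesis using AE_space by eventually_elim simp
qed

lemma E_le: "0 \<le> t \<Longrightarrow> prob {om \<in> space M. E k om \<le> t} = 1 - exp (- t)"
 using exponential_distributedD_le[OF E_dist, of t k] by simp

lemma expectation_exp_E:
 assumes r: "r = 1 / 2"
 shows "(\<integral>\<^sup>+om. ennreal (exp (- E k om)) \<partial>M) = ennreal r"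
proof -
 have "(\<integral>\<^sup>+om. ennreal (exp (- E k om)) \<partial>M) = (\<integral>\<^sup>+x. ennreal (exponential_density 1 x) * ennreal (exp (- x)) \<partial>lborel)"
  using distributed_nn_integral[OF E_dist, of "\<lambda>x. ennreal (exp (- x))" k] by simp
 also have "\<dots> = (\<integral>\<^sup>+x. ennreal r * ennreal (exponential_density 2 x) \<partial>lborel)"
  by (intro nn_integral_cong, subst (1 2) ennreal_mult[symmetric])
    (auto simp: exponential_density_def exp_add[symmetric] r)
 also have "\<dots> = ennreal r * emeasure (density lborel (\<lambda>x. ennreal (exponential_density 2 x))) UNIV"
  by (simp add: nn_integral_cmult emeasure_density)
 also have "emeasure (density lborel (\<lambda>x. ennreal (exponential_density 2 x))) UNIV = 1"
  using prob_space.emeasure_space_1[OF prob_space_exponential_density[of 2]] by simp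
 finally show ?thesis by simp
qed

text \<open>Chernoff bound with exponent 1: each waiting time contributes a factor 1/2, its Laplace
  transform at 1. The bound is summable in \<open>k\<close>, which excludes explosion by
  Borel-Cantelli.\<close>

lemma arrival_tail: "prob {om \<in> space M. arrival E k om \<le> t} \<le> exp t * (1 / 2) ^ Suc k"
proof -
 obtain r :: real where r: "r = 1 / 2" by blast
 have "indep_vars (\<lambda>_. borel) (\<lambda>i om. ennreal (exp (- E i om))) {..k}"
  by (rule indep_vars_compose2[OF indep_vars_subset[OF E_indep]]) auto
 then have "(\<integral>\<^sup>+om. (\<Prod>i\<in>{..k}. ennreal (exp (- E i om))) \<partial>M) = ennreal r ^ Suc k"
  using indep_vars_nn_integral[of "{..k}" "\<lambda>i om. ennreal (exp (- E i om))"] by (simp add: expectation_exp_E[OF r])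
 also have "(\<integral>\<^sup>+om. (\<Prod>i\<in>{..k}. ennreal (exp (- E i om))) \<partial>M) = (\<integral>\<^sup>+om. ennreal (exp (- arrival E k om)) \<partial>M)"
  by (simp add: prod_ennreal exp_sum[symmetric] arrival_def sum_negf)
 finally have *: "(\<integral>\<^sup>+om. ennreal (exp (- arrival E k om)) \<partial>M) = ennreal r ^ Suc k" .
 have [measurable]: "arrival E k \<in> borel_measurable M" unfolding arrival_def[abs_def] by measurable
 have "emeasure M {om \<in> space M. arrival E k om \<le> t} = (\<integral>\<^sup>+om. indicator {om \<in> space M. arrival E k om \<le> t} om \<partial>M)"
  by simp
 also have "\<dots> \<le> (\<integral>\<^sup>+om. ennreal (exp t) * ennreal (exp (- arrival E k om)) \<partial>M)"
  by (intro nn_integral_mono) (auto simp: ennreal_mult[symmetric] exp_add[symmetric] split: split_indicator)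
 also have "\<dots> = ennreal (exp t) * ennreal r ^ Suc k"
  by (simp add: nn_integral_cmult *)
 also have "\<dots> = ennreal (exp t * r ^ Suc k)"
  by (subst ennreal_power, simp add: r, subst ennreal_mult) (simp_all add: r del: power_Suc)
 finally show ?thesis unfolding emeasure_eq_measure
  by (subst (asm) ennreal_le_iff) (simp_all add: r)
qed

text \<open>The almost sure path properties on which all pathwise statements rest. Membership in
  \<open>space M\<close> is included so that continuity of the Wiener path is available as
  well.\<close>

definition good :: "'a \<Rightarrow> bool" where
 "good om \<longleftrightarrow> om \<in> space M \<and> (\<forall>k. 0 < E k om \<and> 0 < J k om) \<and> (\<forall>t. finite {k. arrival E k om \<le> t})"

lemma AE_good: "AE om in M. good om"
proof -
 have 1: "AE om in M. \<forall>k. 0 < E k om" "AE om in M. \<forall>k. 0 < J k om"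
  using AE_exponential_pos[OF E_dist] AE_exponential_pos[OF J_dist] theta_pos by (simp_all add: AE_all_countable)
 have [measurable]: "arrival E k \<in> borel_measurable M" for k unfolding arrival_def[abs_def] by measurable
 have "AE om in M. eventually (\<lambda>k. om \<in> space M - {om \<in> space M. arrival E k om \<le> real n}) sequentially" for n
 proof (rule borel_cantelli_AE1)
  have "summable (\<lambda>k. exp (real n) * (1 / 2) ^ Suc k)"
   by (intro summable_mult summable_ignore_initial_segment[where k=1, simplified] summable_geometric) auto
  then show "summable (\<lambda>k. prob {om \<in> space M. arrival E k om \<le> real n})"
   by (rule summable_comparison_test'[where N=0]) (use arrival_tail in simp)
 qed (auto simp: emeasure_eq_measure)
 then have "AE om in M. \<forall>n. eventually (\<lambda>k. om \<in> space M - {om \<in> space M. arrival E k om \<le> real n}) sequentially"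
  by (simp only: AE_all_countable) simp
 then show ?thesis using 1 AE_space
 proof eventually_elim
  case (elim om)
  have "finite {k. arrival E k om \<le> t}" for t
  proof -
   obtain n where n: "t \<le> real n" using real_arch_simple by blast
   from elim(1) have "eventually (\<lambda>k. \<not> arrival E k om \<le> real n) sequentially"
    by (auto elim!: allE[of _ n] eventually_mono)
   then obtain m where "\<forall>k\<ge>m. \<not> arrival E k om \<le> real n" by (auto simp: eventually_sequentially)
   then have "{k. arrival E k om \<le> t} \<subseteq> {..<m}" using n by (auto simp: not_le[symmetric])
   then show ?thesis by (rule finite_subset) simp
  qed
  then show ?case using elim by (simp add: good_def)
 qed
qed

lemma arrival_mono: "good om \<Longrightarrow> i \<le> k \<Longrightarrow> arrival E i om \<le> arrival E k om"
 unfolding arrival_def good_def by (intro sum_mono2) (auto intro: less_imp_le)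

lemma arrival_0: "arrival E 0 om = E 0 om" by (simp add: arrival_def)

lemma arrival_pos: "good om \<Longrightarrow> 0 < arrival E k om"
 using arrival_mono[of om 0 k] by (auto simp: arrival_0 good_def intro: less_le_trans)

lemma w_moments:
 assumes "0 \<le> s" "s < t"
 defines "D \<equiv> \<lambda>om. w t om - w s om"
 shows "integrable M D" "expectation D = 0" "integrable M (\<lambda>om. (D om)\<^sup>2)" "expectation (\<lambda>om. (D om)\<^sup>2) = t - s"
  "integrable M (\<lambda>om. (D om)^4)" "expectation (\<lambda>om. (D om)^4) = 3 * (t - s)\<^sup>2"
proof -
 have D: "distributed M lborel D (normal_density 0 (sqrt (t - s)))"
  unfolding D_def by (rule w_incr[OF assms(1,2)])
 have s: "0 < sqrt (t - s)" using assms by simp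
 have i: "integrable M (\<lambda>om. (D om)^k)" for k
  using distributed_integrable[OF D, of "\<lambda>x. x^k"] integrable_normal_moment[OF s, of 0 k] by simp
 have e: "expectation (\<lambda>om. (D om)^k) = (\<integral>x. normal_density 0 (sqrt (t - s)) x * (x - 0)^k \<partial>lborel)" for k
  using distributed_integral[OF D, of "\<lambda>x. x^k"] by simp
 show "integrable M D" using i[of 1] by simp
 show "integrable M (\<lambda>om. (D om)\<^sup>2)" "integrable M (\<lambda>om. (D om)^4)" using i by auto
 show "expectation D = 0" using e[of 1] integral_normal_moment_odd[OF s, of 0 0] by simp
 show "expectation (\<lambda>om. (D om)\<^sup>2) = t - s"
  using e[of 2] integral_normal_moment_even[OF s, of 0 1] assms by (simp add: fact_numeral)
 show "expectation (\<lambda>om. (D om)^4) = 3 * (t - s)\<^sup>2"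
  using e[of 4] integral_normal_moment_even[OF s, of 0 2] assms by (simp add: fact_numeral field_simps power2_eq_square)
qed

text \<open>The sigma-algebras generated by the Wiener process and by all waiting times and jumps.
  Their independence is an assumption of the model, which \<open>indep_var_WM_EM\<close> extends to
  arbitrary functionals of the two sources.\<close>

definition WM where "WM = vimage_algebra (space M) (\<lambda>om t. w t om) (PiM UNIV (\<lambda>_::real. borel :: real measure))"
definition EM where "EM = vimage_algebra (space M) (\<lambda>om k. (E k om, J k om)) (PiM UNIV (\<lambda>_::nat. borel \<Otimes>\<^sub>M borel :: (real \<times> real) measure))"

lemma indep_WM_EM: "indep_set (sets WM) (sets EM)"
 using model by (simp add: noise_model_def WM_def EM_def)

lemma space_WM [simp]: "space WM = space M" and space_EM [simp]: "space EM = space M"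
 by (simp_all add: WM_def EM_def)

lemma w_WM [measurable]: "w t \<in> borel_measurable WM"
proof -
 have "(\<lambda>om t. w t om) \<in> measurable WM (PiM UNIV (\<lambda>_::real. borel))"
  unfolding WM_def by (rule measurable_vimage_algebra1) (auto simp: space_PiM)
 from measurable_compose[OF this measurable_component_singleton[of t]] show ?thesis by simp
qed

lemma EJ_EM: "(\<lambda>om. (E k om, J k om)) \<in> measurable EM (borel \<Otimes>\<^sub>M borel)"
proof -
 have "(\<lambda>om k. (E k om, J k om)) \<in> measurable EM (PiM UNIV (\<lambda>_::nat. borel \<Otimes>\<^sub>M borel))"
  unfolding EM_def by (rule measurable_vimage_algebra1) (auto simp: space_PiM space_pair_measure)
 from measurable_compose[OF this measurable_component_singleton[of k]] show ?thesis by simp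
qed

lemma E_EM [measurable]: "E k \<in> borel_measurable EM" and J_EM [measurable]: "J k \<in> borel_measurable EM"
 using measurable_compose[OF EJ_EM[of k] measurable_fst] measurable_compose[OF EJ_EM[of k] measurable_snd] by simp_all

lemma N_EM [measurable]: "N t \<in> borel_measurable EM"
 unfolding cpoisson_cpf[abs_def] by measurable

lemma indep_var_WM_EM:
 assumes f: "f \<in> measurable WM S" and g: "g \<in> measurable EM T"
 shows "indep_var S f T g"
proof -
 have WE: "sets WM \<subseteq> events" "sets EM \<subseteq> events"
  using indep_WM_EM by (auto simp: indep_sets2_eq)
 have "f \<in> measurable M S" "g \<in> measurable M T"
  using f g WE by (auto simp: measurable_def)
 moreover have "sigma_sets (space M) {f -` A \<inter> space M |A. A \<in> sets S} \<subseteq> sets WM"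
  using f sets.sigma_sets_subset[of "{f -` A \<inter> space M |A. A \<in> sets S}" WM] by (auto simp: measurable_def)
 moreover have "sigma_sets (space M) {g -` A \<inter> space M |A. A \<in> sets T} \<subseteq> sets EM"
  using g sets.sigma_sets_subset[of "{g -` A \<inter> space M |A. A \<in> sets T}" EM] by (auto simp: measurable_def)
 ultimately show ?thesis
  using indep_WM_EM unfolding indep_var_eq indep_sets2_eq by blast
qed

definition tail :: "nat \<Rightarrow> real \<Rightarrow> 'a \<Rightarrow> real" where
 "tail j t om = cpf j t (\<lambda>k. E k om) (\<lambda>k. J k om)"

lemma tail_measurable [measurable]: "tail j t \<in> borel_measurable M"
 unfolding tail_def[abs_def] by measurable

lemma tail_0: "tail 0 t = N t" by (simp add: tail_def[abs_def] cpoisson_cpf[abs_def])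

lemma tail_nonneg: "good om \<Longrightarrow> 0 \<le> tail j t om"
 unfolding tail_def cpf_def good_def by (intro sum_nonneg) (auto intro: less_imp_le)

lemma arrival_measurable [measurable]: "arrival E k \<in> borel_measurable M"
 unfolding arrival_def[abs_def] by measurable

text \<open>An early arrival forces each of the \<open>k + 1\<close> waiting times to be at most
  \<open>t\<close>, and each of these independent events has probability at most \<open>t\<close>.
  For short times this gives the powers of \<open>t\<close> that \<open>arrival_tail\<close> does
  not provide.\<close>

lemma arrival_small:
 assumes "0 \<le> t"
 shows "prob {om \<in> space M. arrival E k om \<le> t} \<le> t ^ Suc k"
proof -
 have "AE om in M. om \<in> {om \<in> space M. arrival E k om \<le> t} \<longrightarrow> om \<in> (\<Inter>i\<in>{..k}. E i -` {..t} \<inter> space M)"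
  using AE_good
 proof eventually_elim
  case (elim om)
  have "E i om \<le> arrival E k om" if "i \<le> k" for i
   unfolding arrival_def using elim that by (intro member_le_sum) (auto simp: good_def intro: less_imp_le)
  then show ?case by (auto intro: order_trans)
 qed
 then have "prob {om \<in> space M. arrival E k om \<le> t} \<le> prob (\<Inter>i\<in>{..k}. E i -` {..t} \<inter> space M)"
  by (rule finite_measure_mono_AE) (auto intro!: sets.finite_INT measurable_sets)
 also have "\<dots> = (\<Prod>i\<in>{..k}. prob (E i -` {..t} \<inter> space M))"
  by (rule indep_varsD[OF E_indep]) auto
 also have "\<dots> \<le> (\<Prod>i\<in>{..k}. t)"
 proof (intro prod_mono conjI)
  fix i
  have "E i -` {..t} \<inter> space M = {om \<in> space M. E i om \<le> t}" by auto
  then show "prob (E i -` {..t} \<inter> space M) \<le> t"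
   using E_le[OF assms, of i] exp_ge_add_one_self[of "- t"] by simp
 qed simp
 finally show ?thesis by simp
qed

lemma J_integrable: "integrable M (J k)" and J_expectation: "expectation (J k) = 1 / \<theta>"
 using erlang_ith_moment_integrable[OF theta_pos J_dist, of k 1] exponential_distributed_expectation[OF theta_pos J_dist, of k]
 by simp_all

lemma indep_var_EJ:
 assumes "f \<in> measurable (PiM UNIV (\<lambda>_::nat. borel)) S" "g \<in> measurable (PiM UNIV (\<lambda>_::nat. borel)) T"
 shows "indep_var S (\<lambda>om. f (\<lambda>k. E k om)) T (\<lambda>om. g (\<lambda>k. J k om))"
 using indep_var_compose[OF EJ_indep assms] by (simp add: comp_def)

text \<open>A jump is independent of its arrival time and has mean \<open>1 / \<theta>\<close>, so
  the \<open>k\<close>-th term is at most \<open>t ^ Suc k / \<theta>\<close>. The factor 2 bounds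
  \<open>1 / (1 - t)\<close> in the geometric series. For \<open>j = 1\<close> the result says that
  jumps after the first contribute only order \<open>t^2\<close>.\<close>

lemma tail_expectation:
 assumes "0 \<le> t" "t \<le> 1 / 2"
 shows "integrable M (tail j t)" "expectation (tail j t) \<le> 2 / \<theta> * t ^ Suc j"
proof -
 let ?g = "\<lambda>k om. if j \<le> k \<and> arrival E k om \<le> t then ennreal (J k om) else 0"
 have eq: "AE om in M. ennreal (tail j t om) = (\<Sum>k. ?g k om)"
  using AE_good
 proof eventually_elim
  case (elim om)
  let ?A = "{k. j \<le> k \<and> arrival E k om \<le> t}"
  have fin: "finite ?A" using elim by (auto simp: good_def)
  have "(\<Sum>k. ?g k om) = (\<Sum>k\<in>?A. ?g k om)"
   by (rule suminf_finite[OF fin]) auto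
  also have "\<dots> = (\<Sum>k\<in>?A. ennreal (J k om))" by (rule sum.cong) auto
  also have "\<dots> = ennreal (tail j t om)"
   unfolding tail_def cpf_def using elim by (subst sum_ennreal) (auto simp: good_def arrival_def intro: less_imp_le)
  finally show ?case by simp
 qed
 have trm: "(\<integral>\<^sup>+om. ?g k om \<partial>M) \<le> ennreal (1 / \<theta> * t ^ Suc k)" for k
 proof -
  have "indep_var borel (\<lambda>om. (\<lambda>e. indicator {..t} (\<Sum>i\<le>k. e i) :: real) (\<lambda>k. E k om)) borel (\<lambda>om. (\<lambda>q. q k) (\<lambda>k. J k om))"
   by (rule indep_var_EJ) measurable
  then have ind: "indep_var borel (\<lambda>om. indicator {..t} (arrival E k om) :: real) borel (J k)"
   by (simp add: arrival_def)
  have i1: "integrable M (\<lambda>om. indicator {..t} (arrival E k om) :: real)"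
   by (rule integrable_const_bound[where B=1]) auto
  note I = indep_var_lebesgue_integral[OF ind i1 J_integrable] indep_var_integrable[OF ind i1 J_integrable]
  have "(\<integral>\<^sup>+om. ?g k om \<partial>M) \<le> (\<integral>\<^sup>+om. ennreal (indicator {..t} (arrival E k om) * J k om) \<partial>M)"
   by (intro nn_integral_mono) (auto split: split_indicator)
  also have "\<dots> = ennreal (expectation (\<lambda>om. indicator {..t} (arrival E k om) * J k om))"
  proof (rule nn_integral_eq_integral[OF I(2)])
   show "AE om in M. 0 \<le> indicator {..t} (arrival E k om) * J k om"
    using AE_good by eventually_elim (auto simp: good_def intro: less_imp_le mult_nonneg_nonneg)
  qed
  also have "expectation (\<lambda>om. indicator {..t} (arrival E k om) * J k om) = prob {om \<in> space M. arrival E k om \<le> t} * (1 / \<theta>)"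
  proof -
   have "expectation (\<lambda>om. indicator {..t} (arrival E k om)) = expectation (indicator {om \<in> space M. arrival E k om \<le> t} :: 'a \<Rightarrow> real)"
    by (rule Bochner_Integration.integral_cong) (auto split: split_indicator)
   then show ?thesis unfolding I(1) J_expectation by simp
  qed
  also have "\<dots> \<le> 1 / \<theta> * t ^ Suc k"
   using arrival_small[OF assms(1), of k] theta_pos by (simp add: divide_right_mono)
  finally show ?thesis by (simp add: ennreal_leI)
 qed
 have "(\<integral>\<^sup>+om. ennreal (tail j t om) \<partial>M) = (\<integral>\<^sup>+om. (\<Sum>k. ?g k om) \<partial>M)"
  by (rule nn_integral_cong_AE[OF eq])
 also have "\<dots> = (\<Sum>k. \<integral>\<^sup>+om. ?g k om \<partial>M)"
  by (rule nn_integral_suminf) measurable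
 also have "\<dots> \<le> (\<Sum>k. if j \<le> k then ennreal (1 / \<theta> * t ^ Suc k) else 0)"
 proof (intro suminf_le summableI)
  show "(\<integral>\<^sup>+om. ?g k om \<partial>M) \<le> (if j \<le> k then ennreal (1 / \<theta> * t ^ Suc k) else 0)" for k
   using trm[of k] by (cases "j \<le> k") auto
 qed
 also have "\<dots> = (\<Sum>k. ennreal (if j \<le> k then 1 / \<theta> * t ^ Suc k else 0))"
  by (intro suminf_cong) auto
 also have "\<dots> = ennreal (\<Sum>k. if j \<le> k then 1 / \<theta> * t ^ Suc k else 0)"
 proof (rule suminf_ennreal2)
  show "summable (\<lambda>k. if j \<le> k then 1 / \<theta> * t ^ Suc k else 0)"
   by (rule summable_comparison_test'[where N=0 and g="\<lambda>k. t / \<theta> * t ^ k"])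
     (use assms theta_pos in \<open>auto intro!: summable_mult summable_geometric\<close>)
 qed (use assms theta_pos in auto)
 also have "(\<Sum>k. if j \<le> k then 1 / \<theta> * t ^ Suc k else 0) = 1 / \<theta> * t ^ Suc j * (1 / (1 - t))"
 proof -
  have "(\<lambda>k. 1 / \<theta> * t ^ Suc j * t ^ k) sums (1 / \<theta> * t ^ Suc j * (1 / (1 - t)))"
   by (intro sums_mult geometric_sums) (use assms in auto)
  then have "(\<lambda>k. (\<lambda>k. if j \<le> k then 1 / \<theta> * t ^ Suc k else 0) (k + j)) sums (1 / \<theta> * t ^ Suc j * (1 / (1 - t)))"
   by (simp add: power_add mult_ac)
  then have "(\<lambda>k. if j \<le> k then 1 / \<theta> * t ^ Suc k else 0) sums (1 / \<theta> * t ^ Suc j * (1 / (1 - t)))"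
   by (subst (asm) sums_iff_shift) simp
  then show ?thesis by (rule sums_unique[symmetric])
 qed
 also have "\<dots> \<le> 1 / \<theta> * t ^ Suc j * 2"
  using assms theta_pos by (intro mult_left_mono) (auto simp: field_simps)
 finally have le: "(\<integral>\<^sup>+om. ennreal (tail j t om) \<partial>M) \<le> ennreal (2 / \<theta> * t ^ Suc j)"
  by (simp add: mult_ac ennreal_leI)
 have nn: "AE om in M. 0 \<le> tail j t om" using AE_good by eventually_elim (rule tail_nonneg)
 show int: "integrable M (tail j t)"
  using le nn by (intro integrableI_nonneg) (auto intro: le_less_trans)
 show "expectation (tail j t) \<le> 2 / \<theta> * t ^ Suc j"
  using le nn_integral_eq_integral[OF int nn] assms theta_pos by (simp add: ennreal_le_iff)
qed

lemma N_split:
 assumes "good om"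
 shows "N t om = (if E 0 om \<le> t then J 0 om + tail 1 t om else 0)" "\<not> E 0 om \<le> t \<Longrightarrow> tail 1 t om = 0"
proof -
 have ar: "arrival E k om \<le> t \<Longrightarrow> E 0 om \<le> t" for k
  using arrival_mono[OF assms, of 0 k] by (simp add: arrival_0)
 have fin: "finite {k. 1 \<le> k \<and> arrival E k om \<le> t}" using assms by (auto simp: good_def)
 show "N t om = (if E 0 om \<le> t then J 0 om + tail 1 t om else 0)"
 proof (cases "E 0 om \<le> t")
  case True
  then have "{k. arrival E k om \<le> t} = insert 0 {k. 1 \<le> k \<and> arrival E k om \<le> t}"
   by (auto simp: arrival_0 not_less_eq_eq)
  then show ?thesis using True fin
   unfolding cpoisson_def tail_def cpf_def arrival_def[symmetric] by simp
 next
  case False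
  then have "{k. arrival E k om \<le> t} = {}" using ar by auto
  then show ?thesis using False by (simp add: cpoisson_def)
 qed
 assume "\<not> E 0 om \<le> t"
 then have "{k. 1 \<le> k \<and> arrival E k om \<le> t} = {}" using ar by auto
 then show "tail 1 t om = 0" unfolding tail_def cpf_def arrival_def[symmetric] by (simp only: sum.empty)
qed

lemma Z_integrable:
 assumes "0 < ep" "ep \<le> 1 / 2"
 shows "integrable M (\<lambda>om. \<sigma> * w ep om + N ep om)"
proof -
 have "integrable M (w ep)"
  using w_moments(1)[of 0 ep] assms by (auto cong: Bochner_Integration.integrable_cong simp: w_0)
 moreover have "integrable M (N ep)" using tail_expectation(1)[of ep 0] assms by (simp add: tail_0)
 ultimately show ?thesis by auto
qed

lemma Z_abs_bound:
 assumes "0 < ep" "ep \<le> 1 / 2"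
 shows "expectation (\<lambda>om. \<bar>\<sigma> * w ep om + N ep om\<bar>) \<le> \<bar>\<sigma>\<bar> * sqrt ep + 2 / \<theta> * ep"
proof -
 have e0: "(\<lambda>om. w ep om - w 0 om) om = w ep om" if "om \<in> space M" for om using that w_0 by simp
 have i: "integrable M (w ep)" "integrable M (\<lambda>om. (w ep om)\<^sup>2)" "expectation (\<lambda>om. (w ep om)\<^sup>2) = ep"
  using w_moments(1,3,4)[of 0 ep] assms by (auto cong: Bochner_Integration.integrable_cong Bochner_Integration.integral_cong simp: w_0)
 have iN: "integrable M (N ep)" "expectation (N ep) \<le> 2 / \<theta> * ep" using tail_expectation[of ep 0] assms by (simp_all add: tail_0)
 have nn: "AE om in M. 0 \<le> N ep om" using AE_good by eventually_elim (use tail_nonneg[of _ 0] in \<open>simp add: tail_0\<close>)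
 have "expectation (\<lambda>om. \<bar>w ep om\<bar>) \<le> expectation (\<lambda>om. (ep + (w ep om)\<^sup>2) / (2 * sqrt ep))"
 proof (rule integral_mono)
  fix om
  \<comment> \<open>The arithmetic-geometric mean inequality with weight \<open>sqrt ep\<close>
    reduces the first absolute moment to the second moment.\<close>
  have "0 \<le> (\<bar>w ep om\<bar> - sqrt ep)\<^sup>2" by simp
  then have "2 * sqrt ep * \<bar>w ep om\<bar> \<le> ep + (w ep om)\<^sup>2" using assms by (simp add: power2_diff algebra_simps)
  then show "\<bar>w ep om\<bar> \<le> (ep + (w ep om)\<^sup>2) / (2 * sqrt ep)" using assms by (simp add: field_simps)
 qed (use i in auto)
 also have "\<dots> = (ep + ep) / (2 * sqrt ep)" using i by (simp add: prob_space)
 also have "\<dots> = sqrt ep" using assms by (simp add: real_div_sqrt)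
 finally have 1: "expectation (\<lambda>om. \<bar>w ep om\<bar>) \<le> sqrt ep" .
 have "expectation (\<lambda>om. \<bar>\<sigma> * w ep om + N ep om\<bar>) \<le> expectation (\<lambda>om. \<bar>\<sigma>\<bar> * \<bar>w ep om\<bar> + N ep om)"
 proof (rule integral_mono_AE)
  show "AE om in M. \<bar>\<sigma> * w ep om + N ep om\<bar> \<le> \<bar>\<sigma>\<bar> * \<bar>w ep om\<bar> + N ep om"
   using nn by eventually_elim (metis abs_mult abs_of_nonneg abs_triangle_ineq)
 qed (use i iN in auto)
 also have "\<dots> = \<bar>\<sigma>\<bar> * expectation (\<lambda>om. \<bar>w ep om\<bar>) + expectation (N ep)" using i iN by simp
 also have "\<dots> \<le> \<bar>\<sigma>\<bar> * sqrt ep + 2 / \<theta> * ep" using 1 iN(2) by (intro add_mono mult_left_mono) auto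
 finally show ?thesis .
qed

section \<open>One-step expansion of the expectation\<close>

lemma taylor_global:
 fixes v vd :: "real \<Rightarrow> real"
 assumes "\<And>x. (v has_real_derivative vd x) (at x)" "\<And>x y. \<bar>vd x - vd y\<bar> \<le> K * \<bar>x - y\<bar>"
 shows "v x + vd x * z - K * z\<^sup>2 / 2 \<le> v (x + z)"
proof -
 have "v x + vd x * z + (- K) * z\<^sup>2 / 2 \<le> v (x + z)"
 proof (rule taylor_lower[where \<delta>="\<bar>z\<bar>", OF assms(1)])
  fix s
  have "\<bar>(s - x) * (vd s - vd x)\<bar> \<le> \<bar>s - x\<bar> * (K * \<bar>s - x\<bar>)"
   unfolding abs_mult by (intro mult_left_mono assms(2)) auto
  then show "- K * (s - x)\<^sup>2 \<le> (s - x) * (vd s - vd x)"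
   by (simp add: power2_eq_square algebra_simps abs_le_iff flip: abs_mult)
 qed simp
 then show ?thesis by simp
qed

text \<open>The increment is split into the Gaussian part \<open>W\<close> and the Poisson part
  \<open>n\<close>. In the expansion in \<open>W\<close> around \<open>y + n\<close> the linear term
  has mean zero by independence, and the sharp coefficient \<open>m\<close> is needed only on paths
  without a jump. The Poisson part is then reduced to its first jump; everything else has order
  \<open>ep^2\<close>.\<close>

lemma one_step_raw:
 fixes v vd :: "real \<Rightarrow> real"
 assumes dv: "\<And>x. (v has_real_derivative vd x) (at x)" and vdb: "\<And>x. \<bar>vd x\<bar> \<le> K"
  and vdl: "\<And>x y. \<bar>vd x - vd y\<bar> \<le> K * \<bar>x - y\<bar>"
  and loc: "\<And>z. \<bar>z\<bar> \<le> \<delta> \<Longrightarrow> v y + vd y * z + m * z\<^sup>2 / 2 \<le> v (y + z)"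
  and m: "\<bar>m\<bar> \<le> K" and \<delta>: "\<delta> > 0" and ep: "0 < ep" "ep \<le> 1 / 2"
 shows "integrable M (\<lambda>om. v (y + (\<sigma> * w ep om + N ep om)))"
  and "v y + ep * (\<sigma>\<^sup>2 * m / 2) + (1 - exp (- ep)) * (jump_mean \<theta> v y - v y)
   - K * (3 * \<sigma>^4 / \<delta>\<^sup>2 + \<sigma>\<^sup>2 + 2 / \<theta>) * ep\<^sup>2 \<le> expectation (\<lambda>om. v (y + (\<sigma> * w ep om + N ep om)))"
proof -
 have K: "0 \<le> K" using m abs_ge_zero[of m] by linarith
 have vl: "\<bar>v x - v x'\<bar> \<le> K * \<bar>x - x'\<bar>" for x x'
  using deriv_diff_bound[of "min x x'" "max x x'" v vd "\<lambda>_. 0" "\<lambda>_. 0" K x x'] dv vdb by auto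
 have [measurable]: "v \<in> borel_measurable borel" by (rule lipschitz_borel[OF vl])
 have [measurable]: "vd \<in> borel_measurable borel" by (rule lipschitz_borel[OF vdl])
 define W where "W om = \<sigma> * w ep om" for om
 define n where "n = N ep"
 have [measurable]: "W \<in> borel_measurable M" "n \<in> borel_measurable M" "W \<in> borel_measurable WM" "n \<in> borel_measurable EM"
  unfolding W_def[abs_def] n_def by measurable
 have iW: "integrable M W" "expectation W = 0" "integrable M (\<lambda>om. (W om)\<^sup>2)" "expectation (\<lambda>om. (W om)\<^sup>2) = \<sigma>\<^sup>2 * ep"
  "integrable M (\<lambda>om. (W om)^4)" "expectation (\<lambda>om. (W om)^4) = 3 * \<sigma>^4 * ep\<^sup>2"
  unfolding W_def power_mult_distrib using w_moments[of 0 ep] ep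
  by (auto cong: Bochner_Integration.integrable_cong Bochner_Integration.integral_cong simp: w_0)
 have iN: "integrable M n" using tail_expectation(1)[of ep 0] ep by (simp add: tail_0 n_def)
 have i_v: "integrable M (\<lambda>om. v (y + X om))" if "integrable M X" for X
 proof (rule Bochner_Integration.integrable_bound)
  show "integrable M (\<lambda>om. \<bar>v y\<bar> + K * \<bar>X om\<bar>)" using that by auto
  have [measurable]: "X \<in> borel_measurable M" using that by auto
  show "(\<lambda>om. v (y + X om)) \<in> borel_measurable M" by measurable
  show "AE om in M. norm (v (y + X om)) \<le> norm (\<bar>v y\<bar> + K * \<bar>X om\<bar>)"
   using vl[of "y + _" y] K by (intro AE_I2) (smt (verit, best) add_diff_cancel_left' mult_nonneg_nonneg abs_ge_zero real_norm_def)
 qed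
 show int: "integrable M (\<lambda>om. v (y + (\<sigma> * w ep om + N ep om)))"
  by (rule i_v[OF Z_integrable[OF ep]])
 define I where "I om = (if n om \<noteq> 0 then 1 else 0 :: real)" for om
 have [measurable]: "I \<in> borel_measurable M" "I \<in> borel_measurable EM" unfolding I_def[abs_def] by measurable
 \<comment> \<open>Two corrections make the bound with \<open>m\<close> valid everywhere. If
   \<open>W\<close> exceeds \<open>\<delta>\<close> in absolute value, then
   \<open>W^2 \<le> W^4 / \<delta>^2\<close>; if a jump occurred, \<open>I\<close> is 1. In both
   cases the crude expansion of \<open>taylor_global\<close> takes over, and both corrections have
   means of order \<open>ep^2\<close>.\<close>
 have pw: "v (y + n om) + vd (y + n om) * W om + m / 2 * (W om)\<^sup>2 - K / \<delta>\<^sup>2 * (W om)^4 - K * (I om * (W om)\<^sup>2) \<le> v (y + (\<sigma> * w ep om + N ep om))" for om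
 proof -
  have g: "v (y + n om) + vd (y + n om) * W om - K * (W om)\<^sup>2 / 2 \<le> v (y + n om + W om)"
   by (rule taylor_global[OF dv vdl])
  have m2: "m * (W om)\<^sup>2 \<le> K * (W om)\<^sup>2" using m by (intro mult_right_mono) auto
  have p4: "0 \<le> K / \<delta>\<^sup>2 * (W om)^4" using K by simp
  have e: "y + (\<sigma> * w ep om + N ep om) = y + n om + W om" by (simp add: W_def n_def)
  show ?thesis
  proof (cases "n om = 0")
   case True
   show ?thesis
   proof (cases "\<bar>W om\<bar> \<le> \<delta>")
    case True
    then show ?thesis using loc[OF True] p4 \<open>n om = 0\<close> unfolding e I_def by simp
   next
    case False
    then have "\<delta>\<^sup>2 \<le> (W om)\<^sup>2" using \<delta> by (metis abs_le_square_iff abs_of_pos linear)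
    then have "(W om)\<^sup>2 * \<delta>\<^sup>2 \<le> (W om)\<^sup>2 * (W om)\<^sup>2" by (intro mult_left_mono) auto
    then have "(W om)\<^sup>2 \<le> (W om)^4 / \<delta>\<^sup>2" using \<delta> by (simp add: field_simps power2_eq_square power4_eq_xxxx)
    then have "K * (W om)\<^sup>2 \<le> K * ((W om)^4 / \<delta>\<^sup>2)" using K by (rule mult_left_mono)
    then have "K * (W om)\<^sup>2 \<le> K / \<delta>\<^sup>2 * (W om)^4" by simp
    then show ?thesis using g m2 \<open>n om = 0\<close> unfolding e I_def by simp
   qed
  next
   case False
   then show ?thesis using g m2 p4 unfolding e I_def by simp
  qed
 qed
 have ind: "indep_var borel (\<lambda>om. W om) borel (\<lambda>om. vd (y + n om))" "indep_var borel (\<lambda>om. (W om)\<^sup>2) borel I"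
  by (rule indep_var_WM_EM; measurable)+
 have ivd: "integrable M (\<lambda>om. vd (y + n om))" by (rule integrable_const_bound[where B=K]) (use vdb in auto)
 have iI: "integrable M I" by (rule integrable_const_bound[where B=1]) (auto simp: I_def)
 have EI: "expectation I \<le> ep"
 proof -
  have "expectation I \<le> expectation (indicator {om \<in> space M. E 0 om \<le> ep} :: 'a \<Rightarrow> real)"
  proof (rule integral_mono_AE[OF iI])
   show "AE om in M. I om \<le> indicator {om \<in> space M. E 0 om \<le> ep} om"
    using AE_good by eventually_elim (auto simp: I_def n_def N_split good_def split: split_indicator)
  qed (auto simp: integrable_indicator_iff emeasure_eq_measure)
  also have "\<dots> = 1 - exp (- ep)" using E_le[of ep 0] ep by simp
  also have "\<dots> \<le> ep" using exp_ge_add_one_self[of "- ep"] by simp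
  finally show ?thesis .
 qed
 note ie = indep_var_lebesgue_integral[OF ind(1) iW(1) ivd] indep_var_integrable[OF ind(1) iW(1) ivd]
  indep_var_lebesgue_integral[OF ind(2) iW(3) iI] indep_var_integrable[OF ind(2) iW(3) iI]
 have A: "expectation (\<lambda>om. v (y + n om)) + m / 2 * (\<sigma>\<^sup>2 * ep) - K / \<delta>\<^sup>2 * (3 * \<sigma>^4 * ep\<^sup>2) - K * (\<sigma>\<^sup>2 * ep * expectation I)
   \<le> expectation (\<lambda>om. v (y + (\<sigma> * w ep om + N ep om)))"
 proof -
  have ii: "integrable M (\<lambda>om. v (y + n om) + W om * vd (y + n om) + m / 2 * (W om)\<^sup>2 - K / \<delta>\<^sup>2 * (W om)^4 - K * ((W om)\<^sup>2 * I om))"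
   using i_v[OF iN] ie iW by auto
  have "expectation (\<lambda>om. v (y + n om) + W om * vd (y + n om) + m / 2 * (W om)\<^sup>2 - K / \<delta>\<^sup>2 * (W om)^4 - K * ((W om)\<^sup>2 * I om))
   \<le> expectation (\<lambda>om. v (y + (\<sigma> * w ep om + N ep om)))"
   by (rule integral_mono[OF ii int]) (use pw in \<open>simp add: mult.commute\<close>)
  moreover have "expectation (\<lambda>om. v (y + n om) + W om * vd (y + n om) + m / 2 * (W om)\<^sup>2 - K / \<delta>\<^sup>2 * (W om)^4 - K * ((W om)\<^sup>2 * I om))
   = expectation (\<lambda>om. v (y + n om)) + expectation (\<lambda>om. W om * vd (y + n om)) + m / 2 * expectation (\<lambda>om. (W om)\<^sup>2)
    - K / \<delta>\<^sup>2 * expectation (\<lambda>om. (W om)^4) - K * expectation (\<lambda>om. (W om)\<^sup>2 * I om)"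
   using i_v[OF iN] ie(2,4) iW(1,3,5) by simp
  ultimately show ?thesis unfolding ie iW by simp
 qed
 \<comment> \<open>A first jump occurs with probability \<open>1 - exp (- ep)\<close>, and replacing
   the whole sum by \<open>J 0\<close> costs at most \<open>K\<close> times the later jumps
   \<open>tail 1 ep\<close>.\<close>
 have B: "v y + (1 - exp (- ep)) * (jump_mean \<theta> v y - v y) - K * (2 / \<theta> * ep\<^sup>2) \<le> expectation (\<lambda>om. v (y + n om))"
 proof -
  define e0 where "e0 om = (indicator {..ep} (E 0 om) :: real)" for om
  have [measurable]: "e0 \<in> borel_measurable M" unfolding e0_def[abs_def] by measurable
  have "indep_var borel (\<lambda>om. (\<lambda>e. indicator {..ep} (e 0) :: real) (\<lambda>k. E k om)) borel (\<lambda>om. (\<lambda>q. v (y + q 0) - v y) (\<lambda>k. J k om))"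
   by (rule indep_var_EJ) measurable
  then have ind: "indep_var borel e0 borel (\<lambda>om. v (y + J 0 om) - v y)" by (simp add: e0_def[abs_def])
  have i1: "integrable M e0" by (rule integrable_const_bound[where B=1]) (auto simp: e0_def)
  have i2: "integrable M (\<lambda>om. v (y + J 0 om) - v y)" using i_v[OF J_integrable] by auto
  have e1: "expectation e0 = 1 - exp (- ep)"
  proof -
   have "expectation e0 = expectation (indicator {om \<in> space M. E 0 om \<le> ep} :: 'a \<Rightarrow> real)"
    by (rule Bochner_Integration.integral_cong) (auto simp: e0_def split: split_indicator)
   then show ?thesis using E_le[of ep 0] ep by simp
  qed
  have e2: "expectation (\<lambda>om. v (y + J 0 om) - v y) = jump_mean \<theta> v y - v y"
  proof -
   have "expectation (\<lambda>om. v (y + J 0 om)) = jump_mean \<theta> v y"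
    unfolding jump_mean_def distr_J[symmetric, of 0] by (subst integral_distr) simp_all
   then show ?thesis using i_v[OF J_integrable] by (simp add: prob_space)
  qed
  note iee = indep_var_lebesgue_integral[OF ind i1 i2] indep_var_integrable[OF ind i1 i2]
  have t: "integrable M (tail 1 ep)" "expectation (tail 1 ep) \<le> 2 / \<theta> * ep\<^sup>2"
   using tail_expectation[of ep 1] ep by (simp_all add: numeral_2_eq_2)
  have "v y + expectation e0 * expectation (\<lambda>om. v (y + J 0 om) - v y) - K * expectation (tail 1 ep)
    = expectation (\<lambda>om. v y + e0 om * (v (y + J 0 om) - v y) - K * tail 1 ep om)"
   using iee t by (simp add: prob_space)
  also have "\<dots> \<le> expectation (\<lambda>om. v (y + n om))"
  proof (rule integral_mono_AE)
   show "AE om in M. v y + e0 om * (v (y + J 0 om) - v y) - K * tail 1 ep om \<le> v (y + n om)"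
    using AE_good
   proof eventually_elim
    case (elim om)
    show ?case
    proof (cases "E 0 om \<le> ep")
     case True
     then have "n om = J 0 om + tail 1 ep om" using N_split[OF elim, of ep] by (simp add: n_def)
     then show ?thesis using vl[of "y + J 0 om" "y + n om"] tail_nonneg[OF elim, of 1 ep] True by (simp add: e0_def)
    next
     case False
     then show ?thesis using N_split[OF elim, of ep] by (simp add: e0_def n_def)
    qed
   qed
  qed (use iee t i_v[OF iN] in auto)
  finally have "v y + (1 - exp (- ep)) * (jump_mean \<theta> v y - v y) - K * expectation (tail 1 ep) \<le> expectation (\<lambda>om. v (y + n om))"
   unfolding e1 e2 .
  moreover have "K * expectation (tail 1 ep) \<le> K * (2 / \<theta> * ep\<^sup>2)" using t K by (intro mult_left_mono)
  ultimately show ?thesis by linarith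
 qed
 have "K * (\<sigma>\<^sup>2 * ep * expectation I) \<le> K * (\<sigma>\<^sup>2 * ep * ep)"
  using EI K ep by (intro mult_left_mono) auto
 moreover have "K * (3 * \<sigma>^4 / \<delta>\<^sup>2 + \<sigma>\<^sup>2 + 2 / \<theta>) * ep\<^sup>2 = K / \<delta>\<^sup>2 * (3 * \<sigma>^4 * ep\<^sup>2) + K * (\<sigma>\<^sup>2 * ep * ep) + K * (2 / \<theta> * ep\<^sup>2)"
  by (simp add: algebra_simps power2_eq_square)
 moreover have "ep * (\<sigma>\<^sup>2 * m / 2) = m / 2 * (\<sigma>\<^sup>2 * ep)" by simp
 ultimately show "v y + ep * (\<sigma>\<^sup>2 * m / 2) + (1 - exp (- ep)) * (jump_mean \<theta> v y - v y)
   - K * (3 * \<sigma>^4 / \<delta>\<^sup>2 + \<sigma>\<^sup>2 + 2 / \<theta>) * ep\<^sup>2 \<le> expectation (\<lambda>om. v (y + (\<sigma> * w ep om + N ep om)))"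
  using A B by linarith
qed

lemma exp_quadratic_bounds:
 fixes x :: real
 assumes "0 \<le> x"
 shows "1 - x \<le> exp (- x)" "exp (- x) \<le> 1 - x + x\<^sup>2"
proof -
 show "1 - x \<le> exp (- x)" using exp_ge_add_one_self[of "- x"] by simp
 have "1 + x \<le> exp x" by (rule exp_ge_add_one_self)
 then have "exp (- x) \<le> 1 / (1 + x)" using assms by (simp add: exp_minus field_simps)
 also have "\<dots> \<le> 1 - x + x\<^sup>2"
 proof -
  have "(1 - x + x\<^sup>2) * (1 + x) = 1 + x ^ 3" by (simp add: algebra_simps power2_eq_square power3_eq_cube)
  then have "1 \<le> (1 - x + x\<^sup>2) * (1 + x)" using assms by simp
  then show ?thesis using assms by (simp add: pos_divide_le_eq)
 qed
 finally show "exp (- x) \<le> 1 - x + x\<^sup>2" .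
qed

text \<open>The error \<open>2 * \<eta> * ep\<close> has two sources: one \<open>\<eta>\<close> is
  the defect of the generator inequality, the other pays for all terms of order \<open>ep^2\<close>,
  collected in \<open>C'\<close>. The set \<open>D\<close> carries the uniformity in
  \<open>y\<close>. The lemma is applied to \<open>h\<close> with the running cost as
  \<open>\<phi>\<close>, and to the negative of a smooth approximation with the negative running
  cost.\<close>

lemma one_step:
 fixes v vd :: "real \<Rightarrow> real"
 assumes dv: "\<And>x. (v has_real_derivative vd x) (at x)" and vdb: "\<And>x. \<bar>vd x\<bar> \<le> K"
  and vdl: "\<And>x y. \<bar>vd x - vd y\<bar> \<le> K * \<bar>x - y\<bar>"
  and \<delta>: "\<delta> > 0" and lam: "lam > 0" and \<eta>: "\<eta> > 0"
  and V: "\<And>y. y \<in> D \<Longrightarrow> \<bar>v y\<bar> \<le> V"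
  and loc: "\<And>y. y \<in> D \<Longrightarrow> \<exists>m. \<bar>m\<bar> \<le> K \<and> (\<forall>z. \<bar>z\<bar> \<le> \<delta> \<longrightarrow> v y + vd y * z + m * z\<^sup>2 / 2 \<le> v (y + z)) \<and>
    - \<eta> \<le> \<sigma>\<^sup>2 / 2 * m + (jump_mean \<theta> v y - v y) - lam * v y + \<phi> y"
 shows "\<exists>ep0>0. \<forall>ep. 0 < ep \<and> ep \<le> ep0 \<longrightarrow> (\<forall>y\<in>D. v y - ep * \<phi> y - 2 * \<eta> * ep \<le> exp (- lam * ep) * expectation (\<lambda>om. v (y + (\<sigma> * w ep om + N ep om))))"
proof -
 have K: "0 \<le> K" using vdb[of 0] abs_ge_zero[of "vd 0"] by linarith
 have vl: "\<bar>v x - v x'\<bar> \<le> K * \<bar>x - x'\<bar>" for x x'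
  using deriv_diff_bound[of "min x x'" "max x x'" v vd "\<lambda>_. 0" "\<lambda>_. 0" K x x'] dv vdb by auto
 define C where "C = K * (3 * \<sigma>^4 / \<delta>\<^sup>2 + \<sigma>\<^sup>2 + 2 / \<theta>) + K / \<theta>"
 define A0 where "A0 = \<sigma>\<^sup>2 * K / 2 + K / \<theta>"
 define C' where "C' = C + lam * A0 + lam\<^sup>2 * (\<bar>V\<bar> + A0)"
 have C: "0 \<le> C" "0 \<le> A0" using K theta_pos by (auto simp: C_def A0_def)
 then have C': "0 \<le> C'" using lam by (auto simp: C'_def)
 define ep0 where "ep0 = min (1 / 2) (\<eta> / (C' + 1))"
 have ep0: "0 < ep0" "ep0 \<le> 1 / 2" "C' * ep0 \<le> \<eta>"
 proof -
  show "0 < ep0" using C' \<eta> by (auto simp: ep0_def)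
  show "ep0 \<le> 1 / 2" unfolding ep0_def by (rule min.cobounded1)
  have "C' * ep0 \<le> C' * (\<eta> / (C' + 1))" using C' by (intro mult_left_mono) (auto simp: ep0_def)
  also have "\<dots> \<le> \<eta>" using C' \<eta> by (simp add: field_simps)
  finally show "C' * ep0 \<le> \<eta>" .
 qed
 have "v y - ep * \<phi> y - 2 * \<eta> * ep \<le> exp (- lam * ep) * expectation (\<lambda>om. v (y + (\<sigma> * w ep om + N ep om)))"
  if ep: "0 < ep" "ep \<le> ep0" and y: "y \<in> D" for ep y
 proof -
  obtain m where m: "\<bar>m\<bar> \<le> K" "\<And>z. \<bar>z\<bar> \<le> \<delta> \<Longrightarrow> v y + vd y * z + m * z\<^sup>2 / 2 \<le> v (y + z)"
    "- \<eta> \<le> \<sigma>\<^sup>2 / 2 * m + (jump_mean \<theta> v y - v y) - lam * v y + \<phi> y"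
   using loc[OF y] by blast
  let ?Q = "jump_mean \<theta> v y - v y" and ?E = "expectation (\<lambda>om. v (y + (\<sigma> * w ep om + N ep om)))"
  define A where "A = \<sigma>\<^sup>2 * m / 2 + ?Q"
  have Q: "\<bar>?Q\<bar> \<le> K / \<theta>" by (rule jump_mean_minus_bound[OF theta_pos vl])
  have "\<sigma>\<^sup>2 * \<bar>m\<bar> \<le> \<sigma>\<^sup>2 * K" using m by (intro mult_left_mono) auto
  moreover have "\<bar>\<sigma>\<^sup>2 * m\<bar> = \<sigma>\<^sup>2 * \<bar>m\<bar>" by (simp add: abs_mult)
  ultimately have A: "\<bar>A\<bar> \<le> A0" using Q unfolding A_def A0_def by linarith
  have "v y + ep * (\<sigma>\<^sup>2 * m / 2) + (1 - exp (- ep)) * ?Q - K * (3 * \<sigma>^4 / \<delta>\<^sup>2 + \<sigma>\<^sup>2 + 2 / \<theta>) * ep\<^sup>2 \<le> ?E"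
   using one_step_raw(2)[OF dv vdb vdl m(2,1) \<delta>, of ep \<sigma>] ep ep0 by simp
  moreover have "ep * ?Q - K / \<theta> * ep\<^sup>2 \<le> (1 - exp (- ep)) * ?Q"
  proof -
   have "\<bar>(1 - exp (- ep) - ep) * ?Q\<bar> \<le> ep\<^sup>2 * (K / \<theta>)"
    unfolding abs_mult using exp_quadratic_bounds[of ep] ep Q by (intro mult_mono) auto
   then show ?thesis by (simp add: algebra_simps abs_le_iff)
  qed
  ultimately have E: "v y + ep * A - C * ep\<^sup>2 \<le> ?E"
   unfolding A_def C_def distrib_right distrib_left by linarith
  define r where "r = exp (- lam * ep) - (1 - lam * ep)"
  have r: "0 \<le> r" "r \<le> lam\<^sup>2 * ep\<^sup>2"
   using exp_quadratic_bounds[of "lam * ep"] lam ep by (auto simp: r_def power_mult_distrib)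
  have "exp (- lam * ep) * (C * ep\<^sup>2) \<le> 1 * (C * ep\<^sup>2)" using C lam ep by (intro mult_right_mono) auto
  moreover have "exp (- lam * ep) * (v y + ep * A - C * ep\<^sup>2) \<le> exp (- lam * ep) * ?E" using E by (intro mult_left_mono) auto
  ultimately have 1: "exp (- lam * ep) * (v y + ep * A) - C * ep\<^sup>2 \<le> exp (- lam * ep) * ?E" by (simp add: algebra_simps)
  have "\<bar>v y + ep * A\<bar> \<le> \<bar>V\<bar> + A0"
  proof -
   have "ep * \<bar>A\<bar> \<le> 1 * A0" using ep ep0 A by (intro mult_mono) auto
   moreover have "\<bar>ep * A\<bar> = ep * \<bar>A\<bar>" using ep by (simp add: abs_mult)
   ultimately show ?thesis using V[OF y] by linarith
  qed
  then have "\<bar>r * (v y + ep * A)\<bar> \<le> (lam\<^sup>2 * ep\<^sup>2) * (\<bar>V\<bar> + A0)"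
   unfolding abs_mult using r by (intro mult_mono) auto
  then have 2: "- (lam\<^sup>2 * (\<bar>V\<bar> + A0) * ep\<^sup>2) \<le> r * (v y + ep * A)" by (simp add: abs_le_iff mult_ac)
  have 3: "lam * ep\<^sup>2 * A \<le> lam * A0 * ep\<^sup>2"
  proof -
   have "lam * ep\<^sup>2 * A \<le> lam * ep\<^sup>2 * A0" using A lam by (intro mult_left_mono) auto
   then show ?thesis by (simp add: mult_ac)
  qed
  have "exp (- lam * ep) * (v y + ep * A) = v y + ep * (A - lam * v y) - lam * ep\<^sup>2 * A + r * (v y + ep * A)"
   unfolding r_def by (simp add: algebra_simps power2_eq_square)
  then have "v y + ep * (A - lam * v y) - C' * ep\<^sup>2 \<le> exp (- lam * ep) * ?E"
   using 1 2 3 unfolding C'_def distrib_right by linarith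
  moreover have "ep * (- \<eta> - \<phi> y) \<le> ep * (A - lam * v y)"
   using m(3) ep unfolding A_def by (intro mult_left_mono) auto
  moreover have "C' * ep\<^sup>2 \<le> \<eta> * ep"
  proof -
   have "C' * ep \<le> C' * ep0" using C' ep by (intro mult_left_mono) auto
   then have "C' * ep \<le> \<eta>" using ep0 by linarith
   then have "C' * ep * ep \<le> \<eta> * ep" using ep by (intro mult_right_mono) auto
   then show ?thesis by (simp add: power2_eq_square mult_ac)
  qed
  ultimately show ?thesis by (simp add: algebra_simps)
 qed
 then show ?thesis using ep0(1) by blast
qed

end

section \<open>Renewal of the compound Poisson process\<close>

text \<open>The law of an i.i.d. sequence does not change when everything from index
  \<open>k\<close> on is replaced by an independent copy; \<open>comb_seq\<close> performs this
  replacement and so separates past from future.\<close>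

lemma nn_integral_PiM_comb_seq:
 assumes "prob_space P" and [measurable]: "f \<in> borel_measurable (PiM UNIV (\<lambda>_::nat. P))"
 shows "(\<integral>\<^sup>+e. f e \<partial>PiM UNIV (\<lambda>_::nat. P)) = (\<integral>\<^sup>+e1. \<integral>\<^sup>+e2. f (comb_seq k e1 e2) \<partial>PiM UNIV (\<lambda>_::nat. P) \<partial>PiM UNIV (\<lambda>_::nat. P))"
proof -
 interpret X: prob_space P by fact
 interpret sequence_space P by unfold_locales
 have "(\<integral>\<^sup>+e. f e \<partial>S) = (\<integral>\<^sup>+e. f e \<partial>distr (S \<Otimes>\<^sub>M S) S (\<lambda>(om, om'). comb_seq k om om'))"
  by (simp add: PiM_comb_seq)
 also have "\<dots> = (\<integral>\<^sup>+z. f (case z of (om, om') \<Rightarrow> comb_seq k om om') \<partial>(S \<Otimes>\<^sub>M S))"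
  by (rule nn_integral_distr) measurable
 also have "\<dots> = (\<integral>\<^sup>+e1. \<integral>\<^sup>+e2. f (comb_seq k e1 e2) \<partial>S \<partial>S)"
  by (subst P.nn_integral_fst[symmetric]) simp_all
 finally show ?thesis .
qed

lemma nn_integral_PiM_case_nat:
 assumes "prob_space P" and [measurable]: "f \<in> borel_measurable (PiM UNIV (\<lambda>_::nat. P))"
 shows "(\<integral>\<^sup>+e. f e \<partial>PiM UNIV (\<lambda>_::nat. P)) = (\<integral>\<^sup>+x. \<integral>\<^sup>+e2. f (case_nat x e2) \<partial>PiM UNIV (\<lambda>_::nat. P) \<partial>P)"
proof -
 interpret X: prob_space P by fact
 interpret sequence_space P by unfold_locales
 have "(\<integral>\<^sup>+e. f e \<partial>S) = (\<integral>\<^sup>+e. f e \<partial>distr (P \<Otimes>\<^sub>M S) S (\<lambda>(s, om). case_nat s om))"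
  by (simp add: PiM_iter)
 also have "\<dots> = (\<integral>\<^sup>+z. f (case z of (s, om) \<Rightarrow> case_nat s om) \<partial>(P \<Otimes>\<^sub>M S))"
  by (rule nn_integral_distr) measurable
 also have "\<dots> = (\<integral>\<^sup>+x. \<integral>\<^sup>+e2. f (case_nat x e2) \<partial>S \<partial>P)"
  by (subst P.nn_integral_fst[symmetric]) simp_all
 finally show ?thesis .
qed

lemma expo_memoryless:
 assumes [measurable]: "g \<in> borel_measurable borel" and s: "0 \<le> s"
 shows "(\<integral>\<^sup>+x. indicator {s<..} x * g (x - s) \<partial>expo 1) = ennreal (exp (- s)) * (\<integral>\<^sup>+x. g x \<partial>expo 1)"
proof -
 have "(\<integral>\<^sup>+x. indicator {s<..} x * g (x - s) \<partial>expo 1)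
   = (\<integral>\<^sup>+x. ennreal (exponential_density 1 x) * (indicator {s<..} x * g (x - s)) \<partial>lborel)"
  unfolding expo_def by (subst nn_integral_density) simp_all
 also have "\<dots> = (\<integral>\<^sup>+x. ennreal (exponential_density 1 (s + 1 * x)) * (indicator {s<..} (s + 1 * x) * g (s + 1 * x - s)) \<partial>lborel)"
  by (subst nn_integral_real_affine[where c=1 and t=s]) simp_all
 also have "\<dots> = (\<integral>\<^sup>+x. ennreal (exp (- s)) * (ennreal (exponential_density 1 x) * g x) \<partial>lborel)"
 proof (rule nn_integral_cong_AE)
  have "AE x in lborel. x \<noteq> (0::real)" by (rule AE_lborel_singleton)
  then show "AE x in lborel. ennreal (exponential_density 1 (s + 1 * x)) * (indicator {s<..} (s + 1 * x) * g (s + 1 * x - s))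
    = ennreal (exp (- s)) * (ennreal (exponential_density 1 x) * g x)"
  proof eventually_elim
   case (elim x)
   show ?case
   proof (cases "x > 0")
    case True
    then have "exponential_density 1 (s + 1 * x) = exp (- s) * exponential_density 1 x"
     using s by (simp add: exponential_density_def exp_add[symmetric])
    then show ?thesis using True s by (simp add: ennreal_mult exponential_density_nonneg mult.assoc)
   next
    case False
    then show ?thesis using elim by (simp add: exponential_density_def)
   qed
  qed
 qed
 also have "\<dots> = ennreal (exp (- s)) * (\<integral>\<^sup>+x. g x \<partial>expo 1)"
  unfolding expo_def by (subst nn_integral_density) (simp_all add: nn_integral_cmult)
 finally show ?thesis .
qed

text \<open>Restart at time \<open>t\<close> after \<open>k\<close> arrivals: the waiting time in
  progress is replaced by its residual, and all later waiting times and jumps come from the second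
  copy. The identity is algebraic and holds for every \<open>t\<close>.\<close>

lemma cpf_comb:
 "cpf k u (comb_seq k e1 (case_nat x e2)) (comb_seq k q1 q2) = cpf 0 (u - t) (case_nat ((\<Sum>i<k. e1 i) + x - t) e2) q2"
proof -
 let ?e = "comb_seq k e1 (case_nat x e2)" and ?f = "case_nat ((\<Sum>i<k. e1 i) + x - t) e2"
 have T: "(\<Sum>i\<le>k + l. ?e i) = (\<Sum>i\<le>l. ?f i) + t" for l
 proof (induction l)
  case 0
  have "(\<Sum>i\<le>k. ?e i) = (\<Sum>i<k. ?e i) + ?e k" by (simp add: lessThan_Suc_atMost[symmetric])
  also have "\<dots> = (\<Sum>i<k. e1 i) + x" by (simp add: comb_seq_def)
  finally show ?case by simp
 next
  case (Suc l)
  then show ?case by (simp add: comb_seq_def)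
 qed
 have "{i. k \<le> i \<and> (\<Sum>i\<le>i. ?e i) \<le> u} = (\<lambda>l. k + l) ` {l. 0 \<le> l \<and> (\<Sum>i\<le>l. ?f i) \<le> u - t}"
 proof (intro set_eqI iffI)
  fix i assume "i \<in> {i. k \<le> i \<and> (\<Sum>i\<le>i. ?e i) \<le> u}"
  then show "i \<in> (\<lambda>l. k + l) ` {l. 0 \<le> l \<and> (\<Sum>i\<le>l. ?f i) \<le> u - t}"
   using T[of "i - k"] by (intro image_eqI[of _ _ "i - k"]) auto
 next
  fix i assume "i \<in> (\<lambda>l. k + l) ` {l. 0 \<le> l \<and> (\<Sum>i\<le>l. ?f i) \<le> u - t}"
  then obtain l where "i = k + l" "(\<Sum>i\<le>l. ?f i) \<le> u - t" by auto
  then show "i \<in> {i. k \<le> i \<and> (\<Sum>i\<le>i. ?e i) \<le> u}" using T[of l] by auto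
 qed
 then have "cpf k u ?e (comb_seq k q1 q2) = (\<Sum>i\<in>(\<lambda>l. k + l) ` {l. 0 \<le> l \<and> (\<Sum>i\<le>l. ?f i) \<le> u - t}. comb_seq k q1 q2 i)"
  unfolding cpf_def by simp
 also have "\<dots> = (\<Sum>l\<in>{l. 0 \<le> l \<and> (\<Sum>i\<le>l. ?f i) \<le> u - t}. comb_seq k q1 q2 (k + l))"
  by (subst sum.reindex) (auto simp: inj_on_def)
 also have "\<dots> = cpf 0 (u - t) ?f q2" unfolding cpf_def by (simp add: comb_seq_def)
 finally show ?thesis .
qed

text \<open>Padding with 0 keeps the first \<open>k\<close> entries inside the space of full
  sequences, so that events of the past live on one space for all \<open>k\<close>.\<close>

definition trunc :: "nat \<Rightarrow> (nat \<Rightarrow> real) \<Rightarrow> nat \<Rightarrow> real" where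
 "trunc k e = (\<lambda>i. if i < k then e i else 0)"

lemma trunc_comb: "trunc k (comb_seq k e e') = trunc k e"
 by (auto simp: trunc_def comb_seq_def)

lemma trunc_measurable [measurable]: "trunc k \<in> measurable (PiM UNIV (\<lambda>_::nat. borel)) (PiM UNIV (\<lambda>_::nat. borel))"
 unfolding trunc_def by (rule measurable_PiM_single') (auto simp: space_PiM)

section \<open>Factorisation of the compound Poisson process at a fixed time\<close>

context noise
begin

abbreviation SB where "SB \<equiv> PiM UNIV (\<lambda>_::nat. borel :: real measure)"
lemma space_SB [simp]: "space SB = UNIV" by (auto simp: space_PiM)

definition SE where "SE = PiM UNIV (\<lambda>_::nat. expo 1)"
definition SJ where "SJ = PiM UNIV (\<lambda>_::nat. expo \<theta>)"

lemma sets_SE [simp, measurable_cong]: "sets SE = sets SB" and sets_SJ [simp, measurable_cong]: "sets SJ = sets SB"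
 unfolding SE_def SJ_def by (intro sets_PiM_cong; simp)+

lemma space_SE [simp]: "space SE = UNIV" and space_SJ [simp]: "space SJ = UNIV"
 by (auto simp: SE_def SJ_def space_PiM)

lemma prob_SE: "prob_space SE" and prob_SJ: "prob_space SJ"
 unfolding SE_def SJ_def by (intro prob_space_PiM prob_space_expo theta_pos; simp)+

lemma E_seq_measurable [measurable]: "(\<lambda>om k. E k om) \<in> measurable M SB" and J_seq_measurable [measurable]: "(\<lambda>om k. J k om) \<in> measurable M SB"
 by (rule measurable_PiM_single'; auto simp: space_PiM)+

lemma distr_E_seq: "distr M SB (\<lambda>om k. E k om) = SE" and distr_J_seq: "distr M SB (\<lambda>om k. J k om) = SJ"
 using indep_vars_iff_distr_eq_PiM[where I=UNIV and M'="\<lambda>_. borel" and X=E] indep_vars_iff_distr_eq_PiM[where I=UNIV and M'="\<lambda>_. borel" and X=J] E_indep J_indep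
 by (simp_all add: distr_E distr_J SE_def SJ_def restrict_UNIV)

lemma nn_integral_EJ:
 assumes [measurable]: "(\<lambda>(e, q). F e q) \<in> borel_measurable (SB \<Otimes>\<^sub>M SB)"
 shows "(\<integral>\<^sup>+om. F (\<lambda>k. E k om) (\<lambda>k. J k om) \<partial>M) = (\<integral>\<^sup>+e. \<integral>\<^sup>+q. F e q \<partial>SJ \<partial>SE)"
proof -
 interpret SJ: prob_space SJ by (rule prob_SJ)
 have d: "SE \<Otimes>\<^sub>M SJ = distr M (SB \<Otimes>\<^sub>M SB) (\<lambda>om. (\<lambda>k. E k om, \<lambda>k. J k om))"
  using EJ_indep unfolding indep_var_distribution_eq distr_E_seq distr_J_seq by simp
 have m: "(\<lambda>z. F (fst z) (snd z)) \<in> borel_measurable (SE \<Otimes>\<^sub>M SJ)" "(\<lambda>z. F (fst z) (snd z)) \<in> borel_measurable (SB \<Otimes>\<^sub>M SB)"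
  using assms by (simp_all add: split_beta' cong: measurable_cong_sets sets_pair_measure_cong)
 have "(\<integral>\<^sup>+e. \<integral>\<^sup>+q. F e q \<partial>SJ \<partial>SE) = (\<integral>\<^sup>+z. F (fst z) (snd z) \<partial>(SE \<Otimes>\<^sub>M SJ))"
  by (subst SJ.nn_integral_fst[symmetric, OF m(1)]) simp
 also have "\<dots> = (\<integral>\<^sup>+om. F (\<lambda>k. E k om) (\<lambda>k. J k om) \<partial>M)"
  unfolding d by (subst nn_integral_distr) (use m in auto)
 finally show ?thesis by simp
qed

lemma SE_comb: "f \<in> borel_measurable SB \<Longrightarrow> (\<integral>\<^sup>+e. f e \<partial>SE) = (\<integral>\<^sup>+e1. \<integral>\<^sup>+e2. f (comb_seq k e1 e2) \<partial>SE \<partial>SE)"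
 and SJ_comb: "f \<in> borel_measurable SB \<Longrightarrow> (\<integral>\<^sup>+e. f e \<partial>SJ) = (\<integral>\<^sup>+e1. \<integral>\<^sup>+e2. f (comb_seq k e1 e2) \<partial>SJ \<partial>SJ)"
 and SE_case: "f \<in> borel_measurable SB \<Longrightarrow> (\<integral>\<^sup>+e. f e \<partial>SE) = (\<integral>\<^sup>+x. \<integral>\<^sup>+e2. f (case_nat x e2) \<partial>SE \<partial>expo 1)"
proof -
 assume f: "f \<in> borel_measurable SB"
 then have "f \<in> borel_measurable SE" "f \<in> borel_measurable SJ" by (simp_all cong: measurable_cong_sets)
 then show "(\<integral>\<^sup>+e. f e \<partial>SE) = (\<integral>\<^sup>+e1. \<integral>\<^sup>+e2. f (comb_seq k e1 e2) \<partial>SE \<partial>SE)"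
  "(\<integral>\<^sup>+e. f e \<partial>SJ) = (\<integral>\<^sup>+e1. \<integral>\<^sup>+e2. f (comb_seq k e1 e2) \<partial>SJ \<partial>SJ)"
  "(\<integral>\<^sup>+e. f e \<partial>SE) = (\<integral>\<^sup>+x. \<integral>\<^sup>+e2. f (case_nat x e2) \<partial>SE \<partial>expo 1)"
  unfolding SE_def SJ_def
  by (intro nn_integral_PiM_comb_seq nn_integral_PiM_case_nat prob_space_expo theta_pos; simp)+
qed

text \<open>The first indicator is an event of the past, the second says that \<open>k\<close>
  arrivals fall into \<open>[0, t]\<close> and the next one later. Given both, the residual waiting
  time is again exponential by \<open>expo_memoryless\<close>, so the future sum has the law of
  \<open>N (u - t)\<close>. The first factor on the right contains neither \<open>C\<close> nor
  \<open>u\<close>, so the choice \<open>C = UNIV\<close> identifies it.\<close>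

lemma renewal:
 assumes A [measurable]: "A' \<in> sets (SB \<Otimes>\<^sub>M SB)" and C [measurable]: "C \<in> sets borel"
 shows "(\<integral>\<^sup>+om. indicator A' (trunc k (\<lambda>k. E k om), trunc k (\<lambda>k. J k om)) *
     indicator {(p, x). p \<le> t \<and> t < p + x} (\<Sum>i<k. E i om, E k om) *
     indicator C (cpf k u (\<lambda>k. E k om) (\<lambda>k. J k om)) \<partial>M)
  = (\<integral>\<^sup>+e. \<integral>\<^sup>+q. indicator A' (trunc k e, trunc k q) * (if (\<Sum>i<k. e i) \<le> t then ennreal (exp (- (t - (\<Sum>i<k. e i)))) else 0) \<partial>SJ \<partial>SE)
   * (\<integral>\<^sup>+om. indicator C (N (u - t) om) \<partial>M)" (is "?L = ?R * ?G")
proof -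
 interpret SJ: prob_space SJ by (rule prob_SJ)
 interpret SE: prob_space SE by (rule prob_SE)
 interpret X: prob_space "expo 1" by (rule prob_space_expo) simp
 let ?a = "\<lambda>e q. indicator A' (trunc k e, trunc k q) :: ennreal"
 let ?B = "{(p, x). p \<le> t \<and> t < p + x} :: (real \<times> real) set"
 let ?b = "\<lambda>e x. indicator ?B (\<Sum>i<k. e i, x) :: ennreal"
 have [measurable]: "?B \<in> sets (borel \<Otimes>\<^sub>M borel)"
 proof -
  have "{z \<in> space (borel \<Otimes>\<^sub>M borel). fst z \<le> t \<and> t < fst z + snd z} \<in> sets (borel \<Otimes>\<^sub>M borel :: (real \<times> real) measure)" by measurable
  also have "{z \<in> space (borel \<Otimes>\<^sub>M borel). fst z \<le> t \<and> t < fst z + snd z} = ?B" by (auto simp: space_pair_measure)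
  finally show ?thesis .
 qed
 let ?c = "\<lambda>r e2 q2. indicator C (cpf 0 (u - t) (case_nat r e2) q2) :: ennreal"
 let ?F = "\<lambda>e q. ?a e q * ?b e (e k) * indicator C (cpf k u e q)"
 have cn [measurable]: "(\<lambda>z. case_nat (f z) (g z)) \<in> measurable Q SB" if "f \<in> borel_measurable Q" "g \<in> measurable Q SB" for f g and Q :: "'q measure"
  using measurable_case_nat'[OF that] by simp
 have F_meas: "(\<lambda>(e, q). ?F e q) \<in> borel_measurable (SB \<Otimes>\<^sub>M SB)" by measurable
 have Fe: "(\<lambda>q. ?F e q) \<in> borel_measurable SB" for e
  using measurable_Pair2[OF F_meas, of e] by simp
 define g where "g r = (\<integral>\<^sup>+e2. \<integral>\<^sup>+q2. ?c r e2 q2 \<partial>SJ \<partial>SE)" for r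
 have [measurable]: "g \<in> borel_measurable borel" unfolding g_def by measurable
 have G: "?G = (\<integral>\<^sup>+r. g r \<partial>expo 1)"
 proof -
  have "?G = (\<integral>\<^sup>+e. \<integral>\<^sup>+q. indicator C (cpf 0 (u - t) e q) \<partial>SJ \<partial>SE)"
   unfolding cpoisson_cpf by (rule nn_integral_EJ) measurable
  also have "\<dots> = (\<integral>\<^sup>+r. g r \<partial>expo 1)"
   unfolding g_def by (rule SE_case) measurable
  finally show ?thesis .
 qed
 have "?L = (\<integral>\<^sup>+e. \<integral>\<^sup>+q. ?F e q \<partial>SJ \<partial>SE)" by (rule nn_integral_EJ[OF F_meas])
 also have "\<dots> = (\<integral>\<^sup>+e1. \<integral>\<^sup>+e'. \<integral>\<^sup>+q. ?F (comb_seq k e1 e') q \<partial>SJ \<partial>SE \<partial>SE)"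
  by (rule SE_comb) measurable
 also have "\<dots> = (\<integral>\<^sup>+e1. \<integral>\<^sup>+x. \<integral>\<^sup>+e2. \<integral>\<^sup>+q. ?F (comb_seq k e1 (case_nat x e2)) q \<partial>SJ \<partial>SE \<partial>expo 1 \<partial>SE)"
 proof (rule nn_integral_cong, rule SE_case)
  fix e1
  have "(\<lambda>e. \<integral>\<^sup>+q. ?F e q \<partial>SJ) \<in> borel_measurable SB" (is "?H \<in> _") by measurable
  moreover have "comb_seq k e1 \<in> measurable SB SB"
   by (rule measurable_comb_seq'[OF measurable_const measurable_ident_sets[OF refl]]) (simp add: space_PiM)
  ultimately have "(\<lambda>e'. ?H (comb_seq k e1 e')) \<in> borel_measurable SB"
   by (intro measurable_compose[of "comb_seq k e1" SB SB ?H borel])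
  then show "(\<lambda>e'. \<integral>\<^sup>+q. ?F (comb_seq k e1 e') q \<partial>SJ) \<in> borel_measurable SB" .
 qed
 also have "\<dots> = (\<integral>\<^sup>+e1. \<integral>\<^sup>+x. \<integral>\<^sup>+e2. \<integral>\<^sup>+q1. \<integral>\<^sup>+q2. ?a e1 q1 * ?b e1 x * ?c ((\<Sum>i<k. e1 i) + x - t) e2 q2 \<partial>SJ \<partial>SJ \<partial>SE \<partial>expo 1 \<partial>SE)"
 proof (rule nn_integral_cong, rule nn_integral_cong, rule nn_integral_cong)
  fix e1 x e2
  have "(\<integral>\<^sup>+q. ?F (comb_seq k e1 (case_nat x e2)) q \<partial>SJ) = (\<integral>\<^sup>+q1. \<integral>\<^sup>+q2. ?F (comb_seq k e1 (case_nat x e2)) (comb_seq k q1 q2) \<partial>SJ \<partial>SJ)"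
   by (rule SJ_comb[OF Fe])
  also have "\<dots> = (\<integral>\<^sup>+q1. \<integral>\<^sup>+q2. ?a e1 q1 * ?b e1 x * ?c ((\<Sum>i<k. e1 i) + x - t) e2 q2 \<partial>SJ \<partial>SJ)"
   unfolding trunc_comb cpf_comb[where t=t] by (simp add: comb_seq_def)
  finally show "(\<integral>\<^sup>+q. ?F (comb_seq k e1 (case_nat x e2)) q \<partial>SJ) = \<dots>" .
 qed
 also have "\<dots> = (\<integral>\<^sup>+e1. \<integral>\<^sup>+x. (\<integral>\<^sup>+q1. ?a e1 q1 \<partial>SJ) * (?b e1 x * g ((\<Sum>i<k. e1 i) + x - t)) \<partial>expo 1 \<partial>SE)"
 proof (intro nn_integral_cong)
  fix e1 :: "nat \<Rightarrow> real" and x :: real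
  let ?r = "(\<Sum>i<k. e1 i) + x - t"
  have am: "(\<lambda>q1. ?a e1 q1) \<in> borel_measurable SJ" by measurable
  have cm: "(\<lambda>q2. ?c ?r e2 q2) \<in> borel_measurable SJ" for e2 by measurable
  have cm2: "(\<lambda>e2. \<integral>\<^sup>+q2. ?c ?r e2 q2 \<partial>SJ) \<in> borel_measurable SE" by measurable
  have "(\<integral>\<^sup>+q1. \<integral>\<^sup>+q2. ?a e1 q1 * ?b e1 x * ?c ?r e2 q2 \<partial>SJ \<partial>SJ)
   = (\<integral>\<^sup>+q1. ?a e1 q1 \<partial>SJ) * ?b e1 x * (\<integral>\<^sup>+q2. ?c ?r e2 q2 \<partial>SJ)" for e2
   unfolding nn_integral_cmult[OF cm] unfolding mult.assoc by (rule nn_integral_multc[OF am])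
  then have "(\<integral>\<^sup>+e2. \<integral>\<^sup>+q1. \<integral>\<^sup>+q2. ?a e1 q1 * ?b e1 x * ?c ?r e2 q2 \<partial>SJ \<partial>SJ \<partial>SE)
   = (\<integral>\<^sup>+e2. (\<integral>\<^sup>+q1. ?a e1 q1 \<partial>SJ) * ?b e1 x * (\<integral>\<^sup>+q2. ?c ?r e2 q2 \<partial>SJ) \<partial>SE)"
   by (simp only:)
  also have "\<dots> = (\<integral>\<^sup>+q1. ?a e1 q1 \<partial>SJ) * ?b e1 x * g ?r"
   unfolding g_def by (rule nn_integral_cmult[OF cm2])
  finally show "(\<integral>\<^sup>+e2. \<integral>\<^sup>+q1. \<integral>\<^sup>+q2. ?a e1 q1 * ?b e1 x * ?c ((\<Sum>i<k. e1 i) + x - t) e2 q2 \<partial>SJ \<partial>SJ \<partial>SE)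
   = (\<integral>\<^sup>+q1. ?a e1 q1 \<partial>SJ) * (?b e1 x * g ((\<Sum>i<k. e1 i) + x - t))" by (simp only: mult.assoc)
 qed
 also have "\<dots> = (\<integral>\<^sup>+e1. (\<integral>\<^sup>+q1. ?a e1 q1 * (if (\<Sum>i<k. e1 i) \<le> t then ennreal (exp (- (t - (\<Sum>i<k. e1 i)))) else 0) \<partial>SJ) * ?G \<partial>SE)"
 proof (intro nn_integral_cong)
  fix e1 :: "nat \<Rightarrow> real"
  let ?p = "\<Sum>i<k. e1 i"
  have am: "(\<lambda>q1. ?a e1 q1) \<in> borel_measurable SJ" by measurable
  have bm: "(\<lambda>x. ?b e1 x * g (?p + x - t)) \<in> borel_measurable (expo 1)" by measurable
  have "(\<integral>\<^sup>+x. (\<integral>\<^sup>+q1. ?a e1 q1 \<partial>SJ) * (?b e1 x * g (?p + x - t)) \<partial>expo 1) = (\<integral>\<^sup>+q1. ?a e1 q1 \<partial>SJ) * (\<integral>\<^sup>+x. ?b e1 x * g (?p + x - t) \<partial>expo 1)"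
   by (rule nn_integral_cmult[OF bm])
  also have "(\<integral>\<^sup>+x. ?b e1 x * g (?p + x - t) \<partial>expo 1) = (if ?p \<le> t then ennreal (exp (- (t - ?p))) else 0) * ?G"
  proof (cases "?p \<le> t")
   case True
   have "(\<integral>\<^sup>+x. ?b e1 x * g (?p + x - t) \<partial>expo 1) = (\<integral>\<^sup>+x. indicator {t - ?p<..} x * g (x - (t - ?p)) \<partial>expo 1)"
    using True by (intro nn_integral_cong) (auto split: split_indicator simp: algebra_simps)
   then show ?thesis using True expo_memoryless[of g "t - ?p"] by (simp add: G)
  next
   case False
   then show ?thesis by simp
  qed
  also have "(\<integral>\<^sup>+q1. ?a e1 q1 \<partial>SJ) * ((if ?p \<le> t then ennreal (exp (- (t - ?p))) else 0) * ?G) =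
    (\<integral>\<^sup>+q1. ?a e1 q1 * (if ?p \<le> t then ennreal (exp (- (t - ?p))) else 0) \<partial>SJ) * ?G"
   unfolding nn_integral_multc[OF am] unfolding mult.assoc ..
  finally show "(\<integral>\<^sup>+x. (\<integral>\<^sup>+q1. ?a e1 q1 \<partial>SJ) * (?b e1 x * g (?p + x - t)) \<partial>expo 1) =
    (\<integral>\<^sup>+q1. ?a e1 q1 * (if ?p \<le> t then ennreal (exp (- (t - ?p))) else 0) \<partial>SJ) * ?G" .
 qed
 also have "\<dots> = ?R * ?G" by (rule nn_integral_multc) measurable
 finally show ?thesis .
qed

lemma nat_gen_sets: "nat_gen M w N t \<subseteq> sets M"
 unfolding nat_gen_def by auto

definition GN :: "real \<Rightarrow> 'a set set" where
 "GN t = {{om\<in>space M. N s om \<in> B} | s B. 0 \<le> s \<and> s \<le> t \<and> B \<in> sets borel}"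

lemma GN_EM: "sigma_sets (space M) (GN t) \<subseteq> sets EM"
proof -
 have "GN t \<subseteq> sets EM"
 proof
  fix A assume "A \<in> GN t"
  then obtain s B where A: "A = {om\<in>space EM. N s om \<in> B}" and [measurable]: "B \<in> sets borel" by (auto simp: GN_def)
  show "A \<in> sets EM" unfolding A by measurable
 qed
 then show ?thesis using sets.sigma_sets_subset[of "GN t" EM] by simp
qed

lemma EM_sets: "sets EM \<subseteq> sets M" "sets WM \<subseteq> sets M"
 using indep_WM_EM by (auto simp: indep_sets2_eq)

text \<open>On good paths: exactly \<open>k\<close> arrivals by time \<open>t\<close>. Arrivals are
  numbered from 0, so index \<open>k\<close> is the first one after \<open>t\<close>.\<close>

definition Kev :: "real \<Rightarrow> nat \<Rightarrow> 'a \<Rightarrow> bool" where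
 "Kev t k om \<longleftrightarrow> (\<Sum>i<k. E i om) \<le> t \<and> t < (\<Sum>i<k. E i om) + E k om"

lemma Kev_iff:
 assumes "good om" "0 \<le> t" "Kev t k om"
 shows "arrival E i om \<le> t \<longleftrightarrow> i < k"
proof
 have Tk: "arrival E k om = (\<Sum>i<k. E i om) + E k om" by (simp add: arrival_def lessThan_Suc_atMost[symmetric])
 assume "arrival E i om \<le> t"
 then show "i < k" using arrival_mono[OF assms(1), of k i] assms(3) Tk by (force simp: Kev_def)
next
 assume i: "i < k"
 then obtain l where l: "k = Suc l" by (cases k) auto
 have "arrival E l om \<le> t" using assms(3) by (simp add: Kev_def arrival_def l lessThan_Suc_atMost)
 then show "arrival E i om \<le> t" using arrival_mono[OF assms(1), of i l] i l by simp
qed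

lemma Kev_ex1:
 assumes "good om" "0 \<le> t" shows "\<exists>!k. Kev t k om"
proof -
 have fin: "finite {k. arrival E k om \<le> t}" using assms by (auto simp: good_def)
 then have "\<exists>k. \<not> arrival E k om \<le> t" by (metis (mono_tags) ex_new_if_finite infinite_UNIV_nat mem_Collect_eq)
 define k where "k = (LEAST k. \<not> arrival E k om \<le> t)"
 have k: "\<not> arrival E k om \<le> t" unfolding k_def using \<open>\<exists>k. \<not> arrival E k om \<le> t\<close> by (rule LeastI_ex)
 have k': "arrival E i om \<le> t" if "i < k" for i using not_less_Least[of i] that unfolding k_def by blast
 have "Kev t k om"
 proof -
  have "(\<Sum>i<k. E i om) \<le> t"
  proof (cases k)
   case (Suc l) then show ?thesis using k'[of l] by (simp add: arrival_def lessThan_Suc_atMost)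
  qed (use assms in simp)
  moreover have "t < (\<Sum>i<k. E i om) + E k om" using k by (simp add: arrival_def lessThan_Suc_atMost[symmetric])
  ultimately show ?thesis by (simp add: Kev_def)
 qed
 moreover have "k1 = k2" if "Kev t k1 om" "Kev t k2 om" for k1 k2
  using Kev_iff[OF assms that(1)] Kev_iff[OF assms that(2)] by (metis less_irrefl not_less_iff_gr_or_eq)
 ultimately show ?thesis by blast
qed

text \<open>With exactly \<open>k\<close> arrivals by time \<open>t\<close>, the path of
  \<open>N\<close> up to \<open>t\<close> is a function of the first \<open>k\<close> waiting times
  and jumps. This holds for the generating events and passes through complements and countable
  unions; the representing set depends on \<open>k\<close>.\<close>

lemma GN_trunc:
 assumes t: "0 \<le> t" and A: "A \<in> sigma_sets (space M) (GN t)"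
 shows "\<exists>A'\<in>sets (SB \<Otimes>\<^sub>M SB). \<forall>om. good om \<longrightarrow> Kev t k om \<longrightarrow>
  (om \<in> A \<longleftrightarrow> (trunc k (\<lambda>k. E k om), trunc k (\<lambda>k. J k om)) \<in> A')"
 using A
proof induction
 case (Basic A)
 then obtain s B where A: "A = {om\<in>space M. N s om \<in> B}" "0 \<le> s" "s \<le> t" and [measurable]: "B \<in> sets borel"
  by (auto simp: GN_def)
 define F where "F z = (\<Sum>l<k. if (\<Sum>i\<le>l. fst z i) \<le> s then snd z l else 0 :: real)" for z :: "(nat \<Rightarrow> real) \<times> (nat \<Rightarrow> real)"
 have [measurable]: "F \<in> borel_measurable (SB \<Otimes>\<^sub>M SB)" unfolding F_def by measurable
 have "N s om = F (trunc k (\<lambda>k. E k om), trunc k (\<lambda>k. J k om))" if "good om" "Kev t k om" for om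
 proof -
  have sub: "{l. arrival E l om \<le> s} \<subseteq> {..<k}"
  proof
   fix l assume "l \<in> {l. arrival E l om \<le> s}"
   then have "arrival E l om \<le> t" using A(3) by simp
   then show "l \<in> {..<k}" using Kev_iff[OF that(1) t that(2), of l] by simp
  qed
  have "N s om = (\<Sum>l<k. if arrival E l om \<le> s then J l om else 0)"
  proof -
   have "{l. arrival E l om \<le> s} = {l \<in> {..<k}. arrival E l om \<le> s}" using sub by auto
   then show ?thesis unfolding cpoisson_def by (simp only: sum.inter_filter[OF finite_lessThan])
  qed
  also have "\<dots> = F (trunc k (\<lambda>k. E k om), trunc k (\<lambda>k. J k om))"
   unfolding F_def
  proof (rule sum.cong[OF refl])
   fix l assume "l \<in> {..<k}"
   then have "(\<Sum>i\<le>l. trunc k (\<lambda>k. E k om) i) = arrival E l om" "trunc k (\<lambda>k. J k om) l = J l om"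
    unfolding arrival_def by (auto simp: trunc_def intro!: sum.cong)
   then show "(if arrival E l om \<le> s then J l om else 0) = (if (\<Sum>i\<le>l. fst (trunc k (\<lambda>k. E k om), trunc k (\<lambda>k. J k om)) i) \<le> s
     then snd (trunc k (\<lambda>k. E k om), trunc k (\<lambda>k. J k om)) l else 0)" by simp
  qed
  finally show ?thesis .
 qed
 then show ?case
 proof (intro bexI allI impI)
  fix om assume N: "\<And>om. good om \<Longrightarrow> Kev t k om \<Longrightarrow> N s om = F (trunc k (\<lambda>k. E k om), trunc k (\<lambda>k. J k om))"
   and g: "good om" "Kev t k om"
  show "(om \<in> A) = ((trunc k (\<lambda>k. E k om), trunc k (\<lambda>k. J k om)) \<in> {z \<in> space (SB \<Otimes>\<^sub>M SB). F z \<in> B})"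
   using g(1) by (simp add: A N[OF g] good_def space_pair_measure)
 qed measurable
next
 case Empty
 show ?case by (rule bexI[of _ "{}"]) auto
next
 case (Compl A)
 then obtain A' where A': "A' \<in> sets (SB \<Otimes>\<^sub>M SB)" and eq: "\<And>om. good om \<Longrightarrow> Kev t k om \<Longrightarrow>
  (om \<in> A \<longleftrightarrow> (trunc k (\<lambda>k. E k om), trunc k (\<lambda>k. J k om)) \<in> A')" by blast
 show ?case
 proof (intro bexI allI impI)
  fix om assume g: "good om" "Kev t k om"
  show "(om \<in> space M - A) = ((trunc k (\<lambda>k. E k om), trunc k (\<lambda>k. J k om)) \<in> space (SB \<Otimes>\<^sub>M SB) - A')"
   using g(1) eq[OF g] by (simp add: good_def space_pair_measure)
 qed (use A' in blast)
next
 case (Union A)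
 then have "\<forall>n. \<exists>A'. A' \<in> sets (SB \<Otimes>\<^sub>M SB) \<and> (\<forall>om. good om \<longrightarrow> Kev t k om \<longrightarrow>
  (om \<in> A n \<longleftrightarrow> (trunc k (\<lambda>k. E k om), trunc k (\<lambda>k. J k om)) \<in> A'))" by blast
 then obtain A' where "\<And>n. A' n \<in> sets (SB \<Otimes>\<^sub>M SB)" "\<And>n. \<forall>om. good om \<longrightarrow> Kev t k om \<longrightarrow>
  (om \<in> A n \<longleftrightarrow> (trunc k (\<lambda>k. E k om), trunc k (\<lambda>k. J k om)) \<in> A' n)" by metis
 then show ?case by (intro bexI[of _ "\<Union>n. A' n"]) auto
qed

lemma N_increment:
 assumes "good om" "0 \<le> t" "t \<le> u" "Kev t k om"
 shows "N u om - N t om = cpf k u (\<lambda>k. E k om) (\<lambda>k. J k om)"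
proof -
 note K = Kev_iff[OF assms(1,2,4)]
 have fin: "finite {i. arrival E i om \<le> u}" using assms by (auto simp: good_def)
 have e: "{i. arrival E i om \<le> u} = {i. arrival E i om \<le> t} \<union> {i. k \<le> i \<and> arrival E i om \<le> u}"
 proof (intro set_eqI iffI)
  fix i assume "i \<in> {i. arrival E i om \<le> u}"
  then show "i \<in> {i. arrival E i om \<le> t} \<union> {i. k \<le> i \<and> arrival E i om \<le> u}" using K[of i] by (cases "i < k") simp_all
 next
  fix i assume "i \<in> {i. arrival E i om \<le> t} \<union> {i. k \<le> i \<and> arrival E i om \<le> u}"
  then show "i \<in> {i. arrival E i om \<le> u}" using assms(3) by (elim UnE) simp_all
 qed
 have "N u om = N t om + (\<Sum>i\<in>{i. k \<le> i \<and> arrival E i om \<le> u}. J i om)"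
  unfolding cpoisson_def e
 proof (rule sum.union_disjoint)
  show "finite {i. arrival E i om \<le> t}" using assms by (simp add: good_def)
  show "finite {i. k \<le> i \<and> arrival E i om \<le> u}" by (rule finite_subset[OF _ fin]) blast
  show "{i. arrival E i om \<le> t} \<inter> {i. k \<le> i \<and> arrival E i om \<le> u} = {}" by (simp add: K) (simp add: disjoint_iff)
 qed
 then show ?thesis by (simp add: cpf_def arrival_def)
qed

text \<open>Partition by the number of arrivals before \<open>t\<close> and apply
  \<open>renewal\<close> twice, with \<open>C\<close> and with \<open>UNIV\<close>. The second
  instance shows that the unknown factor is the probability of \<open>A\<close> together with
  \<open>k\<close> arrivals.\<close>

lemma N_renewal:
 assumes t: "0 \<le> t" "t < u" and A: "A \<in> sigma_sets (space M) (GN t)" and C [measurable]: "C \<in> sets borel"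
 shows "prob (A \<inter> {om\<in>space M. N u om - N t om \<in> C}) = prob A * prob {om\<in>space M. N (u - t) om \<in> C}"
proof -
 have [measurable]: "A \<in> sets M" using A GN_EM EM_sets by blast
 have [measurable]: "Measurable.pred M (Kev t k)" for k unfolding Kev_def[abs_def] by measurable
 let ?D = "{om\<in>space M. N u om - N t om \<in> C}"
 have part: "emeasure M B = (\<Sum>k. emeasure M (B \<inter> {om\<in>space M. Kev t k om}))" if [measurable]: "B \<in> sets M" for B
 proof -
  have "emeasure M B = (\<integral>\<^sup>+om. indicator B om \<partial>M)" by simp
  also have "\<dots> = (\<integral>\<^sup>+om. (\<Sum>k. indicator (B \<inter> {om\<in>space M. Kev t k om}) om) \<partial>M)"
  proof (rule nn_integral_cong_AE)
   show "AE om in M. indicator B om = (\<Sum>k. indicator (B \<inter> {om\<in>space M. Kev t k om}) om :: ennreal)"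
    using AE_good
   proof eventually_elim
    case (elim om)
    obtain k where k: "Kev t k om" "\<And>l. l \<noteq> k \<Longrightarrow> \<not> Kev t l om" using Kev_ex1[OF elim t(1)] by blast
    have "(\<Sum>l. indicator (B \<inter> {om\<in>space M. Kev t l om}) om :: ennreal) = (\<Sum>l\<in>{k}. indicator (B \<inter> {om\<in>space M. Kev t l om}) om)"
     by (rule suminf_finite) (use k in \<open>simp_all split: split_indicator\<close>)
    moreover have "om \<in> space M" using elim by (simp add: good_def)
    ultimately show ?case using k(1) by (simp split: split_indicator)
   qed
  qed
  also have "\<dots> = (\<Sum>k. emeasure M (B \<inter> {om\<in>space M. Kev t k om}))"
   by (subst nn_integral_suminf) simp_all
  finally show ?thesis .
 qed
 have step: "emeasure M (A \<inter> ?D \<inter> {om\<in>space M. Kev t k om}) = emeasure M (A \<inter> {om\<in>space M. Kev t k om}) * emeasure M {om\<in>space M. N (u - t) om \<in> C}" for k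
 proof -
  obtain A' where [measurable]: "A' \<in> sets (SB \<Otimes>\<^sub>M SB)" and A': "\<And>om. good om \<Longrightarrow> Kev t k om \<Longrightarrow>
   (om \<in> A \<longleftrightarrow> (trunc k (\<lambda>k. E k om), trunc k (\<lambda>k. J k om)) \<in> A')" using GN_trunc[OF t(1) A, of k] by blast
  have e: "emeasure M (A \<inter> {om\<in>space M. N u om - N t om \<in> C'} \<inter> {om\<in>space M. Kev t k om})
   = (\<integral>\<^sup>+om. indicator A' (trunc k (\<lambda>k. E k om), trunc k (\<lambda>k. J k om)) *
     indicator {(p, x). p \<le> t \<and> t < p + x} (\<Sum>i<k. E i om, E k om) *
     indicator C' (cpf k u (\<lambda>k. E k om) (\<lambda>k. J k om)) \<partial>M)" if [measurable]: "C' \<in> sets borel" for C'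
  proof -
   have "emeasure M (A \<inter> {om\<in>space M. N u om - N t om \<in> C'} \<inter> {om\<in>space M. Kev t k om})
    = (\<integral>\<^sup>+om. indicator (A \<inter> {om\<in>space M. N u om - N t om \<in> C'} \<inter> {om\<in>space M. Kev t k om}) om \<partial>M)" by simp
   also have "\<dots> = (\<integral>\<^sup>+om. indicator A' (trunc k (\<lambda>k. E k om), trunc k (\<lambda>k. J k om)) *
     indicator {(p, x). p \<le> t \<and> t < p + x} (\<Sum>i<k. E i om, E k om) *
     indicator C' (cpf k u (\<lambda>k. E k om) (\<lambda>k. J k om)) \<partial>M)"
   proof (rule nn_integral_cong_AE)
    show "AE om in M. indicator (A \<inter> {om\<in>space M. N u om - N t om \<in> C'} \<inter> {om\<in>space M. Kev t k om}) om =
     (indicator A' (trunc k (\<lambda>k. E k om), trunc k (\<lambda>k. J k om)) *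
     indicator {(p, x). p \<le> t \<and> t < p + x} (\<Sum>i<k. E i om, E k om) *
     indicator C' (cpf k u (\<lambda>k. E k om) (\<lambda>k. J k om)) :: ennreal)"
     using AE_good
    proof eventually_elim
     case (elim om)
     show ?case
     proof (cases "Kev t k om")
      case True
      then have "(\<Sum>i<k. E i om, E k om) \<in> {(p, x). p \<le> t \<and> t < p + x}" by (simp add: Kev_def)
      moreover have "om \<in> space M" using elim by (simp add: good_def)
      ultimately show ?thesis using True A'[OF elim True]
       unfolding N_increment[OF elim t(1) less_imp_le[OF t(2)] True, symmetric] by (simp split: split_indicator)
     next
      case False
      then have "(\<Sum>i<k. E i om, E k om) \<notin> {(p, x). p \<le> t \<and> t < p + x}" by (simp add: Kev_def)
      then show ?thesis using False by simp
     qed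
    qed
   qed
   finally show ?thesis .
  qed
  have G: "(\<integral>\<^sup>+om. indicator C (N (u - t) om) \<partial>M) = emeasure M {om\<in>space M. N (u - t) om \<in> C}"
  proof -
   have "(\<integral>\<^sup>+om. indicator C (N (u - t) om) \<partial>M) = (\<integral>\<^sup>+om. indicator {om\<in>space M. N (u - t) om \<in> C} om \<partial>M)"
    by (rule nn_integral_cong) (simp split: split_indicator)
   then show ?thesis by simp
  qed
  have U: "A \<inter> {om\<in>space M. N u om - N t om \<in> UNIV} \<inter> {om\<in>space M. Kev t k om} = A \<inter> {om\<in>space M. Kev t k om}"
   using sets.sets_into_space[OF \<open>A \<in> sets M\<close>] by auto
  have one: "(\<integral>\<^sup>+om. indicator UNIV (N (u - t) om) \<partial>M) = 1" by (simp add: emeasure_space_1)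
  show ?thesis
   using e[OF C] e[of UNIV] renewal[of A' C k t u] renewal[of A' UNIV k t u] unfolding G U one
   by simp
 qed
 have "emeasure M (A \<inter> ?D) = (\<Sum>k. emeasure M (A \<inter> {om\<in>space M. Kev t k om}) * emeasure M {om\<in>space M. N (u - t) om \<in> C})"
  by (subst part) (simp_all add: step)
 also have "\<dots> = emeasure M A * emeasure M {om\<in>space M. N (u - t) om \<in> C}"
  by (subst part[of A]) (simp_all add: ennreal_suminf_multc)
 finally show ?thesis by (simp add: emeasure_eq_measure ennreal_mult[symmetric])
qed

end

section \<open>Independence of increments and filtration\<close>

context noise
begin

text \<open>Cylinder events over finitely many times. Unlike the one-time events in
  \<open>nat_gen\<close> they are closed under intersection, as the extension to generated
  sigma-algebras requires.\<close>

definition PW :: "real \<Rightarrow> 'a set set" where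
 "PW t = {{om\<in>space M. \<forall>s\<in>F. w s om \<in> B s} | F B. finite F \<and> F \<subseteq> {0..t} \<and> (\<forall>s. B s \<in> sets borel)}"

lemma PW_WM: "PW t \<subseteq> sets WM"
proof
 fix A assume "A \<in> PW t"
 then obtain F B where A: "A = {om\<in>space WM. \<forall>s\<in>F. w s om \<in> B s}" and "finite F" and B: "\<And>s. B s \<in> sets borel" by (auto simp: PW_def)
 have "A = {om\<in>space WM. \<forall>s\<in>F. om \<in> w s -` B s \<inter> space WM}" by (auto simp: A)
 also have "\<dots> \<in> sets WM"
 proof (rule sets.sets_Collect_finite_All[OF _ \<open>finite F\<close>])
  fix s
  have "{om \<in> space WM. om \<in> w s -` B s \<inter> space WM} = w s -` B s \<inter> space WM" by auto
  then show "{om \<in> space WM. om \<in> w s -` B s \<inter> space WM} \<in> sets WM" using measurable_sets[OF w_WM B[of s], of s] by simp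
 qed
 finally show "A \<in> sets WM" .
qed

lemma Int_stable_PW: "Int_stable (PW t)"
proof (rule Int_stableI)
 fix A A' assume P: "A \<in> PW t" "A' \<in> PW t"
 obtain F B where A: "A = {om\<in>space M. \<forall>s\<in>F. w s om \<in> B s}" "finite F" "F \<subseteq> {0..t}" "\<forall>s. B s \<in> sets borel"
  using P(1) by (auto simp only: PW_def mem_Collect_eq)
 obtain F' B' where A': "A' = {om\<in>space M. \<forall>s\<in>F'. w s om \<in> B' s}" "finite F'" "F' \<subseteq> {0..t}" "\<forall>s. B' s \<in> sets borel"
  using P(2) by (auto simp only: PW_def mem_Collect_eq)
 let ?B = "\<lambda>s. (if s \<in> F then B s else UNIV) \<inter> (if s \<in> F' then B' s else UNIV)"
 have "(\<forall>s\<in>F \<union> F'. w s om \<in> ?B s) \<longleftrightarrow> (\<forall>s\<in>F. w s om \<in> B s) \<and> (\<forall>s\<in>F'. w s om \<in> B' s)" for om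
 proof (intro iffI conjI ballI)
  fix s assume a: "\<forall>s\<in>F \<union> F'. w s om \<in> ?B s"
  show "w s om \<in> B s" if "s \<in> F" using bspec[OF a, of s] that by simp
  show "w s om \<in> B' s" if "s \<in> F'" using bspec[OF a, of s] that by simp
 next
  fix s assume "(\<forall>s\<in>F. w s om \<in> B s) \<and> (\<forall>s\<in>F'. w s om \<in> B' s)"
  then show "w s om \<in> ?B s" by simp
 qed
 then have "A \<inter> A' = {om\<in>space M. \<forall>s\<in>F \<union> F'. w s om \<in> ?B s}" unfolding A(1) A'(1) by (simp only:) blast
 moreover have "\<forall>s. ?B s \<in> sets borel" using A(4) A'(4) by simp
 ultimately show "A \<inter> A' \<in> PW t" unfolding PW_def using A(2,3) A'(2,3)
  by (intro CollectI exI[of _ "F \<union> F'"] exI[of _ ?B]) simp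
qed

text \<open>The Wiener axioms concern increments along one increasing list of times. The times of
  the cylinder are sorted, with 0 and \<open>t\<close> added and \<open>u\<close> put at the end;
  past values become partial sums of the earlier increments, and the last increment is the one from
  \<open>t\<close> to \<open>u\<close>.\<close>

lemma W_increment:
 assumes t: "0 \<le> t" "t < u" and A: "A \<in> PW t" and C: "C \<in> sets borel"
 shows "prob (A \<inter> {om\<in>space M. w u om - w t om \<in> C}) = prob A * prob {om\<in>space M. w u om - w t om \<in> C}"
proof -
 obtain F B where A: "A = {om\<in>space M. \<forall>s\<in>F. w s om \<in> B s}" and F: "finite F" "F \<subseteq> {0..t}" and B: "\<And>s. B s \<in> sets borel"
  using A by (auto simp: PW_def)
 define xs where "xs = sorted_list_of_set (insert 0 (insert t F))"
 have xs: "set xs = insert 0 (insert t F)" "sorted xs" "distinct xs" using F unfolding xs_def by (simp_all del: sorted_list_of_set_insert_remove)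
 then have "xs \<noteq> []" by auto
 define n where "n = length xs"
 have n0: "n > 0" using \<open>xs \<noteq> []\<close> by (simp add: n_def)
 have strict: "xs ! i < xs ! j" if "i < j" "j < n" for i j
  using that xs sorted_nth_mono[of xs i j] nth_eq_iff_index_eq[of xs i j] unfolding n_def by fastforce
 have rng: "xs ! i \<in> {0..t}" if "i < n" for i
  using nth_mem[of i xs] that xs(1) F t unfolding n_def by auto
 have first: "xs ! 0 = 0"
 proof -
  obtain i where i: "i < n" "xs ! i = 0" using xs(1) unfolding n_def by (metis in_set_conv_nth insertI1)
  show ?thesis using strict[of 0 i] i rng[of 0] n0 by (cases "i = 0") auto
 qed
 have last: "xs ! (n - 1) = t"
 proof -
  obtain i where i: "i < n" "xs ! i = t" using xs(1) unfolding n_def by (metis in_set_conv_nth insertI1 insert_commute)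
  show ?thesis
  proof (cases "i = n - 1")
   case False
   then have "i < n - 1" "n - 1 < n" using i n0 by linarith+
   then show ?thesis using strict[of i "n - 1"] i rng[of "n - 1"] by force
  qed (use i in simp)
 qed
 \<comment> \<open>From index \<open>n\<close> on the value is \<open>u\<close>; since
   \<open>xs ! (n - 1)\<close> is \<open>t\<close>, the increment with index \<open>n - 1\<close> is
   the one from \<open>t\<close> to \<open>u\<close>.\<close>
 define ts' where "ts' i = (if i < n then xs ! i else u)" for i
 have tsm: "0 \<le> ts' 0" "\<forall>i<n. ts' i < ts' (Suc i)"
 proof -
  show "0 \<le> ts' 0" using first n0 by (simp add: ts'_def)
  show "\<forall>i<n. ts' i < ts' (Suc i)"
  proof (intro allI impI)
   fix i assume "i < n"
   then show "ts' i < ts' (Suc i)" using strict[of i "Suc i"] rng[of i] t by (cases "Suc i < n") (auto simp: ts'_def)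
  qed
 qed
 define D where "D = (\<lambda>i om. w (ts' (Suc i)) om - w (ts' i) om)"
 have ind: "indep_vars (\<lambda>_. borel) D {..<n}"
  using wiener tsm unfolding std_wiener_def D_def by blast
 have sumD: "(\<Sum>i<l. D i om) = w (xs ! l) om" if "l < n" "om \<in> space M" for l om
 proof -
  have "(\<Sum>i<l. D i om) = w (ts' l) om - w (ts' 0) om" unfolding D_def by (rule sum_lessThan_telescope)
  then show ?thesis using that first n0 w_0 by (simp add: ts'_def)
 qed
 have lastD: "D (n - 1) om = w u om - w t om" for om
  using last n0 by (simp add: D_def ts'_def)
 let ?m = "n - 1"
 have iv: "indep_var (PiM {..<?m} (\<lambda>_. borel)) (\<lambda>om. restrict (\<lambda>i. D i om) {..<?m}) (PiM {?m} (\<lambda>_. borel)) (\<lambda>om. restrict (\<lambda>i. D i om) {?m})"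
  by (rule indep_var_restrict[OF ind]) (use n0 in auto)
 let ?P = "PiM {..<?m} (\<lambda>_. borel :: real measure)"
 define Q where "Q = {g \<in> space ?P. \<forall>l\<in>{..<n}. xs ! l \<in> F \<longrightarrow> (\<Sum>i<l. g i) \<in> B (xs ! l)}"
 have Q: "Q \<in> sets ?P"
  unfolding Q_def
 proof (rule sets.sets_Collect_finite_All)
  fix l assume l: "l \<in> {..<n}"
  have "(\<lambda>g. \<Sum>i<l. g i) \<in> borel_measurable ?P"
   by (rule borel_measurable_sum) (use l in \<open>auto intro!: measurable_component_singleton\<close>)
  then show "{g \<in> space ?P. xs ! l \<in> F \<longrightarrow> (\<Sum>i<l. g i) \<in> B (xs ! l)} \<in> sets ?P"
   using B by (cases "xs ! l \<in> F") auto
 qed simp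
 have Aeq: "A = (\<lambda>om. restrict (\<lambda>i. D i om) {..<?m}) -` Q \<inter> space M"
 proof -
  have "om \<in> A \<longleftrightarrow> restrict (\<lambda>i. D i om) {..<?m} \<in> Q" if om: "om \<in> space M" for om
  proof -
   have s: "(\<Sum>i<l. restrict (\<lambda>i. D i om) {..<?m} i) = w (xs ! l) om" if "l < n" for l
   proof -
    have "(\<Sum>i<l. restrict (\<lambda>i. D i om) {..<?m} i) = (\<Sum>i<l. D i om)"
     by (rule sum.cong) (use that in auto)
    then show ?thesis using sumD[OF that om] by simp
   qed
   have "restrict (\<lambda>i. D i om) {..<?m} \<in> Q \<longleftrightarrow> (\<forall>l<n. xs ! l \<in> F \<longrightarrow> w (xs ! l) om \<in> B (xs ! l))"
   proof -
    define R where "R = restrict (\<lambda>i. D i om) {..<?m}"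
    have "R \<in> space ?P" unfolding R_def by (simp add: space_PiM)
    moreover have "\<And>l. l < n \<Longrightarrow> (\<Sum>i<l. R i) = w (xs ! l) om" unfolding R_def by (rule s)
    ultimately show ?thesis unfolding R_def[symmetric] Q_def by (simp add: Ball_def)
   qed
   also have "\<dots> \<longleftrightarrow> (\<forall>x\<in>set xs. x \<in> F \<longrightarrow> w x om \<in> B x)"
    unfolding n_def by (metis in_set_conv_nth)
   also have "\<dots> \<longleftrightarrow> (\<forall>x\<in>F. w x om \<in> B x)" using xs(1) by auto
   finally show ?thesis using om by (simp add: A)
  qed
  moreover have "A \<subseteq> space M" unfolding A by auto
  ultimately show ?thesis by blast
 qed
 define Q' where "Q' = {g \<in> space (PiM {?m} (\<lambda>_. borel :: real measure)). g ?m \<in> C}"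
 have Q': "Q' \<in> sets (PiM {?m} (\<lambda>_. borel))" unfolding Q'_def using C by measurable
 have Ceq: "{om\<in>space M. w u om - w t om \<in> C} = (\<lambda>om. restrict (\<lambda>i. D i om) {?m}) -` Q' \<inter> space M"
  unfolding Q'_def by (auto simp: space_PiM lastD simp del: One_nat_def)
 have "A \<inter> {om\<in>space M. w u om - w t om \<in> C} = (\<lambda>x. (restrict (\<lambda>i. D i x) {..<?m}, restrict (\<lambda>i. D i x) {?m})) -` (Q \<times> Q') \<inter> space M"
  unfolding Ceq by (subst Aeq) auto
 then show ?thesis using indep_varD[OF iv Q Q'] unfolding Ceq by (simp only: Aeq[symmetric])
qed

definition Yd :: "real \<Rightarrow> real \<Rightarrow> real \<Rightarrow> 'a \<Rightarrow> real" where
 "Yd \<sigma> t u om = \<sigma> * (w u om - w t om) + (N u om - N t om)"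

lemma Yd_measurable [measurable]: "Yd \<sigma> t u \<in> borel_measurable M"
 unfolding Yd_def[abs_def] by measurable

text \<open>Two systems closed under intersection are compared: a Wiener cylinder with a Poisson
  event of the past, and events of the two increments. Independence of the sources separates the
  Wiener factors from the Poisson factors, which are then treated by \<open>W_increment\<close> and
  \<open>N_renewal\<close>.\<close>

lemma indep_nat_gen:
 assumes t: "0 \<le> t" "t < u" and A: "A \<in> sigma_sets (space M) (nat_gen M w N t)" and C: "C \<in> sets borel"
 shows "prob (A \<inter> {om\<in>space M. Yd \<sigma> t u om \<in> C}) = prob A * prob {om\<in>space M. Yd \<sigma> t u om \<in> C}"
proof -
 let ?S = "sigma_sets (space M) (GN t)"
 define G1 where "G1 = {Aw \<inter> An | Aw An. Aw \<in> PW t \<and> An \<in> ?S}"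
 define G2 where "G2 = {{om\<in>space M. w u om - w t om \<in> B} \<inter> {om\<in>space M. N u om - N t om \<in> C} | B C. B \<in> sets borel \<and> C \<in> sets borel}"
 interpret SN: sigma_algebra "space M" ?S
  by (rule sigma_algebra_sigma_sets) (auto simp: GN_def)
 have G1M: "G1 \<subseteq> events" unfolding G1_def using PW_WM[of t] GN_EM[of t] EM_sets by (blast intro: sets.Int)
 have G2M: "G2 \<subseteq> events" unfolding G2_def by auto
 have top_PW: "space M \<in> PW t" unfolding PW_def by (intro CollectI exI[of _ "{}"] exI[of _ "\<lambda>_. UNIV"]) auto
 have W_N: "prob (Aw \<inter> An) = prob Aw * prob An" if "Aw \<in> sets WM" "An \<in> sets EM" for Aw An
  using indep_setD[OF indep_WM_EM that] .
 have i: "indep_set G1 G2"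
  unfolding indep_sets2_eq
 proof (intro conjI ballI G1M G2M)
  fix x y assume "x \<in> G1" "y \<in> G2"
  then obtain Aw An B C where x: "x = Aw \<inter> An" "Aw \<in> PW t" "An \<in> ?S"
   and y: "y = {om\<in>space M. w u om - w t om \<in> B} \<inter> {om\<in>space M. N u om - N t om \<in> C}" and [measurable]: "B \<in> sets borel" "C \<in> sets borel"
   by (auto simp: G1_def G2_def)
  let ?B = "{om\<in>space M. w u om - w t om \<in> B}" and ?C = "{om\<in>space M. N u om - N t om \<in> C}"
  have [measurable]: "Aw \<in> sets WM" "An \<in> sets EM" using x PW_WM GN_EM by auto
  have B: "?B \<in> sets WM"
  proof -
   have "{om\<in>space WM. w u om - w t om \<in> B} \<in> sets WM" by measurable
   then show ?thesis by simp
  qed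
  have C: "?C \<in> sets EM"
  proof -
   have "{om\<in>space EM. N u om - N t om \<in> C} \<in> sets EM" by measurable
   then show ?thesis by simp
  qed
  have "prob (x \<inter> y) = prob ((Aw \<inter> ?B) \<inter> (An \<inter> ?C))" unfolding x y by (rule arg_cong[where f=prob]) auto
  also have "\<dots> = prob (Aw \<inter> ?B) * prob (An \<inter> ?C)" using B C by (intro W_N) auto
  also have "prob (Aw \<inter> ?B) = prob Aw * prob ?B" by (rule W_increment[OF t x(2)]) simp
  also have "prob (An \<inter> ?C) = prob An * prob ?C"
  proof -
   have "prob ?C = prob {om\<in>space M. N (u - t) om \<in> C}"
    using N_renewal[OF t SN.top, of C] by (simp add: prob_space Int_absorb1)
   then show ?thesis using N_renewal[OF t x(3), of C] by simp
  qed
  also have "prob Aw * prob ?B * (prob An * prob ?C) = (prob Aw * prob An) * (prob ?B * prob ?C)" by (simp add: mult_ac)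
  also have "\<dots> = prob x * prob y" unfolding x y using B C by (simp add: W_N)
  finally show "prob (x \<inter> y) = prob x * prob y" .
 qed
 have "Int_stable G1"
 proof (rule Int_stableI)
  fix x y assume "x \<in> G1" "y \<in> G1"
  then obtain Aw An Bw Bn where "x = Aw \<inter> An" "Aw \<in> PW t" "An \<in> ?S" "y = Bw \<inter> Bn" "Bw \<in> PW t" "Bn \<in> ?S" by (auto simp: G1_def)
  moreover from this have "x \<inter> y = (Aw \<inter> Bw) \<inter> (An \<inter> Bn)" by auto
  moreover have "Aw \<inter> Bw \<in> PW t" using Int_stable_PW[of t] calculation by (simp add: Int_stable_def)
  moreover have "An \<inter> Bn \<in> ?S" using calculation by (intro SN.Int)
  ultimately show "x \<inter> y \<in> G1" unfolding G1_def by blast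
 qed
 moreover have "Int_stable G2"
 proof (rule Int_stableI)
  fix x y assume "x \<in> G2" "y \<in> G2"
  then obtain B C B' C' where "x = {om\<in>space M. w u om - w t om \<in> B} \<inter> {om\<in>space M. N u om - N t om \<in> C}" "B \<in> sets borel" "C \<in> sets borel"
   "y = {om\<in>space M. w u om - w t om \<in> B'} \<inter> {om\<in>space M. N u om - N t om \<in> C'}" "B' \<in> sets borel" "C' \<in> sets borel" by (auto simp: G2_def)
  then show "x \<inter> y \<in> G2" unfolding G2_def
   by (intro CollectI exI[of _ "B \<inter> B'"] exI[of _ "C \<inter> C'"]) auto
 qed
 ultimately have I: "indep_set (sigma_sets (space M) G1) (sigma_sets (space M) G2)"
  by (rule indep_set_sigma_sets[OF i])
 have "A \<in> sigma_sets (space M) G1"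
 proof -
  have "nat_gen M w N t \<subseteq> G1"
  proof
   fix x assume "x \<in> nat_gen M w N t"
   then consider s B where "x = {om\<in>space M. w s om \<in> B}" "0 \<le> s" "s \<le> t" "B \<in> sets borel"
    | s B where "x = {om\<in>space M. N s om \<in> B}" "0 \<le> s" "s \<le> t" "B \<in> sets borel" by (auto simp: nat_gen_def)
   then show "x \<in> G1"
   proof cases
    case 1
    have "x \<in> PW t" unfolding PW_def 1(1) using 1 by (intro CollectI exI[of _ "{s}"] exI[of _ "\<lambda>_. B"]) auto
    moreover have "x = x \<inter> space M" using 1 by auto
    ultimately show ?thesis unfolding G1_def using SN.top by blast
   next
    case 2
    then have "x \<in> ?S" by (intro sigma_sets.Basic) (auto simp: GN_def)
    moreover have "x = space M \<inter> x" using 2 by auto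
    ultimately show ?thesis unfolding G1_def using top_PW by blast
   qed
  qed
  then show ?thesis using A sigma_sets_mono'[of "nat_gen M w N t" G1 "space M"] by auto
 qed
 moreover have "{om\<in>space M. Yd \<sigma> t u om \<in> C} \<in> sigma_sets (space M) G2"
 proof -
  define S where "S = sigma (space M) G2"
  have sub: "G2 \<subseteq> Pow (space M)" by (auto simp: G2_def)
  have S: "sets S = sigma_sets (space M) G2" "space S = space M" using sub by (auto simp: S_def)
  have [measurable]: "(\<lambda>om. w u om - w t om) \<in> borel_measurable S"
  proof (rule measurableI)
   fix B :: "real set" assume "B \<in> sets borel"
   then have g: "{om\<in>space M. w u om - w t om \<in> B} \<inter> {om\<in>space M. N u om - N t om \<in> UNIV} \<in> G2"
    unfolding G2_def by (intro CollectI exI[of _ B] exI[of _ UNIV]) simp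
   have e: "(\<lambda>om. w u om - w t om) -` B \<inter> space M = {om\<in>space M. w u om - w t om \<in> B} \<inter> {om\<in>space M. N u om - N t om \<in> UNIV}" by auto
   show "(\<lambda>om. w u om - w t om) -` B \<inter> space S \<in> sets S" unfolding S e by (rule sigma_sets.Basic[OF g])
  qed simp
  have [measurable]: "(\<lambda>om. N u om - N t om) \<in> borel_measurable S"
  proof (rule measurableI)
   fix B :: "real set" assume "B \<in> sets borel"
   then have g: "{om\<in>space M. w u om - w t om \<in> UNIV} \<inter> {om\<in>space M. N u om - N t om \<in> B} \<in> G2"
    unfolding G2_def by (intro CollectI exI[of _ UNIV] exI[of _ B]) simp
   have e: "(\<lambda>om. N u om - N t om) -` B \<inter> space M = {om\<in>space M. w u om - w t om \<in> UNIV} \<inter> {om\<in>space M. N u om - N t om \<in> B}" by auto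
   show "(\<lambda>om. N u om - N t om) -` B \<inter> space S \<in> sets S" unfolding S e by (rule sigma_sets.Basic[OF g])
  qed simp
  have "{om\<in>space S. Yd \<sigma> t u om \<in> C} \<in> sets S" unfolding Yd_def using C by measurable
  then show ?thesis unfolding S .
 qed
 ultimately show ?thesis using indep_setD[OF I] by blast
qed

section \<open>Right limits of the paths and the augmented filtration\<close>

lemma N_right_const:
 assumes "good om" "0 \<le> t"
 shows "\<exists>r>t. \<forall>s. t \<le> s \<and> s < r \<longrightarrow> N s om = N t om"
proof -
 define S where "S = (\<lambda>k. arrival E k om) ` {k. arrival E k om \<le> t + 1 \<and> t < arrival E k om}"
 have fin: "finite S"
 proof -
  have "finite {k. arrival E k om \<le> t + 1}" using assms by (simp add: good_def)
  then have "finite {k. arrival E k om \<le> t + 1 \<and> t < arrival E k om}" by (rule rev_finite_subset) blast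
  then show ?thesis unfolding S_def by (rule finite_imageI)
 qed
 define r where "r = Min (insert (t + 1) S)"
 have r: "t < r" unfolding r_def using fin by (subst Min_gr_iff) (auto simp: S_def)
 have le: "r \<le> t + 1" "\<And>x. x \<in> S \<Longrightarrow> r \<le> x" unfolding r_def using fin by auto
 have "N s om = N t om" if s: "t \<le> s" "s < r" for s
 proof -
  have "arrival E k om \<le> s \<longleftrightarrow> arrival E k om \<le> t" for k
  proof
   assume a: "arrival E k om \<le> s"
   show "arrival E k om \<le> t"
   proof (rule ccontr)
    assume "\<not> arrival E k om \<le> t"
    then have "arrival E k om \<in> S" unfolding S_def using a s le(1) by force
    then show False using le(2) a s by force
   qed
  qed (use s in simp)
  then show ?thesis by (simp add: cpoisson_def)
 qed
 then show ?thesis using r by blast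
qed

lemma N_right_tendsto:
 assumes "good om" "0 \<le> t" "X \<longlonglongrightarrow> t" "\<And>i. t \<le> X i"
 shows "(\<lambda>i. N (X i) om) \<longlonglongrightarrow> N t om"
proof -
 obtain r where r: "r > t" "\<forall>s. t \<le> s \<and> s < r \<longrightarrow> N s om = N t om" using N_right_const[OF assms(1,2)] by blast
 have "eventually (\<lambda>i. X i < r) sequentially" using assms(3) r(1) by (rule order_tendstoD)
 then have "eventually (\<lambda>i. N (X i) om = N t om) sequentially" by eventually_elim (use r assms(4) in blast)
 then show ?thesis by (rule tendsto_eventually)
qed

lemma w_tendsto:
 assumes "om \<in> space M" "0 \<le> t" "X \<longlonglongrightarrow> t" "\<And>i. 0 \<le> X i"
 shows "(\<lambda>i. w (X i) om) \<longlonglongrightarrow> w t om"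
 by (rule continuous_on_tendsto_compose[OF w_cont[OF assms(1)] assms(3)]) (use assms in auto)

lemma N_0: "good om \<Longrightarrow> N 0 om = 0"
 using arrival_pos[of om] by (simp add: cpoisson_def not_le[symmetric])

abbreviation Fl where "Fl t \<equiv> filt M w N t"

lemma Fl_sets: "Fl t \<subseteq> sets M" by (auto simp: filt_def)

lemma Fl_mono: "s \<le> t \<Longrightarrow> Fl s \<subseteq> Fl t" by (auto simp: filt_def)

lemma sigma_nat_gen_sets: "sigma_sets (space M) (nat_gen M w N t) \<subseteq> sets M"
 by (rule sets.sigma_sets_subset[OF nat_gen_sets])

lemma Fl_sigma_algebra: "sigma_algebra (space M) (Fl t)"
 unfolding sigma_algebra_iff2
proof (intro conjI ballI allI impI)
 show "Fl t \<subseteq> Pow (space M)" using Fl_sets[of t] sets.sets_into_space[of _ M] by blast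
 show "{} \<in> Fl t" unfolding filt_def by (auto intro!: bexI[of _ "{}"] sigma_sets.Empty)
next
 fix A assume A: "A \<in> Fl t"
 show "space M - A \<in> Fl t"
  unfolding filt_def
 proof (intro CollectI conjI allI impI)
  show "space M - A \<in> sets M" using A Fl_sets by auto
  fix s assume "t < s"
  then obtain B where B: "B \<in> sigma_sets (space M) (nat_gen M w N s)" "(A - B) \<union> (B - A) \<in> null_sets M" using A by (auto simp: filt_def)
  have "A \<subseteq> space M" "B \<subseteq> space M" using A Fl_sets B sigma_nat_gen_sets sets.sets_into_space by blast+
  then have "(space M - A - (space M - B)) \<union> (space M - B - (space M - A)) = (A - B) \<union> (B - A)" by auto
  then show "\<exists>B\<in>sigma_sets (space M) (nat_gen M w N s). (space M - A - B) \<union> (B - (space M - A)) \<in> null_sets M"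
   using B sigma_sets.Compl by metis
 qed
next
 fix A :: "nat \<Rightarrow> 'a set" assume A: "range A \<subseteq> Fl t"
 show "(\<Union>i. A i) \<in> Fl t"
  unfolding filt_def
 proof (intro CollectI conjI allI impI)
  show "(\<Union>i. A i) \<in> sets M" using A Fl_sets by blast
  fix s assume "t < s"
  then have "\<forall>i. \<exists>B. B \<in> sigma_sets (space M) (nat_gen M w N s) \<and> (A i - B) \<union> (B - A i) \<in> null_sets M" using A by (force simp: filt_def)
  then obtain B where B: "\<And>i. B i \<in> sigma_sets (space M) (nat_gen M w N s)" "\<And>i. (A i - B i) \<union> (B i - A i) \<in> null_sets M" by metis
  have "(\<Union>i. (A i - B i) \<union> (B i - A i)) \<in> null_sets M" using B(2) by (rule null_sets_UN)
  moreover have "(\<Union>i. B i) \<in> sigma_sets (space M) (nat_gen M w N s)" using B(1) by (rule sigma_sets.Union)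
  moreover have "((\<Union>i. A i) - (\<Union>i. B i)) \<union> ((\<Union>i. B i) - (\<Union>i. A i)) \<in> sets M"
  proof -
   have "A i \<in> sets M" "B i \<in> sets M" for i using A B(1)[of i] Fl_sets sigma_nat_gen_sets by blast+
   then show ?thesis by auto
  qed
  moreover have "((\<Union>i. A i) - (\<Union>i. B i)) \<union> ((\<Union>i. B i) - (\<Union>i. A i)) \<subseteq> (\<Union>i. (A i - B i) \<union> (B i - A i))" by auto
  ultimately show "\<exists>B\<in>sigma_sets (space M) (nat_gen M w N s). ((\<Union>i. A i) - B) \<union> (B - (\<Union>i. A i)) \<in> null_sets M"
   using null_sets_subset by blast
 qed
qed

definition Ft where "Ft t = sigma (space M) (Fl t)"

lemma sets_Ft [simp]: "sets (Ft t) = Fl t" and space_Ft [simp]: "space (Ft t) = space M"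
proof -
 interpret sigma_algebra "space M" "Fl t" by (rule Fl_sigma_algebra)
 have "Fl t \<subseteq> Pow (space M)" by (rule space_closed)
 then show "sets (Ft t) = Fl t" "space (Ft t) = space M" by (auto simp: Ft_def sigma_sets_eq)
qed

text \<open>Augmentation makes \<open>Fl t\<close> insensitive to null sets; this is one half of the
  argument that almost sure identities preserve adaptedness.\<close>

lemma Fl_null:
 assumes "A \<in> sets M" "B \<in> Fl t" "(A - B) \<union> (B - A) \<in> null_sets M"
 shows "A \<in> Fl t"
 unfolding filt_def
proof (intro CollectI conjI allI impI assms)
 fix s assume "t < s"
 then obtain B' where B': "B' \<in> sigma_sets (space M) (nat_gen M w N s)" "(B - B') \<union> (B' - B) \<in> null_sets M" using assms(2) by (auto simp: filt_def)
 have "B' \<in> sets M" using B' sigma_nat_gen_sets by blast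
 then have "(A - B') \<union> (B' - A) \<in> sets M" using assms(1) by auto
 moreover have "(A - B') \<union> (B' - A) \<subseteq> ((A - B) \<union> (B - A)) \<union> ((B - B') \<union> (B' - B))" by auto
 ultimately show "\<exists>B\<in>sigma_sets (space M) (nat_gen M w N s). (A - B) \<union> (B - A) \<in> null_sets M"
  using B' assms(3) null_sets_subset[OF null_sets.Un[OF assms(3) B'(2)]] by blast
qed

lemma nat_gen_mono: "t \<le> s \<Longrightarrow> nat_gen M w N t \<subseteq> nat_gen M w N s"
proof
 fix A assume ts: "t \<le> s" and "A \<in> nat_gen M w N t"
 then consider r B where "A = {om\<in>space M. w r om \<in> B}" "0 \<le> r" "r \<le> t" "B \<in> sets borel"
  | r B where "A = {om\<in>space M. N r om \<in> B}" "0 \<le> r" "r \<le> t" "B \<in> sets borel" by (auto simp: nat_gen_def)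
 then show "A \<in> nat_gen M w N s"
 proof cases
  case 1
  then show ?thesis unfolding nat_gen_def using ts by (intro UnI1 CollectI exI[of _ r] exI[of _ B]) simp
 next
  case 2
  then show ?thesis unfolding nat_gen_def using ts by (intro UnI2 CollectI exI[of _ r] exI[of _ B]) simp
 qed
qed

lemma nat_gen_Fl: "A \<in> nat_gen M w N t \<Longrightarrow> A \<in> Fl t"
proof -
 assume A: "A \<in> nat_gen M w N t"
 have "A \<in> sigma_sets (space M) (nat_gen M w N s)" if "s > t" for s
  using A nat_gen_mono[OF less_imp_le[OF that]] by (intro sigma_sets.Basic) blast
 moreover have "A \<in> sets M" using A nat_gen_sets by blast
 ultimately show ?thesis unfolding filt_def by (auto intro!: bexI[of _ A])
qed

lemma w_Ft [measurable]: "0 \<le> s \<Longrightarrow> s \<le> t \<Longrightarrow> w s \<in> borel_measurable (Ft t)"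
 and N_Ft [measurable]: "0 \<le> s \<Longrightarrow> s \<le> t \<Longrightarrow> N s \<in> borel_measurable (Ft t)"
proof -
 assume s: "0 \<le> s" "s \<le> t"
 show "w s \<in> borel_measurable (Ft t)" "N s \<in> borel_measurable (Ft t)"
 proof (auto intro!: measurableI)
  fix B :: "real set" assume "B \<in> sets borel"
  then have "{om\<in>space M. w s om \<in> B} \<in> nat_gen M w N t" "{om\<in>space M. N s om \<in> B} \<in> nat_gen M w N t"
   using s unfolding nat_gen_def by blast+
  then have "{om\<in>space M. w s om \<in> B} \<in> Fl t" "{om\<in>space M. N s om \<in> B} \<in> Fl t" by (auto intro: nat_gen_Fl)
  then show "w s -` B \<inter> space M \<in> Fl t" "N s -` B \<inter> space M \<in> Fl t" by (auto simp: vimage_def Int_def conj_commute)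
 qed
qed

lemma Ft_subalgebra: "subalgebra M (Ft t)"
 unfolding subalgebra_def using Fl_sets by simp

lemma measurable_Ft_M: "f \<in> measurable (Ft t) S \<Longrightarrow> f \<in> measurable M S"
 by (rule measurable_from_subalg[OF Ft_subalgebra])

lemma measurable_Ft_mono: "f \<in> measurable (Ft s) S \<Longrightarrow> s \<le> t \<Longrightarrow> f \<in> measurable (Ft t) S"
 using Fl_mono[of s t] by (auto simp: measurable_def)

text \<open>Passes from events to integrals: the law of \<open>Z\<close> under the measure
  restricted to \<open>A\<close> is a multiple of the law of \<open>Z\<close>.\<close>

lemma indep_nn:
 assumes [measurable]: "A \<in> sets M" "Z \<in> borel_measurable M" "\<kappa> \<in> borel_measurable borel"
  and ind: "\<And>C. C \<in> sets borel \<Longrightarrow> prob (A \<inter> {om\<in>space M. Z om \<in> C}) = prob A * prob {om\<in>space M. Z om \<in> C}"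
 shows "(\<integral>\<^sup>+om. indicator A om * \<kappa> (Z om :: real) \<partial>M) = ennreal (prob A) * (\<integral>\<^sup>+om. \<kappa> (Z om) \<partial>M)"
proof -
 have "distr (density M (indicator A)) borel Z = scale_measure (ennreal (prob A)) (distr M borel Z)"
 proof (rule measure_eqI)
  fix C assume "C \<in> sets (distr (density M (indicator A)) borel Z)"
  then have [measurable]: "C \<in> sets borel" by simp
  have e: "Z -` C \<inter> space M = {om\<in>space M. Z om \<in> C}" by auto
  have "emeasure (distr (density M (indicator A)) borel Z) C = emeasure (density M (indicator A)) {om\<in>space M. Z om \<in> C}"
   by (subst emeasure_distr) (simp_all add: e)
  also have "\<dots> = emeasure M (A \<inter> {om\<in>space M. Z om \<in> C})"
  proof (subst emeasure_density)
   have "(\<integral>\<^sup>+ x. indicator A x * indicator {om \<in> space M. Z om \<in> C} x \<partial>M) = (\<integral>\<^sup>+ x. indicator (A \<inter> {om \<in> space M. Z om \<in> C}) x \<partial>M)"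
    by (rule nn_integral_cong) (simp split: split_indicator)
   then show "(\<integral>\<^sup>+ x. indicator A x * indicator {om \<in> space M. Z om \<in> C} x \<partial>M) = emeasure M (A \<inter> {om \<in> space M. Z om \<in> C})" by simp
  qed simp_all
  also have "\<dots> = ennreal (prob A) * emeasure M {om\<in>space M. Z om \<in> C}"
   by (simp add: emeasure_eq_measure ind ennreal_mult)
  also have "\<dots> = emeasure (scale_measure (ennreal (prob A)) (distr M borel Z)) C"
   by (simp add: emeasure_distr e)
  finally show "emeasure (distr (density M (indicator A)) borel Z) C = emeasure (scale_measure (ennreal (prob A)) (distr M borel Z)) C" .
 qed simp
 then have "(\<integral>\<^sup>+x. \<kappa> x \<partial>distr (density M (indicator A)) borel Z) = (\<integral>\<^sup>+x. \<kappa> x \<partial>scale_measure (ennreal (prob A)) (distr M borel Z))" by simp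
 then show ?thesis by (simp add: nn_integral_distr nn_integral_density nn_integral_scale_measure)
qed

text \<open>An event of \<open>Fl t\<close> agrees up to a null set with an event of the natural
  filtration at any \<open>t' > t\<close>, so independence is first available for increments that
  start at \<open>t'\<close>. Letting \<open>t'\<close> decrease to \<open>t\<close> uses
  right-continuity of the paths and continuous test functions; half-lines and closure under
  intersection then give all Borel sets.\<close>

lemma indep_Fl:
 assumes t: "0 \<le> t" "t < u" and A: "A \<in> Fl t" and C: "C \<in> sets borel"
 shows "prob (A \<inter> {om\<in>space M. Yd \<sigma> t u om \<in> C}) = prob A * prob {om\<in>space M. Yd \<sigma> t u om \<in> C}"
proof -
 have step1: "prob (A \<inter> {om\<in>space M. Yd \<sigma> t' u om \<in> C}) = prob A * prob {om\<in>space M. Yd \<sigma> t' u om \<in> C}"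
  if t': "t < t'" "t' < u" and A: "A \<in> Fl t" and [measurable]: "C \<in> sets borel" for t' C A
 proof -
  obtain B where B: "B \<in> sigma_sets (space M) (nat_gen M w N t')" "(A - B) \<union> (B - A) \<in> null_sets M" using A t' by (auto simp: filt_def)
  have [measurable]: "A \<in> sets M" "B \<in> sets M" using A Fl_sets B sigma_nat_gen_sets by blast+
  have AE: "AE om in M. om \<in> A \<longleftrightarrow> om \<in> B" using AE_not_in[OF B(2)] by eventually_elim auto
  have "prob A = prob B" by (rule finite_measure_eq_AE) (use AE in auto)
  moreover have "prob (A \<inter> {om\<in>space M. Yd \<sigma> t' u om \<in> C}) = prob (B \<inter> {om\<in>space M. Yd \<sigma> t' u om \<in> C})"
  proof (rule finite_measure_eq_AE)
   show "AE x in M. (x \<in> A \<inter> {om \<in> space M. Yd \<sigma> t' u om \<in> C}) = (x \<in> B \<inter> {om \<in> space M. Yd \<sigma> t' u om \<in> C})"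
    using AE by eventually_elim simp
  qed simp_all
  ultimately show ?thesis using indep_nat_gen[OF _ t'(2) B(1), of C \<sigma>] t t' by simp
 qed
 have cont: "(\<integral>\<^sup>+om. indicator A om * ennreal (\<kappa> (Yd \<sigma> t u om)) \<partial>M) = ennreal (prob A) * (\<integral>\<^sup>+om. ennreal (\<kappa> (Yd \<sigma> t u om)) \<partial>M)"
  if \<kappa>: "continuous_on UNIV \<kappa>" "\<And>x. 0 \<le> \<kappa> x" "\<And>x. \<kappa> x \<le> 1" and A: "A \<in> Fl t" for \<kappa> :: "real \<Rightarrow> real" and A
 proof -
  have [measurable]: "\<kappa> \<in> borel_measurable borel" by (rule borel_measurable_continuous_onI[OF \<kappa>(1)])
  have [measurable]: "A \<in> sets M" using A Fl_sets by blast
  \<comment> \<open>The offset 2 keeps \<open>T i\<close> strictly between \<open>t\<close> and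
    \<open>u\<close> also for \<open>i = 0\<close>.\<close>
  define T where "T i = t + (u - t) / real (i + 2)" for i :: nat
  have T: "t < T i" "T i < u" for i
  proof -
   show "t < T i" using t by (simp add: T_def)
   have "(u - t) / real (i + 2) < (u - t) / 1" using t by (intro divide_strict_left_mono) auto
   then show "T i < u" by (simp add: T_def)
  qed
  have "(\<lambda>i. t + (u - t) / real (i + 2)) \<longlonglongrightarrow> t + 0"
   by (intro tendsto_add tendsto_const LIMSEQ_ignore_initial_segment[where f="\<lambda>i. (u - t) / real i"] lim_const_over_n)
  then have Tl: "T \<longlonglongrightarrow> t" by (simp add: T_def[abs_def])
  have lim: "AE om in M. (\<lambda>i. ennreal (\<kappa> (Yd \<sigma> (T i) u om))) \<longlonglongrightarrow> ennreal (\<kappa> (Yd \<sigma> t u om))"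
   using AE_good
  proof eventually_elim
   case (elim om)
   then have "(\<lambda>i. Yd \<sigma> (T i) u om) \<longlonglongrightarrow> Yd \<sigma> t u om" unfolding Yd_def
    using order_trans[OF t(1) less_imp_le[OF T(1)]] less_imp_le[OF T(1)] t Tl
    by (intro tendsto_intros w_tendsto N_right_tendsto) (auto simp: good_def)
   then have "(\<lambda>i. \<kappa> (Yd \<sigma> (T i) u om)) \<longlonglongrightarrow> \<kappa> (Yd \<sigma> t u om)"
    by (intro continuous_on_tendsto_compose[OF \<kappa>(1)]) auto
   then show ?case by (rule tendsto_ennrealI)
  qed
  have "(\<lambda>i. \<integral>\<^sup>+om. indicator A om * ennreal (\<kappa> (Yd \<sigma> (T i) u om)) \<partial>M) \<longlonglongrightarrow> (\<integral>\<^sup>+om. indicator A om * ennreal (\<kappa> (Yd \<sigma> t u om)) \<partial>M)"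
  proof (rule nn_integral_dominated_convergence[where w="\<lambda>_. 1"])
   show "AE om in M. (\<lambda>i. indicator A om * ennreal (\<kappa> (Yd \<sigma> (T i) u om))) \<longlonglongrightarrow> indicator A om * ennreal (\<kappa> (Yd \<sigma> t u om))"
    using lim by eventually_elim (simp split: split_indicator)
  qed (use \<kappa> in \<open>auto split: split_indicator simp: emeasure_space_1\<close>)
  moreover have "(\<lambda>i. \<integral>\<^sup>+om. ennreal (\<kappa> (Yd \<sigma> (T i) u om)) \<partial>M) \<longlonglongrightarrow> (\<integral>\<^sup>+om. ennreal (\<kappa> (Yd \<sigma> t u om)) \<partial>M)"
   by (rule nn_integral_dominated_convergence[where w="\<lambda>_. 1"]) (use \<kappa> lim in \<open>auto simp: emeasure_space_1\<close>)
  then have "(\<lambda>i. ennreal (prob A) * (\<integral>\<^sup>+om. ennreal (\<kappa> (Yd \<sigma> (T i) u om)) \<partial>M)) \<longlonglongrightarrow> ennreal (prob A) * (\<integral>\<^sup>+om. ennreal (\<kappa> (Yd \<sigma> t u om)) \<partial>M)"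
   by (intro ennreal_tendsto_cmult) auto
  moreover have "(\<integral>\<^sup>+om. indicator A om * ennreal (\<kappa> (Yd \<sigma> (T i) u om)) \<partial>M) = ennreal (prob A) * (\<integral>\<^sup>+om. ennreal (\<kappa> (Yd \<sigma> (T i) u om)) \<partial>M)" for i
   by (rule indep_nn[where \<kappa>="\<lambda>x. ennreal (\<kappa> x)"]) (use step1[OF T A] in auto)
  ultimately show ?thesis using LIMSEQ_unique by fastforce
 qed
 have le: "prob (A \<inter> {om\<in>space M. Yd \<sigma> t u om \<le> c}) = prob A * prob {om\<in>space M. Yd \<sigma> t u om \<le> c}" if A: "A \<in> Fl t" for c A
 proof -
  have [measurable]: "A \<in> sets M" using A Fl_sets by blast
  \<comment> \<open>Piecewise linear functions that decrease to the indicator of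
    \<open>{..c}\<close>.\<close>
  define \<kappa> where "\<kappa> m z = max 0 (1 - real m * max 0 (z - c))" for m :: nat and z :: real
  have \<kappa>: "continuous_on UNIV (\<kappa> m)" "0 \<le> \<kappa> m x" "\<kappa> m x \<le> 1" for m x
   unfolding \<kappa>_def by (auto intro!: continuous_intros)
  have [measurable]: "\<kappa> m \<in> borel_measurable borel" for m unfolding \<kappa>_def[abs_def] by measurable
  have lim: "(\<lambda>m. ennreal (\<kappa> m z)) \<longlonglongrightarrow> indicator {..c} z" for z
  proof (cases "z \<le> c")
   case True then show ?thesis by (simp add: \<kappa>_def)
  next
   case False
   obtain m0 where m0: "1 / (z - c) \<le> real m0" using real_arch_simple by blast
   have "\<kappa> m z = 0" if "m \<ge> m0" for m
   proof -
    have "1 / (z - c) \<le> real m" using m0 that by linarith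
    then have "1 \<le> real m * (z - c)" using False by (simp add: field_simps)
    then show ?thesis using False by (simp add: \<kappa>_def)
   qed
   then have "eventually (\<lambda>m. ennreal (\<kappa> m z) = 0) sequentially"
    unfolding eventually_sequentially by (intro exI[of _ m0]) simp
   then show ?thesis using False by (simp add: tendsto_eventually)
  qed
  have "(\<lambda>m. \<integral>\<^sup>+om. indicator A om * ennreal (\<kappa> m (Yd \<sigma> t u om)) \<partial>M) \<longlonglongrightarrow> (\<integral>\<^sup>+om. indicator A om * indicator {..c} (Yd \<sigma> t u om) \<partial>M)"
  proof (rule nn_integral_dominated_convergence[where w="\<lambda>_. 1"])
   show "AE om in M. (\<lambda>m. indicator A om * ennreal (\<kappa> m (Yd \<sigma> t u om))) \<longlonglongrightarrow> indicator A om * indicator {..c} (Yd \<sigma> t u om)"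
    by (intro AE_I2 ennreal_tendsto_cmult lim) (simp split: split_indicator)
  qed (use \<kappa> in \<open>auto split: split_indicator simp: emeasure_space_1\<close>)
  moreover have "(\<lambda>m. \<integral>\<^sup>+om. ennreal (\<kappa> m (Yd \<sigma> t u om)) \<partial>M) \<longlonglongrightarrow> (\<integral>\<^sup>+om. indicator {..c} (Yd \<sigma> t u om) \<partial>M)"
   by (rule nn_integral_dominated_convergence[where w="\<lambda>_. 1"]) (use \<kappa> lim in \<open>auto simp: emeasure_space_1\<close>)
  then have "(\<lambda>m. ennreal (prob A) * (\<integral>\<^sup>+om. ennreal (\<kappa> m (Yd \<sigma> t u om)) \<partial>M)) \<longlonglongrightarrow> ennreal (prob A) * (\<integral>\<^sup>+om. indicator {..c} (Yd \<sigma> t u om) \<partial>M)"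
   by (intro ennreal_tendsto_cmult) auto
  ultimately have "(\<integral>\<^sup>+om. indicator A om * indicator {..c} (Yd \<sigma> t u om) \<partial>M) = ennreal (prob A) * (\<integral>\<^sup>+om. indicator {..c} (Yd \<sigma> t u om) \<partial>M)"
   unfolding cont[OF \<kappa> A] using LIMSEQ_unique by blast
  also have "(\<integral>\<^sup>+om. indicator A om * indicator {..c} (Yd \<sigma> t u om) \<partial>M) = (\<integral>\<^sup>+om. indicator (A \<inter> {om\<in>space M. Yd \<sigma> t u om \<le> c}) om \<partial>M)"
   by (rule nn_integral_cong) (simp split: split_indicator)
  also have "(\<integral>\<^sup>+om. indicator {..c} (Yd \<sigma> t u om) \<partial>M) = (\<integral>\<^sup>+om. indicator {om\<in>space M. Yd \<sigma> t u om \<le> c} om \<partial>M)"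
   by (rule nn_integral_cong) (simp split: split_indicator)
  finally show ?thesis by (simp add: emeasure_eq_measure ennreal_mult[symmetric])
 qed
 let ?G = "range (\<lambda>c. {om\<in>space M. Yd \<sigma> t u om \<le> c})"
 interpret F: sigma_algebra "space M" "Fl t" by (rule Fl_sigma_algebra)
 have "indep_set (Fl t) ?G" unfolding indep_sets2_eq using le Fl_sets by auto
 moreover have "Int_stable (Fl t)" by (auto simp: Int_stable_def)
 moreover have "Int_stable ?G"
 proof (rule Int_stableI)
  fix x y assume "x \<in> ?G" "y \<in> ?G"
  then obtain c c' where "x = {om\<in>space M. Yd \<sigma> t u om \<le> c}" "y = {om\<in>space M. Yd \<sigma> t u om \<le> c'}" by auto
  then have "x \<inter> y = {om\<in>space M. Yd \<sigma> t u om \<le> min c c'}" by auto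
  then show "x \<inter> y \<in> ?G" by blast
 qed
 ultimately have I: "indep_set (sigma_sets (space M) (Fl t)) (sigma_sets (space M) ?G)" by (rule indep_set_sigma_sets)
 have "{om\<in>space M. Yd \<sigma> t u om \<in> C} \<in> sigma_sets (space M) ?G"
 proof -
  define S where "S = sigma (space M) ?G"
  have "?G \<subseteq> Pow (space M)" by auto
  then have S: "sets S = sigma_sets (space M) ?G" "space S = space M" by (auto simp: S_def)
  have "Yd \<sigma> t u \<in> borel_measurable S"
   unfolding borel_measurable_iff_le S by (auto intro!: sigma_sets.Basic)
  then have "{om\<in>space S. Yd \<sigma> t u om \<in> C} \<in> sets S" using C by measurable
  then show ?thesis unfolding S .
 qed
 then show ?thesis using indep_setD[OF I] A by blast
qed

lemma distr_Yd:
 assumes t: "0 \<le> t" "t < u"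
 shows "distr M borel (Yd \<sigma> t u) = distr M borel (\<lambda>om. \<sigma> * w (u - t) om + N (u - t) om)"
proof -
 have w: "distr M borel (\<lambda>om. w u om - w t om) = distr M borel (w (u - t))"
 proof -
  have "distr M lborel (\<lambda>om. w u om - w t om) = distr M lborel (\<lambda>om. w (u - t) om - w 0 om)"
   using distributed_distr_eq_density[OF w_incr[OF t]] distributed_distr_eq_density[OF w_incr[of 0 "u - t"]] t by simp
  also have "\<dots> = distr M lborel (w (u - t))" by (rule distr_cong) (simp_all add: w_0)
  finally show ?thesis by (simp cong: distr_cong)
 qed
 have N: "distr M borel (\<lambda>om. N u om - N t om) = distr M borel (N (u - t))"
 proof (rule measure_eqI)
  fix C assume "C \<in> sets (distr M borel (\<lambda>om. N u om - N t om))"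
  then have C [measurable]: "C \<in> sets borel" by simp
  have "space M \<in> sigma_sets (space M) (GN t)" by (rule sigma_sets_top)
  from N_renewal[OF t this C] have "prob {om\<in>space M. N u om - N t om \<in> C} = prob {om\<in>space M. N (u - t) om \<in> C}"
   by (simp add: prob_space Int_absorb1)
  then show "emeasure (distr M borel (\<lambda>om. N u om - N t om)) C = emeasure (distr M borel (N (u - t))) C"
   by (simp add: emeasure_distr emeasure_eq_measure vimage_def Int_def conj_commute)
 qed simp
 have "distr M (borel \<Otimes>\<^sub>M borel) (\<lambda>om. (w u om - w t om, N u om - N t om)) = distr M (borel \<Otimes>\<^sub>M borel) (\<lambda>om. (w (u - t) om, N (u - t) om))"
 proof -
  have "indep_var borel (\<lambda>om. w u om - w t om) borel (\<lambda>om. N u om - N t om)" "indep_var borel (w (u - t)) borel (N (u - t))"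
   by (rule indep_var_WM_EM; measurable)+
  then show ?thesis unfolding indep_var_distribution_eq w N by simp
 qed
 then have "distr (distr M (borel \<Otimes>\<^sub>M borel) (\<lambda>om. (w u om - w t om, N u om - N t om))) borel (\<lambda>z. \<sigma> * fst z + snd z)
  = distr (distr M (borel \<Otimes>\<^sub>M borel) (\<lambda>om. (w (u - t) om, N (u - t) om))) borel (\<lambda>z. \<sigma> * fst z + snd z)" by simp
 then show ?thesis by (simp add: distr_distr comp_def Yd_def[abs_def])
qed

text \<open>Freezing of the past: the increment is integrated against its law while the past is held
  fixed. The joint law of past and increment is a product measure, which is checked on rectangles by
  \<open>indep_Fl\<close>.\<close>

lemma indep_expectation:
 assumes t: "0 \<le> t" "t < u" and G [measurable]: "G \<in> borel_measurable (Ft t \<Otimes>\<^sub>M borel)"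
  and int: "integrable M (\<lambda>om. G (om, Yd \<sigma> t u om))"
 defines "Z \<equiv> \<lambda>om. \<sigma> * w (u - t) om + N (u - t) om"
 shows "integrable M (\<lambda>om. expectation (\<lambda>om'. G (om, Z om') :: real))"
  "expectation (\<lambda>om. G (om, Yd \<sigma> t u om)) = expectation (\<lambda>om. expectation (\<lambda>om'. G (om, Z om')))"
proof -
 let ?R = "restr_to_subalg M (Ft t)" and ?\<mu> = "distr M borel (Yd \<sigma> t u)"
 interpret R: prob_space ?R
  by (rule prob_spaceI) (simp add: space_restr_to_subalg emeasure_restr_to_subalg[OF Ft_subalgebra] emeasure_space_1
    emeasure_restr_to_subalg[OF Ft_subalgebra, of "space M", simplified] sets.top[of "Ft t", simplified])
 interpret D: prob_space ?\<mu> by (rule prob_space_distr) simp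
 interpret P: pair_sigma_finite ?R ?\<mu> by unfold_locales
 have sR: "sets (?R \<Otimes>\<^sub>M ?\<mu>) = sets (Ft t \<Otimes>\<^sub>M borel)"
  by (intro sets_pair_measure_cong) (simp_all add: sets_restr_to_subalg[OF Ft_subalgebra])
 have m1: "(\<lambda>om. (om, Yd \<sigma> t u om)) \<in> measurable M (Ft t \<Otimes>\<^sub>M borel)"
 proof (rule measurable_Pair)
  show "(\<lambda>om. om) \<in> measurable M (Ft t)" using Fl_sets by (intro measurableI) (auto dest: sets.sets_into_space)
 qed simp
 have eq: "?R \<Otimes>\<^sub>M ?\<mu> = distr M (Ft t \<Otimes>\<^sub>M borel) (\<lambda>om. (om, Yd \<sigma> t u om))"
 proof (rule pair_measure_eqI)
  show "sigma_finite_measure ?R" "sigma_finite_measure ?\<mu>" by unfold_locales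
  show "sets (?R \<Otimes>\<^sub>M ?\<mu>) = sets (distr M (Ft t \<Otimes>\<^sub>M borel) (\<lambda>om. (om, Yd \<sigma> t u om)))" using sR by simp
  fix A C assume AC: "A \<in> sets ?R" "C \<in> sets ?\<mu>"
  then have A: "A \<in> Fl t" and C: "C \<in> sets borel" by (simp_all add: sets_restr_to_subalg[OF Ft_subalgebra])
  have "emeasure (distr M (Ft t \<Otimes>\<^sub>M borel) (\<lambda>om. (om, Yd \<sigma> t u om))) (A \<times> C) = emeasure M ((\<lambda>om. (om, Yd \<sigma> t u om)) -` (A \<times> C) \<inter> space M)"
   using A C by (intro emeasure_distr[OF m1]) (auto intro!: pair_measureI)
  also have "(\<lambda>om. (om, Yd \<sigma> t u om)) -` (A \<times> C) \<inter> space M = A \<inter> {om\<in>space M. Yd \<sigma> t u om \<in> C}" by auto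
  also have "emeasure M \<dots> = emeasure M A * emeasure M {om\<in>space M. Yd \<sigma> t u om \<in> C}"
   by (simp add: emeasure_eq_measure indep_Fl[OF t A C] ennreal_mult)
  also have "emeasure M A = emeasure ?R A" using A by (simp add: emeasure_restr_to_subalg[OF Ft_subalgebra])
  also have "emeasure M {om\<in>space M. Yd \<sigma> t u om \<in> C} = emeasure ?\<mu> C"
   using C by (simp add: emeasure_distr vimage_def Int_def conj_commute)
  finally show "emeasure ?R A * emeasure ?\<mu> C = emeasure (distr M (Ft t \<Otimes>\<^sub>M borel) (\<lambda>om. (om, Yd \<sigma> t u om))) (A \<times> C)" by simp
 qed
 have intP: "integrable (?R \<Otimes>\<^sub>M ?\<mu>) G" unfolding eq by (subst integrable_distr_eq[OF m1 G]) (rule int)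
 have inner: "(\<integral>z. G (om, z) \<partial>?\<mu>) = expectation (\<lambda>om'. G (om, Z om'))" if "om \<in> space M" for om
  unfolding distr_Yd[OF t] Z_def using that by (subst integral_distr) (auto intro!: measurable_Pair2[OF G])
 have io: "integrable ?R (\<lambda>om. \<integral>z. G (om, z) \<partial>?\<mu>)" using P.integrable_fst'[OF intP] .
 have "integrable M (\<lambda>om. \<integral>z. G (om, z) \<partial>?\<mu>)" by (rule integrable_from_subalg[OF Ft_subalgebra io])
 then show "integrable M (\<lambda>om. expectation (\<lambda>om'. G (om, Z om')))" by (simp add: inner cong: Bochner_Integration.integrable_cong)
 have "expectation (\<lambda>om. G (om, Yd \<sigma> t u om)) = (\<integral>z. G z \<partial>(?R \<Otimes>\<^sub>M ?\<mu>))"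
  unfolding eq by (rule integral_distr[OF m1 G, symmetric])
 also have "\<dots> = (\<integral>om. \<integral>z. G (om, z) \<partial>?\<mu> \<partial>?R)" by (rule P.integral_fst'[OF intP, symmetric])
 also have "\<dots> = expectation (\<lambda>om. \<integral>z. G (om, z) \<partial>?\<mu>)"
  by (rule integral_subalgebra2[OF Ft_subalgebra])
    (use borel_measurable_integrable[OF io] in \<open>simp add: measurable_def space_restr_to_subalg sets_restr_to_subalg[OF Ft_subalgebra]\<close>)
 also have "\<dots> = expectation (\<lambda>om. expectation (\<lambda>om'. G (om, Z om')))"
  by (rule Bochner_Integration.integral_cong) (simp_all add: inner)
 finally show "expectation (\<lambda>om. G (om, Yd \<sigma> t u om)) = expectation (\<lambda>om. expectation (\<lambda>om'. G (om, Z om')))" .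
qed

lemma Yd_integrable:
 assumes "0 \<le> t" "t < u" "u \<le> t + 1 / 2"
 shows "integrable M (Yd \<sigma> t u)" "expectation (\<lambda>om. \<bar>Yd \<sigma> t u om\<bar>) \<le> \<bar>\<sigma>\<bar> * sqrt (u - t) + 2 / \<theta> * (u - t)"
proof -
 have "integrable (distr M borel (Yd \<sigma> t u)) (\<lambda>x. x)"
  unfolding distr_Yd[OF assms(1,2)] by (subst integrable_distr_eq) (use Z_integrable[of "u - t" \<sigma>] assms in auto)
 then show "integrable M (Yd \<sigma> t u)" by (subst (asm) integrable_distr_eq) auto
 have "expectation (\<lambda>om. \<bar>Yd \<sigma> t u om\<bar>) = (\<integral>x. \<bar>x\<bar> \<partial>distr M borel (Yd \<sigma> t u))" by (subst integral_distr) auto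
 also have "\<dots> = expectation (\<lambda>om. \<bar>\<sigma> * w (u - t) om + N (u - t) om\<bar>)"
  unfolding distr_Yd[OF assms(1,2)] by (subst integral_distr) auto
 finally show "expectation (\<lambda>om. \<bar>Yd \<sigma> t u om\<bar>) \<le> \<bar>\<sigma>\<bar> * sqrt (u - t) + 2 / \<theta> * (u - t)"
  using Z_abs_bound[of "u - t" \<sigma>] assms by simp
qed

text \<open>Lifts a one-step bound from deterministic starting points in \<open>D\<close> to a
  random starting point known at time \<open>t\<close>, on an event known at time \<open>t\<close>.
  For the lower bound the event is the whole space, for the band policy it says that the path has
  not been stopped yet.\<close>

lemma step_ge:
 fixes v \<psi> :: "real \<Rightarrow> real"
 assumes t: "0 \<le> t" "t < u" "u \<le> t + 1 / 2"
  and X [measurable]: "X \<in> borel_measurable (Ft t)" and A: "A \<in> Fl t"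
  and v: "\<And>x y. \<bar>v x - v y\<bar> \<le> K * \<bar>x - y\<bar>"
  and D: "AE om in M. om \<in> A \<longrightarrow> X om \<in> D" and Kb: "\<And>y. y \<in> D \<Longrightarrow> \<bar>y\<bar> \<le> Kb"
  and \<psi>: "\<And>y. y \<in> D \<Longrightarrow> \<psi> y \<le> expectation (\<lambda>om. v (y + (\<sigma> * w (u - t) om + N (u - t) om)))"
  and i\<psi>: "integrable M (\<lambda>om. indicator A om * \<psi> (X om))"
 shows "integrable M (\<lambda>om. indicator A om * v (X om + Yd \<sigma> t u om))"
  "expectation (\<lambda>om. indicator A om * \<psi> (X om)) \<le> expectation (\<lambda>om. indicator A om * v (X om + Yd \<sigma> t u om))"
proof -
 have K: "0 \<le> K" using v[of 1 0] abs_ge_zero[of "v 1 - v 0"] by simp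
 have vm [measurable]: "v \<in> borel_measurable borel" by (rule lipschitz_borel[OF v])
 have [measurable]: "A \<in> sets M" using A Fl_sets by blast
 have XM [measurable]: "X \<in> borel_measurable M" by (rule measurable_Ft_M[OF X])
 have [measurable]: "(\<lambda>z. indicator A (fst z) :: real) \<in> borel_measurable (Ft t \<Otimes>\<^sub>M borel)"
 proof -
  have "(indicator A :: 'a \<Rightarrow> real) \<in> borel_measurable (Ft t)" using A by (intro borel_measurable_indicator) simp
  then show ?thesis by (rule measurable_compose[OF measurable_fst])
 qed
 define G where "G z = indicator A (fst z) * v (X (fst z) + snd z)" for z :: "'a \<times> real"
 have G: "G \<in> borel_measurable (Ft t \<Otimes>\<^sub>M borel)" unfolding G_def by measurable
 have vb: "\<bar>v (x + z)\<bar> \<le> \<bar>v 0\<bar> + K * (\<bar>x\<bar> + \<bar>z\<bar>)" for x z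
 proof -
  have "\<bar>v (x + z)\<bar> \<le> \<bar>v 0\<bar> + K * \<bar>x + z\<bar>" using v[of "x + z" 0] by simp
  also have "\<dots> \<le> \<bar>v 0\<bar> + K * (\<bar>x\<bar> + \<bar>z\<bar>)" using K by (intro add_left_mono mult_left_mono) auto
  finally show ?thesis .
 qed
 show int: "integrable M (\<lambda>om. indicator A om * v (X om + Yd \<sigma> t u om))"
 proof (rule Bochner_Integration.integrable_bound)
  show "integrable M (\<lambda>om. \<bar>v 0\<bar> + K * (\<bar>Kb\<bar> + \<bar>Yd \<sigma> t u om\<bar>))" using Yd_integrable(1)[OF t] by auto
  show "AE om in M. norm (indicator A om * v (X om + Yd \<sigma> t u om)) \<le> norm (\<bar>v 0\<bar> + K * (\<bar>Kb\<bar> + \<bar>Yd \<sigma> t u om\<bar>))"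
   using D
  proof eventually_elim
   case (elim om)
   show ?case
   proof (cases "om \<in> A")
    case True
    then have "\<bar>X om\<bar> \<le> \<bar>Kb\<bar>" using Kb[of "X om"] elim by auto
    then have "\<bar>v 0\<bar> + K * (\<bar>X om\<bar> + \<bar>Yd \<sigma> t u om\<bar>) \<le> \<bar>v 0\<bar> + K * (\<bar>Kb\<bar> + \<bar>Yd \<sigma> t u om\<bar>)"
     using K by (intro add_left_mono mult_left_mono) auto
    then have "\<bar>v (X om + Yd \<sigma> t u om)\<bar> \<le> \<bar>v 0\<bar> + K * (\<bar>Kb\<bar> + \<bar>Yd \<sigma> t u om\<bar>)"
     using vb[of "X om" "Yd \<sigma> t u om"] by linarith
    then show ?thesis using True K by simp
   next
    case False
    then show ?thesis using K by simp
   qed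
  qed
 qed measurable
 then have intG: "integrable M (\<lambda>om. G (om, Yd \<sigma> t u om))" by (simp add: G_def)
 note I = indep_expectation[OF t(1,2) G intG]
 have "expectation (\<lambda>om. indicator A om * \<psi> (X om)) \<le> expectation (\<lambda>om. expectation (\<lambda>om'. G (om, \<sigma> * w (u - t) om' + N (u - t) om')))"
 proof (rule integral_mono_AE[OF i\<psi> I(1)])
  show "AE om in M. indicator A om * \<psi> (X om) \<le> expectation (\<lambda>om'. G (om, \<sigma> * w (u - t) om' + N (u - t) om'))"
   using D
  proof eventually_elim
   case (elim om)
   then show ?case using \<psi>[of "X om"] by (cases "om \<in> A") (simp_all add: G_def)
  qed
 qed
 then show "expectation (\<lambda>om. indicator A om * \<psi> (X om)) \<le> expectation (\<lambda>om. indicator A om * v (X om + Yd \<sigma> t u om))"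
  unfolding I(2)[symmetric] by (simp add: G_def)
qed

end

section \<open>Controlled paths and their cost\<close>

definition rcont :: "(real \<Rightarrow> real) \<Rightarrow> bool" where
 "rcont g \<longleftrightarrow> (\<forall>t\<ge>0. continuous (at t within {t..}) g)"

lemma rcont_seq: "rcont g \<Longrightarrow> 0 \<le> t \<Longrightarrow> X \<longlonglongrightarrow> t \<Longrightarrow> (\<And>i. t \<le> X i) \<Longrightarrow> (\<lambda>i. g (X i)) \<longlonglongrightarrow> g t"
 unfolding rcont_def continuous_within_sequentially by (auto simp: comp_def)

lemma finite_right_const:
 fixes a :: "nat \<Rightarrow> ennreal"
 assumes t: "0 \<le> t" and fin: "finite {n. a n \<le> ennreal (t + 1)}"
 shows "\<exists>r>t. \<forall>s. t \<le> s \<and> s < r \<longrightarrow> {n. a n \<le> ennreal s} = {n. a n \<le> ennreal t}"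
proof -
 define S where "S = (\<lambda>n. enn2real (a n)) ` {n. a n \<le> ennreal (t + 1) \<and> \<not> a n \<le> ennreal t}"
 have fS: "finite S" unfolding S_def using fin by (intro finite_imageI) (rule rev_finite_subset, auto)
 define r where "r = Min (insert (t + 1) S)"
 have gt: "t < x" if x: "x \<in> S" for x
 proof -
  obtain n where n: "x = enn2real (a n)" "a n \<le> ennreal (t + 1)" "\<not> a n \<le> ennreal t" using x unfolding S_def by blast
  then have "a n < \<top>" by (auto intro: le_less_trans)
  then have "a n = ennreal x" using n(1) by simp
  then show ?thesis using n(3) t by (metis ennreal_leI not_le)
 qed
 have r: "t < r" unfolding r_def using fS gt by (subst Min_gr_iff) auto
 have le: "r \<le> t + 1" "\<And>x. x \<in> S \<Longrightarrow> r \<le> x" unfolding r_def using fS by auto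
 have "{n. a n \<le> ennreal s} = {n. a n \<le> ennreal t}" if s: "t \<le> s" "s < r" for s
 proof (intro set_eqI iffI CollectI; drule CollectD)
  fix n assume "a n \<le> ennreal t"
  then show "a n \<le> ennreal s" using s by (meson ennreal_leI order_trans)
 next
  fix n assume a: "a n \<le> ennreal s"
  show "a n \<le> ennreal t"
  proof (rule ccontr)
   assume n: "\<not> a n \<le> ennreal t"
   have "a n \<le> ennreal (t + 1)" using a s le(1) by (meson ennreal_leI less_imp_le order_trans)
   then have "enn2real (a n) \<in> S" using n unfolding S_def by blast
   then have "r \<le> enn2real (a n)" by (rule le(2))
   moreover have "enn2real (a n) \<le> s" using a s t by (intro enn2real_leI) auto
   ultimately show False using s by simp
  qed
 qed
 then show ?thesis using r by blast
qed

text \<open>Rounding up to the grid of mesh \<open>ep\<close>. The upward direction suits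
  right-continuous paths, and a stopping time rounded up is known at its grid value.\<close>

definition cl :: "real \<Rightarrow> real \<Rightarrow> real" where
 "cl ep s = ep * real_of_int \<lceil>s / ep\<rceil>"

lemma cl_ge: "0 < ep \<Longrightarrow> s \<le> cl ep s" and cl_less: "0 < ep \<Longrightarrow> cl ep s < s + ep"
proof -
 assume e: "0 < ep"
 have c: "s / ep \<le> real_of_int \<lceil>s / ep\<rceil>" "real_of_int \<lceil>s / ep\<rceil> < s / ep + 1" by linarith+
 have "ep * (s / ep) \<le> ep * real_of_int \<lceil>s / ep\<rceil>" using c(1) e by (intro mult_left_mono) auto
 then show "s \<le> cl ep s" using e by (simp add: cl_def)
 have "ep * real_of_int \<lceil>s / ep\<rceil> < ep * (s / ep + 1)" using c(2) e by (intro mult_strict_left_mono) auto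
 then show "cl ep s < s + ep" using e by (simp add: cl_def distrib_left)
qed

lemma cl_tendsto: "(\<And>m. 0 < ep m) \<Longrightarrow> ep \<longlonglongrightarrow> 0 \<Longrightarrow> (\<lambda>m. cl (ep m) s) \<longlonglongrightarrow> s"
proof -
 assume e: "\<And>m. 0 < ep m" "ep \<longlonglongrightarrow> 0"
 have "(\<lambda>m. s + ep m) \<longlonglongrightarrow> s + 0" by (intro tendsto_intros e)
 then have lim: "(\<lambda>m. s + ep m) \<longlonglongrightarrow> s" by simp
 have lo: "eventually (\<lambda>m. s \<le> cl (ep m) s) sequentially" by (rule always_eventually) (simp add: cl_ge e)
 have up: "eventually (\<lambda>m. cl (ep m) s \<le> s + ep m) sequentially"
  by (rule always_eventually) (simp add: less_imp_le cl_less e)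
 show ?thesis by (rule tendsto_sandwich[OF lo up tendsto_const lim])
qed

text \<open>After rounding only countably many times occur, so measurability at each grid time gives
  joint measurability; the maximum with 0 discards negative times.\<close>

lemma cl_compose_measurable:
 assumes g: "\<And>t. 0 \<le> t \<Longrightarrow> g t \<in> borel_measurable M"
 shows "(\<lambda>(t, om). g (max 0 (cl ep t)) om :: real) \<in> borel_measurable (lborel \<Otimes>\<^sub>M M)"
proof -
 have "(\<lambda>z. (\<lambda>k z. g (max 0 (ep * real_of_int k)) (snd z)) \<lceil>fst z / ep\<rceil> z) \<in> borel_measurable (lborel \<Otimes>\<^sub>M M)"
 proof (rule measurable_compose_countable)
  fix k :: int
  have "g (max 0 (ep * real_of_int k)) \<in> borel_measurable M" by (rule g) simp
  then show "(\<lambda>z. g (max 0 (ep * real_of_int k)) (snd z)) \<in> borel_measurable (lborel \<Otimes>\<^sub>M M)"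
   by (rule measurable_compose[OF measurable_snd])
 qed measurable
 then show ?thesis by (simp add: cl_def split_beta')
qed

lemma cl_measurable [measurable]: "(\<lambda>t. g (cl ep t) :: real) \<in> borel_measurable borel"
proof -
 have "(\<lambda>t. (\<lambda>k t. g (ep * real_of_int k)) \<lceil>t / ep\<rceil> t) \<in> borel_measurable borel"
  by (rule measurable_compose_countable) measurable
 then show ?thesis by (simp add: cl_def)
qed

text \<open>\<open>cl\<close> rounds up, so the integral of the rounded integrand is a Riemann sum
  with right endpoints.\<close>

lemma cl_step_integral:
 assumes e: "0 < ep"
 shows "(\<integral>\<^sup>+t. indicator {0<..real n * ep} t * ennreal (g (cl ep t)) \<partial>lborel) = (\<Sum>j<n. ennreal ep * ennreal (g (real (Suc j) * ep)))"
proof (induction n)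
 case 0 show ?case by simp
next
 case (Suc n)
 have split: "indicator {0<..real (Suc n) * ep} t = indicator {0<..real n * ep} t + (indicator {real n * ep<..real (Suc n) * ep} t :: ennreal)" for t
 proof -
  have "0 \<le> real n * ep" "real n * ep \<le> real (Suc n) * ep" using e by simp_all
  then show ?thesis by (auto split: split_indicator)
 qed
 have const: "cl ep t = real (Suc n) * ep" if "t \<in> {real n * ep<..real (Suc n) * ep}" for t
 proof -
  have "\<lceil>t / ep\<rceil> = int n + 1"
   by (rule ceiling_unique) (use that e in \<open>auto simp: field_simps\<close>)
  then show ?thesis by (simp add: cl_def algebra_simps)
 qed
 have "(\<integral>\<^sup>+t. indicator {0<..real (Suc n) * ep} t * ennreal (g (cl ep t)) \<partial>lborel)
  = (\<integral>\<^sup>+t. indicator {0<..real n * ep} t * ennreal (g (cl ep t)) + indicator {real n * ep<..real (Suc n) * ep} t * ennreal (g (real (Suc n) * ep)) \<partial>lborel)"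
 proof (rule nn_integral_cong)
  fix t
  show "indicator {0<..real (Suc n) * ep} t * ennreal (g (cl ep t)) = indicator {0<..real n * ep} t * ennreal (g (cl ep t)) + indicator {real n * ep<..real (Suc n) * ep} t * ennreal (g (real (Suc n) * ep))"
   unfolding split distrib_right using const[of t] by (cases "t \<in> {real n * ep<..real (Suc n) * ep}") auto
 qed
 also have "\<dots> = (\<integral>\<^sup>+t. indicator {0<..real n * ep} t * ennreal (g (cl ep t)) \<partial>lborel) + (\<integral>\<^sup>+t. indicator {real n * ep<..real (Suc n) * ep} t * ennreal (g (real (Suc n) * ep)) \<partial>lborel)"
  by (rule nn_integral_add) measurable
 also have "(\<integral>\<^sup>+t. indicator {real n * ep<..real (Suc n) * ep} t * ennreal (g (real (Suc n) * ep)) \<partial>lborel) = ennreal ep * ennreal (g (real (Suc n) * ep))"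
 proof -
  have "emeasure lborel {real n * ep<..real (Suc n) * ep} = ennreal ep" using e by (simp add: algebra_simps)
  then show ?thesis by (subst nn_integral_multc) simp_all
 qed
 finally show ?case using Suc by simp
qed

lemma downward_finite_eq_lessThan:
 assumes "finite (A :: nat set)" "\<And>i j. i \<le> j \<Longrightarrow> j \<in> A \<Longrightarrow> i \<in> A"
 shows "A = {..<card A}"
proof (cases "A = {}")
 case False
 define m where "m = Max A"
 have "A = {..m}"
 proof (intro set_eqI iffI)
  fix i assume "i \<in> A" then show "i \<in> {..m}" using assms(1) by (simp add: m_def)
 next
  fix i assume "i \<in> {..m}"
  moreover have "m \<in> A" unfolding m_def using assms(1) False by (rule Max_in)
  ultimately show "i \<in> A" using assms(2)[of i m] by simp
 qed
 then show ?thesis by (simp add: lessThan_Suc_atMost)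
qed simp

section \<open>Measurability of controlled paths and of their cost\<close>

locale cnoise = noise +
 assumes complete: "complete_space_measure M"
begin

lemma completeD: "Z \<in> null_sets M \<Longrightarrow> B \<subseteq> Z \<Longrightarrow> B \<in> sets M"
 using complete unfolding complete_space_measure_def by simp

text \<open>The preimages under \<open>f\<close> and \<open>g\<close> differ by a subset of a null
  set. Completeness makes this difference measurable, and augmentation then puts the preimage under
  \<open>g\<close> into \<open>Fl t\<close>.\<close>

lemma AE_measurable_Ft:
 assumes f: "f \<in> measurable (Ft t) S" and eq: "AE om in M. f om = g om" and g: "\<And>om. om \<in> space M \<Longrightarrow> g om \<in> space S"
 shows "g \<in> measurable (Ft t) S"
proof (rule measurableI)
 fix B assume B: "B \<in> sets S"
 obtain Z where Z: "{om \<in> space M. \<not> f om = g om} \<subseteq> Z" "emeasure M Z = 0" "Z \<in> sets M" using eq by (rule AE_E)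
 then have Zn: "Z \<in> null_sets M" by (intro null_setsI)
 have fB: "f -` B \<inter> space M \<in> Fl t" using measurable_sets[OF f B] by simp
 then have fBM: "f -` B \<inter> space M \<in> sets M" using Fl_sets by blast
 have eq: "g -` B \<inter> space M = (f -` B \<inter> space M - Z) \<union> (g -` B \<inter> space M \<inter> Z)" using Z(1) by auto
 have "g -` B \<inter> space M \<inter> Z \<in> sets M" by (rule completeD[OF Zn]) simp
 then have gM: "g -` B \<inter> space M \<in> sets M" by (subst eq) (rule sets.Un[OF sets.Diff[OF fBM Z(3)]])
 have "g -` B \<inter> space M \<in> Fl t"
 proof (rule Fl_null[OF gM fB])
  have sub: "(g -` B \<inter> space M - f -` B \<inter> space M) \<union> (f -` B \<inter> space M - g -` B \<inter> space M) \<subseteq> Z" using Z(1) by auto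
  show "(g -` B \<inter> space M - f -` B \<inter> space M) \<union> (f -` B \<inter> space M - g -` B \<inter> space M) \<in> null_sets M"
   by (rule null_sets_subset[OF Zn sets.Un[OF sets.Diff[OF gM fBM] sets.Diff[OF fBM gM]] sub])
 qed
 then show "g -` B \<inter> space (Ft t) \<in> sets (Ft t)" by simp
qed (use g in simp)

lemma AE_measurable_M:
 assumes f: "f \<in> measurable M S" and eq: "AE om in M. f om = g om" and g: "\<And>om. om \<in> space M \<Longrightarrow> g om \<in> space S"
 shows "g \<in> measurable M S"
proof (rule measurableI)
 fix B assume B: "B \<in> sets S"
 obtain Z where Z: "{om \<in> space M. \<not> f om = g om} \<subseteq> Z" "emeasure M Z = 0" "Z \<in> sets M" using eq by (rule AE_E)
 have eq: "g -` B \<inter> space M = (f -` B \<inter> space M - Z) \<union> (g -` B \<inter> space M \<inter> Z)" using Z(1) by auto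
 have "g -` B \<inter> space M \<inter> Z \<in> sets M" by (rule completeD[OF null_setsI[OF Z(2,3)]]) simp
 then show "g -` B \<inter> space M \<in> sets M" by (subst eq) (rule sets.Un[OF sets.Diff[OF measurable_sets[OF f B] Z(3)]])
qed (use g in simp)

definition Yp :: "real \<Rightarrow> real \<Rightarrow> real \<Rightarrow> 'a \<Rightarrow> real" where
 "Yp \<sigma> x t om = x + \<sigma> * w t om + N t om"

lemma Yp_Ft: "0 \<le> s \<Longrightarrow> s \<le> t \<Longrightarrow> Yp \<sigma> x s \<in> borel_measurable (Ft t)"
 unfolding Yp_def[abs_def] by measurable

lemma Yp_measurable [measurable]: "Yp \<sigma> x s \<in> borel_measurable M"
 unfolding Yp_def[abs_def] by measurable

lemma Yp_rcont: "good om \<Longrightarrow> rcont (\<lambda>t. Yp \<sigma> x t om)"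
 unfolding rcont_def continuous_within_sequentially comp_def Yp_def
 by (intro allI impI tendsto_intros w_tendsto N_right_tendsto) (auto simp: good_def intro: order_trans)

lemma Yd_Yp: "Yp \<sigma> x u om = Yp \<sigma> x t om + Yd \<sigma> t u om"
 by (simp add: Yp_def Yd_def algebra_simps)

lemma Yp_0: "good om \<Longrightarrow> Yp \<sigma> x 0 om = x"
 by (simp add: Yp_def N_0 w_0 good_def)

text \<open>A right-continuous process is the limit of its roundings, which are jointly measurable.
  The limit \<open>P\<close> agrees with the process at all times on almost every path, which is
  enough for Fubini.\<close>

lemma running_measurable:
 assumes \<psi>: "\<And>t. 0 \<le> t \<Longrightarrow> \<psi> t \<in> borel_measurable M" and rc: "AE om in M. rcont (\<lambda>t. \<psi> t om)"
 obtains P where "(\<lambda>(t, om). P t om :: real) \<in> borel_measurable (lborel \<Otimes>\<^sub>M M)" "AE om in M. \<forall>t\<ge>0. P t om = \<psi> t om"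
proof -
 define P where "P t om = lim (\<lambda>m. \<psi> (max 0 (cl (1 / real (Suc m)) t)) om)" for t om
 have m: "(\<lambda>(t, om). \<psi> (max 0 (cl (1 / real (Suc m)) t)) om) \<in> borel_measurable (lborel \<Otimes>\<^sub>M M)" for m
  by (rule cl_compose_measurable[OF \<psi>])
 have "(\<lambda>z. lim (\<lambda>m. (\<lambda>(t, om). \<psi> (max 0 (cl (1 / real (Suc m)) t)) om) z)) \<in> borel_measurable (lborel \<Otimes>\<^sub>M M)"
  by (rule borel_measurable_lim_metric[OF m])
 then have "(\<lambda>(t, om). P t om) \<in> borel_measurable (lborel \<Otimes>\<^sub>M M)" by (simp add: P_def split_beta')
 moreover have "AE om in M. \<forall>t\<ge>0. P t om = \<psi> t om"
  using rc
 proof (eventually_elim, intro allI impI)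
  fix om t assume rc: "rcont (\<lambda>t. \<psi> t om)" and t: "0 \<le> (t::real)"
  have ge: "t \<le> cl (1 / real (Suc m)) t" for m by (rule cl_ge) simp
  have "(\<lambda>m. cl (1 / real (Suc m)) t) \<longlonglongrightarrow> t"
   by (rule cl_tendsto) (use LIMSEQ_Suc[OF lim_const_over_n[of 1]] in auto)
  then have "(\<lambda>m. \<psi> (cl (1 / real (Suc m)) t) om) \<longlonglongrightarrow> \<psi> t om" using rcont_seq[OF rc t] ge by blast
  moreover have "max 0 (cl (1 / real (Suc m)) t) = cl (1 / real (Suc m)) t" for m using ge[of m] t by linarith
  ultimately show "P t om = \<psi> t om" unfolding P_def by (auto intro!: limI)
 qed
 ultimately show thesis by (rule that)
qed

definition csum :: "(nat \<Rightarrow> 'a \<Rightarrow> ennreal) \<Rightarrow> (nat \<Rightarrow> 'a \<Rightarrow> real) \<Rightarrow> real \<Rightarrow> 'a \<Rightarrow> real" where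
 "csum \<tau> \<xi> t om = (\<Sum>n\<in>{n. \<tau> n om \<le> ennreal t}. \<xi> n om)"

text \<open>The part of the definition of an impulse control that fixes index sets: at each time the
  interventions made so far form a finite initial segment.\<close>

definition cgood :: "(nat \<Rightarrow> 'a \<Rightarrow> ennreal) \<Rightarrow> 'a \<Rightarrow> bool" where
 "cgood \<tau> om \<longleftrightarrow> (\<forall>n. \<tau> n om \<le> \<tau> (Suc n) om) \<and> (\<forall>t. finite {n. \<tau> n om \<le> ennreal t})"

lemma ctrl_X_csum: "ctrl_X (Yp \<sigma> x) \<tau> \<xi> t om = Yp \<sigma> x t om + csum \<tau> \<xi> t om"
 by (simp add: ctrl_X_def csum_def)

lemma AE_cgood: "impulse_control M (filt M w N) \<tau> \<xi> \<Longrightarrow> AE om in M. cgood \<tau> om"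
 unfolding impulse_control_def cgood_def by (elim conjE) (erule eventually_mono, blast)

lemma cgood_lessThan:
 assumes "cgood \<tau> om"
 obtains m where "\<And>t. {n. \<tau> n om \<le> ennreal t} = {..<m t}"
proof (rule that)
 have mono: "i \<le> j \<Longrightarrow> \<tau> i om \<le> \<tau> j om" for i j
  using assms lift_Suc_mono_le[of "\<lambda>n. \<tau> n om"] by (auto simp: cgood_def)
 show "{n. \<tau> n om \<le> ennreal t} = {..<card {n. \<tau> n om \<le> ennreal t}}" for t
 proof (rule downward_finite_eq_lessThan)
  show "finite {n. \<tau> n om \<le> ennreal t}" using assms by (simp add: cgood_def)
  show "i \<in> {n. \<tau> n om \<le> ennreal t}" if "i \<le> j" "j \<in> {n. \<tau> n om \<le> ennreal t}" for i j
   using mono[OF that(1)] that(2) by (auto intro: order_trans)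
 qed
qed

lemma stopped_trunc_Ft:
 assumes "is_stopping_time M (filt M w N) T" "\<And>B. B \<in> sets borel \<Longrightarrow> {om\<in>space M. Z om \<in> B} \<in> stopped_sets M (filt M w N) T" "0 \<le> t"
 shows "(\<lambda>om. if T om \<le> ennreal t then Z om else 0 :: real) \<in> borel_measurable (Ft t)"
proof (rule measurableI)
 fix B :: "real set" assume B: "B \<in> sets borel"
 interpret F: sigma_algebra "space M" "Fl t" by (rule Fl_sigma_algebra)
 let ?T = "{om\<in>space M. T om \<le> ennreal t}"
 have 1: "?T \<in> Fl t" using assms by (auto simp: is_stopping_time_def)
 have 2: "{om\<in>space M. Z om \<in> B} \<inter> ?T \<in> Fl t" using assms(2)[OF B] assms(3) by (auto simp: stopped_sets_def)
 have "(\<lambda>om. if T om \<le> ennreal t then Z om else 0) -` B \<inter> space M = ({om\<in>space M. Z om \<in> B} \<inter> ?T) \<union> (if 0 \<in> B then space M - ?T else {})"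
  by (auto split: if_splits)
 also have "\<dots> \<in> Fl t" using 1 2 by (intro F.Un) auto
 finally show "(\<lambda>om. if T om \<le> ennreal t then Z om else 0) -` B \<inter> space (Ft t) \<in> sets (Ft t)" by simp
qed simp

text \<open>Each summand is known at time \<open>t\<close> because the impulse is known at its
  intervention time. The random number of summands is handled by partial sums that are eventually
  constant on almost every path.\<close>

lemma csum_Ft:
 assumes imp: "impulse_control M (filt M w N) \<tau> \<xi>" and t: "0 \<le> t"
 shows "csum \<tau> \<xi> t \<in> borel_measurable (Ft t)"
proof (rule AE_measurable_Ft)
 let ?p = "\<lambda>m om. \<Sum>n<m. if \<tau> n om \<le> ennreal t then \<xi> n om else 0"
 have "(\<lambda>om. if \<tau> n om \<le> ennreal t then \<xi> n om else 0) \<in> borel_measurable (Ft t)" for n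
  using imp t by (intro stopped_trunc_Ft) (auto simp: impulse_control_def)
 then have "?p m \<in> borel_measurable (Ft t)" for m by (intro borel_measurable_sum)
 then show "(\<lambda>om. lim (\<lambda>m. ?p m om)) \<in> borel_measurable (Ft t)" by (rule borel_measurable_lim_metric)
 show "AE om in M. lim (\<lambda>m. ?p m om) = csum \<tau> \<xi> t om"
  using AE_cgood[OF imp]
 proof eventually_elim
  case (elim om)
  obtain k where k: "\<And>t. {n. \<tau> n om \<le> ennreal t} = {..<k t}" using cgood_lessThan[OF elim] by blast
  have "?p m om = csum \<tau> \<xi> t om" if m: "m \<ge> k t" for m
  proof -
   have "n < m" if "\<tau> n om \<le> ennreal t" for n
   proof -
    have "n \<in> {n. \<tau> n om \<le> ennreal t}" using that by (rule CollectI)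
    then have "n \<in> {..<k t}" by (subst k[symmetric])
    then show ?thesis using m by simp
   qed
   then have "{n \<in> {..<m}. \<tau> n om \<le> ennreal t} = {n. \<tau> n om \<le> ennreal t}" by blast
   then show ?thesis unfolding csum_def by (simp only: sum.inter_filter[OF finite_lessThan, symmetric])
  qed
  then have "eventually (\<lambda>m. ?p m om = csum \<tau> \<xi> t om) sequentially" unfolding eventually_sequentially by blast
  then show ?case by (intro limI tendsto_eventually)
 qed
qed simp

lemma ctrl_X_Ft:
 assumes "impulse_control M (filt M w N) \<tau> \<xi>" "0 \<le> t"
 shows "ctrl_X (Yp \<sigma> x) \<tau> \<xi> t \<in> borel_measurable (Ft t)"
proof -
 note [measurable] = csum_Ft[OF assms] Yp_Ft[OF assms(2) order_refl, of \<sigma> x]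
 show ?thesis unfolding ctrl_X_csum[abs_def] by measurable
qed

lemma csum_rcont: "cgood \<tau> om \<Longrightarrow> rcont (\<lambda>t. csum \<tau> \<xi> t om)"
 unfolding rcont_def continuous_within_sequentially comp_def
proof (intro allI impI)
 fix t :: real and X assume c: "cgood \<tau> om" and t: "0 \<le> t" and X: "(\<forall>n. X n \<in> {t..}) \<and> X \<longlonglongrightarrow> t"
 obtain r where r: "r > t" "\<forall>s. t \<le> s \<and> s < r \<longrightarrow> {n. \<tau> n om \<le> ennreal s} = {n. \<tau> n om \<le> ennreal t}"
  using finite_right_const[OF t, of "\<lambda>n. \<tau> n om"] c unfolding cgood_def by blast
 have "eventually (\<lambda>i. X i < r) sequentially" using conjunct2[OF X] r(1) by (rule order_tendstoD)
 then have "eventually (\<lambda>i. csum \<tau> \<xi> (X i) om = csum \<tau> \<xi> t om) sequentially"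
 proof eventually_elim
  case (elim i)
  then have "{n. \<tau> n om \<le> ennreal (X i)} = {n. \<tau> n om \<le> ennreal t}" using r(2)[rule_format, of "X i"] X by simp
  then show ?case by (simp add: csum_def)
 qed
 then show "(\<lambda>i. csum \<tau> \<xi> (X i) om) \<longlonglongrightarrow> csum \<tau> \<xi> t om" by (rule tendsto_eventually)
qed

lemma ctrl_X_rcont: "good om \<Longrightarrow> cgood \<tau> om \<Longrightarrow> rcont (\<lambda>t. ctrl_X (Yp \<sigma> x) \<tau> \<xi> t om)"
 using Yp_rcont[of om \<sigma> x] csum_rcont[of \<tau> om \<xi>] unfolding ctrl_X_csum rcont_def by (auto intro!: continuous_add)

lemma rcont_discounted: "rcont g \<Longrightarrow> rcont (\<lambda>t. exp (- lam * t) * (g t - \<rho>)\<^sup>2)"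
 unfolding rcont_def by (auto intro!: continuous_intros)

lemma stopping_measurable:
 assumes "is_stopping_time M (filt M w N) T" shows "T \<in> borel_measurable M"
proof (rule borel_measurableI_le)
 fix y :: ennreal
 show "{x \<in> space M. T x \<le> y} \<in> sets M"
 proof (cases y)
  case (real r)
  then have "{x \<in> space M. T x \<le> y} \<in> Fl r" using assms by (simp add: is_stopping_time_def)
  then show ?thesis by (rule subsetD[OF Fl_sets])
 qed simp
qed

lemma xi_measurable:
 assumes "impulse_control M (filt M w N) \<tau> \<xi>" shows "\<xi> n \<in> borel_measurable M"
proof (rule measurableI)
 fix B :: "real set" assume "B \<in> sets borel"
 then have "{om\<in>space M. \<xi> n om \<in> B} \<in> stopped_sets M (filt M w N) (\<tau> n)" using assms by (simp add: impulse_control_def)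
 then have "{om\<in>space M. \<xi> n om \<in> B} \<in> sets M" by (simp add: stopped_sets_def)
 then show "\<xi> n -` B \<inter> space M \<in> sets M" by (simp add: vimage_def Int_def conj_commute)
qed simp

lemma imp_cost_measurable [measurable]: "imp_cost C c D d \<in> borel_measurable borel"
 unfolding imp_cost_def[abs_def] by measurable

lemma imp_cost_nonneg: "0 \<le> C \<Longrightarrow> 0 \<le> D \<Longrightarrow> 0 \<le> c \<Longrightarrow> 0 \<le> d \<Longrightarrow> 0 \<le> imp_cost C c D d x"
 by (auto simp: imp_cost_def mult_nonneg_nonpos2 intro!: add_nonneg_nonneg) (simp add: mult_nonneg_nonpos order_trans[of _ 0])

definition gcost :: "real \<Rightarrow> (real \<Rightarrow> real) \<Rightarrow> (nat \<Rightarrow> 'a \<Rightarrow> ennreal) \<Rightarrow> (nat \<Rightarrow> 'a \<Rightarrow> real) \<Rightarrow> 'a \<Rightarrow> ennreal" where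
 "gcost lam g \<tau> \<xi> om = (\<Sum>n. if \<tau> n om = \<top> then 0 else ennreal (exp (- lam * enn2real (\<tau> n om)) * g (\<xi> n om)))"

definition rcost :: "real \<Rightarrow> real \<Rightarrow> (real \<Rightarrow> 'a \<Rightarrow> real) \<Rightarrow> 'a \<Rightarrow> ennreal" where
 "rcost lam \<rho> X om = (\<integral>\<^sup>+ t. indicator {0..} t * ennreal (exp (- lam * t) * (X t om - \<rho>)\<^sup>2) \<partial>lborel)"

lemma gcost_measurable:
 assumes imp: "impulse_control M (filt M w N) \<tau> \<xi>" and [measurable]: "g \<in> borel_measurable borel"
 shows "gcost lam g \<tau> \<xi> \<in> borel_measurable M"
proof -
 have [measurable]: "\<tau> n \<in> borel_measurable M" for n using imp by (intro stopping_measurable) (auto simp: impulse_control_def)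
 have [measurable]: "\<xi> n \<in> borel_measurable M" for n by (rule xi_measurable[OF imp])
 show ?thesis unfolding gcost_def[abs_def] by measurable
qed

lemma rcost_representation:
 assumes imp: "impulse_control M (filt M w N) \<tau> \<xi>"
 obtains P where "(\<lambda>(t, om). P t om :: real) \<in> borel_measurable (lborel \<Otimes>\<^sub>M M)"
  "AE om in M. \<forall>t\<ge>0. P t om = exp (- lam * t) * (ctrl_X (Yp \<sigma> x) \<tau> \<xi> t om - \<rho>)\<^sup>2"
proof -
 have 1: "(\<lambda>om. exp (- lam * t) * (ctrl_X (Yp \<sigma> x) \<tau> \<xi> t om - \<rho>)\<^sup>2) \<in> borel_measurable M" if "0 \<le> t" for t
 proof -
  have [measurable]: "ctrl_X (Yp \<sigma> x) \<tau> \<xi> t \<in> borel_measurable M" by (rule measurable_Ft_M[OF ctrl_X_Ft[OF imp that]])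
  show ?thesis by measurable
 qed
 have 2: "AE om in M. rcont (\<lambda>t. exp (- lam * t) * (ctrl_X (Yp \<sigma> x) \<tau> \<xi> t om - \<rho>)\<^sup>2)"
  using AE_good AE_cgood[OF imp] by eventually_elim (intro rcont_discounted ctrl_X_rcont)
 from 1 2 show thesis
  by (rule running_measurable[where \<psi>="\<lambda>t om. exp (- lam * t) * (ctrl_X (Yp \<sigma> x) \<tau> \<xi> t om - \<rho>)\<^sup>2"]) (assumption, rule that)
qed

lemma rcost_measurable:
 assumes imp: "impulse_control M (filt M w N) \<tau> \<xi>"
 shows "rcost lam \<rho> (ctrl_X (Yp \<sigma> x) \<tau> \<xi>) \<in> borel_measurable M"
proof -
 obtain P where [measurable]: "(\<lambda>(t, om). P t om :: real) \<in> borel_measurable (lborel \<Otimes>\<^sub>M M)"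
  and P: "AE om in M. \<forall>t\<ge>0. P t om = exp (- lam * t) * (ctrl_X (Yp \<sigma> x) \<tau> \<xi> t om - \<rho>)\<^sup>2"
  using rcost_representation[OF imp] by blast
 have "(\<lambda>om. \<integral>\<^sup>+ t. indicator {0..} t * ennreal (P t om) \<partial>lborel) \<in> borel_measurable M"
 proof -
  have "(\<lambda>(om, t). indicator {0..} t * ennreal ((\<lambda>(t, om). P t om) (t, om))) \<in> borel_measurable (M \<Otimes>\<^sub>M lborel)" by measurable
  then have m: "(\<lambda>(om, t). indicator {0..} t * ennreal (P t om)) \<in> borel_measurable (M \<Otimes>\<^sub>M lborel)" by simp
  show ?thesis by (rule sigma_finite_measure.borel_measurable_nn_integral[OF sigma_finite_lborel m])
 qed
 then show ?thesis
 proof (rule AE_measurable_M)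
  show "AE om in M. (\<integral>\<^sup>+ t. indicator {0..} t * ennreal (P t om) \<partial>lborel) = rcost lam \<rho> (ctrl_X (Yp \<sigma> x) \<tau> \<xi>) om"
   using P
  proof eventually_elim
   case (elim om)
   then show ?case unfolding rcost_def by (intro nn_integral_cong) (auto split: split_indicator)
  qed
 qed simp
qed

lemma cost_eq:
 assumes imp: "impulse_control M (filt M w N) \<tau> \<xi>" and [measurable]: "g \<in> borel_measurable borel"
 shows "cost M lam \<rho> g (Yp \<sigma> x) \<tau> \<xi> = (\<integral>\<^sup>+om. rcost lam \<rho> (ctrl_X (Yp \<sigma> x) \<tau> \<xi>) om \<partial>M) + (\<integral>\<^sup>+om. gcost lam g \<tau> \<xi> om \<partial>M)"
 unfolding cost_def rcost_def[symmetric] gcost_def[symmetric]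
 by (rule nn_integral_add[OF rcost_measurable[OF imp] gcost_measurable[OF imp assms(2)]])

lemma partial_gcost_le:
 assumes c: "cgood \<tau> om" and g: "\<And>x. 0 \<le> g x"
 shows "ennreal (\<Sum>n\<in>{n. \<tau> n om \<le> ennreal t}. exp (- lam * enn2real (\<tau> n om)) * g (\<xi> n om)) \<le> gcost lam g \<tau> \<xi> om"
proof -
 let ?A = "{n. \<tau> n om \<le> ennreal t}"
 let ?a = "\<lambda>n. if \<tau> n om = \<top> then 0 else ennreal (exp (- lam * enn2real (\<tau> n om)) * g (\<xi> n om))"
 have fin: "finite ?A" using c by (simp add: cgood_def)
 have "ennreal (\<Sum>n\<in>?A. exp (- lam * enn2real (\<tau> n om)) * g (\<xi> n om)) = (\<Sum>n\<in>?A. ennreal (exp (- lam * enn2real (\<tau> n om)) * g (\<xi> n om)))"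
  by (rule sum_ennreal[symmetric]) (simp add: g)
 also have "\<dots> = (\<Sum>n\<in>?A. ?a n)" by (rule sum.cong) (auto simp: top_unique)
 also have "\<dots> \<le> (\<Sum>n. ?a n)" by (rule sum_le_suminf) (auto intro: fin)
 finally show ?thesis by (simp add: gcost_def)
qed

end

section \<open>Lower bound for admissible controls\<close>

locale impulse_problem = cnoise M \<theta> w E J + band_equations \<sigma> \<theta> lam \<rho> C D c d L1 L2 L3 a \<alpha> \<beta> b c1 c2 c3 f h
 for M :: "'a measure" and \<theta> :: real and w :: "real \<Rightarrow> 'a \<Rightarrow> real" and E J :: "nat \<Rightarrow> 'a \<Rightarrow> real"
  and \<sigma> lam \<rho> C D c d L1 L2 L3 a \<alpha> \<beta> b c1 c2 c3 :: real and f h :: "real \<Rightarrow> real"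
begin

abbreviation g where "g \<equiv> imp_cost C c D d"

lemma g_nonneg: "0 \<le> g z"
 using CD by (intro imp_cost_nonneg) auto

definition GT :: "(nat \<Rightarrow> 'a \<Rightarrow> ennreal) \<Rightarrow> (nat \<Rightarrow> 'a \<Rightarrow> real) \<Rightarrow> real \<Rightarrow> 'a \<Rightarrow> real" where
 "GT \<tau> \<xi> t om = (\<Sum>n\<in>{n. \<tau> n om \<le> ennreal t}. exp (- lam * enn2real (\<tau> n om)) * g (\<xi> n om))"

text \<open>\<open>h_quasi\<close> once per intervention, since several interventions may fall
  between two grid times.\<close>

lemma h_multi:
 fixes i j :: nat
 assumes "i \<le> j"
 shows "h (y + (\<Sum>n<i. \<xi> n)) \<le> h (y + (\<Sum>n<j. \<xi> n)) + (\<Sum>n=i..<j. g (\<xi> n))"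
 using assms
proof (induction j rule: dec_induct)
 case base show ?case by simp
next
 case (step j)
 have "h (y + (\<Sum>n<j. \<xi> n)) \<le> h (y + (\<Sum>n<j. \<xi> n) + \<xi> j) + g (\<xi> j)" by (rule h_quasi)
 then show ?case using step by (simp add: add.assoc)
qed

lemma sum_lessThan_split: "i \<le> (j :: nat) \<Longrightarrow> (\<Sum>n<j. F n) = (\<Sum>n<i. F n) + (\<Sum>n=i..<j. F n :: real)"
 using sum.atLeastLessThan_concat[of 0 i j F] by (simp add: lessThan_atLeast0)

text \<open>All interventions after \<open>s\<close> and up to \<open>t\<close> are postponed to
  \<open>t\<close>. Their costs are then discounted more than in reality, which is the harmless
  direction for a lower bound.\<close>

lemma path_step:
 assumes c: "cgood \<tau> om" and st: "0 \<le> s" "s \<le> t"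
 shows "exp (- lam * t) * h (ctrl_X (Yp \<sigma> x) \<tau> \<xi> s om + Yd \<sigma> s t om)
  \<le> exp (- lam * t) * h (ctrl_X (Yp \<sigma> x) \<tau> \<xi> t om) + GT \<tau> \<xi> t om - GT \<tau> \<xi> s om"
proof -
 obtain m where m: "\<And>t. {n. \<tau> n om \<le> ennreal t} = {..<m t}" using cgood_lessThan[OF c] by blast
 have mst: "m s \<le> m t"
 proof -
  have "{n. \<tau> n om \<le> ennreal s} \<subseteq> {n. \<tau> n om \<le> ennreal t}" using st by (auto intro: order_trans ennreal_leI)
  then show ?thesis unfolding m by simp
 qed
 let ?y = "Yp \<sigma> x t om"
 have 1: "ctrl_X (Yp \<sigma> x) \<tau> \<xi> s om + Yd \<sigma> s t om = ?y + (\<Sum>n<m s. \<xi> n om)"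
  unfolding ctrl_X_csum csum_def m Yd_Yp[of \<sigma> x t om s] by simp
 have 2: "ctrl_X (Yp \<sigma> x) \<tau> \<xi> t om = ?y + (\<Sum>n<m t. \<xi> n om)" unfolding ctrl_X_csum csum_def m by simp
 have "GT \<tau> \<xi> t om - GT \<tau> \<xi> s om = (\<Sum>n=m s..<m t. exp (- lam * enn2real (\<tau> n om)) * g (\<xi> n om))"
  unfolding GT_def m using sum_lessThan_split[OF mst, of "\<lambda>n. exp (- lam * enn2real (\<tau> n om)) * g (\<xi> n om)"] by simp
 moreover have "(\<Sum>n=m s..<m t. exp (- lam * t) * g (\<xi> n om)) \<le> (\<Sum>n=m s..<m t. exp (- lam * enn2real (\<tau> n om)) * g (\<xi> n om))"
 proof (rule sum_mono, rule mult_right_mono[OF _ g_nonneg])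
  fix n assume "n \<in> {m s..<m t}"
  then have "n \<in> {..<m t}" by simp
  then have "n \<in> {n. \<tau> n om \<le> ennreal t}" by (subst m)
  then have "\<tau> n om \<le> ennreal t" by simp
  then have "enn2real (\<tau> n om) \<le> t" using st by (intro enn2real_leI) auto
  then show "exp (- lam * t) \<le> exp (- lam * enn2real (\<tau> n om))" using lam by simp
 qed
 moreover have "exp (- lam * t) * h (?y + (\<Sum>n<m s. \<xi> n om)) \<le> exp (- lam * t) * (h (?y + (\<Sum>n<m t. \<xi> n om)) + (\<Sum>n=m s..<m t. g (\<xi> n om)))"
  by (intro mult_left_mono h_multi mst) simp
 ultimately show ?thesis unfolding 1 2 by (simp add: distrib_left sum_distrib_left)
qed

lemma path_start:
 assumes c: "cgood \<tau> om" and gd: "good om"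
 shows "h x \<le> h (ctrl_X (Yp \<sigma> x) \<tau> \<xi> 0 om) + GT \<tau> \<xi> 0 om"
proof -
 obtain m where m: "\<And>t. {n. \<tau> n om \<le> ennreal t} = {..<m t}" using cgood_lessThan[OF c] by blast
 have "GT \<tau> \<xi> 0 om = (\<Sum>n<m 0. g (\<xi> n om))"
  unfolding GT_def m
 proof (rule sum.cong[OF refl])
  fix n assume "n \<in> {..<m 0}"
  then have "n \<in> {n. \<tau> n om \<le> ennreal 0}" by (subst m)
  then show "exp (- lam * enn2real (\<tau> n om)) * g (\<xi> n om) = g (\<xi> n om)" by simp
 qed
 then show ?thesis
  using h_multi[of 0 "m 0" x "\<lambda>n. \<xi> n om"] unfolding ctrl_X_csum csum_def m Yp_0[OF gd] by (simp add: lessThan_atLeast0)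
qed

lemma GT_le_gcost: "cgood \<tau> om \<Longrightarrow> ennreal (GT \<tau> \<xi> t om) \<le> gcost lam g \<tau> \<xi> om"
 unfolding GT_def by (rule partial_gcost_le[OF _ g_nonneg])

lemma h_linear_bound: "\<bar>h y\<bar> \<le> \<bar>h 0\<bar> + KK * \<bar>y\<bar>"
 using h_lip[of y 0] by simp

text \<open>Admissibility bounds the state on \<open>[0, T]\<close> by a constant \<open>K'\<close>,
  which makes the one-step estimate uniform and all expectations finite. Summed over the grid, the
  terms with \<open>h\<close> telescope and the running cost appears as a Riemann sum that converges
  to the integral.\<close>

lemma lower_T:
 assumes imp: "impulse_control M (filt M w N) \<tau> \<xi>"
  and bnd: "AE om in M. \<forall>t\<ge>0. exp (- lam * t) * \<bar>ctrl_X (Yp \<sigma> x) \<tau> \<xi> t om\<bar> < K"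
  and Rfin: "(\<integral>\<^sup>+om. rcost lam \<rho> (ctrl_X (Yp \<sigma> x) \<tau> \<xi>) om \<partial>M) < \<top>"
  and Gfin: "(\<integral>\<^sup>+om. gcost lam g \<tau> \<xi> om \<partial>M) < \<top>" and T: "0 < T"
 shows "h x \<le> exp (- lam * T) * expectation (\<lambda>om. h (ctrl_X (Yp \<sigma> x) \<tau> \<xi> T om))
  + enn2real (\<integral>\<^sup>+om. rcost lam \<rho> (ctrl_X (Yp \<sigma> x) \<tau> \<xi>) om \<partial>M) + enn2real (\<integral>\<^sup>+om. gcost lam g \<tau> \<xi> om \<partial>M)"
proof (rule field_le_epsilon)
 fix e :: real assume e: "0 < e"
 define X where "X t om = ctrl_X (Yp \<sigma> x) \<tau> \<xi> t om" for t om
 define K' where "K' = exp (lam * T) * \<bar>K\<bar>"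
 define \<psi> where "\<psi> t om = exp (- lam * t) * (X t om - \<rho>)\<^sup>2" for t om
 define \<Psi> where "\<Psi> = (K' + \<bar>\<rho>\<bar>)\<^sup>2"
 have K'0: "0 \<le> K'" by (simp add: K'_def)
 have XFt: "X t \<in> borel_measurable (Ft t)" if "0 \<le> t" for t
  using ctrl_X_Ft[OF imp that, of \<sigma> x] by (simp add: X_def[abs_def])
 have XM: "X t \<in> borel_measurable M" if "0 \<le> t" for t by (rule measurable_Ft_M[OF XFt[OF that]])
 have Xb: "AE om in M. \<forall>t. 0 \<le> t \<and> t \<le> T \<longrightarrow> \<bar>X t om\<bar> \<le> K'"
  using bnd
 proof (eventually_elim, intro allI impI)
  fix om t assume b: "\<forall>t\<ge>0. exp (- lam * t) * \<bar>ctrl_X (Yp \<sigma> x) \<tau> \<xi> t om\<bar> < K" and t: "0 \<le> t \<and> t \<le> T"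
  from b t have "exp (- lam * t) * \<bar>X t om\<bar> < K" by (simp add: X_def)
  then have "exp (lam * t) * (exp (- lam * t) * \<bar>X t om\<bar>) \<le> exp (lam * t) * \<bar>K\<bar>" by (intro mult_left_mono) auto
  moreover have "exp (lam * t) * (exp (- lam * t) * \<bar>X t om\<bar>) = \<bar>X t om\<bar>" by (simp add: exp_minus)
  moreover have "exp (lam * t) * \<bar>K\<bar> \<le> exp (lam * T) * \<bar>K\<bar>" using t lam by (intro mult_right_mono) auto
  ultimately show "\<bar>X t om\<bar> \<le> K'" unfolding K'_def by linarith
 qed
 have int_b: "integrable M (\<lambda>om. u (X t om))" if t: "0 \<le> t" "t \<le> T" and u: "u \<in> borel_measurable borel" "\<And>y. \<bar>y\<bar> \<le> K' \<Longrightarrow> \<bar>u y\<bar> \<le> U" for u :: "real \<Rightarrow> real" and t U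
 proof (rule integrable_const_bound[where B=U])
  show "AE om in M. norm (u (X t om)) \<le> U" using Xb by eventually_elim (use u(2) t in simp)
  show "(\<lambda>om. u (X t om)) \<in> borel_measurable M" by (rule measurable_compose[OF XM[OF t(1)] u(1)])
 qed
 have hK: "\<bar>h y\<bar> \<le> \<bar>h 0\<bar> + KK * K'" if "\<bar>y\<bar> \<le> K'" for y
 proof -
  have "KK * \<bar>y\<bar> \<le> KK * K'" using that KK(1) by (intro mult_left_mono) auto
  then show ?thesis using h_linear_bound[of y] by linarith
 qed
 have \<phi>K: "\<bar>(y - \<rho>)\<^sup>2\<bar> \<le> \<Psi>" if "\<bar>y\<bar> \<le> K'" for y
 proof -
  have "\<bar>y - \<rho>\<bar> \<le> \<bar>K' + \<bar>\<rho>\<bar>\<bar>" using that K'0 by linarith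
  then show ?thesis unfolding \<Psi>_def by (simp add: abs_le_square_iff)
 qed
 have ih: "integrable M (\<lambda>om. h (X t om))" if "0 \<le> t" "t \<le> T" for t using int_b[OF that h_measurable hK] .
 have i\<phi>: "integrable M (\<lambda>om. (X t om - \<rho>)\<^sup>2)" if "0 \<le> t" "t \<le> T" for t
  using int_b[OF that, of "\<lambda>y. (y - \<rho>)\<^sup>2" \<Psi>] \<phi>K by simp
 \<comment> \<open>The grid steps lose \<open>2 * \<eta> * q\<close> each, in total
   \<open>2 * \<eta> * T\<close>, which has to stay below a quarter of \<open>e\<close>.\<close>
 define \<eta> where "\<eta> = e / (8 * (T + 1))"
 have \<eta>: "0 < \<eta>" "2 * \<eta> * T \<le> e / 4"
 proof -
  show "0 < \<eta>" using e T by (simp add: \<eta>_def)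
  have "2 * \<eta> * T = e / 4 * (T / (T + 1))" using T by (simp add: \<eta>_def field_simps)
  also have "\<dots> \<le> e / 4 * 1" using e T by (intro mult_left_mono) auto
  finally show "2 * \<eta> * T \<le> e / 4" by simp
 qed
 obtain \<delta> where \<delta>: "\<delta> > 0" "\<And>y. \<bar>y\<bar> \<le> K' \<Longrightarrow> (\<exists>m. \<bar>m\<bar> \<le> KK \<and> (\<forall>z. \<bar>z\<bar> \<le> \<delta> \<longrightarrow> h y + hder y * z + m * z\<^sup>2 / 2 \<le> h (y + z)) \<and>
  - \<eta> \<le> \<sigma>\<^sup>2 / 2 * m + (jump_mean \<theta> h y - h y) - lam * h y + (y - \<rho>)\<^sup>2)"
  using lower_step[OF \<eta>(1), of K'] by blast
 have "\<exists>ep0>0. \<forall>ep. 0 < ep \<and> ep \<le> ep0 \<longrightarrow> (\<forall>y\<in>{y. \<bar>y\<bar> \<le> K'}. h y - ep * (y - \<rho>)\<^sup>2 - 2 * \<eta> * ep \<le> exp (- lam * ep) * expectation (\<lambda>om. h (y + (\<sigma> * w ep om + N ep om))))"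
  by (rule one_step[OF h_deriv hder_bound hder_lip \<delta>(1) lam \<eta>(1), where V="\<bar>h 0\<bar> + KK * K'"]) (use hK \<delta>(2) in simp_all)
 then obtain ep0 where ep0: "0 < ep0" and os: "\<And>ep y. 0 < ep \<Longrightarrow> ep \<le> ep0 \<Longrightarrow> \<bar>y\<bar> \<le> K' \<Longrightarrow> h y - ep * (y - \<rho>)\<^sup>2 - 2 * \<eta> * ep \<le> exp (- lam * ep) * expectation (\<lambda>om. h (y + (\<sigma> * w ep om + N ep om)))"
  by blast
 define ep where "ep m = T / real (Suc m)" for m
 have epp: "0 < ep m" for m using T by (simp add: ep_def)
 have epl: "ep \<longlonglongrightarrow> 0" unfolding ep_def[abs_def] by (rule LIMSEQ_Suc[OF lim_const_over_n])
 have epn: "real (Suc m) * ep m = T" for m by (simp add: ep_def)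
 have \<psi>M: "\<psi> t \<in> borel_measurable M" if "0 \<le> t" for t
 proof -
  note [measurable] = XM[OF that]
  show ?thesis unfolding \<psi>_def[abs_def] by measurable
 qed
 have \<psi>n: "0 \<le> \<psi> t om" for t om by (simp add: \<psi>_def)
 define I where "I = (\<integral>\<^sup>+om. \<integral>\<^sup>+t. indicator {0<..T} t * ennreal (\<psi> t om) \<partial>lborel \<partial>M)"
 \<comment> \<open>The Riemann sum of \<open>I\<close> with right endpoints. Convergence to
   \<open>I\<close> uses dominated convergence twice, in time and over the paths, each time with a
   constant obtained from the bound \<open>K'\<close> on the state.\<close>
 define Im where "Im m = (\<integral>\<^sup>+om. \<integral>\<^sup>+t. indicator {0<..T} t * ennreal (\<psi> (cl (ep m) t) om) \<partial>lborel \<partial>M)" for m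
 have I_le: "I \<le> (\<integral>\<^sup>+om. rcost lam \<rho> (ctrl_X (Yp \<sigma> x) \<tau> \<xi>) om \<partial>M)"
  unfolding I_def rcost_def X_def[symmetric] \<psi>_def[symmetric]
  by (intro nn_integral_mono mult_right_mono) (auto split: split_indicator)
 have Im_inner: "(\<integral>\<^sup>+t. indicator {0<..T} t * ennreal (\<psi> (cl (ep m) t) om) \<partial>lborel) = (\<Sum>j<Suc m. ennreal (ep m) * ennreal (\<psi> (real (Suc j) * ep m) om))" for m om
  using cl_step_integral[OF epp[of m], of "Suc m" "\<lambda>t. \<psi> t om"] unfolding epn .
 have lim_in: "AE om in M. (\<lambda>m. \<integral>\<^sup>+t. indicator {0<..T} t * ennreal (\<psi> (cl (ep m) t) om) \<partial>lborel) \<longlonglongrightarrow> (\<integral>\<^sup>+t. indicator {0<..T} t * ennreal (\<psi> t om) \<partial>lborel)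
   \<and> (\<forall>m. (\<integral>\<^sup>+t. indicator {0<..T} t * ennreal (\<psi> (cl (ep m) t) om) \<partial>lborel) \<le> ennreal (T * \<Psi>))"
  using Xb AE_good AE_cgood[OF imp]
 proof eventually_elim
  case (elim om)
  have rc: "rcont (\<lambda>t. \<psi> t om)" unfolding \<psi>_def X_def by (rule rcont_discounted[OF ctrl_X_rcont[OF elim(2,3)]])
  have cl_T: "cl (ep m) t \<le> T" if "0 < t" "t \<le> T" for m t
  proof -
   have "t / ep m \<le> real (Suc m)" using that epn[of m] epp[of m] by (simp add: pos_divide_le_eq)
   then have "\<lceil>t / ep m\<rceil> \<le> int (Suc m)" by (simp add: ceiling_le_iff)
   then have "real_of_int \<lceil>t / ep m\<rceil> \<le> real (Suc m)" by linarith
   then have "ep m * real_of_int \<lceil>t / ep m\<rceil> \<le> ep m * real (Suc m)" using epp[of m] by (intro mult_left_mono) auto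
   then show ?thesis using epn[of m] by (simp add: cl_def mult.commute)
  qed
  have \<psi>b: "\<psi> s om \<le> \<Psi>" if "0 \<le> s" "s \<le> T" for s
  proof -
   have "exp (- lam * s) * (X s om - \<rho>)\<^sup>2 \<le> 1 * (X s om - \<rho>)\<^sup>2" using that lam by (intro mult_right_mono) auto
   also have "\<dots> \<le> \<Psi>" using \<phi>K[of "X s om"] elim(1) that by simp
   finally show ?thesis by (simp add: \<psi>_def)
  qed
  have dom: "indicator {0<..T} t * ennreal (\<psi> (cl (ep m) t) om) \<le> indicator {0<..T} t * ennreal \<Psi>" for m t
   using \<psi>b[of "cl (ep m) t"] cl_T[of t m] cl_ge[OF epp[of m], of t] by (auto split: split_indicator intro!: ennreal_leI)
  have cint: "(\<integral>\<^sup>+t. indicator {0<..T} t * ennreal \<Psi> \<partial>lborel) = ennreal (T * \<Psi>)"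
   using T by (subst nn_integral_multc) (simp_all add: ennreal_mult \<Psi>_def)
  have meas: "(\<lambda>t. \<psi> t om) \<in> borel_measurable (restrict_space lborel {0..})"
  proof -
   have "(\<lambda>t. \<psi> (cl (1 / real (Suc m)) t) om) \<in> borel_measurable (restrict_space lborel {0..})" for m
    by (rule measurable_restrict_space1) (use cl_measurable[of "\<lambda>t. \<psi> t om" "1 / real (Suc m)"] in simp)
   then show ?thesis
   proof (rule borel_measurable_LIMSEQ_real[rotated])
    fix t :: real assume "t \<in> space (restrict_space lborel {0..})"
    then have t: "0 \<le> t" by (simp add: space_restrict_space)
    have "(\<lambda>m. cl (1 / real (Suc m)) t) \<longlonglongrightarrow> t" by (rule cl_tendsto) (use LIMSEQ_Suc[OF lim_const_over_n[of 1]] in auto)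
    then show "(\<lambda>m. \<psi> (cl (1 / real (Suc m)) t) om) \<longlonglongrightarrow> \<psi> t om"
     by (rule rcont_seq[OF rc t]) (simp add: cl_ge)
   qed
  qed
  have mA: "(\<lambda>t. indicator {0<..T} t * ennreal (\<psi> t om)) \<in> borel_measurable lborel"
  proof -
   have "(\<lambda>t. indicator {0..} t *\<^sub>R \<psi> t om) \<in> borel_measurable lborel"
    using meas by (subst (asm) borel_measurable_restrict_space_iff) auto
   then have "(\<lambda>t. indicator {0<..T} t * ennreal (indicator {0..} t *\<^sub>R \<psi> t om)) \<in> borel_measurable lborel" by measurable
   also have "(\<lambda>t. indicator {0<..T} t * ennreal (indicator {0..} t *\<^sub>R \<psi> t om)) = (\<lambda>t. indicator {0<..T} t * ennreal (\<psi> t om))"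
    by (rule ext) (auto split: split_indicator)
   finally show ?thesis .
  qed
  have mB: "(\<lambda>t. indicator {0<..T} t * ennreal (\<psi> (cl (ep m) t) om)) \<in> borel_measurable lborel" for m
   using cl_measurable[of "\<lambda>t. \<psi> t om" "ep m"] by measurable
  have "(\<lambda>m. \<integral>\<^sup>+t. indicator {0<..T} t * ennreal (\<psi> (cl (ep m) t) om) \<partial>lborel) \<longlonglongrightarrow> (\<integral>\<^sup>+t. indicator {0<..T} t * ennreal (\<psi> t om) \<partial>lborel)"
  proof (rule nn_integral_dominated_convergence[where w="\<lambda>t. indicator {0<..T} t * ennreal \<Psi>", OF mB mA])
   show "AE t in lborel. (\<lambda>m. indicator {0<..T} t * ennreal (\<psi> (cl (ep m) t) om)) \<longlonglongrightarrow> indicator {0<..T} t * ennreal (\<psi> t om)"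
   proof (rule AE_I2)
    fix t :: real
    show "(\<lambda>m. indicator {0<..T} t * ennreal (\<psi> (cl (ep m) t) om)) \<longlonglongrightarrow> indicator {0<..T} t * ennreal (\<psi> t om)"
    proof (cases "t \<in> {0<..T}")
     case True
     then have "(\<lambda>m. \<psi> (cl (ep m) t) om) \<longlonglongrightarrow> \<psi> t om"
      by (intro rcont_seq[OF rc _ cl_tendsto[OF epp epl]]) (simp_all add: cl_ge epp)
     then show ?thesis using True by simp
    qed simp
   qed
   show "(\<integral>\<^sup>+t. indicator {0<..T} t * ennreal \<Psi> \<partial>lborel) < \<infinity>" unfolding cint by simp
  qed (use dom in auto)
  moreover have "(\<integral>\<^sup>+t. indicator {0<..T} t * ennreal (\<psi> (cl (ep m) t) om) \<partial>lborel) \<le> ennreal (T * \<Psi>)" for m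
   unfolding cint[symmetric] by (rule nn_integral_mono[OF dom])
  ultimately show ?case by blast
 qed
 have lim: "Im \<longlonglongrightarrow> I"
  unfolding Im_def[abs_def] I_def
 proof (rule nn_integral_dominated_convergence[where w="\<lambda>_. ennreal (T * \<Psi>)"])
  show mm: "(\<lambda>om. \<integral>\<^sup>+t. indicator {0<..T} t * ennreal (\<psi> (cl (ep m) t) om) \<partial>lborel) \<in> borel_measurable M" for m
   unfolding Im_inner using \<psi>M[of "real (Suc _) * ep m"] epp[of m]
   by (intro borel_measurable_sum borel_measurable_times_ennreal measurable_compose[OF \<psi>M measurable_ennreal] borel_measurable_const) (simp add: less_imp_le)
  show "(\<lambda>om. \<integral>\<^sup>+t. indicator {0<..T} t * ennreal (\<psi> t om) \<partial>lborel) \<in> borel_measurable M"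
  proof (rule AE_measurable_M)
   show "(\<lambda>om. liminf (\<lambda>m. \<integral>\<^sup>+t. indicator {0<..T} t * ennreal (\<psi> (cl (ep m) t) om) \<partial>lborel)) \<in> borel_measurable M"
    by (rule borel_measurable_liminf[OF mm])
   show "AE om in M. liminf (\<lambda>m. \<integral>\<^sup>+t. indicator {0<..T} t * ennreal (\<psi> (cl (ep m) t) om) \<partial>lborel) = (\<integral>\<^sup>+t. indicator {0<..T} t * ennreal (\<psi> t om) \<partial>lborel)"
    using lim_in by eventually_elim (rule lim_imp_Liminf, simp_all)
  qed simp
  show "AE om in M. (\<integral>\<^sup>+t. indicator {0<..T} t * ennreal (\<psi> (cl (ep m) t) om) \<partial>lborel) \<le> ennreal (T * \<Psi>)" for m
   using lim_in by eventually_elim blast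
  show "(\<integral>\<^sup>+om. ennreal (T * \<Psi>) \<partial>M) < \<infinity>" by (simp add: emeasure_space_1)
  show "AE om in M. (\<lambda>m. \<integral>\<^sup>+t. indicator {0<..T} t * ennreal (\<psi> (cl (ep m) t) om) \<partial>lborel) \<longlonglongrightarrow> (\<integral>\<^sup>+t. indicator {0<..T} t * ennreal (\<psi> t om) \<partial>lborel)"
   using lim_in by eventually_elim blast
 qed simp
 have Ifin: "I < \<top>" using I_le Rfin by (rule le_less_trans)
 have "I < I + ennreal (e / 4)" using Ifin e by (simp add: ennreal_add_left_cancel_less[of I 0, simplified])
 then have ev1: "eventually (\<lambda>m. Im m < I + ennreal (e / 4)) sequentially" by (rule order_tendstoD[OF lim])
 \<comment> \<open>The three bounds on the mesh serve the one-step estimate, the moment bounds of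
   the increment, and the change from left to right endpoints.\<close>
 have ev2: "eventually (\<lambda>m. ep m < min ep0 (min (1 / 2) (e / (4 * (\<Psi> + 1))))) sequentially"
 proof (rule order_tendstoD[OF epl])
  have "0 \<le> \<Psi>" by (simp add: \<Psi>_def)
  then show "0 < min ep0 (min (1 / 2) (e / (4 * (\<Psi> + 1))))" using ep0 e by simp
 qed
 obtain m where m1: "Im m < I + ennreal (e / 4)" and m2: "ep m < min ep0 (min (1 / 2) (e / (4 * (\<Psi> + 1))))"
  using eventually_happens[OF eventually_conj[OF ev1 ev2]] by auto
 define n where "n = Suc m"
 define q where "q = ep m"
 define t where "t j = real j * q" for j
 have q: "0 < q" "q \<le> ep0" "q \<le> 1 / 2" "q * \<Psi> \<le> e / 4"
 proof -
  show "0 < q" using epp by (simp add: q_def)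
  show "q \<le> ep0" "q \<le> 1 / 2" using m2 by (simp_all add: q_def)
  have \<Psi>0: "0 \<le> \<Psi>" by (simp add: \<Psi>_def)
  have "q \<le> e / (4 * (\<Psi> + 1))" using m2 by (simp add: q_def)
  then have "q * (\<Psi> + 1) \<le> e / 4" using \<Psi>0 by (simp add: field_simps)
  then show "q * \<Psi> \<le> e / 4" using \<open>0 < q\<close> by (simp add: distrib_left)
 qed
 have t: "0 \<le> t j" "t 0 = 0" "t n = T" "t (Suc j) = t j + q" for j
  using q epn[of m] by (simp_all add: t_def n_def q_def algebra_simps)
 have tT: "t j \<le> T" if "j \<le> n" for j
 proof -
  have "real j * q \<le> real n * q" using that q by (intro mult_right_mono) auto
  then show ?thesis using t(3) by (simp add: t_def)
 qed
 define A where "A j = expectation (\<lambda>om. h (X (t j) om))" for j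
 define p where "p j = expectation (\<lambda>om. (X (t j) om - \<rho>)\<^sup>2)" for j
 define Q where "Q j = expectation (\<lambda>om. h (X (t j) om + Yd \<sigma> (t j) (t (Suc j)) om))" for j
 have step: "integrable M (\<lambda>om. h (X (t j) om + Yd \<sigma> (t j) (t (Suc j)) om)) \<and>
   exp (- lam * t j) * A j - q * (exp (- lam * t j) * p j) - 2 * \<eta> * q \<le> exp (- lam * t (Suc j)) * Q j" if j: "j < n" for j
 proof -
  have tj: "0 \<le> t j" "t j < t (Suc j)" "t (Suc j) \<le> t j + 1 / 2" "t (Suc j) - t j = q" using t q by simp_all
  have jT: "t j \<le> T" using tT j by simp
  define \<psi>1 where "\<psi>1 y = exp (lam * q) * (h y - q * (y - \<rho>)\<^sup>2 - 2 * \<eta> * q)" for y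
  have i\<psi>: "integrable M (\<lambda>om. indicator (space M) om * \<psi>1 (X (t j) om))"
  proof -
   have "integrable M (\<lambda>om. \<psi>1 (X (t j) om))" unfolding \<psi>1_def using ih[OF tj(1) jT] i\<phi>[OF tj(1) jT] by simp
   then show ?thesis by (subst Bochner_Integration.integrable_cong[of M M _ "\<lambda>om. \<psi>1 (X (t j) om)"]) simp_all
  qed
  have ge: "\<psi>1 y \<le> expectation (\<lambda>om. h (y + (\<sigma> * w (t (Suc j) - t j) om + N (t (Suc j) - t j) om)))" if "y \<in> {y. \<bar>y\<bar> \<le> K'}" for y
  proof -
   have "exp (lam * q) * (h y - q * (y - \<rho>)\<^sup>2 - 2 * \<eta> * q) \<le> exp (lam * q) * (exp (- lam * q) * expectation (\<lambda>om. h (y + (\<sigma> * w q om + N q om))))"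
    using os[OF q(1,2), of y] that by (intro mult_left_mono) auto
   also have "\<dots> = expectation (\<lambda>om. h (y + (\<sigma> * w q om + N q om)))" by (simp add: exp_minus flip: mult.assoc)
   finally show ?thesis unfolding tj(4) \<psi>1_def .
  qed
  have sp: "space M \<in> Fl (t j)" using sigma_algebra.axioms(1)[OF Fl_sigma_algebra[of "t j"]] algebra.top by blast
  have D: "AE om in M. om \<in> space M \<longrightarrow> X (t j) om \<in> {y. \<bar>y\<bar> \<le> K'}" using Xb by eventually_elim (use tj(1) jT in simp)
  note sg = step_ge[OF tj(1,2,3) XFt[OF tj(1)] sp h_lip D _ ge i\<psi>, of K', simplified]
  have cong: "integrable M (\<lambda>om. h (X (t j) om + Yd \<sigma> (t j) (t (Suc j)) om))"
   using sg(1) by (subst (asm) Bochner_Integration.integrable_cong[of M M _ "\<lambda>om. h (X (t j) om + Yd \<sigma> (t j) (t (Suc j)) om)"]) simp_all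
  have "expectation (\<lambda>om. \<psi>1 (X (t j) om)) = expectation (\<lambda>om. indicator (space M) om * \<psi>1 (X (t j) om))"
   by (rule Bochner_Integration.integral_cong) simp_all
  also have "\<dots> \<le> expectation (\<lambda>om. indicator (space M) om * h (X (t j) om + Yd \<sigma> (t j) (t (Suc j)) om))" by (rule sg(2))
  also have "\<dots> = Q j" unfolding Q_def by (rule Bochner_Integration.integral_cong) simp_all
  also have "expectation (\<lambda>om. \<psi>1 (X (t j) om)) = exp (lam * q) * (A j - q * p j - 2 * \<eta> * q)"
   unfolding \<psi>1_def A_def p_def using ih[OF tj(1) jT] i\<phi>[OF tj(1) jT] by (simp add: prob_space)
  finally have "exp (- lam * t (Suc j)) * (exp (lam * q) * (A j - q * p j - 2 * \<eta> * q)) \<le> exp (- lam * t (Suc j)) * Q j" by (intro mult_left_mono) auto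
  moreover have ee: "exp (- lam * t (Suc j)) * exp (lam * q) = exp (- lam * t j)" unfolding t(4) exp_add[symmetric] by (simp add: algebra_simps)
  moreover have "exp (- lam * t (Suc j)) * (exp (lam * q) * (A j - q * p j - 2 * \<eta> * q)) = exp (- lam * t j) * (A j - q * p j - 2 * \<eta> * q)"
   unfolding ee[symmetric] by (rule mult.assoc[symmetric])
  ultimately have "exp (- lam * t j) * (A j - q * p j - 2 * \<eta> * q) \<le> exp (- lam * t (Suc j)) * Q j" by linarith
  moreover have "exp (- lam * t j) * (2 * \<eta> * q) \<le> 1 * (2 * \<eta> * q)" using lam t(1)[of j] \<eta>(1) q(1) by (intro mult_right_mono) auto
  ultimately show ?thesis using cong by (simp add: algebra_simps)
 qed
 define Gr where "Gr om = enn2real (gcost lam g \<tau> \<xi> om)" for om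
 have gM: "gcost lam g \<tau> \<xi> \<in> borel_measurable M" by (rule gcost_measurable[OF imp]) simp
 have gAE: "AE om in M. gcost lam g \<tau> \<xi> om \<noteq> \<infinity>" by (rule nn_integral_PInf_AE[OF gM]) (use Gfin in auto)
 have eG: "(\<integral>\<^sup>+om. ennreal (Gr om) \<partial>M) = (\<integral>\<^sup>+om. gcost lam g \<tau> \<xi> om \<partial>M)"
  by (rule nn_integral_cong_AE) (use gAE in \<open>eventually_elim, simp add: Gr_def less_top[symmetric]\<close>)
 have GrM: "Gr \<in> borel_measurable M" unfolding Gr_def[abs_def] using gM by measurable
 have iG: "integrable M Gr"
  by (rule integrableI_nonneg[OF GrM]) (use eG Gfin in \<open>auto simp: Gr_def\<close>)
 have EG: "expectation Gr = enn2real (\<integral>\<^sup>+om. gcost lam g \<tau> \<xi> om \<partial>M)"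
  unfolding eG[symmetric] by (rule integral_eq_nn_integral[OF GrM]) (simp add: Gr_def)
 \<comment> \<open>\<open>path_step\<close> summed over the grid: the partial intervention costs
   telescope to the cost on \<open>(0, T]\<close>, and \<open>path_start\<close> accounts for
   interventions at time 0.\<close>
 have path: "AE om in M. (\<Sum>j<n. exp (- lam * t (Suc j)) * h (X (t j) om + Yd \<sigma> (t j) (t (Suc j)) om))
   \<le> (\<Sum>j<n. exp (- lam * t (Suc j)) * h (X (t (Suc j)) om)) + Gr om - h x + h (X 0 om)"
  using AE_good AE_cgood[OF imp] gAE
 proof eventually_elim
  case (elim om)
  have "(\<Sum>j<n. exp (- lam * t (Suc j)) * h (X (t j) om + Yd \<sigma> (t j) (t (Suc j)) om))
    \<le> (\<Sum>j<n. exp (- lam * t (Suc j)) * h (X (t (Suc j)) om) + (GT \<tau> \<xi> (t (Suc j)) om - GT \<tau> \<xi> (t j) om))"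
  proof (rule sum_mono)
   fix j
   have "t j \<le> t (Suc j)" using t(4)[of j] q(1) by simp
   from path_step[OF elim(2) t(1)[of j] this, of x \<xi>]
   show "exp (- lam * t (Suc j)) * h (X (t j) om + Yd \<sigma> (t j) (t (Suc j)) om) \<le> exp (- lam * t (Suc j)) * h (X (t (Suc j)) om) + (GT \<tau> \<xi> (t (Suc j)) om - GT \<tau> \<xi> (t j) om)"
    by (simp add: X_def)
  qed
  also have "\<dots> = (\<Sum>j<n. exp (- lam * t (Suc j)) * h (X (t (Suc j)) om)) + (GT \<tau> \<xi> T om - GT \<tau> \<xi> 0 om)"
   unfolding sum.distrib by (simp only: sum_lessThan_telescope[of "\<lambda>j. GT \<tau> \<xi> (t j) om" n] t(2,3))
  also have "GT \<tau> \<xi> T om \<le> Gr om"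
  proof -
   have "ennreal (GT \<tau> \<xi> T om) \<le> ennreal (Gr om)" using GT_le_gcost[OF elim(2), of \<xi> T] elim(3) by (simp add: Gr_def less_top[symmetric])
   then show ?thesis by (simp add: Gr_def ennreal_le_iff)
  qed
  finally show ?case using path_start[OF elim(2,1), of x \<xi>] by (simp add: X_def)
 qed
 have ihj: "integrable M (\<lambda>om. h (X (t j) om))" if "j \<le> n" for j using ih[OF t(1) tT[OF that]] .
 have ih0: "integrable M (\<lambda>om. h (X 0 om))" using ih[of 0] T by simp
 have "(\<Sum>j<n. exp (- lam * t (Suc j)) * Q j) \<le> (\<Sum>j<n. exp (- lam * t (Suc j)) * A (Suc j)) + expectation Gr - h x + A 0"
 proof -
  have "(\<Sum>j<n. exp (- lam * t (Suc j)) * Q j) = expectation (\<lambda>om. \<Sum>j<n. exp (- lam * t (Suc j)) * h (X (t j) om + Yd \<sigma> (t j) (t (Suc j)) om))"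
   unfolding Q_def using step by (subst Bochner_Integration.integral_sum) auto
  also have "\<dots> \<le> expectation (\<lambda>om. (\<Sum>j<n. exp (- lam * t (Suc j)) * h (X (t (Suc j)) om)) + Gr om - h x + h (X 0 om))"
  proof (rule integral_mono_AE[OF _ _ path])
   show "integrable M (\<lambda>om. (\<Sum>j<n. exp (- lam * t (Suc j)) * h (X (t (Suc j)) om)) + Gr om - h x + h (X 0 om))"
    by (intro Bochner_Integration.integrable_add Bochner_Integration.integrable_diff Bochner_Integration.integrable_sum integrable_mult_right ihj iG ih0 integrable_const) simp
  qed (use step in \<open>auto intro!: Bochner_Integration.integrable_sum\<close>)
  also have "\<dots> = (\<Sum>j<n. exp (- lam * t (Suc j)) * A (Suc j)) + expectation Gr - h x + A 0"
  proof -
   have i1: "integrable M (\<lambda>om. \<Sum>j<n. exp (- lam * t (Suc j)) * h (X (t (Suc j)) om))" using ihj by (intro Bochner_Integration.integrable_sum) auto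
   have "expectation (\<lambda>om. \<Sum>j<n. exp (- lam * t (Suc j)) * h (X (t (Suc j)) om)) = (\<Sum>j<n. exp (- lam * t (Suc j)) * A (Suc j))"
    unfolding A_def using ihj by (subst Bochner_Integration.integral_sum) auto
   then show ?thesis using i1 iG ih0 unfolding A_def t(2) by (simp add: prob_space)
  qed
  finally show ?thesis .
 qed
 moreover have "(\<Sum>j<n. exp (- lam * t j) * A j - q * (exp (- lam * t j) * p j) - 2 * \<eta> * q) \<le> (\<Sum>j<n. exp (- lam * t (Suc j)) * Q j)"
  by (rule sum_mono) (use step in simp)
 moreover have "(\<Sum>j<n. exp (- lam * t j) * A j) - (\<Sum>j<n. exp (- lam * t (Suc j)) * A (Suc j)) = A 0 - exp (- lam * T) * A n"
  unfolding sum_subtractf[symmetric] sum_lessThan_telescope'[of "\<lambda>j. exp (- lam * t j) * A j"] t(2,3) by simp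
 moreover have "(\<Sum>j<n. 2 * \<eta> * q) = 2 * \<eta> * T" using t(3) by (simp add: t_def)
 ultimately have main: "h x \<le> exp (- lam * T) * A n + expectation Gr + (\<Sum>j<n. q * (exp (- lam * t j) * p j)) + 2 * \<eta> * T"
  unfolding sum_subtractf by linarith
 \<comment> \<open>The one-step estimate yields left endpoints, \<open>Im\<close> has right
   endpoints; the difference is at most the initial term, bounded by
   \<open>q * \<Psi>\<close>.\<close>
 have sum_p: "(\<Sum>j<n. q * (exp (- lam * t j) * p j)) \<le> q * \<Psi> + (\<Sum>j<n. q * (exp (- lam * t (Suc j)) * p (Suc j)))"
 proof -
  let ?s = "\<lambda>j. q * (exp (- lam * t j) * p j)"
  have "(\<Sum>j<n. ?s j) - (\<Sum>j<n. ?s (Suc j)) = ?s 0 - ?s n"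
   unfolding sum_subtractf[symmetric] by (rule sum_lessThan_telescope')
  moreover have "0 \<le> ?s n" using q(1) by (auto simp: p_def intro!: mult_nonneg_nonneg Bochner_Integration.integral_nonneg)
  moreover have "?s 0 \<le> q * \<Psi>"
  proof -
   have "p 0 \<le> expectation (\<lambda>_. \<Psi>)"
    unfolding p_def
   proof (rule integral_mono_AE)
    show "AE om in M. (X (t 0) om - \<rho>)\<^sup>2 \<le> \<Psi>" using Xb by eventually_elim (use \<phi>K T t(2) in force)
   qed (use i\<phi>[of 0] T t(2) in simp_all)
   then have "p 0 \<le> \<Psi>" by (simp add: prob_space)
   then show ?thesis using q(1) t(2) by simp
  qed
  ultimately show ?thesis by linarith
 qed
 have "ennreal (\<Sum>j<n. q * (exp (- lam * t (Suc j)) * p (Suc j))) = Im m"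
 proof -
  have e1: "(\<integral>\<^sup>+om. ennreal (\<psi> (t (Suc j)) om) \<partial>M) = ennreal (exp (- lam * t (Suc j)) * p (Suc j))" if "j < n" for j
  proof -
   have jT: "0 \<le> t (Suc j)" "t (Suc j) \<le> T" using t(1) tT[of "Suc j"] that by simp_all
   have "(\<integral>\<^sup>+om. ennreal (\<psi> (t (Suc j)) om) \<partial>M) = ennreal (expectation (\<psi> (t (Suc j))))"
    by (rule nn_integral_eq_integral) (use i\<phi>[OF jT] in \<open>auto simp: \<psi>_def[abs_def]\<close>)
   then show ?thesis by (simp add: \<psi>_def[abs_def] p_def)
  qed
  have "Im m = (\<integral>\<^sup>+om. (\<Sum>j<n. ennreal q * ennreal (\<psi> (t (Suc j)) om)) \<partial>M)"
   unfolding Im_def Im_inner n_def q_def t_def ..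
  also have "\<dots> = (\<Sum>j<n. \<integral>\<^sup>+om. ennreal q * ennreal (\<psi> (t (Suc j)) om) \<partial>M)"
   by (rule nn_integral_sum) (intro borel_measurable_times_ennreal measurable_compose[OF \<psi>M measurable_ennreal] borel_measurable_const t(1))
  also have "\<dots> = (\<Sum>j<n. ennreal (q * (exp (- lam * t (Suc j)) * p (Suc j))))"
  proof (rule sum.cong[OF refl])
   fix j assume "j \<in> {..<n}"
   then have j: "j < n" by simp
   have "(\<integral>\<^sup>+om. ennreal q * ennreal (\<psi> (t (Suc j)) om) \<partial>M) = ennreal q * (\<integral>\<^sup>+om. ennreal (\<psi> (t (Suc j)) om) \<partial>M)"
    by (rule nn_integral_cmult) (intro measurable_compose[OF \<psi>M measurable_ennreal] t(1))
   then show "(\<integral>\<^sup>+om. ennreal q * ennreal (\<psi> (t (Suc j)) om) \<partial>M) = ennreal (q * (exp (- lam * t (Suc j)) * p (Suc j)))"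
    unfolding e1[OF j] using q(1) by (simp add: ennreal_mult' )
  qed
  also have "\<dots> = ennreal (\<Sum>j<n. q * (exp (- lam * t (Suc j)) * p (Suc j)))"
   by (rule sum_ennreal) (use q(1) in \<open>auto simp: p_def intro!: mult_nonneg_nonneg Bochner_Integration.integral_nonneg\<close>)
  finally show ?thesis by simp
 qed
 also have "Im m \<le> ennreal (enn2real I + e / 4)"
 proof -
  have "Im m \<le> ennreal (enn2real I) + ennreal (e / 4)" using m1 Ifin by simp
  then show ?thesis using e by (subst ennreal_plus) auto
 qed
 finally have "(\<Sum>j<n. q * (exp (- lam * t (Suc j)) * p (Suc j))) \<le> enn2real I + e / 4"
  using e by (subst (asm) ennreal_le_iff) auto
 moreover have "enn2real I \<le> enn2real (\<integral>\<^sup>+om. rcost lam \<rho> (ctrl_X (Yp \<sigma> x) \<tau> \<xi>) om \<partial>M)"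
  by (rule enn2real_mono[OF I_le Rfin])
 ultimately show "h x \<le> exp (- lam * T) * expectation (\<lambda>om. h (ctrl_X (Yp \<sigma> x) \<tau> \<xi> T om))
  + enn2real (\<integral>\<^sup>+om. rcost lam \<rho> (ctrl_X (Yp \<sigma> x) \<tau> \<xi>) om \<partial>M) + enn2real (\<integral>\<^sup>+om. gcost lam g \<tau> \<xi> om \<partial>M) + e"
  using main sum_p q(4) \<eta>(2) e unfolding EG A_def t(3) X_def by linarith
qed

text \<open>The terminal term of \<open>lower_T\<close> is not small a priori. If the cost were
  below \<open>h x\<close>, that term would be at least a fixed \<open>\<delta>\<close> at every
  horizon. Since \<open>h\<close> is dominated by
  \<open>\<kappa> + \<kappa> * (y - \<rho>)^2\<close>, the expected discounted running cost
  \<open>s T\<close> would stay above a positive constant for large \<open>T\<close>, and its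
  integral, a part of the finite cost, would be infinite.\<close>

lemma lower_bound:
 assumes adm: "admissible M (filt M w N) lam (Yp \<sigma> x) \<tau> \<xi>"
 shows "ennreal (h x) \<le> cost M lam \<rho> g (Yp \<sigma> x) \<tau> \<xi>"
proof (rule ccontr)
 assume "\<not> ?thesis"
 then have lt: "cost M lam \<rho> g (Yp \<sigma> x) \<tau> \<xi> < ennreal (h x)" by simp
 define X where "X t om = ctrl_X (Yp \<sigma> x) \<tau> \<xi> t om" for t om
 define Rn where "Rn = (\<integral>\<^sup>+om. rcost lam \<rho> (ctrl_X (Yp \<sigma> x) \<tau> \<xi>) om \<partial>M)"
 define Gn where "Gn = (\<integral>\<^sup>+om. gcost lam g \<tau> \<xi> om \<partial>M)"
 from adm obtain K where imp: "impulse_control M (filt M w N) \<tau> \<xi>"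
  and bnd: "AE om in M. \<forall>t\<ge>0. exp (- lam * t) * \<bar>ctrl_X (Yp \<sigma> x) \<tau> \<xi> t om\<bar> < K"
  by (auto simp: admissible_def)
 have ce: "cost M lam \<rho> g (Yp \<sigma> x) \<tau> \<xi> = Rn + Gn" unfolding Rn_def Gn_def by (rule cost_eq[OF imp]) simp
 have "Rn + Gn < \<top>" using lt unfolding ce by (rule less_trans) simp
 then have fin: "Rn < \<top>" "Gn < \<top>" by (simp_all add: ennreal_add_less_top)
 have "ennreal (enn2real Rn + enn2real Gn) < ennreal (h x)"
  using lt fin unfolding ce by (simp add: ennreal_plus)
 then have c0: "enn2real Rn + enn2real Gn < h x" by (subst (asm) ennreal_less_iff) auto
 define \<delta> where "\<delta> = h x - (enn2real Rn + enn2real Gn)"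
 have \<delta>: "0 < \<delta>" using c0 by (simp add: \<delta>_def)
 define \<kappa> where "\<kappa> = \<bar>h \<rho>\<bar> + KK"
 have \<kappa>: "0 < \<kappa>" using KK(1) by (simp add: \<kappa>_def add_nonneg_pos)
 have h\<kappa>: "h y \<le> \<kappa> + \<kappa> * (y - \<rho>)\<^sup>2" for y
 proof -
  have z: "\<bar>y - \<rho>\<bar> \<le> 1 + (y - \<rho>)\<^sup>2"
   using zero_le_power2[of "\<bar>y - \<rho>\<bar> - 1"] by (simp add: power2_diff) (smt (verit) zero_le_power2)
  have "h y \<le> \<bar>h \<rho>\<bar> + KK * \<bar>y - \<rho>\<bar>" using h_lip[of y \<rho>] by simp
  also have "\<dots> \<le> \<bar>h \<rho>\<bar> + KK * (1 + (y - \<rho>)\<^sup>2)" using z KK(1) by (intro add_left_mono mult_left_mono) auto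
  also have "\<dots> \<le> \<kappa> + \<kappa> * (y - \<rho>)\<^sup>2" unfolding \<kappa>_def by (simp add: distrib_left distrib_right)
  finally show ?thesis .
 qed
 define s where "s t = (\<integral>\<^sup>+om. ennreal (exp (- lam * t) * (X t om - \<rho>)\<^sup>2) \<partial>M)" for t
 have sT: "ennreal \<delta> \<le> ennreal (exp (- lam * T) * \<kappa>) + ennreal \<kappa> * s T" if T: "0 < T" for T
 proof -
  have XM [measurable]: "X T \<in> borel_measurable M"
   using measurable_Ft_M[OF ctrl_X_Ft[OF imp less_imp_le[OF T], of \<sigma> x]] by (simp add: X_def[abs_def])
  have Xb: "AE om in M. \<bar>X T om\<bar> \<le> exp (lam * T) * \<bar>K\<bar>"
   using bnd
  proof eventually_elim
   case (elim om)
   then have "exp (- lam * T) * \<bar>X T om\<bar> < K" using T by (simp add: X_def)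
   then have "exp (lam * T) * (exp (- lam * T) * \<bar>X T om\<bar>) \<le> exp (lam * T) * \<bar>K\<bar>" by (intro mult_left_mono) auto
   moreover have "exp (lam * T) * (exp (- lam * T) * \<bar>X T om\<bar>) = \<bar>X T om\<bar>" by (simp add: exp_minus)
   ultimately show ?case by linarith
  qed
  let ?K = "exp (lam * T) * \<bar>K\<bar>"
  have i\<phi>: "integrable M (\<lambda>om. (X T om - \<rho>)\<^sup>2)"
  proof (rule integrable_const_bound[where B="(?K + \<bar>\<rho>\<bar>)\<^sup>2"])
   show "AE om in M. norm ((X T om - \<rho>)\<^sup>2) \<le> (?K + \<bar>\<rho>\<bar>)\<^sup>2"
    using Xb
   proof eventually_elim
    case (elim om)
    then have "\<bar>X T om - \<rho>\<bar> \<le> \<bar>?K + \<bar>\<rho>\<bar>\<bar>" by linarith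
    then have "(X T om - \<rho>)\<^sup>2 \<le> (?K + \<bar>\<rho>\<bar>)\<^sup>2" by (simp only: abs_le_square_iff)
    then show ?case by simp
   qed
  qed measurable
  have ih: "integrable M (\<lambda>om. h (X T om))"
  proof (rule integrable_const_bound[where B="\<bar>h 0\<bar> + KK * ?K"])
   show "AE om in M. norm (h (X T om)) \<le> \<bar>h 0\<bar> + KK * ?K"
    using Xb
   proof eventually_elim
    case (elim om)
    then have "KK * \<bar>X T om\<bar> \<le> KK * ?K" using KK(1) by (intro mult_left_mono) auto
    then show ?case using h_linear_bound[of "X T om"] by simp
   qed
  qed measurable
  have "expectation (\<lambda>om. h (X T om)) \<le> expectation (\<lambda>om. \<kappa> + \<kappa> * (X T om - \<rho>)\<^sup>2)"
   by (rule integral_mono[OF ih]) (use i\<phi> h\<kappa> in auto)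
  also have "\<dots> = \<kappa> + \<kappa> * expectation (\<lambda>om. (X T om - \<rho>)\<^sup>2)" using i\<phi> by (simp add: prob_space)
  finally have "exp (- lam * T) * expectation (\<lambda>om. h (X T om)) \<le> exp (- lam * T) * (\<kappa> + \<kappa> * expectation (\<lambda>om. (X T om - \<rho>)\<^sup>2))"
   by (intro mult_left_mono) auto
  moreover have "\<delta> \<le> exp (- lam * T) * expectation (\<lambda>om. h (X T om))"
   using lower_T[OF imp bnd fin(1)[unfolded Rn_def] fin(2)[unfolded Gn_def] T] unfolding \<delta>_def Rn_def Gn_def X_def by linarith
  ultimately have "\<delta> \<le> exp (- lam * T) * \<kappa> + \<kappa> * (exp (- lam * T) * expectation (\<lambda>om. (X T om - \<rho>)\<^sup>2))"
   by (simp add: algebra_simps)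
  then have "ennreal \<delta> \<le> ennreal (exp (- lam * T) * \<kappa> + \<kappa> * (exp (- lam * T) * expectation (\<lambda>om. (X T om - \<rho>)\<^sup>2)))" by (rule ennreal_leI)
  also have "\<dots> = ennreal (exp (- lam * T) * \<kappa>) + ennreal \<kappa> * ennreal (exp (- lam * T) * expectation (\<lambda>om. (X T om - \<rho>)\<^sup>2))"
   using \<kappa> by (subst ennreal_plus) (auto simp: ennreal_mult' less_imp_le intro!: mult_nonneg_nonneg Bochner_Integration.integral_nonneg)
  also have "ennreal (exp (- lam * T) * expectation (\<lambda>om. (X T om - \<rho>)\<^sup>2)) = s T"
  proof -
   have "s T = ennreal (expectation (\<lambda>om. exp (- lam * T) * (X T om - \<rho>)\<^sup>2))"
    unfolding s_def by (rule nn_integral_eq_integral) (use i\<phi> in auto)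
   then show ?thesis by simp
  qed
  finally show ?thesis .
 qed
 obtain T0 where T0: "0 < T0" "\<And>T. T \<ge> T0 \<Longrightarrow> exp (- lam * T) * \<kappa> \<le> \<delta> / 2"
 proof
  let ?T0 = "max 1 (2 * \<kappa> / (\<delta> * lam))"
  show "0 < ?T0" by simp
  fix T assume T: "T \<ge> ?T0"
  have "2 * \<kappa> / (\<delta> * lam) \<le> T" using T by simp
  then have "2 * \<kappa> / \<delta> \<le> lam * T" using \<delta> lam by (simp add: field_simps)
  also have "\<dots> \<le> exp (lam * T)" using exp_ge_add_one_self[of "lam * T"] by linarith
  finally have "\<kappa> \<le> \<delta> / 2 * exp (lam * T)" using \<delta> by (simp add: field_simps)
  then show "exp (- lam * T) * \<kappa> \<le> \<delta> / 2" by (simp add: exp_minus field_simps)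
 qed
 have s_ge: "ennreal (\<delta> / 2) \<le> ennreal \<kappa> * s T" if "T \<ge> T0" for T
 proof -
  have "ennreal (\<delta> / 2) + ennreal (\<delta> / 2) = ennreal \<delta>" using \<delta> by (subst ennreal_plus[symmetric]) auto
  also have "\<dots> \<le> ennreal (exp (- lam * T) * \<kappa>) + ennreal \<kappa> * s T" using sT[of T] T0(1) that by simp
  also have "\<dots> \<le> ennreal (\<delta> / 2) + ennreal \<kappa> * s T" by (intro add_right_mono ennreal_leI T0(2) that)
  finally show ?thesis by (subst (asm) ennreal_add_left_cancel_le) auto
 qed
 obtain P where Pm: "(\<lambda>(t, om). P t om :: real) \<in> borel_measurable (lborel \<Otimes>\<^sub>M M)"
  and P: "AE om in M. \<forall>t\<ge>0. P t om = exp (- lam * t) * (ctrl_X (Yp \<sigma> x) \<tau> \<xi> t om - \<rho>)\<^sup>2"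
  using rcost_representation[OF imp] by blast
 interpret PS: pair_sigma_finite lborel M by unfold_locales
 have m2: "(\<lambda>z. indicator {0..} (fst z) * ennreal (P (fst z) (snd z))) \<in> borel_measurable (lborel \<Otimes>\<^sub>M M)"
 proof -
  have "(\<lambda>z. P (fst z) (snd z)) \<in> borel_measurable (lborel \<Otimes>\<^sub>M M)" using Pm by (simp add: split_beta')
  then show ?thesis by measurable
 qed
 have "Rn = (\<integral>\<^sup>+om. \<integral>\<^sup>+t. indicator {0..} t * ennreal (P t om) \<partial>lborel \<partial>M)"
  unfolding Rn_def
 proof (rule nn_integral_cong_AE)
  show "AE om in M. rcost lam \<rho> (ctrl_X (Yp \<sigma> x) \<tau> \<xi>) om = (\<integral>\<^sup>+t. indicator {0..} t * ennreal (P t om) \<partial>lborel)"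
   using P
  proof eventually_elim
   case (elim om)
   then show ?case unfolding rcost_def by (intro nn_integral_cong) (auto split: split_indicator)
  qed
 qed
 also have "\<dots> = (\<integral>\<^sup>+t. \<integral>\<^sup>+om. indicator {0..} t * ennreal (P t om) \<partial>M \<partial>lborel)"
  using PS.Fubini[OF m2] by simp
 also have "\<dots> \<ge> (\<integral>\<^sup>+t. indicator {T0..T0 + real n} t * s t \<partial>lborel)" for n
 proof (rule nn_integral_mono)
  fix t
  show "indicator {T0..T0 + real n} t * s t \<le> (\<integral>\<^sup>+om. indicator {0..} t * ennreal (P t om) \<partial>M)"
  proof (cases "t \<in> {T0..T0 + real n}")
   case True
   then have t: "0 \<le> t" using T0(1) by simp
   have "s t = (\<integral>\<^sup>+om. ennreal (P t om) \<partial>M)"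
    unfolding s_def X_def
    by (rule nn_integral_cong_AE) (use P in \<open>eventually_elim, simp add: t\<close>)
   then show ?thesis using True t by simp
  qed simp
 qed
 finally have Rn_ge: "(\<integral>\<^sup>+t. indicator {T0..T0 + real n} t * s t \<partial>lborel) \<le> Rn" for n .
 have big: "ennreal (real n * (\<delta> / 2)) \<le> ennreal \<kappa> * Rn" for n
 proof -
  have "ennreal (real n * (\<delta> / 2)) = ennreal (real n) * ennreal (\<delta> / 2)" by (rule ennreal_mult) (use \<delta> in auto)
  also have "\<dots> = (\<integral>\<^sup>+t. indicator {T0..T0 + real n} t * ennreal (\<delta> / 2) \<partial>lborel)"
   by (subst nn_integral_multc) simp_all
  also have "\<dots> \<le> (\<integral>\<^sup>+t. ennreal \<kappa> * (indicator {T0..T0 + real n} t * s t) \<partial>lborel)"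
   by (rule nn_integral_mono) (use s_ge in \<open>auto split: split_indicator\<close>)
  also have "\<dots> \<le> ennreal \<kappa> * (\<integral>\<^sup>+t. indicator {T0..T0 + real n} t * s t \<partial>lborel)"
  proof (rule eq_refl, rule nn_integral_cmult)
   have "(\<lambda>t. \<integral>\<^sup>+om. indicator {0..} t * ennreal (P t om) \<partial>M) \<in> borel_measurable lborel"
    using borel_measurable_nn_integral[of "\<lambda>t om. indicator {0..} t * ennreal (P t om)" lborel] m2 by (simp add: split_beta')
   then have "(\<lambda>t. indicator {T0..T0 + real n} t * (\<integral>\<^sup>+om. indicator {0..} t * ennreal (P t om) \<partial>M)) \<in> borel_measurable lborel" by measurable
   also have "(\<lambda>t. indicator {T0..T0 + real n} t * (\<integral>\<^sup>+om. indicator {0..} t * ennreal (P t om) \<partial>M)) = (\<lambda>t. indicator {T0..T0 + real n} t * s t)"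
   proof (rule ext)
    fix t
    show "indicator {T0..T0 + real n} t * (\<integral>\<^sup>+om. indicator {0..} t * ennreal (P t om) \<partial>M) = indicator {T0..T0 + real n} t * s t"
    proof (cases "t \<in> {T0..T0 + real n}")
     case True
     then have t: "0 \<le> t" using T0(1) by simp
     have "s t = (\<integral>\<^sup>+om. ennreal (P t om) \<partial>M)"
      unfolding s_def X_def
      by (rule nn_integral_cong_AE) (use P in \<open>eventually_elim, simp add: t\<close>)
     then show ?thesis using True t by simp
    qed simp
   qed
   finally show "(\<lambda>t. indicator {T0..T0 + real n} t * s t) \<in> borel_measurable lborel" .
  qed
  also have "\<dots> \<le> ennreal \<kappa> * Rn" by (intro mult_left_mono Rn_ge) simp
  finally show ?thesis .
 qed
 have "ennreal \<kappa> * Rn = ennreal (\<kappa> * enn2real Rn)" using fin(1) \<kappa> by (simp add: ennreal_mult')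
 then have le: "real n * (\<delta> / 2) \<le> \<kappa> * enn2real Rn" for n
  using big[of n] \<kappa> by (simp add: ennreal_le_iff)
 obtain n :: nat where "\<kappa> * enn2real Rn / (\<delta> / 2) < real n" using reals_Archimedean2 by blast
 then have "\<kappa> * enn2real Rn < real n * (\<delta> / 2)" using \<delta> by (simp add: field_simps)
 then show False using le[of n] by linarith
qed

end

section \<open>Paths of the band policy\<close>

lemma band_time_le: "0 \<le> t \<Longrightarrow> P t \<Longrightarrow> y t + S \<notin> {a<..<b} \<Longrightarrow> band_time a b y P S \<le> ennreal t"
 unfolding band_time_def by (rule Inf_lower) blast

text \<open>Times of the set approach the infimum from the right, and the complement of the open
  band is closed. The weak constraint \<open>p \<le> ennreal t\<close> survives the limit; a strict
  one would not.\<close>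

lemma band_time_attained:
 fixes p :: ennreal
 assumes rc: "rcont y" and fin: "band_time a b y (\<lambda>t. p \<le> ennreal t) S \<noteq> \<top>"
 obtains t where "0 \<le> t" "band_time a b y (\<lambda>t. p \<le> ennreal t) S = ennreal t" "p \<le> ennreal t" "y t + S \<notin> {a<..<b}"
proof -
 define A where "A = {t. 0 \<le> t \<and> p \<le> ennreal t \<and> y t + S \<notin> {a<..<b}}"
 have bt: "band_time a b y (\<lambda>t. p \<le> ennreal t) S = Inf (ennreal ` A)"
  unfolding band_time_def A_def by (rule arg_cong[where f=Inf]) auto
 have ne: "A \<noteq> {}" using fin unfolding bt by auto
 have bdd: "bdd_below A" unfolding A_def by (rule bdd_belowI[of _ 0]) simp
 define t where "t = Inf A"
 have "\<exists>s. s \<in> A \<and> s < t + 1 / real (Suc k)" for k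
  using cInf_lessD[OF ne, of "t + 1 / real (Suc k)"] unfolding t_def by auto
 then obtain s where s: "\<And>k. s k \<in> A" "\<And>k. s k < t + 1 / real (Suc k)" by metis
 have st: "t \<le> s k" for k unfolding t_def by (rule cInf_lower[OF s(1) bdd])
 have t0: "0 \<le> t" unfolding t_def by (rule cInf_greatest[OF ne]) (simp add: A_def)
 have "(\<lambda>k. t + 1 / real (Suc k)) \<longlonglongrightarrow> t + 0"
  by (intro tendsto_intros LIMSEQ_Suc[OF lim_const_over_n])
 then have l1: "(\<lambda>k. t + 1 / real (Suc k)) \<longlonglongrightarrow> t" by simp
 have lim: "s \<longlonglongrightarrow> t"
  by (rule tendsto_sandwich[OF _ _ tendsto_const[of t] l1]) (intro always_eventually allI st less_imp_le s(2))+
 have "p \<le> ennreal t"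
  by (rule LIMSEQ_le_const[OF tendsto_ennrealI[OF lim]]) (use s(1) in \<open>auto simp: A_def\<close>)
 moreover have "y t + S \<notin> {a<..<b}"
 proof
  assume "y t + S \<in> {a<..<b}"
  moreover have "(\<lambda>k. y (s k) + S) \<longlonglongrightarrow> y t + S" by (intro tendsto_intros rcont_seq[OF rc t0 lim st])
  ultimately have "eventually (\<lambda>k. y (s k) + S \<in> {a<..<b}) sequentially" by (intro topological_tendstoD) auto
  then obtain k where "y (s k) + S \<in> {a<..<b}" by (auto simp: eventually_sequentially)
  then show False using s(1)[of k] by (simp add: A_def)
 qed
 moreover from calculation t0 have tA: "t \<in> A" by (simp add: A_def)
 have "Inf (ennreal ` A) = ennreal t"
 proof (rule antisym)
  show "Inf (ennreal ` A) \<le> ennreal t" by (rule Inf_lower) (use tA in simp)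
  show "ennreal t \<le> Inf (ennreal ` A)"
  proof (rule Inf_greatest)
   fix z assume "z \<in> ennreal ` A"
   then obtain u where "u \<in> A" "z = ennreal u" by blast
   then show "ennreal t \<le> z" unfolding t_def by (simp add: ennreal_leI cInf_lower bdd)
  qed
 qed
 ultimately show thesis using that t0 bt by simp
qed

context noise
begin

lemma N_mono: "good om \<Longrightarrow> s \<le> t \<Longrightarrow> N s om \<le> N t om"
 unfolding cpoisson_def by (rule sum_mono2) (auto simp: good_def intro: less_imp_le order_trans)

lemma N_left_const:
 assumes g: "good om" and s: "0 < s"
 shows "\<exists>r. 0 \<le> r \<and> r < s \<and> (\<forall>u. r \<le> u \<and> u < s \<longrightarrow> N u om = N r om)"
proof -
 define A where "A = {k. arrival E k om < s}"
 have fin: "finite A"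
 proof -
  have "finite {k. arrival E k om \<le> s}" using g by (simp add: good_def)
  then show ?thesis unfolding A_def by (rule rev_finite_subset) auto
 qed
 define r where "r = Max (insert 0 ((\<lambda>k. arrival E k om) ` A))"
 have r: "0 \<le> r" "r < s" and rA: "\<And>k. k \<in> A \<Longrightarrow> arrival E k om \<le> r"
  unfolding r_def using fin s by (auto simp: A_def)
 have c: "N u om = (\<Sum>k\<in>A. J k om)" if "r \<le> u" "u < s" for u
 proof -
  have "{k. arrival E k om \<le> u} = A" using that rA unfolding A_def by fastforce
  then show ?thesis by (simp add: cpoisson_def)
 qed
 then show ?thesis using r by (intro exI[of _ r]) simp
qed

end

context cnoise
begin

text \<open>All jumps of \<open>N\<close> go upwards, so the path is upper semicontinuous: values
  close to a level along convergent times force the value at the limit time to reach that level. For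
  levels approached from above this fails.\<close>

lemma Yp_usc:
 assumes g: "good om" and s: "0 \<le> s" "X \<longlonglongrightarrow> s" "\<And>i. 0 \<le> X i" and B: "B' \<longlonglongrightarrow> B" "\<And>i. B' i \<le> Yp \<sigma> x (X i) om"
 shows "B \<le> Yp \<sigma> x s om"
proof -
 have sp: "om \<in> space M" using g by (simp add: good_def)
 obtain r where r: "r > s" "\<forall>u. s \<le> u \<and> u < r \<longrightarrow> N u om = N s om" using N_right_const[OF g s(1)] by blast
 have "eventually (\<lambda>i. X i < r) sequentially" using s(2) r(1) by (rule order_tendstoD)
 then have "eventually (\<lambda>i. B' i \<le> x + \<sigma> * w (X i) om + N s om) sequentially"
 proof eventually_elim
  case (elim i)
  have "N (X i) om \<le> N s om"
  proof (cases "X i \<le> s")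
   case True then show ?thesis by (rule N_mono[OF g])
  next
   case False then show ?thesis using r(2)[rule_format, of "X i"] elim by simp
  qed
  then show ?case using B(2)[of i] by (simp add: Yp_def)
 qed
 moreover have "(\<lambda>i. x + \<sigma> * w (X i) om + N s om) \<longlonglongrightarrow> Yp \<sigma> x s om"
  unfolding Yp_def by (intro tendsto_intros w_tendsto[OF sp s(1,2,3)])
 ultimately show ?thesis using tendsto_le[OF _ _ B(1)] by auto
qed

lemma Yp_left_convergent:
 assumes g: "good om" and X: "incseq X" "\<And>i. 0 \<le> X i" "\<And>i. X i \<le> T"
 shows "convergent (\<lambda>i. Yp \<sigma> x (X i) om)"
proof -
 have sp: "om \<in> space M" using g by (simp add: good_def)
 obtain s where s: "X \<longlonglongrightarrow> s" "\<forall>i. X i \<le> s" using incseq_convergent[OF X(1), of T] X(3) by blast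
 have s0: "0 \<le> s" using X(2)[of 0] s(2) by (meson order_trans)
 have "incseq (\<lambda>i. N (X i) om)" using X(1) N_mono[OF g] by (auto simp: incseq_def)
 then obtain l where "(\<lambda>i. N (X i) om) \<longlonglongrightarrow> l"
  using incseq_convergent[of "\<lambda>i. N (X i) om" "N T om"] N_mono[OF g X(3)] by blast
 then have "(\<lambda>i. Yp \<sigma> x (X i) om) \<longlonglongrightarrow> x + \<sigma> * w s om + l"
  unfolding Yp_def by (intro tendsto_intros w_tendsto[OF sp s0 s(1) X(2)])
 then show ?thesis by (rule convergentI)
qed

end

section \<open>The band policy along a single deterministic path\<close>

text \<open>\<open>lconv\<close> expresses the existence of left limits; it serves to exclude an
  accumulation of interventions.\<close>

locale band_path =
 fixes a \<alpha> \<beta> b :: real and y :: "real \<Rightarrow> real"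
 assumes par: "a < \<alpha>" "\<alpha> \<le> \<beta>" "\<beta> < b" and rc: "rcont y"
  and lconv: "\<And>X T. incseq X \<Longrightarrow> (\<And>i. 0 \<le> X i) \<Longrightarrow> (\<And>i. X i \<le> T) \<Longrightarrow> convergent (\<lambda>i::nat. y (X i))"
begin

definition bt where "bt n = fst (band a \<alpha> \<beta> b y n)"
definition bx where "bx n = fst (snd (band a \<alpha> \<beta> b y n))"
definition bs where "bs n = (\<Sum>i<n. bx i)"
definition bp where "bp n = (if n = 0 then 0 else bt (n - 1))"

lemma band_shift: "snd (snd (band a \<alpha> \<beta> b y n)) = bs (Suc n)"
 by (induction n) (simp_all add: bs_def bx_def Let_def split_beta)

lemma bx_rec: "bx n = band_jump \<alpha> \<beta> b y (bt n) (bs n)"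
 by (cases n) (simp_all add: bx_def bt_def band_shift[symmetric] Let_def split_beta, simp add: bs_def)

lemma after_jump: "bt n \<noteq> \<top> \<Longrightarrow> y (enn2real (bt n)) + bs (Suc n) = (if y (enn2real (bt n)) + bs n \<ge> b then \<beta> else \<alpha>)"
 using bx_rec[of n] by (simp add: bs_def band_jump_def Let_def split: if_splits)

text \<open>The policy demands times strictly after the previous intervention, except for the first
  one. Both cases become the weak constraint with \<open>bp n\<close>, because right after an
  intervention the state is \<open>\<alpha>\<close> or \<open>\<beta>\<close>, inside the open band,
  and so is no exit.\<close>

lemma bt_rec: "bt n = band_time a b y (\<lambda>t. bp n \<le> ennreal t) (bs n)"
proof (cases n)
 case 0 then show ?thesis by (simp add: bt_def bp_def bs_def Let_def)
next
 case (Suc k)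
 have 1: "bt n = band_time a b y (\<lambda>t. bt k < ennreal t) (bs (Suc k))"
  by (simp add: bt_def Suc band_shift[symmetric] Let_def split_beta)
 have 2: "bt k < ennreal t \<longleftrightarrow> bt k \<le> ennreal t" if t: "0 \<le> t" "y t + bs (Suc k) \<notin> {a<..<b}" for t
 proof
  assume le: "bt k \<le> ennreal t"
  show "bt k < ennreal t"
  proof (rule ccontr)
   assume "\<not> bt k < ennreal t"
   then have e: "bt k = ennreal t" using le by simp
   then have "y t + bs (Suc k) = (if y t + bs k \<ge> b then \<beta> else \<alpha>)" using after_jump[of k] t(1) by simp
   then show False using t(2) par by (simp split: if_splits)
  qed
 qed simp
 show ?thesis unfolding 1 band_time_def unfolding bp_def Suc using 2 by (auto intro!: arg_cong[where f=Inf])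
qed

lemma bt_finite:
 assumes "bt n \<noteq> \<top>"
 obtains t where "0 \<le> t" "bt n = ennreal t" "bp n \<le> ennreal t" "y t + bs n \<notin> {a<..<b}" "y t + bs (Suc n) = (if y t + bs n \<ge> b then \<beta> else \<alpha>)"
proof -
 obtain t where t: "0 \<le> t" "bt n = ennreal t" "bp n \<le> ennreal t" "y t + bs n \<notin> {a<..<b}"
  using band_time_attained[OF rc] assms unfolding bt_rec[of n] by metis
 then show thesis using that after_jump[OF assms] by simp
qed

lemma bx_nonzero: "bt n \<noteq> \<top> \<Longrightarrow> bx n \<noteq> 0"
 by (erule bt_finite) (use par in \<open>auto simp: bs_def split: if_splits\<close>)

lemma bx_top: "bt n = \<top> \<Longrightarrow> bx n = 0" by (simp add: bx_rec band_jump_def)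

lemma bp_le_bt: "bp n \<le> bt n"
 by (cases "bt n = \<top>") (auto elim: bt_finite)

lemma bt_mono: "bt n \<le> bt (Suc n)" using bp_le_bt[of "Suc n"] by (simp add: bp_def)

lemma bt_strict:
 assumes "bt n < \<top>" shows "bt n < bt (Suc n)"
proof (cases "bt (Suc n) = \<top>")
 case False
 obtain s where s: "0 \<le> s" "bt n = ennreal s" "y s + bs (Suc n) = (if y s + bs n \<ge> b then \<beta> else \<alpha>)"
  using bt_finite[of n] assms by (metis less_irrefl)
 obtain t where t: "0 \<le> t" "bt (Suc n) = ennreal t" "y t + bs (Suc n) \<notin> {a<..<b}"
  using bt_finite[OF False] by metis
 have "s \<noteq> t" using s(3) t(3) par by (auto split: if_splits)
 then have "bt n \<noteq> bt (Suc n)" using s t by simp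
 with bt_mono[of n] show ?thesis by (rule le_neq_trans)
qed (use assms in simp)

lemma inside: "0 \<le> t \<Longrightarrow> bp n \<le> ennreal t \<Longrightarrow> ennreal t < bt n \<Longrightarrow> y t + bs n \<in> {a<..<b}"
 using band_time_le[of t "\<lambda>t. bp n \<le> ennreal t" y "bs n" a b] unfolding bt_rec[of n] by (meson not_le)

text \<open>Infinitely many interventions before \<open>T\<close> would give increasing times along
  which the path converges. But between two consecutive ones it has to move from
  \<open>\<alpha>\<close> or \<open>\<beta>\<close> out of the band, by at least
  \<open>min (\<alpha> - a) (b - \<beta>)\<close>.\<close>

lemma bt_locally_finite: "finite {n. bt n \<le> ennreal T}"
proof (rule ccontr)
 assume inf: "infinite {n. bt n \<le> ennreal T}"
 have all: "bt n \<le> ennreal T" for n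
 proof -
  obtain m where "m \<ge> n" "bt m \<le> ennreal T" using inf by (auto simp: infinite_nat_iff_unbounded_le)
  then show ?thesis using lift_Suc_mono_le[of bt, OF bt_mono] order_trans by blast
 qed
 have nt: "bt n \<noteq> \<top>" for n using all[of n] by (auto simp: top_unique)
 define X where "X n = enn2real (bt n)" for n
 have X: "bt n = ennreal (X n)" "0 \<le> X n" for n using nt[of n] by (simp_all add: X_def less_top[symmetric])
 have XT: "X n \<le> max T 0" for n
 proof -
  have "ennreal T \<le> ennreal (max T 0)" by (rule ennreal_leI) simp
  with all[of n] have "ennreal (X n) \<le> ennreal (max T 0)" unfolding X(1)[of n] by (rule order_trans)
  then show ?thesis by (subst (asm) ennreal_le_iff) auto
 qed
 have "incseq X"
 proof (rule incseq_SucI)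
  show "X n \<le> X (Suc n)" for n
   unfolding X_def by (rule enn2real_mono[OF bt_mono]) (simp add: nt less_top[symmetric])
 qed
 then have "convergent (\<lambda>i. y (X i))" by (rule lconv[OF _ X(2) XT])
 then obtain l where l: "(\<lambda>i. y (X i)) \<longlonglongrightarrow> l" by (auto simp: convergent_def)
 have "(\<lambda>i. y (X (Suc i)) - y (X i)) \<longlonglongrightarrow> l - l" by (intro tendsto_diff LIMSEQ_Suc l)
 moreover define \<delta> where "\<delta> = min (\<alpha> - a) (b - \<beta>)"
 moreover have "0 < \<delta>" using par by (simp add: \<delta>_def)
 ultimately have "eventually (\<lambda>i. dist (y (X (Suc i)) - y (X i)) (l - l) < \<delta>) sequentially" by (intro tendstoD)
 then obtain i where i: "\<bar>y (X (Suc i)) - y (X i)\<bar> < \<delta>" by (auto simp: eventually_sequentially dist_real_def)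
 have "y (X i) + bs (Suc i) = (if y (X i) + bs i \<ge> b then \<beta> else \<alpha>)" using after_jump[OF nt[of i]] by (simp add: X_def)
 moreover obtain t where "0 \<le> t" "bt (Suc i) = ennreal t" "y t + bs (Suc i) \<notin> {a<..<b}" by (rule bt_finite[OF nt])
 moreover from calculation have "X (Suc i) = t" by (simp add: X_def)
 moreover have "\<bar>y (X (Suc i)) - y (X i)\<bar> < \<alpha> - a" "\<bar>y (X (Suc i)) - y (X i)\<bar> < b - \<beta>" using i unfolding \<delta>_def by simp_all
 ultimately show False using par by (smt (verit) greaterThanLessThan_iff)
qed

end

section \<open>Exit times\<close>

lemma rcont_open:
 assumes rc: "rcont y" and s: "0 \<le> s" and A: "open A" "y s \<in> A"
 shows "\<exists>r>s. \<forall>u. s \<le> u \<and> u < r \<longrightarrow> y u \<in> A"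
proof -
 have "(y \<longlongrightarrow> y s) (at s within {s..})" using rc s by (simp add: rcont_def continuous_within)
 then have "eventually (\<lambda>u. y u \<in> A) (at s within {s..})" by (rule topological_tendstoD[OF _ A])
 then obtain d where d: "d > 0" "\<And>u. u \<in> {s..} \<Longrightarrow> u \<noteq> s \<Longrightarrow> dist u s < d \<Longrightarrow> y u \<in> A" unfolding eventually_at by blast
 have "y u \<in> A" if "s \<le> u" "u < s + d" for u
  using that d(2)[of u] A(2) by (cases "u = s") (simp_all add: dist_real_def)
 then show ?thesis using d(1) by (intro exI[of _ "s + d"]) simp
qed

text \<open>Countably many times that suffice to approach each point of \<open>[0, t]\<close> from
  the right; \<open>t\<close> is added because no time beyond it may be used.\<close>

definition Qs :: "real \<Rightarrow> real set" where "Qs t = (\<rat> \<inter> {0..t}) \<union> {t}"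

lemma countable_Qs: "countable (Qs t)"
 unfolding Qs_def by (intro countable_Un countable_Int1 countable_rat) simp

lemma Qs_range: "0 \<le> t \<Longrightarrow> s \<in> Qs t \<Longrightarrow> 0 \<le> s \<and> s \<le> t" by (auto simp: Qs_def)

lemma Qs_right:
 assumes "0 \<le> s" "s \<le> t" "s < r"
 obtains u where "u \<in> Qs t" "s \<le> u" "u < r"
proof (cases "s = t")
 case True then show ?thesis using that[of t] assms by (simp add: Qs_def)
next
 case False
 then have "s < min r t" using assms by simp
 then obtain u where "u \<in> \<rat>" "s < u" "u < min r t" using Rats_dense_in_real by blast
 then show ?thesis using that[of u] assms by (simp add: Qs_def)
qed

lemma pred_countable_Bex: "countable X \<Longrightarrow> (\<And>i. i \<in> X \<Longrightarrow> Measurable.pred M (\<lambda>x. P x i)) \<Longrightarrow> Measurable.pred M (\<lambda>x. \<exists>i\<in>X. P x i)"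
 unfolding pred_def by (rule sets.sets_Collect_countable_Ex')

lemma pred_constant: "Measurable.pred M (\<lambda>_. P)" by simp

context cnoise
begin

text \<open>Reduces leaving the band by time \<open>t\<close> to countably many times. At the upper
  level it is enough to come arbitrarily close, by upper semicontinuity. At the lower level it is
  not, since the path may approach \<open>a\<close> and then jump up; closeness is therefore
  demanded on an interval \<open>[q, r]\<close> on which \<open>N\<close> is constant, so that the
  path is continuous there.\<close>

lemma exit_by_iff:
 fixes p :: ennreal
 assumes g: "good om" and t: "0 \<le> t"
  and st: "p = 0 \<or> p = \<top> \<or> Yp \<sigma> x (enn2real p) om + S \<in> {a<..<b}"
 shows "band_time a b (\<lambda>t. Yp \<sigma> x t om) (\<lambda>t. p \<le> ennreal t) S \<le> ennreal t \<longleftrightarrow>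
  (\<forall>k. \<exists>s\<in>Qs t. p \<le> ennreal s \<and> b - 1 / real (Suc k) < Yp \<sigma> x s om + S) \<or>
  (\<exists>q\<in>Qs t. \<exists>r\<in>Qs t. q \<le> r \<and> p \<le> ennreal q \<and> N q om = N r om \<and>
    (\<forall>k. \<exists>s\<in>Qs r. q \<le> s \<and> Yp \<sigma> x s om + S < a + 1 / real (Suc k)))"
  (is "?bt \<le> _ \<longleftrightarrow> ?U \<or> ?L")
proof
 note rc = Yp_rcont[OF g, of \<sigma> x]
 have sp: "om \<in> space M" using g by (simp add: good_def)
 {
  assume le: "?bt \<le> ennreal t"
  then have "?bt \<noteq> \<top>" by (auto simp: top_unique)
  then obtain s where s: "0 \<le> s" "?bt = ennreal s" "p \<le> ennreal s" "Yp \<sigma> x s om + S \<notin> {a<..<b}"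
   using band_time_attained[OF rc] by metis
  have sT: "s \<le> t" using le s(1,2) t by simp
  consider "b \<le> Yp \<sigma> x s om + S" | "Yp \<sigma> x s om + S \<le> a" using s(4) by force
  then show "?U \<or> ?L"
  proof cases
   case 1
   have "\<exists>s\<in>Qs t. p \<le> ennreal s \<and> b - 1 / real (Suc k) < Yp \<sigma> x s om + S" for k
   proof -
    have "b - 1 / real (Suc k) - S < Yp \<sigma> x s om" using 1 by (smt (verit) divide_pos_pos of_nat_0_less_iff zero_less_Suc)
    then obtain r where r: "r > s" "\<And>u. s \<le> u \<Longrightarrow> u < r \<Longrightarrow> Yp \<sigma> x u om \<in> {b - 1 / real (Suc k) - S <..}"
     using rcont_open[OF rc s(1), of "{b - 1 / real (Suc k) - S <..}"] by auto
    obtain u where u: "u \<in> Qs t" "s \<le> u" "u < r" using Qs_right[OF s(1) sT r(1)] .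
    have "p \<le> ennreal u" using s(3) u(2) by (meson ennreal_leI order_trans)
    moreover have "b - 1 / real (Suc k) < Yp \<sigma> x u om + S" using r(2)[OF u(2,3)] unfolding greaterThan_iff by linarith
    ultimately show ?thesis using u(1) by blast
   qed
   then show ?thesis by blast
  next
   case 2
   obtain r0 where r0: "r0 > s" "\<forall>u. s \<le> u \<and> u < r0 \<longrightarrow> N u om = N s om" using N_right_const[OF g s(1)] by blast
   obtain r where r: "r \<in> Qs t" "s \<le> r" "r < r0" using Qs_right[OF s(1) sT r0(1)] .
   have Nr: "N r om = N s om" using r0(2) r by blast
   have near: "\<exists>u\<in>Qs r. s \<le> u \<and> Yp \<sigma> x u om + S < a + 1 / real (Suc k)" for k
   proof -
    have "Yp \<sigma> x s om < a + 1 / real (Suc k) - S" using 2 by (smt (verit) divide_pos_pos of_nat_0_less_iff zero_less_Suc)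
    then obtain r1 where r1: "r1 > s" "\<And>u. s \<le> u \<Longrightarrow> u < r1 \<Longrightarrow> Yp \<sigma> x u om \<in> {..<a + 1 / real (Suc k) - S}"
     using rcont_open[OF rc s(1), of "{..<a + 1 / real (Suc k) - S}"] by auto
    obtain u where u: "u \<in> Qs r" "s \<le> u" "u < r1" using Qs_right[OF s(1) r(2) r1(1)] .
    moreover have "Yp \<sigma> x u om + S < a + 1 / real (Suc k)" using r1(2)[OF u(2,3)] unfolding lessThan_iff by linarith
    ultimately show ?thesis by blast
   qed
   have "?L"
   \<comment> \<open>Here \<open>st\<close> enters: a restart inside the band is no exit, so
     equality is possible only at time 0, where \<open>q = 0\<close> is available in
     \<open>Qs t\<close>.\<close>
   proof (cases "p = ennreal s")
    case True
    have "s = 0"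
    proof -
     have "p = 0 \<or> Yp \<sigma> x s om + S \<in> {a<..<b}" using st True s(1) by simp
     then show ?thesis using s(4) True s(1) by auto
    qed
    then have "(0::real) \<in> Qs t" "p \<le> ennreal 0" "N 0 om = N r om" "0 \<le> r" using t True Nr r(2) by (simp_all add: Qs_def)
    then show ?thesis using near r(1) \<open>s = 0\<close> by blast
   next
    case False
    define p' where "p' = enn2real p"
    have "p \<noteq> \<top>" using s(3) by (auto simp: top_unique)
    then have pf: "p = ennreal p'" "0 \<le> p'" by (simp_all add: p'_def less_top[symmetric])
    have ps: "p' < s" using False s(1,3) pf by (simp add: less_le)
    then have s0: "0 < s" using pf(2) by linarith
    obtain l where l: "0 \<le> l" "l < s" "\<And>u. l \<le> u \<Longrightarrow> u < s \<Longrightarrow> N u om = N l om" using N_left_const[OF g s0] by blast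
    show ?thesis
    proof (cases "N l om = N s om")
     case True
     obtain q where q: "q \<in> \<rat>" "max l p' < q" "q < s" using Rats_dense_in_real[of "max l p'" s] l(2) ps by auto
     have "q \<in> Qs t" using q l sT by (simp add: Qs_def)
     moreover have "p \<le> ennreal q" unfolding pf(1) using q(2) by (intro ennreal_leI) simp
     moreover have "N q om = N r om" using l(3)[of q] q True Nr by simp
     moreover have "q \<le> r" using q r by simp
     moreover have "\<exists>u\<in>Qs r. q \<le> u \<and> Yp \<sigma> x u om + S < a + 1 / real (Suc k)" for k
      using near[of k] q(3) by (meson less_imp_le order_trans)
     ultimately show ?thesis using r(1) by blast
    next
     \<comment> \<open>\<open>N\<close> jumps at \<open>s\<close> and the path is still at or below
       \<open>a\<close>, so just before \<open>s\<close> it was strictly below \<open>a\<close>. A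
       single rational time \<open>u\<close> before \<open>s\<close> then serves as a degenerate
       interval.\<close>
     case False
     then have Nl: "N l om < N s om" using N_mono[OF g, of l s] l(2) by simp
     have "((\<lambda>u. x + \<sigma> * w u om + N l om + S) \<longlongrightarrow> x + \<sigma> * w s om + N l om + S) (at s within {0..})"
      using w_cont[OF sp] s(1) by (intro tendsto_intros) (simp add: continuous_on_def)
     moreover have "x + \<sigma> * w s om + N l om + S < a" using Nl 2 by (simp add: Yp_def)
     ultimately have "eventually (\<lambda>u. x + \<sigma> * w u om + N l om + S < a) (at s within {0..})" by (rule order_tendstoD)
     then obtain e where e: "e > 0" "\<And>u. u \<in> {0..} \<Longrightarrow> u \<noteq> s \<Longrightarrow> dist u s < e \<Longrightarrow> x + \<sigma> * w u om + N l om + S < a"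
      unfolding eventually_at by blast
     obtain u where u: "u \<in> \<rat>" "max (max l p') (s - e) < u" "u < s" using Rats_dense_in_real[of "max (max l p') (s - e)" s] l(2) ps e(1) by auto
     have "x + \<sigma> * w u om + N l om + S < a" by (rule e(2)) (use u l in \<open>auto simp: dist_real_def\<close>)
     then have *: "Yp \<sigma> x u om + S < a" using l(3)[of u] u by (simp add: Yp_def)
     have "Yp \<sigma> x u om + S < a + 1 / real (Suc k)" for k using * by (smt (verit) divide_pos_pos of_nat_0_less_iff zero_less_Suc)
     moreover have "u \<in> Qs t" "u \<in> Qs u" using u l sT by (simp_all add: Qs_def)
     moreover have "p \<le> ennreal u" unfolding pf(1) using u(2) by (intro ennreal_leI) simp
     ultimately show ?thesis by blast
    qed
   qed
   then show ?thesis ..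
  qed
 }
 have inv: "(\<lambda>k. 1 / real (Suc k)) \<longlonglongrightarrow> 0" by (rule LIMSEQ_Suc[OF lim_const_over_n])
 assume "?U \<or> ?L"
 then obtain s where "0 \<le> s" "s \<le> t" "p \<le> ennreal s" "Yp \<sigma> x s om + S \<notin> {a<..<b}"
 proof
  assume ?U
  then obtain u where u: "\<And>k. u k \<in> Qs t" "\<And>k. p \<le> ennreal (u k)" "\<And>k. b - 1 / real (Suc k) < Yp \<sigma> x (u k) om + S" by metis
  have ur: "u k \<in> {0..t}" for k using Qs_range[OF t u(1)] by simp
  obtain s \<phi> where s: "s \<in> {0..t}" "strict_mono \<phi>" "(u \<circ> \<phi>) \<longlonglongrightarrow> s"
   using compact_Icc[of 0 t, THEN compact_imp_seq_compact] ur unfolding seq_compact_def by metis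
  have "p \<le> ennreal s" by (rule LIMSEQ_le_const[OF tendsto_ennrealI[OF s(3)]]) (use u(2) in simp)
  moreover have "b - 0 - S \<le> Yp \<sigma> x s om"
  proof (rule Yp_usc[OF g _ s(3)])
   show "(\<lambda>i. b - 1 / real (Suc (\<phi> i)) - S) \<longlonglongrightarrow> b - 0 - S"
    using LIMSEQ_subseq_LIMSEQ[OF inv s(2)] by (intro tendsto_intros) (simp add: comp_def)
   show "b - 1 / real (Suc (\<phi> i)) - S \<le> Yp \<sigma> x ((u \<circ> \<phi>) i) om" for i using u(3)[of "\<phi> i"] unfolding comp_def by linarith
  qed (use s(1) ur in auto)
  ultimately show thesis using that[of s] s(1) by simp
 next
  assume ?L
  then obtain q r where qr: "q \<in> Qs t" "r \<in> Qs t" "q \<le> r" "p \<le> ennreal q" "N q om = N r om"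
   "\<forall>k. \<exists>s\<in>Qs r. q \<le> s \<and> Yp \<sigma> x s om + S < a + 1 / real (Suc k)" by blast
  then obtain u where u: "\<And>k. u k \<in> Qs r" "\<And>k. q \<le> u k" "\<And>k. Yp \<sigma> x (u k) om + S < a + 1 / real (Suc k)" by metis
  have q0: "0 \<le> q" "r \<le> t" using Qs_range[OF t] qr(1,2) by auto
  have ur: "u k \<in> {q..r}" for k using Qs_range[OF _ u(1), of k] u(2)[of k] q0 qr(3) by simp
  obtain s \<phi> where s: "s \<in> {q..r}" "strict_mono \<phi>" "(u \<circ> \<phi>) \<longlonglongrightarrow> s"
   using compact_Icc[of q r, THEN compact_imp_seq_compact] ur unfolding seq_compact_def by metis
  have Nc: "N v om = N q om" if "v \<in> {q..r}" for v
   using N_mono[OF g, of q v] N_mono[OF g, of v r] that qr(5) by simp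
  have "(\<lambda>i. x + \<sigma> * w ((u \<circ> \<phi>) i) om + N q om + S) \<longlonglongrightarrow> x + \<sigma> * w s om + N q om + S"
   using s(1) q0 ur by (intro tendsto_intros w_tendsto[OF sp _ s(3)]) (auto intro: order_trans)
  moreover have "(\<lambda>i. a + 1 / real (Suc (\<phi> i))) \<longlonglongrightarrow> a + 0"
   using LIMSEQ_subseq_LIMSEQ[OF inv s(2)] by (intro tendsto_intros) (simp add: comp_def)
  ultimately have "x + \<sigma> * w s om + N q om + S \<le> a + 0"
  proof (rule LIMSEQ_le)
   show "\<exists>N0. \<forall>n\<ge>N0. x + \<sigma> * w ((u \<circ> \<phi>) n) om + N q om + S \<le> a + 1 / real (Suc (\<phi> n))"
   proof (intro exI allI impI)
    fix n show "x + \<sigma> * w ((u \<circ> \<phi>) n) om + N q om + S \<le> a + 1 / real (Suc (\<phi> n))"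
     using u(3)[of "\<phi> n"] Nc[OF ur[of "\<phi> n"]] unfolding Yp_def comp_def by linarith
   qed
  qed
  then have "Yp \<sigma> x s om + S \<le> a" using Nc[OF s(1)] by (simp add: Yp_def)
  moreover have "p \<le> ennreal s" using qr(4) s(1) by (meson atLeastAtMost_iff ennreal_leI order_trans)
  ultimately show thesis using that[of s] s(1) q0 by simp
 qed
 then show "?bt \<le> ennreal t" using band_time_le[of s "\<lambda>t. p \<le> ennreal t" "\<lambda>t. Yp \<sigma> x t om" S a b] by (meson ennreal_leI order_trans)
qed

lemma Fl_AE:
 assumes B: "Measurable.pred (Ft t) Q" and eq: "AE om in M. Q om = P om"
 shows "{om\<in>space M. P om} \<in> Fl t"
 using AE_measurable_Ft[OF B eq] by (simp add: pred_def)

lemma stopping_pred: "is_stopping_time M (filt M w N) T \<Longrightarrow> 0 \<le> s \<Longrightarrow> s \<le> t \<Longrightarrow> Measurable.pred (Ft t) (\<lambda>om. T om \<le> ennreal s)"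
 using Fl_mono[of s t] by (auto simp: is_stopping_time_def pred_def)

text \<open>The shift \<open>S\<close> is known only from time \<open>p\<close> on. Every clause of
  \<open>exit_by_iff\<close> carries a time that is not before \<open>p\<close>, so \<open>S\<close>
  may be replaced there by the truncation \<open>S'\<close>, which is measurable at that
  time.\<close>

lemma exit_stopping:
 assumes p: "is_stopping_time M (filt M w N) p"
  and S: "\<And>t. 0 \<le> t \<Longrightarrow> (\<lambda>om. if p om \<le> ennreal t then S om else 0) \<in> borel_measurable (Ft t)"
  and st: "AE om in M. p om = 0 \<or> p om = \<top> \<or> Yp \<sigma> x (enn2real (p om)) om + S om \<in> {a<..<b}"
  and T: "AE om in M. T om = band_time a b (\<lambda>t. Yp \<sigma> x t om) (\<lambda>t. p om \<le> ennreal t) (S om)"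
 shows "is_stopping_time M (filt M w N) T"
 unfolding is_stopping_time_def
proof (intro allI impI)
 fix t :: real assume t: "0 \<le> t"
 define S' where "S' s om = (if p om \<le> ennreal s then S om else 0)" for s om
 have S'm: "S' s \<in> borel_measurable (Ft t)" if "0 \<le> s" "s \<le> t" for s
  using measurable_Ft_mono[OF S[OF that(1)] that(2)] by (simp add: S'_def[abs_def])
 have U: "Measurable.pred (Ft t) (\<lambda>om. \<forall>k. \<exists>s\<in>Qs t. p om \<le> ennreal s \<and> b - 1 / real (Suc k) < Yp \<sigma> x s om + S' s om)"
 proof (rule pred_intros_countable(1), rule pred_countable_Bex[OF countable_Qs])
  fix k s assume "s \<in> Qs t"
  then have s: "0 \<le> s" "s \<le> t" using Qs_range[OF t] by auto
  have "(\<lambda>om. Yp \<sigma> x s om + S' s om) \<in> borel_measurable (Ft t)" by (intro borel_measurable_add Yp_Ft S'm s)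
  from pred_intros_logic(3)[OF stopping_pred[OF p s] borel_measurable_pred_less[OF borel_measurable_const this]]
  show "Measurable.pred (Ft t) (\<lambda>om. p om \<le> ennreal s \<and> b - 1 / real (Suc k) < Yp \<sigma> x s om + S' s om)" .
 qed
 have L: "Measurable.pred (Ft t) (\<lambda>om. \<exists>q\<in>Qs t. \<exists>r\<in>Qs t. q \<le> r \<and> p om \<le> ennreal q \<and> N q om = N r om \<and>
    (\<forall>k. \<exists>s\<in>Qs r. q \<le> s \<and> Yp \<sigma> x s om + S' q om < a + 1 / real (Suc k)))"
 proof (rule pred_countable_Bex[OF countable_Qs], rule pred_countable_Bex[OF countable_Qs])
  fix q r assume "q \<in> Qs t" "r \<in> Qs t"
  then have q: "0 \<le> q" "q \<le> t" and r: "0 \<le> r" "r \<le> t" using Qs_range[OF t] by auto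
  note [measurable] = N_Ft[OF q] N_Ft[OF r]
  have 1: "Measurable.pred (Ft t) (\<lambda>om. N q om = N r om)" by measurable
  have 2: "Measurable.pred (Ft t) (\<lambda>om. \<forall>k. \<exists>s\<in>Qs r. q \<le> s \<and> Yp \<sigma> x s om + S' q om < a + 1 / real (Suc k))"
  proof (rule pred_intros_countable(1), rule pred_countable_Bex[OF countable_Qs])
   fix k s assume "s \<in> Qs r"
   then have s: "0 \<le> s" "s \<le> t" using Qs_range[OF r(1), of s] r(2) by auto
   have "(\<lambda>om. Yp \<sigma> x s om + S' q om) \<in> borel_measurable (Ft t)" by (intro borel_measurable_add Yp_Ft S'm s q)
   from pred_intros_logic(3)[OF pred_constant borel_measurable_pred_less[OF this borel_measurable_const]]
   show "Measurable.pred (Ft t) (\<lambda>om. q \<le> s \<and> Yp \<sigma> x s om + S' q om < a + 1 / real (Suc k))" .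
  qed
  show "Measurable.pred (Ft t) (\<lambda>om. q \<le> r \<and> p om \<le> ennreal q \<and> N q om = N r om \<and>
    (\<forall>k. \<exists>s\<in>Qs r. q \<le> s \<and> Yp \<sigma> x s om + S' q om < a + 1 / real (Suc k)))"
   by (rule pred_intros_logic(3)[OF pred_constant pred_intros_logic(3)[OF stopping_pred[OF p q] pred_intros_logic(3)[OF 1 2]]])
 qed
 show "{om\<in>space M. T om \<le> ennreal t} \<in> Fl t"
 proof (rule Fl_AE[OF pred_intros_logic(5)[OF U L]])
  show "AE om in M. ((\<forall>k. \<exists>s\<in>Qs t. p om \<le> ennreal s \<and> b - 1 / real (Suc k) < Yp \<sigma> x s om + S' s om) \<or>
   (\<exists>q\<in>Qs t. \<exists>r\<in>Qs t. q \<le> r \<and> p om \<le> ennreal q \<and> N q om = N r om \<and>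
    (\<forall>k. \<exists>s\<in>Qs r. q \<le> s \<and> Yp \<sigma> x s om + S' q om < a + 1 / real (Suc k)))) = (T om \<le> ennreal t)"
   using AE_good st T
  proof eventually_elim
   case (elim om)
   show ?case unfolding elim(3) exit_by_iff[OF elim(1) t elim(2)] S'_def by (simp cong: conj_cong)
  qed
 qed
qed

lemma trunc_time_Ft:
 assumes T: "is_stopping_time M (filt M w N) T" and t: "0 \<le> t"
 shows "(\<lambda>om. if T om \<le> ennreal t then enn2real (T om) else 0) \<in> borel_measurable (Ft t)"
proof (rule borel_measurableI_le)
 fix r :: real
 have v: "enn2real (T om) \<le> t \<and> (enn2real (T om) \<le> r \<longleftrightarrow> T om \<le> ennreal r)" if "T om \<le> ennreal t" "0 \<le> r" for om
  using that t by (cases "T om" rule: ennreal_cases) (auto simp: top_unique)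
 consider "r < 0" | "0 \<le> r" "r < t" | "t \<le> r" by linarith
 then show "{om\<in>space (Ft t). (if T om \<le> ennreal t then enn2real (T om) else 0) \<le> r} \<in> sets (Ft t)"
 proof cases
  case 1
  then have "{om\<in>space (Ft t). (if T om \<le> ennreal t then enn2real (T om) else 0) \<le> r} = {}"
   by (auto simp: not_le intro: less_le_trans)
  then show ?thesis by (simp only: sets.empty_sets)
 next
  case 2
  have "{om\<in>space (Ft t). (if T om \<le> ennreal t then enn2real (T om) else 0) \<le> r} = {om\<in>space (Ft t). T om \<le> ennreal t \<longrightarrow> T om \<le> ennreal r}"
   using v 2(1) by auto
  moreover have "{om\<in>space (Ft t). T om \<le> ennreal t \<longrightarrow> T om \<le> ennreal r} \<in> sets (Ft t)"
   using pred_intros_logic(4)[OF stopping_pred[OF T t order_refl] stopping_pred[OF T 2(1) less_imp_le[OF 2(2)]]] unfolding pred_def .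
  ultimately show ?thesis by (simp only:)
 next
  case 3
  then have "{om\<in>space (Ft t). (if T om \<le> ennreal t then enn2real (T om) else 0) \<le> r} = space (Ft t)"
   using v t by fastforce
  then show ?thesis by (simp only: sets.top)
 qed
qed

text \<open>The stopped value is a limit along times rounded up and capped at \<open>t\<close>.
  Rounding leaves countably many times, the cap keeps them within the information at
  \<open>t\<close>, and right-continuity identifies the limit.\<close>

lemma stopped_Yp_Ft:
 assumes T: "is_stopping_time M (filt M w N) T" and t: "0 \<le> t"
 shows "(\<lambda>om. if T om \<le> ennreal t then Yp \<sigma> x (enn2real (T om)) om else 0) \<in> borel_measurable (Ft t)"
proof -
 define U where "U om = (if T om \<le> ennreal t then enn2real (T om) else 0)" for om
 have U [measurable]: "U \<in> borel_measurable (Ft t)" using trunc_time_Ft[OF T t] by (simp add: U_def[abs_def])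
 have U0: "0 \<le> U om" "U om \<le> t" for om using t by (auto simp: U_def intro: enn2real_leI)
 define V where "V k om = max 0 (min t (cl (1 / real (Suc k)) (U om)))" for k om
 have m: "(\<lambda>om. Yp \<sigma> x (V k om) om) \<in> borel_measurable (Ft t)" for k
  unfolding V_def cl_def
 proof (rule measurable_compose_countable[where f="\<lambda>i om. Yp \<sigma> x (max 0 (min t (1 / real (Suc k) * real_of_int i))) om" and g="\<lambda>om. \<lceil>U om / (1 / real (Suc k))\<rceil>"])
  show "(\<lambda>om. Yp \<sigma> x (max 0 (min t (1 / real (Suc k) * real_of_int i))) om) \<in> borel_measurable (Ft t)" for i
   using Yp_Ft[of "max 0 (min t (1 / real (Suc k) * real_of_int i))" t] t by simp
 qed measurable
 have P: "(\<lambda>om. lim (\<lambda>k. Yp \<sigma> x (V k om) om)) \<in> borel_measurable (Ft t)" by (rule borel_measurable_lim_metric[OF m])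
 show ?thesis
 proof (rule AE_measurable_Ft)
  show "(\<lambda>om. if T om \<le> ennreal t then lim (\<lambda>k. Yp \<sigma> x (V k om) om) else 0) \<in> borel_measurable (Ft t)"
   by (rule measurable_If[OF P borel_measurable_const stopping_pred[OF T t order_refl, unfolded pred_def]])
  show "AE om in M. (if T om \<le> ennreal t then lim (\<lambda>k. Yp \<sigma> x (V k om) om) else 0) = (if T om \<le> ennreal t then Yp \<sigma> x (enn2real (T om)) om else 0)"
   using AE_good
  proof eventually_elim
   case (elim om)
   have "(\<lambda>k. V k om) \<longlonglongrightarrow> max 0 (min t (U om))"
    unfolding V_def by (intro tendsto_max tendsto_min tendsto_const cl_tendsto LIMSEQ_Suc[OF lim_const_over_n]) simp
   then have "(\<lambda>k. V k om) \<longlonglongrightarrow> U om" using U0 by simp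
   moreover have "U om \<le> V k om" for k using U0[of om] cl_ge[of "1 / real (Suc k)" "U om"] by (simp add: V_def max_def)
   ultimately have "(\<lambda>k. Yp \<sigma> x (V k om) om) \<longlonglongrightarrow> Yp \<sigma> x (U om) om" by (intro rcont_seq[OF Yp_rcont[OF elim] U0(1)])
   then show ?case by (auto simp: U_def dest!: limI)
  qed
 qed simp
qed

end

section \<open>Admissibility of the band policy\<close>

context impulse_problem
begin

definition tb where "tb x n om = band_tau a \<alpha> \<beta> b (Yp \<sigma> x) n om"
definition xb where "xb x n om = band_xi a \<alpha> \<beta> b (Yp \<sigma> x) n om"
definition sb where "sb x n om = (\<Sum>i<n. xb x i om)"
definition pb where "pb x n om = (if n = 0 then 0 else tb x (n - 1) om)"

lemma sb_Suc: "sb x (Suc n) om = sb x n om + xb x n om" by (simp add: sb_def)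

lemma band_path:
 assumes "good om" shows "band_path a \<alpha> \<beta> b (\<lambda>t. Yp \<sigma> x t om)"
 by (rule band_path.intro[OF band_par Yp_rcont[OF assms]]) (rule Yp_left_convergent[OF assms]; assumption)

lemma band_facts:
 assumes "good om"
 shows tb_rec: "tb x n om = band_time a b (\<lambda>t. Yp \<sigma> x t om) (\<lambda>t. pb x n om \<le> ennreal t) (sb x n om)"
  and xb_rec: "xb x n om = band_jump \<alpha> \<beta> b (\<lambda>t. Yp \<sigma> x t om) (tb x n om) (sb x n om)"
  and tb_after: "tb x n om \<noteq> \<top> \<Longrightarrow> Yp \<sigma> x (enn2real (tb x n om)) om + sb x (Suc n) om = (if Yp \<sigma> x (enn2real (tb x n om)) om + sb x n om \<ge> b then \<beta> else \<alpha>)"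
  and tb_exit: "tb x n om \<noteq> \<top> \<Longrightarrow> Yp \<sigma> x (enn2real (tb x n om)) om + sb x n om \<notin> {a<..<b}"
  and xb_nonzero: "tb x n om \<noteq> \<top> \<Longrightarrow> xb x n om \<noteq> 0" and xb_top: "tb x n om = \<top> \<Longrightarrow> xb x n om = 0"
  and pb_le_tb: "pb x n om \<le> tb x n om" and tb_mono: "tb x n om \<le> tb x (Suc n) om"
  and tb_strict: "tb x n om < \<top> \<Longrightarrow> tb x n om < tb x (Suc n) om"
  and tb_inside: "0 \<le> t \<Longrightarrow> pb x n om \<le> ennreal t \<Longrightarrow> ennreal t < tb x n om \<Longrightarrow> Yp \<sigma> x t om + sb x n om \<in> {a<..<b}"
  and tb_finite: "finite {n. tb x n om \<le> ennreal t}"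
proof -
 interpret BP: band_path a \<alpha> \<beta> b "\<lambda>t. Yp \<sigma> x t om" by (rule band_path[OF assms])
 have e1: "BP.bt n = tb x n om" for n by (simp add: BP.bt_def tb_def band_tau_def)
 have e2: "BP.bx n = xb x n om" for n by (simp add: BP.bx_def xb_def band_xi_def)
 have e3: "BP.bs n = sb x n om" for n by (simp add: BP.bs_def sb_def e2)
 have e4: "BP.bp n = pb x n om" for n by (simp add: BP.bp_def pb_def e1)
 note e = e1 e2 e3 e4
 show "tb x n om = band_time a b (\<lambda>t. Yp \<sigma> x t om) (\<lambda>t. pb x n om \<le> ennreal t) (sb x n om)" by (rule BP.bt_rec[of n, unfolded e])
 show "xb x n om = band_jump \<alpha> \<beta> b (\<lambda>t. Yp \<sigma> x t om) (tb x n om) (sb x n om)" by (rule BP.bx_rec[of n, unfolded e])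
 show "tb x n om \<noteq> \<top> \<Longrightarrow> Yp \<sigma> x (enn2real (tb x n om)) om + sb x (Suc n) om = (if Yp \<sigma> x (enn2real (tb x n om)) om + sb x n om \<ge> b then \<beta> else \<alpha>)"
  by (rule BP.after_jump[of n, unfolded e])
 show "Yp \<sigma> x (enn2real (tb x n om)) om + sb x n om \<notin> {a<..<b}" if nt: "tb x n om \<noteq> \<top>"
 proof -
  obtain t where "0 \<le> t" "tb x n om = ennreal t" "Yp \<sigma> x t om + sb x n om \<notin> {a<..<b}"
   by (rule BP.bt_finite[of n, unfolded e, OF nt])
  then show ?thesis by simp
 qed
 show "tb x n om \<noteq> \<top> \<Longrightarrow> xb x n om \<noteq> 0" by (rule BP.bx_nonzero[of n, unfolded e])
 show "tb x n om = \<top> \<Longrightarrow> xb x n om = 0" by (rule BP.bx_top[of n, unfolded e])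
 show "pb x n om \<le> tb x n om" by (rule BP.bp_le_bt[of n, unfolded e])
 show "tb x n om \<le> tb x (Suc n) om" by (rule BP.bt_mono[of n, unfolded e])
 show "tb x n om < \<top> \<Longrightarrow> tb x n om < tb x (Suc n) om" by (rule BP.bt_strict[of n, unfolded e])
 show "0 \<le> t \<Longrightarrow> pb x n om \<le> ennreal t \<Longrightarrow> ennreal t < tb x n om \<Longrightarrow> Yp \<sigma> x t om + sb x n om \<in> {a<..<b}" by (rule BP.inside[of t n, unfolded e])
 show "finite {n. tb x n om \<le> ennreal t}" by (rule BP.bt_locally_finite[of t, unfolded e])
qed

lemma good_cgood: "good om \<Longrightarrow> cgood (tb x) om"
 unfolding cgood_def using tb_mono tb_finite by blast

lemma Xb_inside:
 assumes g: "good om" and t: "0 \<le> t"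
 shows "ctrl_X (Yp \<sigma> x) (tb x) (xb x) t om \<in> {a<..<b}"
proof -
 obtain m where m: "\<And>t. {n. tb x n om \<le> ennreal t} = {..<m t}" using cgood_lessThan[OF good_cgood[OF g]] by blast
 have iff: "tb x n om \<le> ennreal t \<longleftrightarrow> n < m t" for n using m[of t] by blast
 have "ctrl_X (Yp \<sigma> x) (tb x) (xb x) t om = Yp \<sigma> x t om + sb x (m t) om" by (simp add: ctrl_X_csum csum_def m sb_def)
 moreover have "pb x (m t) om \<le> ennreal t" using iff[of "m t - 1"] by (simp add: pb_def)
 moreover have "ennreal t < tb x (m t) om" using iff[of "m t"] by simp
 ultimately show ?thesis using tb_inside[OF g t] by simp
qed

text \<open>One joint induction, since an exit time needs the accumulated shift and the next impulse
  needs the position at that exit. The shift is known only after the previous intervention, hence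
  the truncated formulations.\<close>

lemma band_measurable:
 "is_stopping_time M (filt M w N) (pb x n) \<and> (\<forall>t\<ge>0. (\<lambda>om. if pb x n om \<le> ennreal t then sb x n om else 0) \<in> borel_measurable (Ft t)) \<and>
  is_stopping_time M (filt M w N) (tb x n) \<and> (\<forall>t\<ge>0. (\<lambda>om. if tb x n om \<le> ennreal t then xb x n om else 0) \<in> borel_measurable (Ft t))"
proof -
 have step: "is_stopping_time M (filt M w N) (tb x n) \<and> (\<forall>t\<ge>0. (\<lambda>om. if tb x n om \<le> ennreal t then xb x n om else 0) \<in> borel_measurable (Ft t))"
  if p: "is_stopping_time M (filt M w N) (pb x n)" and S: "\<And>t. 0 \<le> t \<Longrightarrow> (\<lambda>om. if pb x n om \<le> ennreal t then sb x n om else 0) \<in> borel_measurable (Ft t)" for n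
 proof
  show T: "is_stopping_time M (filt M w N) (tb x n)"
  proof (rule exit_stopping[OF p S])
   show "AE om in M. pb x n om = 0 \<or> pb x n om = \<top> \<or> Yp \<sigma> x (enn2real (pb x n om)) om + sb x n om \<in> {a<..<b}"
    using AE_good
   proof eventually_elim
    case (elim om)
    show ?case
    proof (cases n)
     case (Suc k)
     then show ?thesis using tb_after[OF elim, of x k] band_par by (auto simp: pb_def split: if_splits)
    qed (simp add: pb_def)
   qed
   show "AE om in M. tb x n om = band_time a b (\<lambda>t. Yp \<sigma> x t om) (\<lambda>t. pb x n om \<le> ennreal t) (sb x n om)"
    using AE_good by eventually_elim (rule tb_rec)
  qed
  show "\<forall>t\<ge>0. (\<lambda>om. if tb x n om \<le> ennreal t then xb x n om else 0) \<in> borel_measurable (Ft t)"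
  proof (intro allI impI)
   fix t :: real assume t: "0 \<le> t"
   define z where "z om = (if tb x n om \<le> ennreal t then Yp \<sigma> x (enn2real (tb x n om)) om else 0) + (if pb x n om \<le> ennreal t then sb x n om else 0)" for om
   have z [measurable]: "z \<in> borel_measurable (Ft t)"
    unfolding z_def[abs_def] by (intro borel_measurable_add stopped_Yp_Ft T S t)
   have zf: "(\<lambda>om. if b \<le> z om then \<beta> - z om else \<alpha> - z om) \<in> borel_measurable (Ft t)" by measurable
   show "(\<lambda>om. if tb x n om \<le> ennreal t then xb x n om else 0) \<in> borel_measurable (Ft t)"
   proof (rule AE_measurable_Ft[OF measurable_If[OF zf borel_measurable_const[of 0] stopping_pred[OF T t order_refl, unfolded pred_def]]])
    show "AE om in M. (if tb x n om \<le> ennreal t then if b \<le> z om then \<beta> - z om else \<alpha> - z om else 0) = (if tb x n om \<le> ennreal t then xb x n om else 0)"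
     using AE_good
    proof eventually_elim
     case (elim om)
     show ?case
     proof (cases "tb x n om \<le> ennreal t")
      case True
      then have "tb x n om \<noteq> \<top>" by (auto simp: top_unique)
      moreover have "pb x n om \<le> ennreal t" using pb_le_tb[OF elim] True by (rule order_trans)
      ultimately show ?thesis using True xb_rec[OF elim, of x n] by (simp add: z_def band_jump_def Let_def)
     qed simp
    qed
   qed simp
  qed
 qed
 show ?thesis
 proof (induction n)
  case 0
  have z: "is_stopping_time M (filt M w N) (pb x 0)"
   using sets.top[of "Ft _"] by (simp add: is_stopping_time_def pb_def)
  have "(\<lambda>om. if pb x 0 om \<le> ennreal t then sb x 0 om else 0) \<in> borel_measurable (Ft t)" for t
   unfolding sb_def lessThan_0 sum.empty if_cancel by simp
  then show ?case using step[OF z] z by simp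
 next
  case (Suc n)
  have p: "pb x (Suc n) = tb x n" by (simp add: pb_def fun_eq_iff)
  have T: "is_stopping_time M (filt M w N) (pb x (Suc n))" unfolding p using Suc by blast
  have S: "(\<lambda>om. if pb x (Suc n) om \<le> ennreal t then sb x (Suc n) om else 0) \<in> borel_measurable (Ft t)" if t: "0 \<le> t" for t
  proof -
   have "(\<lambda>om. (if pb x n om \<le> ennreal t then sb x n om else 0) + (if tb x n om \<le> ennreal t then xb x n om else 0)) \<in> borel_measurable (Ft t)"
    using Suc t by (intro borel_measurable_add) blast+
   from measurable_If[OF this borel_measurable_const[of 0] stopping_pred[OF T t order_refl, unfolded pred_def]]
   show ?thesis
   proof (rule AE_measurable_Ft)
    show "AE om in M. (if pb x (Suc n) om \<le> ennreal t then (if pb x n om \<le> ennreal t then sb x n om else 0) + (if tb x n om \<le> ennreal t then xb x n om else 0) else 0)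
      = (if pb x (Suc n) om \<le> ennreal t then sb x (Suc n) om else 0)"
     using AE_good
    proof eventually_elim
     case (elim om)
     then show ?case using order_trans[OF pb_le_tb[OF elim, of x n], of "ennreal t"] unfolding p by (simp add: sb_Suc)
    qed
   qed simp
  qed
  show ?case using step[OF T S] T S by blast
 qed
qed

lemma tb_stopping: "is_stopping_time M (filt M w N) (tb x n)" using band_measurable by blast

lemma tb_measurable [measurable]: "tb x n \<in> borel_measurable M" by (rule stopping_measurable[OF tb_stopping])

lemma xb_measurable [measurable]: "xb x n \<in> borel_measurable M"
proof (rule AE_measurable_M)
 have "(\<lambda>om. if tb x n om \<le> ennreal (real k) then xb x n om else 0) \<in> borel_measurable M" for k
  using band_measurable[of x n] by (intro measurable_Ft_M[of _ "real k"]) simp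
 then show "(\<lambda>om. lim (\<lambda>k. if tb x n om \<le> ennreal (real k) then xb x n om else 0)) \<in> borel_measurable M" by (rule borel_measurable_lim_metric)
 show "AE om in M. lim (\<lambda>k. if tb x n om \<le> ennreal (real k) then xb x n om else 0) = xb x n om"
  using AE_good
 proof eventually_elim
  case (elim om)
  have "(\<lambda>k. if tb x n om \<le> ennreal (real k) then xb x n om else 0) \<longlonglongrightarrow> xb x n om"
  proof (cases "tb x n om = \<top>")
   case True then show ?thesis unfolding xb_top[OF elim True] by simp
  next
   case False
   obtain k0 where k0: "enn2real (tb x n om) \<le> real k0" using real_arch_simple by blast
   have "tb x n om \<le> ennreal (real k)" if "k \<ge> k0" for k
   proof -
    have "tb x n om = ennreal (enn2real (tb x n om))" using False by (simp add: less_top[symmetric])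
    also have "\<dots> \<le> ennreal (real k)" using k0 that by (intro ennreal_leI) linarith
    finally show ?thesis .
   qed
   then show ?thesis by (intro tendsto_eventually) (auto simp: eventually_sequentially)
  qed
  then show ?case by (rule limI)
 qed
qed simp

lemma band_impulse: "impulse_control M (filt M w N) (tb x) (xb x)"
 unfolding impulse_control_def
proof (intro conjI allI impI)
 show "is_stopping_time M (filt M w N) (tb x n)" for n by (rule tb_stopping)
 fix n and B :: "real set" assume B: "B \<in> sets borel"
 show "{om\<in>space M. xb x n om \<in> B} \<in> stopped_sets M (filt M w N) (tb x n)"
  unfolding stopped_sets_def
 proof (intro CollectI conjI allI impI)
  show "{om\<in>space M. xb x n om \<in> B} \<in> sets M" using measurable_sets[OF xb_measurable B] by (simp add: vimage_def Int_def conj_commute)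
  fix t :: real assume t: "0 \<le> t"
  let ?f = "\<lambda>om. if tb x n om \<le> ennreal t then xb x n om else 0"
  have f: "?f \<in> borel_measurable (Ft t)" using band_measurable[of x n] t by blast
  have "{om\<in>space M. xb x n om \<in> B} \<inter> {om\<in>space M. tb x n om \<le> ennreal t} = (?f -` B \<inter> space (Ft t)) \<inter> {om\<in>space (Ft t). tb x n om \<le> ennreal t}" by auto
  also have "\<dots> \<in> sets (Ft t)" by (intro sets.Int measurable_sets[OF f B] stopping_pred[OF tb_stopping t order_refl, unfolded pred_def])
  finally show "{om\<in>space M. xb x n om \<in> B} \<inter> {om\<in>space M. tb x n om \<le> ennreal t} \<in> Fl t" by simp
 qed
next
 show "AE om in M. (\<forall>n. tb x n om \<le> tb x (Suc n) om \<and> (tb x n om < \<top> \<longrightarrow> tb x n om < tb x (Suc n) om \<and> xb x n om \<noteq> 0) \<and>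
   (tb x n om = \<top> \<longrightarrow> xb x n om = 0)) \<and> (\<forall>t. finite {n. tb x n om \<le> ennreal t})"
  using AE_good
 proof eventually_elim
  case (elim om)
  show ?case using tb_mono[OF elim] tb_strict[OF elim] xb_nonzero[OF elim] xb_top[OF elim] tb_finite[OF elim] by (auto simp: less_top[symmetric])
 qed
qed

lemma band_admissible: "admissible M (filt M w N) lam (Yp \<sigma> x) (tb x) (xb x)"
 unfolding admissible_def
proof (intro conjI band_impulse exI[of _ "\<bar>a\<bar> + \<bar>b\<bar> + 1"])
 show "AE om in M. \<forall>t\<ge>0. exp (- lam * t) * \<bar>ctrl_X (Yp \<sigma> x) (tb x) (xb x) t om\<bar> < \<bar>a\<bar> + \<bar>b\<bar> + 1"
  using AE_good
 proof (eventually_elim, intro allI impI)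
  fix om and t :: real assume g: "good om" and t: "0 \<le> t"
  let ?X = "ctrl_X (Yp \<sigma> x) (tb x) (xb x) t om"
  have "exp (- lam * t) * \<bar>?X\<bar> \<le> 1 * \<bar>?X\<bar>" using t lam by (intro mult_right_mono) auto
  moreover have "\<bar>?X\<bar> < \<bar>a\<bar> + \<bar>b\<bar> + 1" using Xb_inside[OF g t, of x] unfolding greaterThanLessThan_iff by linarith
  ultimately show "exp (- lam * t) * \<bar>?X\<bar> < \<bar>a\<bar> + \<bar>b\<bar> + 1" by linarith
 qed
qed

end

section \<open>Cost of the band policy\<close>

text \<open>The grid of mesh \<open>ep / real (Suc k)\<close> contains that of mesh
  \<open>ep\<close>. A stopping time may therefore be made discrete on the finer grid without moving
  its next coarse grid point.\<close>

lemma cl_refine: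
 assumes e: "0 < ep"
 shows "cl ep (cl (ep / real (Suc k)) s) = cl ep s"
proof -
 have e': "0 < ep / real (Suc k)" using e by simp
 have "\<lceil>cl (ep / real (Suc k)) s / ep\<rceil> = \<lceil>s / ep\<rceil>"
 proof (rule antisym)
  show "\<lceil>s / ep\<rceil> \<le> \<lceil>cl (ep / real (Suc k)) s / ep\<rceil>"
   using cl_ge[OF e', of s] e by (intro ceiling_mono divide_right_mono) auto
  have "s / ep * real (Suc k) \<le> of_int \<lceil>s / ep\<rceil> * real (Suc k)" by (intro mult_right_mono) auto
  then have "s / (ep / real (Suc k)) \<le> of_int (\<lceil>s / ep\<rceil> * int (Suc k))" by simp
  then have "\<lceil>s / (ep / real (Suc k))\<rceil> \<le> \<lceil>s / ep\<rceil> * int (Suc k)" by (simp only: ceiling_le_iff)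
  then have "real_of_int \<lceil>s / (ep / real (Suc k))\<rceil> \<le> real_of_int \<lceil>s / ep\<rceil> * real (Suc k)"
   using of_int_le_iff[where 'a=real, of "\<lceil>s / (ep / real (Suc k))\<rceil>" "\<lceil>s / ep\<rceil> * int (Suc k)"] by simp
  then have "real_of_int \<lceil>s / (ep / real (Suc k))\<rceil> / real (Suc k) \<le> real_of_int \<lceil>s / ep\<rceil>" by (subst pos_divide_le_eq) simp_all
  moreover have "cl (ep / real (Suc k)) s / ep = real_of_int \<lceil>s / (ep / real (Suc k))\<rceil> / real (Suc k)"
   using e unfolding cl_def by simp
  ultimately show "\<lceil>cl (ep / real (Suc k)) s / ep\<rceil> \<le> \<lceil>s / ep\<rceil>" by (simp only: ceiling_le_iff)
 qed
 then show ?thesis by (simp only: cl_def[of ep])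
qed

lemma cl_unique: "0 < ep \<Longrightarrow> (real i - 1) * ep < s \<Longrightarrow> s \<le> real i * ep \<Longrightarrow> cl ep s = real i * ep"
 unfolding cl_def by (subst ceiling_unique[of "int i"]) (simp_all add: pos_less_divide_eq pos_divide_le_eq)

context cnoise
begin

lemma Yp_cl_measurable:
 assumes [measurable]: "T \<in> borel_measurable M"
 shows "(\<lambda>om. Yp \<sigma> x (cl e (enn2real (T om))) om) \<in> borel_measurable M"
 unfolding cl_def
 by (rule measurable_compose_countable[where f="\<lambda>i om. Yp \<sigma> x (e * real_of_int i) om" and g="\<lambda>om. \<lceil>enn2real (T om) / e\<rceil>"]) measurable

text \<open>A substitute for the strong Markov property. Rounded up to a fine grid, the stopping
  time takes countably many values \<open>real i * q\<close>; on each of these events the increment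
  to the next coarse grid point is independent of the past and has mean absolute value at most
  \<open>\<kappa>\<close>. Fatou removes the fine rounding.\<close>

lemma stopped_overshoot:
 assumes T: "is_stopping_time M (filt M w N) T" and e: "0 < ep" "ep \<le> 1 / 2"
 shows "(\<integral>\<^sup>+om. ennreal (if T om = \<top> then 0 else \<bar>Yp \<sigma> x (cl ep (enn2real (T om))) om - Yp \<sigma> x (enn2real (T om)) om\<bar>) \<partial>M)
  \<le> ennreal (\<bar>\<sigma>\<bar> * sqrt ep + 2 / \<theta> * ep)"
proof -
 define \<kappa> where "\<kappa> = \<bar>\<sigma>\<bar> * sqrt ep + 2 / \<theta> * ep"
 have \<kappa>0: "0 \<le> \<kappa>" using e theta_pos by (simp add: \<kappa>_def)
 define F where "F k om = ennreal (if T om = \<top> then 0 else \<bar>Yp \<sigma> x (cl ep (enn2real (T om))) om - Yp \<sigma> x (cl (ep / real (Suc k)) (enn2real (T om))) om\<bar>)" for k om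
 have Tm [measurable]: "T \<in> borel_measurable M" by (rule stopping_measurable[OF T])
 note [measurable] = Yp_cl_measurable[OF Tm]
 have Fm [measurable]: "F k \<in> borel_measurable M" for k unfolding F_def[abs_def] by measurable
 have lim: "AE om in M. ennreal (if T om = \<top> then 0 else \<bar>Yp \<sigma> x (cl ep (enn2real (T om))) om - Yp \<sigma> x (enn2real (T om)) om\<bar>) = liminf (\<lambda>k. F k om)"
  using AE_good
 proof eventually_elim
  case (elim om)
  have "(\<lambda>k. cl (ep / real (Suc k)) (enn2real (T om))) \<longlonglongrightarrow> enn2real (T om)"
   by (rule cl_tendsto) (use e LIMSEQ_Suc[OF lim_const_over_n[of ep]] in auto)
  then have "(\<lambda>k. Yp \<sigma> x (cl (ep / real (Suc k)) (enn2real (T om))) om) \<longlonglongrightarrow> Yp \<sigma> x (enn2real (T om)) om"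
   by (rule rcont_seq[OF Yp_rcont[OF elim] enn2real_nonneg]) (use e in \<open>auto intro: cl_ge\<close>)
  then have "(\<lambda>k. F k om) \<longlonglongrightarrow> ennreal (if T om = \<top> then 0 else \<bar>Yp \<sigma> x (cl ep (enn2real (T om))) om - Yp \<sigma> x (enn2real (T om)) om\<bar>)"
   unfolding F_def by (cases "T om = \<top>") (auto intro!: tendsto_ennrealI tendsto_intros)
  then show ?case by (intro lim_imp_Liminf[symmetric]) auto
 qed
 have bound: "(\<integral>\<^sup>+om. F k om \<partial>M) \<le> ennreal \<kappa>" for k
 proof -
  define q where "q = ep / real (Suc k)"
  have q: "0 < q" using e by (simp add: q_def)
  define D where "D i = {om\<in>space M. T om \<le> ennreal (real i * q)}" for i :: nat
  have DF: "D i \<in> Fl (real i * q)" for i using T q by (simp add: D_def is_stopping_time_def)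
  have DF': "D j \<in> Fl (real i * q)" if "j \<le> i" for i j
   using DF[of j] Fl_mono[of "real j * q" "real i * q"] that q by auto
  have AF: "disjointed D i \<in> Fl (real i * q)" for i
  proof -
   interpret S: sigma_algebra "space M" "Fl (real i * q)" by (rule Fl_sigma_algebra)
   show ?thesis unfolding disjointed_def by (intro S.Diff S.finite_UN DF') auto
  qed
  have AM [measurable]: "disjointed D i \<in> sets M" for i using AF Fl_sets by blast
  have Acl: "T om \<noteq> \<top> \<and> cl q (enn2real (T om)) = real i * q" if A: "om \<in> disjointed D i" for om i
  proof -
   have le: "T om \<le> ennreal (real i * q)" and sp: "om \<in> space M" using A by (auto simp: disjointed_def D_def)
   then have nt: "T om \<noteq> \<top>" by (auto simp: top_unique)
   define u where "u = enn2real (T om)"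
   have u: "T om = ennreal u" "0 \<le> u" using nt by (simp_all add: u_def less_top[symmetric])
   have 1: "u \<le> real i * q" using le u q by simp
   have 2: "(real i - 1) * q < u"
   proof (cases i)
    case 0 then show ?thesis using u(2) q by simp
   next
    case (Suc j)
    then have "om \<notin> D j" using A by (auto simp: disjointed_def)
    then have "\<not> ennreal u \<le> ennreal (real j * q)" using sp u by (simp add: D_def)
    then show ?thesis using Suc q u(2) by simp
   qed
   show ?thesis using nt cl_unique[OF q 2 1] by (simp add: u_def)
  qed
  define I where "I i om = indicator (disjointed D i) om * ennreal \<bar>Yd \<sigma> (real i * q) (cl ep (real i * q)) om\<bar>" for i om
  have Ib: "(\<integral>\<^sup>+om. I i om \<partial>M) \<le> emeasure M (disjointed D i) * ennreal \<kappa>" for i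
  proof -
   let ?s = "real i * q" let ?u = "cl ep (real i * q)"
   have s0: "0 \<le> ?s" using q by simp
   have u: "?s \<le> ?u" "?u < ?s + ep" using cl_ge[OF e(1)] cl_less[OF e(1)] by auto
   show ?thesis
   proof (cases "?u = ?s")
    case True then show ?thesis by (simp add: I_def Yd_def)
   next
    case False
    then have su: "?s < ?u" "?u \<le> ?s + 1 / 2" using u e by auto
    have "(\<integral>\<^sup>+om. I i om \<partial>M) = ennreal (prob (disjointed D i)) * (\<integral>\<^sup>+om. ennreal \<bar>Yd \<sigma> ?s ?u om\<bar> \<partial>M)"
     unfolding I_def
     by (rule indep_nn[where \<kappa>="\<lambda>z. ennreal \<bar>z\<bar>"]) (use indep_Fl[OF s0 su(1) AF] in auto)
    also have "(\<integral>\<^sup>+om. ennreal \<bar>Yd \<sigma> ?s ?u om\<bar> \<partial>M) = ennreal (expectation (\<lambda>om. \<bar>Yd \<sigma> ?s ?u om\<bar>))"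
     by (rule nn_integral_eq_integral) (use Yd_integrable(1)[OF s0 su] in auto)
    also have "\<dots> \<le> ennreal \<kappa>"
    proof (rule ennreal_leI)
     have "\<bar>\<sigma>\<bar> * sqrt (?u - ?s) + 2 / \<theta> * (?u - ?s) \<le> \<kappa>"
      unfolding \<kappa>_def using u theta_pos by (intro add_mono mult_left_mono) auto
     then show "expectation (\<lambda>om. \<bar>Yd \<sigma> ?s ?u om\<bar>) \<le> \<kappa>" using Yd_integrable(2)[OF s0 su, of \<sigma>] by linarith
    qed
    finally show ?thesis by (simp add: emeasure_eq_measure mult_left_mono)
   qed
  qed
  have "(\<integral>\<^sup>+om. F k om \<partial>M) \<le> (\<integral>\<^sup>+om. (\<Sum>i. I i om) \<partial>M)"
  proof (rule nn_integral_mono)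
   fix om assume sp: "om \<in> space M"
   show "F k om \<le> (\<Sum>i. I i om)"
   proof (cases "T om = \<top>")
    case False
    obtain i0 where "enn2real (T om) / q \<le> real i0" using real_arch_simple by blast
    then have "T om \<le> ennreal (real i0 * q)"
     using False q ennreal_leI[of "enn2real (T om)" "real i0 * q"] by (simp add: pos_divide_le_eq less_top[symmetric])
    then have "om \<in> (\<Union>i. D i)" using sp by (auto simp: D_def)
    then obtain i where i: "om \<in> disjointed D i" using UN_disjointed_eq[of D] by blast
    have c: "cl q (enn2real (T om)) = real i * q" using Acl[OF i] by simp
    have "cl ep (enn2real (T om)) = cl ep (real i * q)" using cl_refine[OF e(1), of k "enn2real (T om)", folded q_def] c by simp
    then have "F k om = I i om"
     using False i c Yd_Yp[of \<sigma> x "cl ep (real i * q)" om "real i * q"] unfolding F_def I_def q_def[symmetric] by simp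
    also have "\<dots> \<le> (\<Sum>i. I i om)" using sum_le_suminf[of "\<lambda>i. I i om" "{i}"] by simp
    finally show ?thesis .
   qed (simp add: F_def)
  qed
  also have "\<dots> = (\<Sum>i. \<integral>\<^sup>+om. I i om \<partial>M)" by (rule nn_integral_suminf) (simp add: I_def[abs_def])
  also have "\<dots> \<le> (\<Sum>i. emeasure M (disjointed D i) * ennreal \<kappa>)" by (intro suminf_le Ib) auto
  also have "\<dots> = (\<Sum>i. emeasure M (disjointed D i)) * ennreal \<kappa>" by simp
  also have "(\<Sum>i. emeasure M (disjointed D i)) = emeasure M (\<Union>i. disjointed D i)" by (rule suminf_emeasure) (auto simp: disjoint_family_disjointed)
  also have "\<dots> * ennreal \<kappa> \<le> 1 * ennreal \<kappa>" by (intro mult_right_mono emeasure_le_1) simp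
  finally show ?thesis by simp
 qed
 have "(\<integral>\<^sup>+om. ennreal (if T om = \<top> then 0 else \<bar>Yp \<sigma> x (cl ep (enn2real (T om))) om - Yp \<sigma> x (enn2real (T om)) om\<bar>) \<partial>M) = (\<integral>\<^sup>+om. liminf (\<lambda>k. F k om) \<partial>M)"
  by (rule nn_integral_cong_AE[OF lim])
 also have "\<dots> \<le> liminf (\<lambda>k. \<integral>\<^sup>+om. F k om \<partial>M)" by (rule nn_integral_liminf) measurable
 also have "\<dots> \<le> ennreal \<kappa>" by (rule Liminf_le) (auto intro!: always_eventually bound)
 finally show ?thesis by (simp add: \<kappa>_def)
qed

end

section \<open>Upper estimate along a grid, path by path\<close>

context impulse_problem
begin

definition mt where "mt x s om = card {n. tb x n om \<le> ennreal s}"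
definition gb where "gb x n om = exp (- lam * enn2real (tb x n om)) * g (xb x n om)"
text \<open>Interventions are booked at the next grid point; this is the change of the noise in
  between, which measures the error.\<close>

definition er where "er x ep n om = (if tb x n om = \<top> then 0 else \<bar>Yp \<sigma> x (cl ep (enn2real (tb x n om))) om - Yp \<sigma> x (enn2real (tb x n om)) om\<bar>)"
abbreviation "Xb x \<equiv> ctrl_X (Yp \<sigma> x) (tb x) (xb x)"

lemma gb_nonneg: "0 \<le> gb x n om" by (simp add: gb_def g_nonneg)
lemma er_nonneg: "0 \<le> er x ep n om" by (simp add: er_def)

lemma tb_le_iff: "good om \<Longrightarrow> tb x n om \<le> ennreal s \<longleftrightarrow> n < mt x s om"
proof -
 assume "good om"
 then obtain m where m: "\<And>t. {n. tb x n om \<le> ennreal t} = {..<m t}" using cgood_lessThan[OF good_cgood] by blast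
 then have "mt x s om = m s" by (simp add: mt_def)
 moreover have "n \<in> {n. tb x n om \<le> ennreal s} \<longleftrightarrow> n \<in> {..<m s}" by (simp only: m)
 ultimately show ?thesis by simp
qed

lemma mt_mono: "good om \<Longrightarrow> s \<le> t \<Longrightarrow> mt x s om \<le> mt x t om"
 unfolding mt_def by (rule card_mono[OF tb_finite]) (auto intro: order_trans[OF _ ennreal_leI])

lemma Xb_mt: "good om \<Longrightarrow> Xb x s om = Yp \<sigma> x s om + sb x (mt x s om) om"
 by (simp add: ctrl_X_csum csum_def sb_def lessThan_def tb_le_iff)

text \<open>At the exact intervention time the fifth and sixth equations give equality for
  \<open>h\<close>. Replacing \<open>h\<close> by \<open>v\<close> costs \<open>\<eta>\<close> at
  two points, and moving the noise to the value \<open>y\<close> costs the Lipschitz bound at two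
  points.\<close>

lemma intervene_step:
 fixes n :: nat
 assumes gd: "good om" and nt: "tb x n om \<noteq> \<top>" and v: "\<And>z z'. \<bar>v z - v z'\<bar> \<le> K * \<bar>z - z'\<bar>" "\<And>z. \<bar>v z - h z\<bar> \<le> \<eta>"
 shows "v (y + sb x (Suc n) om) + g (xb x n om) \<le> v (y + sb x n om) + (2 * \<eta> + 2 * K * \<bar>y - Yp \<sigma> x (enn2real (tb x n om)) om\<bar>)"
proof -
 define u where "u = Yp \<sigma> x (enn2real (tb x n om)) om"
 define z where "z = u + sb x n om"
 have z: "z \<notin> {a<..<b}" unfolding z_def u_def by (rule tb_exit[OF gd nt])
 have z': "u + sb x (Suc n) om = (if z \<ge> b then \<beta> else \<alpha>)" unfolding z_def u_def by (rule tb_after[OF gd nt])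
 then have xz: "xb x n om = (if z \<ge> b then \<beta> else \<alpha>) - z" by (simp add: sb_Suc z_def)
 have hz: "h z = h (u + sb x (Suc n) om) + g (xb x n om)"
 proof (cases "z \<ge> b")
  case True then show ?thesis using h_intervene_b[OF True] by (simp add: z' xz)
 next
  case False
  then have "z \<le> a" using z by force
  then show ?thesis using h_intervene_a[of z] False by (simp add: z' xz)
 qed
 have "\<bar>v (y + sb x (Suc n) om) - v (u + sb x (Suc n) om)\<bar> \<le> K * \<bar>y - u\<bar>" "\<bar>v z - v (y + sb x n om)\<bar> \<le> K * \<bar>y - u\<bar>"
  using v(1)[of "y + sb x (Suc n) om" "u + sb x (Suc n) om"] v(1)[of z "y + sb x n om"] by (simp_all add: z_def abs_minus_commute)
 then show ?thesis using hz v(2)[of z] v(2)[of "u + sb x (Suc n) om"] unfolding u_def[symmetric] by linarith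
qed

lemma intervene_chain:
 fixes m0 m1 :: nat
 assumes gd: "good om" and v: "\<And>z z'. \<bar>v z - v z'\<bar> \<le> K * \<bar>z - z'\<bar>" "\<And>z. \<bar>v z - h z\<bar> \<le> \<eta>"
  and m: "m0 \<le> m1" "\<And>n. m0 \<le> n \<Longrightarrow> n < m1 \<Longrightarrow> tb x n om \<noteq> \<top>"
 shows "v (y + sb x m1 om) + (\<Sum>n=m0..<m1. g (xb x n om)) \<le> v (y + sb x m0 om) + (\<Sum>n=m0..<m1. 2 * \<eta> + 2 * K * \<bar>y - Yp \<sigma> x (enn2real (tb x n om)) om\<bar>)"
 using m
proof (induction m1 rule: dec_induct)
 case base show ?case by simp
next
 case (step k)
 have "v (y + sb x k om) + (\<Sum>n=m0..<k. g (xb x n om)) \<le> v (y + sb x m0 om) + (\<Sum>n=m0..<k. 2 * \<eta> + 2 * K * \<bar>y - Yp \<sigma> x (enn2real (tb x n om)) om\<bar>)"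
  using step.IH step.prems by simp
 moreover have "v (y + sb x (Suc k) om) + g (xb x k om) \<le> v (y + sb x k om) + (2 * \<eta> + 2 * K * \<bar>y - Yp \<sigma> x (enn2real (tb x k om)) om\<bar>)"
  by (rule intervene_step[OF gd _ v]) (use step in simp)
 ultimately show ?case using step.hyps by simp
qed

text \<open>Only interventions with index below \<open>L\<close> are tracked; after them the shift
  is frozen. The factor \<open>exp (- lam * ep)\<close> compensates for discounting at the later
  grid time, while the error terms are kept with discount at most 1.\<close>

lemma path_upper_prefix:
 fixes L i :: nat
 assumes gd: "good om" and L: "1 \<le> L" and v: "\<And>z z'. \<bar>v z - v z'\<bar> \<le> K * \<bar>z - z'\<bar>" "\<And>z. \<bar>v z - h z\<bar> \<le> \<eta>" "\<And>z. z \<in> {a..b} \<Longrightarrow> v z = h z"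
  and e: "0 < ep" and A: "\<And>j. j < i \<Longrightarrow> ennreal (real j * ep) < tb x L om"
 shows "exp (- lam * ep) * (\<Sum>n<min L (mt x (real i * ep) om). gb x n om)
   + exp (- lam * (real i * ep)) * v (Yp \<sigma> x (real i * ep) om + sb x (min L (mt x (real i * ep) om)) om)
  \<le> h x + (\<Sum>j<i. exp (- lam * (real (Suc j) * ep)) * v (Xb x (real j * ep) om + Yd \<sigma> (real j * ep) (real (Suc j) * ep) om) - exp (- lam * (real j * ep)) * v (Xb x (real j * ep) om))
   + (\<Sum>n<min L (mt x (real i * ep) om). 2 * \<eta> + 2 * K * er x ep n om)"
 using A
proof (induction i)
 have \<eta>0: "0 \<le> \<eta>" using v(2)[of 0] by (meson abs_ge_zero order_trans)
 have K0: "0 \<le> K" using v(1)[of 1 0] abs_ge_zero[of "v 1 - v 0"] by simp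
 {
  case 0
  \<comment> \<open>Intervention times increase strictly, so at time 0 at most one intervention is
    possible.\<close>
  have m1: "mt x 0 om \<le> 1"
  proof (rule ccontr)
   assume "\<not> ?thesis"
   then have "tb x 1 om \<le> 0" using tb_le_iff[OF gd, of x 1 0] by simp
   moreover from this have "tb x 0 om \<le> 0" using tb_mono[OF gd, of x 0] by (metis One_nat_def order_trans)
   then have "tb x 0 om < tb x 1 om" using tb_strict[OF gd, of x 0] by simp
   ultimately show False by simp
  qed
  have Y0: "Yp \<sigma> x 0 om = x" by (rule Yp_0[OF gd])
  have in0: "v (x + sb x (mt x 0 om) om) = h (x + sb x (mt x 0 om) om)"
   using Xb_inside[OF gd order_refl, of x] v(3) unfolding Xb_mt[OF gd] Y0 by simp
  have ex: "exp (- lam * ep) * g (xb x 0 om) \<le> 1 * g (xb x 0 om)" using lam e by (intro mult_right_mono g_nonneg) simp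
  have "mt x 0 om = 0 \<or> mt x 0 om = 1" using m1 by linarith
  then show ?case
  proof
   assume m: "mt x 0 om = 0" then show ?thesis using in0 Y0 by (simp add: sb_def)
  next
   assume m: "mt x 0 om = 1"
   then have "tb x 0 om = 0" using tb_le_iff[OF gd, of x 0 0] by simp
   then have nt: "tb x 0 om \<noteq> \<top>" and t0: "enn2real (tb x 0 om) = 0" by simp_all
   have ext: "Yp \<sigma> x 0 om + sb x 0 om \<notin> {a<..<b}" using tb_exit[OF gd nt] unfolding t0 .
   have af: "Yp \<sigma> x 0 om + sb x (Suc 0) om = (if Yp \<sigma> x 0 om + sb x 0 om \<ge> b then \<beta> else \<alpha>)" using tb_after[OF gd nt] unfolding t0 .
   have s: "sb x 0 om = 0" "sb x (Suc 0) om = xb x 0 om" by (simp_all add: sb_def)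
   have "h x = h (x + sb x 1 om) + g (xb x 0 om)"
   proof (cases "x \<ge> b")
    case True
    then have "xb x 0 om = \<beta> - x" using af unfolding Y0 s by simp
    then show ?thesis using h_intervene_b[OF True] s by simp
   next
    case False
    then have "xb x 0 om = \<alpha> - x" "x \<le> a" using af ext unfolding Y0 s by auto
    then show ?thesis using h_intervene_a[of x] s by simp
   qed
   moreover have "0 \<le> 2 * \<eta> + 2 * K * er x ep 0 om" using \<eta>0 K0 by (simp add: er_nonneg)
   ultimately show ?thesis using ex in0 m L t0 by (simp add: Y0 gb_def)
  qed
 next
  case (Suc i)
  let ?t = "real i * ep" let ?t' = "real (Suc i) * ep"
  define m0 where "m0 = min L (mt x ?t om)"
  define m1 where "m1 = min L (mt x ?t' om)"
  let ?y = "Yp \<sigma> x ?t' om"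
  have tt: "?t \<le> ?t'" "0 \<le> ?t" using e by (simp_all add: mult_right_mono)
  have m01: "m0 \<le> m1" unfolding m0_def m1_def by (intro min.mono order_refl mt_mono[OF gd tt(1)])
  have "ennreal ?t < tb x L om" using Suc.prems by simp
  then have "\<not> L < mt x ?t om" unfolding tb_le_iff[OF gd, symmetric] not_le .
  then have m0: "m0 = mt x ?t om" by (simp add: m0_def)
  have tn: "tb x n om \<noteq> \<top> \<and> ?t < enn2real (tb x n om) \<and> enn2real (tb x n om) \<le> ?t'" if "m0 \<le> n" "n < m1" for n
  proof -
   have 1: "tb x n om \<le> ennreal ?t'" using that tb_le_iff[OF gd] by (simp add: m1_def)
   have "\<not> n < mt x ?t om" using that m0 by simp
   then have 2: "ennreal ?t < tb x n om" unfolding tb_le_iff[OF gd, symmetric] not_le .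
   have nt: "tb x n om \<noteq> \<top>" using 1 by (auto simp: top_unique)
   then have u: "tb x n om = ennreal (enn2real (tb x n om))" by (simp add: less_top[symmetric])
   have "ennreal ?t < ennreal (enn2real (tb x n om))" using 2 unfolding u[symmetric] .
   then have "?t < enn2real (tb x n om)" using tt(2) by (simp only: ennreal_less_iff)
   moreover have "enn2real (tb x n om) \<le> ?t'" by (rule enn2real_leI[OF _ 1]) (use e in simp)
   ultimately show ?thesis using nt by blast
  qed
  have ern: "er x ep n om = \<bar>?y - Yp \<sigma> x (enn2real (tb x n om)) om\<bar>" if "m0 \<le> n" "n < m1" for n
  proof -
   have "cl ep (enn2real (tb x n om)) = ?t'" by (rule cl_unique[OF e]) (use tn[OF that] in simp_all)
   then show ?thesis using tn[OF that] by (simp add: er_def)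
  qed
  have ch: "v (?y + sb x m1 om) + (\<Sum>n=m0..<m1. g (xb x n om)) \<le> v (?y + sb x m0 om) + (\<Sum>n=m0..<m1. 2 * \<eta> + 2 * K * er x ep n om)"
   using intervene_chain[OF gd v(1,2) m01, of x ?y] tn ern by simp
  let ?e = "exp (- lam * ?t')"
  have e1: "?e \<le> 1" "0 \<le> ?e" using lam e by simp_all
  have s0: "0 \<le> (\<Sum>n=m0..<m1. 2 * \<eta> + 2 * K * er x ep n om)" using \<eta>0 K0 by (intro sum_nonneg) (simp add: er_nonneg)
  have "?e * (v (?y + sb x m1 om) + (\<Sum>n=m0..<m1. g (xb x n om))) \<le> ?e * (v (?y + sb x m0 om) + (\<Sum>n=m0..<m1. 2 * \<eta> + 2 * K * er x ep n om))"
   by (rule mult_left_mono[OF ch e1(2)])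
  moreover have "?e * (\<Sum>n=m0..<m1. 2 * \<eta> + 2 * K * er x ep n om) \<le> 1 * (\<Sum>n=m0..<m1. 2 * \<eta> + 2 * K * er x ep n om)"
   by (rule mult_right_mono[OF e1(1) s0])
  moreover have "exp (- lam * ep) * (\<Sum>n=m0..<m1. gb x n om) \<le> ?e * (\<Sum>n=m0..<m1. g (xb x n om))"
   unfolding sum_distrib_left
  proof (rule sum_mono)
   fix n assume "n \<in> {m0..<m1}"
   then have "?t < enn2real (tb x n om)" using tn by simp
   then have "?t' \<le> enn2real (tb x n om) + ep" by (simp add: algebra_simps)
   then have "lam * ?t' \<le> lam * (enn2real (tb x n om) + ep)" using lam by (intro mult_left_mono) auto
   then have "exp (- lam * ep + - lam * enn2real (tb x n om)) \<le> ?e" by (simp add: algebra_simps)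
   then have "exp (- lam * ep) * exp (- lam * enn2real (tb x n om)) * g (xb x n om) \<le> ?e * g (xb x n om)" unfolding exp_add by (rule mult_right_mono[OF _ g_nonneg])
   then show "exp (- lam * ep) * gb x n om \<le> ?e * g (xb x n om)" by (simp add: gb_def mult.assoc)
  qed
  moreover have "exp (- lam * ep) * (\<Sum>n<m1. gb x n om) = exp (- lam * ep) * (\<Sum>n<m0. gb x n om) + exp (- lam * ep) * (\<Sum>n=m0..<m1. gb x n om)"
   unfolding sum_lessThan_split[OF m01] by (rule distrib_left)
  moreover note sum_lessThan_split[OF m01, of "\<lambda>n. 2 * \<eta> + 2 * K * er x ep n om"]
  moreover
  have Xj: "Xb x ?t om = Yp \<sigma> x ?t om + sb x m0 om" unfolding m0 by (rule Xb_mt[OF gd])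
  then have Xd: "Xb x ?t om + Yd \<sigma> ?t ?t' om = ?y + sb x m0 om" using Yd_Yp[of \<sigma> x ?t' om ?t] by simp
  moreover have "exp (- lam * ep) * (\<Sum>n<m0. gb x n om) + exp (- lam * ?t) * v (Yp \<sigma> x ?t om + sb x m0 om)
  \<le> h x + (\<Sum>j<i. exp (- lam * (real (Suc j) * ep)) * v (Xb x (real j * ep) om + Yd \<sigma> (real j * ep) (real (Suc j) * ep) om) - exp (- lam * (real j * ep)) * v (Xb x (real j * ep) om))
   + (\<Sum>n<m0. 2 * \<eta> + 2 * K * er x ep n om)"
   unfolding m0_def by (rule Suc.IH) (use Suc.prems in simp)
  ultimately show ?case unfolding m1_def[symmetric] sum.lessThan_Suc distrib_left Xd unfolding Xj by linarith
 }
qed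

text \<open>The discount at the intervention that stops the estimate, with value 0 if it never
  happens, in accordance with an infinite time. It weights the terminal value that is lost by
  stopping.\<close>

definition dl where "dl x L om = (if tb x L om = \<top> then 0 else exp (- lam * enn2real (tb x L om)))"
definition GL where "GL x L T om = (\<Sum>n<L. if tb x n om \<le> ennreal T then gb x n om else 0)"
definition AS where "AS x L t = {om\<in>space M. ennreal t < tb x L om}"
definition ps where "ps x L t om = indicator (AS x L t) om * (exp (- lam * t) * (Xb x t om - \<rho>)\<^sup>2)"

lemma gb_measurable [measurable]: "gb x n \<in> borel_measurable M" unfolding gb_def[abs_def] by measurable
lemma dl_measurable [measurable]: "dl x L \<in> borel_measurable M" unfolding dl_def[abs_def] by measurable
lemma GL_measurable [measurable]: "GL x L T \<in> borel_measurable M" unfolding GL_def[abs_def] by measurable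
lemma GL_nonneg: "0 \<le> GL x L T om" unfolding GL_def by (intro sum_nonneg) (simp add: gb_nonneg)
lemma dl_bounds: "0 \<le> dl x L om" "dl x L om \<le> 1" using lam by (auto simp: dl_def)
lemma dl_integrable: "integrable M (dl x L)"
 by (rule integrable_const_bound[where B=1]) (use dl_bounds in auto)

lemma GL_mt: "good om \<Longrightarrow> GL x L T om = (\<Sum>n<min L (mt x T om). gb x n om)"
proof -
 assume g: "good om"
 have "{..<min L (mt x T om)} = {n\<in>{..<L}. n < mt x T om}" by auto
 then show ?thesis unfolding GL_def tb_le_iff[OF g] by (simp only: sum.inter_filter[OF finite_lessThan])
qed

lemma AS_Fl: "0 \<le> t \<Longrightarrow> AS x L t \<in> Fl t"
proof -
 assume t: "0 \<le> t"
 interpret S: sigma_algebra "space M" "Fl t" by (rule Fl_sigma_algebra)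
 have "AS x L t = space M - {om\<in>space M. tb x L om \<le> ennreal t}" by (auto simp: AS_def)
 also have "\<dots> \<in> Fl t" using tb_stopping[of x L] t by (intro S.compl_sets) (simp add: is_stopping_time_def)
 finally show ?thesis .
qed

lemma AS_sets [measurable]: "0 \<le> t \<Longrightarrow> AS x L t \<in> sets M" using AS_Fl Fl_sets by blast

lemma Xb_Ft: "0 \<le> t \<Longrightarrow> Xb x t \<in> borel_measurable (Ft t)" by (rule ctrl_X_Ft[OF band_impulse])
lemma Xb_measurable [measurable]: "0 \<le> t \<Longrightarrow> Xb x t \<in> borel_measurable M" by (rule measurable_Ft_M[OF Xb_Ft])

text \<open>The index \<open>i\<close> is the first grid point at which the stopping intervention
  has occurred, or the final index \<open>Jn\<close>. The value of \<open>v\<close> left over there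
  is at least \<open>- (B + \<eta>)\<close>; its discount is \<open>exp (- lam * T)\<close> at the
  final index and otherwise at most \<open>dl x L om\<close>.\<close>

lemma path_upper:
 fixes L Jn :: nat
 assumes gd: "good om" and L: "1 \<le> L" and v: "\<And>z z'. \<bar>v z - v z'\<bar> \<le> K * \<bar>z - z'\<bar>" "\<And>z. \<bar>v z - h z\<bar> \<le> \<eta>" "\<And>z. z \<in> {a..b} \<Longrightarrow> v z = h z"
  and e: "0 < ep" and B: "0 \<le> B" "\<And>z. - B \<le> h z" and T: "T = real Jn * ep"
 shows "exp (- lam * ep) * GL x L T om \<le> h x + (\<Sum>j<Jn. indicator (AS x L (real j * ep)) om *
   (exp (- lam * (real (Suc j) * ep)) * v (Xb x (real j * ep) om + Yd \<sigma> (real j * ep) (real (Suc j) * ep) om) - exp (- lam * (real j * ep)) * v (Xb x (real j * ep) om)))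
  + (B + \<eta>) * (exp (- lam * T) + dl x L om) + (\<Sum>n<L. 2 * \<eta> + 2 * K * er x ep n om)"
proof -
 have \<eta>0: "0 \<le> \<eta>" using v(2)[of 0] by (meson abs_ge_zero order_trans)
 have K0: "0 \<le> K" using v(1)[of 1 0] abs_ge_zero[of "v 1 - v 0"] by simp
 have sp: "om \<in> space M" using gd by (simp add: good_def)
 define A where "A j \<longleftrightarrow> ennreal (real j * ep) < tb x L om" for j :: nat
 define i where "i = (LEAST i. i = Jn \<or> \<not> A i)"
 have i: "i = Jn \<or> \<not> A i" unfolding i_def by (rule LeastI[of _ Jn]) simp
 have iJ: "i \<le> Jn" unfolding i_def by (rule Least_le) simp
 have before: "A j" if "j < i" for j using not_less_Least[OF that[unfolded i_def]] by blast
 have after: "\<not> A j" if "i \<le> j" "j < Jn" for j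
 proof
  assume "A j"
  moreover have "ennreal (real i * ep) \<le> ennreal (real j * ep)" using that e by (intro ennreal_leI mult_right_mono) auto
  ultimately have "A i" unfolding A_def by (rule order.strict_trans1[rotated])
  then show False using i that by simp
 qed
 let ?c = "\<lambda>j. exp (- lam * (real (Suc j) * ep)) * v (Xb x (real j * ep) om + Yd \<sigma> (real j * ep) (real (Suc j) * ep) om) - exp (- lam * (real j * ep)) * v (Xb x (real j * ep) om)"
 have ind: "indicator (AS x L (real j * ep)) om = (if A j then 1 else 0 :: real)" for j using sp by (simp add: AS_def A_def)
 have S: "(\<Sum>j<Jn. indicator (AS x L (real j * ep)) om * ?c j) = (\<Sum>j<i. ?c j)"
 proof -
  have "(\<Sum>j<Jn. indicator (AS x L (real j * ep)) om * ?c j) = (\<Sum>j<i. indicator (AS x L (real j * ep)) om * ?c j)"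
   by (rule sum.mono_neutral_right) (use iJ after in \<open>auto simp: ind\<close>)
  also have "\<dots> = (\<Sum>j<i. ?c j)" by (rule sum.cong[OF refl]) (use before in \<open>simp add: ind\<close>)
  finally show ?thesis .
 qed
 let ?m = "min L (mt x (real i * ep) om)"
 have P: "exp (- lam * ep) * (\<Sum>n<?m. gb x n om) + exp (- lam * (real i * ep)) * v (Yp \<sigma> x (real i * ep) om + sb x ?m om)
  \<le> h x + (\<Sum>j<i. ?c j) + (\<Sum>n<?m. 2 * \<eta> + 2 * K * er x ep n om)"
  by (rule path_upper_prefix[OF gd L v e]) (use before in \<open>simp_all add: A_def\<close>)
 have E: "(\<Sum>n<?m. 2 * \<eta> + 2 * K * er x ep n om) \<le> (\<Sum>n<L. 2 * \<eta> + 2 * K * er x ep n om)"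
  by (rule sum_mono2) (use \<eta>0 K0 in \<open>auto simp: er_nonneg\<close>)
 have G: "GL x L T om \<le> (\<Sum>n<?m. gb x n om) \<and> exp (- lam * (real i * ep)) \<le> exp (- lam * T) + dl x L om"
 proof (cases "i = Jn")
  case True then show ?thesis using dl_bounds(1) by (simp add: GL_mt[OF gd] T)
 next
  case False
  then have nA: "tb x L om \<le> ennreal (real i * ep)" using i by (simp add: A_def)
  then have "L < mt x (real i * ep) om" by (simp add: tb_le_iff[OF gd])
  then have m: "?m = L" by simp
  have "GL x L T om \<le> (\<Sum>n<L. gb x n om)" unfolding GL_def by (rule sum_mono) (simp add: gb_nonneg)
  moreover have "tb x L om \<noteq> \<top>" using nA by (auto simp: top_unique)
  then have "dl x L om = exp (- lam * enn2real (tb x L om))" by (simp add: dl_def)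
  moreover have "enn2real (tb x L om) \<le> real i * ep" by (rule enn2real_leI[OF _ nA]) (use e in simp)
  then have "exp (- lam * (real i * ep)) \<le> exp (- lam * enn2real (tb x L om))" using lam by simp
  moreover have "0 \<le> exp (- lam * T)" by simp
  ultimately show ?thesis unfolding m by linarith
 qed
 have "exp (- lam * ep) * GL x L T om \<le> exp (- lam * ep) * (\<Sum>n<?m. gb x n om)" using G by (intro mult_left_mono) auto
 moreover have "- (B + \<eta>) \<le> v (Yp \<sigma> x (real i * ep) om + sb x ?m om)"
  using v(2)[of "Yp \<sigma> x (real i * ep) om + sb x ?m om"] B(2)[of "Yp \<sigma> x (real i * ep) om + sb x ?m om"] by linarith
 then have "exp (- lam * (real i * ep)) * - (B + \<eta>) \<le> exp (- lam * (real i * ep)) * v (Yp \<sigma> x (real i * ep) om + sb x ?m om)"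
  by (intro mult_left_mono) auto
 then have "- ((B + \<eta>) * exp (- lam * (real i * ep))) \<le> exp (- lam * (real i * ep)) * v (Yp \<sigma> x (real i * ep) om + sb x ?m om)"
  by (simp only: mult_minus_right mult.commute)
 moreover have "(B + \<eta>) * exp (- lam * (real i * ep)) \<le> (B + \<eta>) * (exp (- lam * T) + dl x L om)"
  using G B(1) \<eta>0 by (intro mult_left_mono) auto
 ultimately show ?thesis using P E unfolding S by linarith
qed

section \<open>Expectations of the error terms and of one grid step\<close>

lemma integrable_of_nn_bound:
 fixes q :: "'a \<Rightarrow> real"
 assumes [measurable]: "q \<in> borel_measurable M" and q: "\<And>om. 0 \<le> q om" "(\<integral>\<^sup>+om. ennreal (q om) \<partial>M) \<le> ennreal B" and B: "0 \<le> B"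
 shows "integrable M q" "expectation q \<le> B"
proof -
 show i: "integrable M q"
 proof (rule integrableI_bounded)
  have "(\<integral>\<^sup>+om. ennreal (norm (q om)) \<partial>M) \<le> ennreal B" using q by simp
  then show "(\<integral>\<^sup>+om. ennreal (norm (q om)) \<partial>M) < \<infinity>" by (rule le_less_trans) simp
 qed simp
 have "ennreal (expectation q) \<le> ennreal B" using q nn_integral_eq_integral[OF i] by simp
 then show "expectation q \<le> B" using B by simp
qed

lemma er_expectation:
 assumes e: "0 < ep" "ep \<le> 1 / 2"
 shows "integrable M (er x ep n)" "expectation (er x ep n) \<le> \<bar>\<sigma>\<bar> * sqrt ep + 2 / \<theta> * ep"
proof -
 \<comment> \<open>The noise at the random time is recovered from the policy: after the impulse the
   state is \<open>\<beta>\<close> or \<open>\<alpha>\<close>, and the sign of the impulse tells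
   which.\<close>
 have m: "er x ep n \<in> borel_measurable M"
 proof (rule AE_measurable_M)
  note [measurable] = Yp_cl_measurable[OF tb_measurable]
  show "(\<lambda>om. if tb x n om = \<top> then 0 else \<bar>Yp \<sigma> x (cl ep (enn2real (tb x n om))) om - ((if xb x n om < 0 then \<beta> else \<alpha>) - (\<Sum>i<Suc n. xb x i om))\<bar>) \<in> borel_measurable M"
   by measurable
  show "AE om in M. (if tb x n om = \<top> then 0 else \<bar>Yp \<sigma> x (cl ep (enn2real (tb x n om))) om - ((if xb x n om < 0 then \<beta> else \<alpha>) - (\<Sum>i<Suc n. xb x i om))\<bar>) = er x ep n om"
   using AE_good
  proof eventually_elim
   case (elim om)
   show ?case
   proof (cases "tb x n om = \<top>")
    case False
    let ?u = "Yp \<sigma> x (enn2real (tb x n om)) om"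
    have 1: "?u + sb x (Suc n) om = (if ?u + sb x n om \<ge> b then \<beta> else \<alpha>)" by (rule tb_after[OF elim False])
    have 2: "?u + sb x n om \<notin> {a<..<b}" by (rule tb_exit[OF elim False])
    have "xb x n om < 0 \<longleftrightarrow> ?u + sb x n om \<ge> b" using 1 2 band_par unfolding sb_Suc by (auto split: if_splits)
    then have "(if xb x n om < 0 then \<beta> else \<alpha>) - (\<Sum>i<Suc n. xb x i om) = ?u" using 1 by (simp add: sb_def[of x "Suc n"] split: if_splits)
    then show ?thesis using False by (simp only: er_def if_False)
   qed (simp add: er_def)
  qed
 qed simp
 have "(\<integral>\<^sup>+om. ennreal (er x ep n om) \<partial>M) \<le> ennreal (\<bar>\<sigma>\<bar> * sqrt ep + 2 / \<theta> * ep)"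
  unfolding er_def by (rule stopped_overshoot[OF tb_stopping e])
 moreover have "0 \<le> \<bar>\<sigma>\<bar> * sqrt ep + 2 / \<theta> * ep" using e theta by simp
 ultimately show "integrable M (er x ep n)" "expectation (er x ep n) \<le> \<bar>\<sigma>\<bar> * sqrt ep + 2 / \<theta> * ep"
  by (rule integrable_of_nn_bound[OF m er_nonneg])+
qed

text \<open>\<open>step_ge\<close> for \<open>- v\<close> on the event \<open>AS x L t\<close>; the
  one-step estimate is available because the controlled state lies in the band. The last two claims
  serve the change from left to right Riemann sums.\<close>

lemma band_step:
 fixes v :: "real \<Rightarrow> real" and x :: real and L :: nat
 assumes e: "0 < ep" "ep \<le> 1 / 2" and vl: "\<And>z z'. \<bar>v z - v z'\<bar> \<le> K * \<bar>z - z'\<bar>"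
  and os: "\<And>y. y \<in> {a..b} \<Longrightarrow> - v y + ep * (y - \<rho>)\<^sup>2 - 2 * \<eta> * ep \<le> exp (- lam * ep) * expectation (\<lambda>om. - v (y + (\<sigma> * w ep om + N ep om)))"
  and \<eta>: "0 \<le> \<eta>" and t: "0 \<le> t" and u: "u = t + ep"
 defines "Q \<equiv> \<lambda>om. indicator (AS x L t) om * (exp (- lam * u) * v (Xb x t om + Yd \<sigma> t u om) - exp (- lam * t) * v (Xb x t om))"
 shows "integrable M Q" "expectation Q \<le> 2 * \<eta> * ep - ep * expectation (ps x L t)" "integrable M (ps x L t)"
  "0 \<le> expectation (ps x L t)" "expectation (ps x L t) \<le> (\<bar>a\<bar> + \<bar>b\<bar> + \<bar>\<rho>\<bar>)\<^sup>2"
proof -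
 define \<Psi> where "\<Psi> = (\<bar>a\<bar> + \<bar>b\<bar> + \<bar>\<rho>\<bar>)\<^sup>2"
 let ?I = "\<lambda>om. indicator (AS x L t) om :: real"
 have vm [measurable]: "v \<in> borel_measurable borel" by (rule lipschitz_borel[OF vl])
 have [measurable]: "AS x L t \<in> sets M" "Xb x t \<in> borel_measurable M" using t by (rule AS_sets, rule Xb_measurable)
 have Xin: "AE om in M. Xb x t om \<in> {a..b}"
  using AE_good
 proof eventually_elim
  case (elim om)
  then show ?case using Xb_inside[OF elim t, of x] by simp
 qed
 have ib: "integrable M (\<lambda>om. ?I om * f (Xb x t om))" if [measurable]: "f \<in> borel_measurable borel" and f: "\<And>y. y \<in> {a..b} \<Longrightarrow> \<bar>f y\<bar> \<le> F" for f F
 proof (rule integrable_const_bound[where B="\<bar>F\<bar>"])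
  show "AE om in M. norm (?I om * f (Xb x t om)) \<le> \<bar>F\<bar>"
   using Xin
  proof eventually_elim
   case (elim om)
   then show ?case using f[OF elim] by (auto simp: indicator_def)
  qed
 qed measurable
 have \<phi>b: "(y - \<rho>)\<^sup>2 \<le> \<Psi>" if "y \<in> {a..b}" for y
 proof -
  have "\<bar>y - \<rho>\<bar> \<le> \<bar>\<bar>a\<bar> + \<bar>b\<bar> + \<bar>\<rho>\<bar>\<bar>" using that unfolding atLeastAtMost_iff by linarith
  then show ?thesis unfolding \<Psi>_def by (simp only: abs_le_square_iff)
 qed
 have K0: "0 \<le> K" using vl[of 1 0] abs_ge_zero[of "v 1 - v 0"] by simp
 have vb: "\<bar>v y\<bar> \<le> \<bar>v a\<bar> + K * (b - a)" if "y \<in> {a..b}" for y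
 proof -
  have "K * \<bar>y - a\<bar> \<le> K * (b - a)" using that K0 by (intro mult_left_mono) auto
  then show ?thesis using vl[of y a] by linarith
 qed
 have iv: "integrable M (\<lambda>om. ?I om * v (Xb x t om))" by (rule ib[OF vm vb])
 have i\<phi>: "integrable M (\<lambda>om. ?I om * (Xb x t om - \<rho>)\<^sup>2)" by (rule ib[of "\<lambda>y. (y - \<rho>)\<^sup>2" \<Psi>]) (use \<phi>b in simp_all)
 have i1: "integrable M ?I"
 proof (rule integrable_const_bound[where B=1])
  show "AE om in M. norm (?I om) \<le> 1" by (rule AE_I2) (simp add: indicator_def)
 qed measurable
 have ps_eq: "ps x L t = (\<lambda>om. exp (- lam * t) * (?I om * (Xb x t om - \<rho>)\<^sup>2))" by (simp add: ps_def fun_eq_iff)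
 show ips: "integrable M (ps x L t)" unfolding ps_eq by (rule integrable_mult_right[OF i\<phi>])
 show "0 \<le> expectation (ps x L t)" by (rule Bochner_Integration.integral_nonneg) (simp add: ps_def)
 have "expectation (ps x L t) \<le> expectation (\<lambda>_. \<Psi>)"
 proof (rule integral_mono_AE[OF ips])
  show "AE om in M. ps x L t om \<le> \<Psi>"
   using Xin
  proof eventually_elim
   case (elim om)
   have "exp (- lam * t) * (Xb x t om - \<rho>)\<^sup>2 \<le> 1 * \<Psi>" using lam t by (intro mult_mono \<phi>b elim) auto
   moreover have "0 \<le> \<Psi>" by (simp add: \<Psi>_def)
   ultimately show ?case unfolding ps_def by (auto simp: indicator_def)
  qed
 qed simp
 then show "expectation (ps x L t) \<le> (\<bar>a\<bar> + \<bar>b\<bar> + \<bar>\<rho>\<bar>)\<^sup>2" by (simp add: prob_space \<Psi>_def)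
 define \<psi> where "\<psi> y = exp (lam * ep) * (- v y + ep * (y - \<rho>)\<^sup>2 - 2 * \<eta> * ep)" for y
 have psi_eq: "(\<lambda>om. ?I om * \<psi> (Xb x t om)) = (\<lambda>om. exp (lam * ep) * (ep * (?I om * (Xb x t om - \<rho>)\<^sup>2) - ?I om * v (Xb x t om) - 2 * \<eta> * ep * ?I om))"
  by (simp add: \<psi>_def fun_eq_iff algebra_simps)
 have i\<psi>: "integrable M (\<lambda>om. ?I om * \<psi> (Xb x t om))"
  unfolding psi_eq by (intro integrable_mult_right Bochner_Integration.integrable_diff i\<phi> iv i1)
 have tu: "t < u" "u \<le> t + 1 / 2" "u - t = ep" using u e by simp_all
 have D: "AE om in M. om \<in> AS x L t \<longrightarrow> Xb x t om \<in> {a..b}" using Xin by eventually_elim simp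
 have \<psi>le: "\<psi> y \<le> expectation (\<lambda>om. - v (y + (\<sigma> * w (u - t) om + N (u - t) om)))" if "y \<in> {a..b}" for y
 proof -
  have "\<psi> y \<le> exp (lam * ep) * (exp (- lam * ep) * expectation (\<lambda>om. - v (y + (\<sigma> * w ep om + N ep om))))"
   unfolding \<psi>_def by (rule mult_left_mono[OF os[OF that]]) simp
  also have "\<dots> = expectation (\<lambda>om. - v (y + (\<sigma> * w ep om + N ep om)))" by (simp add: exp_minus)
  finally show ?thesis unfolding tu(3) .
 qed
 have vl': "\<bar>- v z - - v z'\<bar> \<le> K * \<bar>z - z'\<bar>" for z z' using vl[of z z'] by linarith
 have Kb: "\<bar>y\<bar> \<le> \<bar>a\<bar> + \<bar>b\<bar>" if "y \<in> {a..b}" for y using that unfolding atLeastAtMost_iff by linarith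
 note sg = step_ge[OF t tu(1,2) Xb_Ft[OF t] AS_Fl[OF t] vl' D Kb \<psi>le i\<psi>]
 let ?W = "\<lambda>om. ?I om * v (Xb x t om + Yd \<sigma> t u om)"
 have iW: "integrable M ?W" using sg(1) by simp
 have EW: "expectation ?W \<le> - expectation (\<lambda>om. ?I om * \<psi> (Xb x t om))" using sg(2) by simp
 have Q_eq: "Q = (\<lambda>om. exp (- lam * u) * ?W om - exp (- lam * t) * (?I om * v (Xb x t om)))" by (simp add: Q_def fun_eq_iff algebra_simps)
 show "integrable M Q" unfolding Q_eq by (intro integrable_mult_right Bochner_Integration.integrable_diff iW iv)
 have "expectation Q = exp (- lam * u) * expectation ?W - exp (- lam * t) * expectation (\<lambda>om. ?I om * v (Xb x t om))"
  unfolding Q_eq using iW iv by simp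
 also have "\<dots> \<le> exp (- lam * u) * - expectation (\<lambda>om. ?I om * \<psi> (Xb x t om)) - exp (- lam * t) * expectation (\<lambda>om. ?I om * v (Xb x t om))"
  by (intro diff_right_mono mult_left_mono EW) simp
 also have "expectation (\<lambda>om. ?I om * \<psi> (Xb x t om)) = exp (lam * ep) * (ep * expectation (\<lambda>om. ?I om * (Xb x t om - \<rho>)\<^sup>2) - expectation (\<lambda>om. ?I om * v (Xb x t om)) - 2 * \<eta> * ep * expectation ?I)"
  unfolding psi_eq using i\<phi> iv i1 by (simp add: Bochner_Integration.integral_diff)
 also have "exp (- lam * u) * - (exp (lam * ep) * (ep * expectation (\<lambda>om. ?I om * (Xb x t om - \<rho>)\<^sup>2) - expectation (\<lambda>om. ?I om * v (Xb x t om)) - 2 * \<eta> * ep * expectation ?I)) - exp (- lam * t) * expectation (\<lambda>om. ?I om * v (Xb x t om))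
   = exp (- lam * t) * (2 * \<eta> * ep * expectation ?I) - ep * (exp (- lam * t) * expectation (\<lambda>om. ?I om * (Xb x t om - \<rho>)\<^sup>2))"
 proof -
  have x: "exp (- lam * u) * exp (lam * ep) = exp (- lam * t)" unfolding u by (simp add: exp_add[symmetric] algebra_simps)
  show ?thesis unfolding mult_minus_right mult.assoc[symmetric] x by (simp add: algebra_simps)
 qed
 also have "\<dots> \<le> 2 * \<eta> * ep - ep * expectation (ps x L t)"
 proof -
  have "exp (- lam * t) * (2 * \<eta> * ep * expectation ?I) \<le> 1 * (2 * \<eta> * ep * 1)"
   using lam t \<eta> e by (intro mult_mono) (auto simp: measure_nonneg)
  then show ?thesis unfolding ps_eq using i\<phi> by simp
 qed
 finally show "expectation Q \<le> 2 * \<eta> * ep - ep * expectation (ps x L t)" .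
qed

end

lemma liminf_add_ennreal:
 fixes u k :: "nat \<Rightarrow> ennreal"
 shows "liminf u + liminf k \<le> liminf (\<lambda>n. u n + k n)"
proof -
 have "liminf u + liminf k = (SUP n. INF m\<in>{n..}. u m) + (SUP n. INF m\<in>{n..}. k m)" by (simp only: liminf_SUP_INF)
 also have "\<dots> = (SUP n. (INF m\<in>{n..}. u m) + (INF m\<in>{n..}. k m))"
  by (rule ennreal_SUP_add[symmetric]) (auto simp: incseq_def intro!: INF_superset_mono)
 also have "\<dots> \<le> (SUP n. INF m\<in>{n..}. u m + k m)"
  by (rule SUP_mono') (intro INF_greatest add_mono INF_lower, simp_all)
 finally show ?thesis by (simp only: liminf_SUP_INF)
qed

section \<open>The limit in horizon, number of interventions and mesh\<close>

context impulse_problem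
begin

text \<open>By \<open>rf_sum\<close> this is a Riemann sum of the running cost before stopping; it
  is written as an integral so that Fatou applies in time.\<close>

definition rf where "rf x L T ep om = (\<integral>\<^sup>+t. indicator {0<..T} t * ennreal (ps x L (cl ep t) om) \<partial>lborel)"

lemma ps_nonneg: "0 \<le> ps x L t om" by (simp add: ps_def)

lemma ps_measurable: "0 \<le> t \<Longrightarrow> ps x L t \<in> borel_measurable M"
 unfolding ps_def[abs_def] by measurable

lemma rf_sum:
 assumes "0 < ep" "T = real n * ep"
 shows "rf x L T ep om = (\<Sum>j<n. ennreal ep * ennreal (ps x L (real (Suc j) * ep) om))"
 unfolding rf_def assms(2) by (rule cl_step_integral[OF assms(1)])

lemma rf_measurable:
 assumes "0 < ep" "T = real n * ep"
 shows "rf x L T ep \<in> borel_measurable M"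
proof -
 have "(\<lambda>om. \<Sum>j<n. ennreal ep * ennreal (ps x L (real (Suc j) * ep) om)) \<in> borel_measurable M"
  by (intro borel_measurable_sum borel_measurable_times_ennreal borel_measurable_const measurable_compose[OF ps_measurable measurable_ennreal]) (use assms in simp)
 then show ?thesis by (subst rf_sum[OF assms, abs_def])
qed

text \<open>The order of choices matters: first \<open>\<eta>\<close>, then \<open>v\<close>, whose
  constant \<open>K\<close> depends on it, then the mesh, for fixed \<open>T\<close> and
  \<open>L\<close>. The terms with \<open>B\<close> remain, as they vanish only for \<open>T\<close>
  and \<open>L\<close> tending to infinity.\<close>

lemma upper_T:
 fixes L :: nat and x T e B :: real
 assumes L: "1 \<le> L" and T: "0 < T" and e: "0 < e" and B: "0 \<le> B" "\<And>z. - B \<le> h z"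
 defines "U \<equiv> h x + B * (exp (- lam * T) + expectation (dl x L)) + e"
 shows "\<exists>ep n. 0 < ep \<and> ep \<le> e \<and> T = real n * ep \<and> integrable M (GL x L T) \<and> 0 \<le> U \<and>
  (\<integral>\<^sup>+om. rf x L T ep om \<partial>M) + ennreal (exp (- lam * ep) * expectation (GL x L T)) \<le> ennreal U"
proof -
 \<comment> \<open>The denominator covers the generator errors on \<open>[0, T]\<close>, the lower
   bound of \<open>v\<close>, and the two approximation errors of each of \<open>L\<close>
   interventions, in total \<open>e / 2\<close>.\<close>
 define \<eta> where "\<eta> = e / (4 * (T + 1 + real L))"
 have \<eta>: "0 < \<eta>" using e T by (simp add: \<eta>_def)
 have \<eta>e: "2 * \<eta> * T + 2 * \<eta> + 2 * \<eta> * real L = e / 2"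
 proof -
  have "2 * \<eta> * T + 2 * \<eta> + 2 * \<eta> * real L = 2 * \<eta> * (T + 1 + real L)" by (simp add: algebra_simps)
  also have "\<dots> = e / 2" using T unfolding \<eta>_def by (simp add: field_simps)
  finally show ?thesis .
 qed
 obtain v vd K \<delta> where up: "\<And>x. (v has_real_derivative vd x) (at x)" "\<And>x. \<bar>vd x\<bar> \<le> K"
  "\<And>x y. \<bar>vd x - vd y\<bar> \<le> K * \<bar>x - y\<bar>" "\<And>x. \<bar>v x - h x\<bar> \<le> \<eta>" "\<And>x. x \<in> {a..b} \<Longrightarrow> v x = h x"
  "\<delta> > 0" "\<And>y. y \<in> {a..b} \<Longrightarrow> (\<exists>m. \<bar>m\<bar> \<le> K \<and> (\<forall>z. \<bar>z\<bar> \<le> \<delta> \<longrightarrow> v (y + z) \<le> v y + vd y * z + m * z\<^sup>2 / 2) \<and>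
   \<sigma>\<^sup>2 / 2 * m + (jump_mean \<theta> v y - v y) - lam * v y + (y - \<rho>)\<^sup>2 \<le> \<eta>)"
  by (rule upper_step[OF \<eta>], rule that, assumption+)
 have vl: "\<bar>v z - v z'\<bar> \<le> K * \<bar>z - z'\<bar>" for z z' by (rule lip_of_deriv[OF up(1,2)])
 have K0: "0 \<le> K" using up(2)[of 0] abs_ge_zero[of "vd 0"] by linarith
 have "\<exists>ep0>0. \<forall>ep. 0 < ep \<and> ep \<le> ep0 \<longrightarrow> (\<forall>y\<in>{a..b}. - v y - ep * (- (y - \<rho>)\<^sup>2) - 2 * \<eta> * ep \<le> exp (- lam * ep) * expectation (\<lambda>om. - v (y + (\<sigma> * w ep om + N ep om))))"
 proof (rule one_step[where v="\<lambda>y. - v y" and vd="\<lambda>y. - vd y" and K=K and V="\<bar>v a\<bar> + K * (b - a)", OF _ _ _ up(6) lam \<eta>])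
  show "((\<lambda>y. - v y) has_real_derivative - vd y) (at y)" for y by (rule DERIV_minus[OF up(1)])
  show "\<bar>- vd y\<bar> \<le> K" for y using up(2) by simp
  show "\<bar>- vd y - - vd z\<bar> \<le> K * \<bar>y - z\<bar>" for y z using up(3)[of y z] by linarith
  fix y assume y: "y \<in> {a..b}"
  have "K * \<bar>y - a\<bar> \<le> K * (b - a)" using y K0 by (intro mult_left_mono) auto
  then show "\<bar>- v y\<bar> \<le> \<bar>v a\<bar> + K * (b - a)" using vl[of y a] by linarith
  obtain m where m: "\<bar>m\<bar> \<le> K" "\<And>z. \<bar>z\<bar> \<le> \<delta> \<Longrightarrow> v (y + z) \<le> v y + vd y * z + m * z\<^sup>2 / 2"
   "\<sigma>\<^sup>2 / 2 * m + (jump_mean \<theta> v y - v y) - lam * v y + (y - \<rho>)\<^sup>2 \<le> \<eta>" using up(7)[OF y] by blast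
  have jm: "jump_mean \<theta> (\<lambda>y. - v y) y = - jump_mean \<theta> v y" by (simp add: jump_mean_def)
  show "\<exists>m. \<bar>m\<bar> \<le> K \<and> (\<forall>z. \<bar>z\<bar> \<le> \<delta> \<longrightarrow> - v y + - vd y * z + m * z\<^sup>2 / 2 \<le> - v (y + z)) \<and>
    - \<eta> \<le> \<sigma>\<^sup>2 / 2 * m + (jump_mean \<theta> (\<lambda>y. - v y) y - - v y) - lam * - v y + - (y - \<rho>)\<^sup>2"
  proof (intro exI[of _ "- m"] conjI allI impI)
   show "\<bar>- m\<bar> \<le> K" using m(1) by simp
   fix z assume "\<bar>z\<bar> \<le> \<delta>"
   from m(2)[OF this] show "- v y + - vd y * z + - m * z\<^sup>2 / 2 \<le> - v (y + z)" by simp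
  next
   show "- \<eta> \<le> \<sigma>\<^sup>2 / 2 * - m + (jump_mean \<theta> (\<lambda>y. - v y) y - - v y) - lam * - v y + - (y - \<rho>)\<^sup>2"
    using m(3) unfolding jm mult_minus_right by linarith
  qed
 qed
 then obtain ep0 where ep0: "0 < ep0" and os: "\<And>ep y. 0 < ep \<Longrightarrow> ep \<le> ep0 \<Longrightarrow> y \<in> {a..b} \<Longrightarrow> - v y - ep * (- (y - \<rho>)\<^sup>2) - 2 * \<eta> * ep \<le> exp (- lam * ep) * expectation (\<lambda>om. - v (y + (\<sigma> * w ep om + N ep om)))"
  by blast
 define \<Psi> where "\<Psi> = (\<bar>a\<bar> + \<bar>b\<bar> + \<bar>\<rho>\<bar>)\<^sup>2"
 define q where "q m = T / real (Suc m)" for m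
 have ql: "q \<longlonglongrightarrow> 0" unfolding q_def[abs_def] by (rule LIMSEQ_Suc[OF lim_const_over_n])
 have kl: "(\<lambda>m. 2 * K * real L * (\<bar>\<sigma>\<bar> * sqrt (q m) + 2 / \<theta> * q m)) \<longlonglongrightarrow> 2 * K * real L * (\<bar>\<sigma>\<bar> * sqrt 0 + 2 / \<theta> * 0)"
  by (intro tendsto_intros ql)
 have pl: "(\<lambda>m. q m * \<Psi>) \<longlonglongrightarrow> 0 * \<Psi>" by (intro tendsto_intros ql)
 \<comment> \<open>The other half of \<open>e\<close> is shared by the overshoots of the
   interventions and the shift of the Riemann sum.\<close>
 have "eventually (\<lambda>m. q m < min (min ep0 e) (1 / 2) \<and> 2 * K * real L * (\<bar>\<sigma>\<bar> * sqrt (q m) + 2 / \<theta> * q m) < e / 4 \<and> q m * \<Psi> < e / 4) sequentially"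
  using order_tendstoD(2)[OF ql, of "min (min ep0 e) (1 / 2)"] order_tendstoD(2)[OF kl, of "e / 4"] order_tendstoD(2)[OF pl, of "e / 4"] ep0 e
  by (intro eventually_conj) simp_all
 then obtain m where m: "q m < min (min ep0 e) (1 / 2)" "2 * K * real L * (\<bar>\<sigma>\<bar> * sqrt (q m) + 2 / \<theta> * q m) < e / 4" "q m * \<Psi> < e / 4"
  by (auto simp: eventually_sequentially)
 define ep where "ep = q m"
 define n where "n = Suc m"
 define \<kappa> where "\<kappa> = \<bar>\<sigma>\<bar> * sqrt ep + 2 / \<theta> * ep"
 have ep: "0 < ep" "ep \<le> ep0" "ep \<le> e" "ep \<le> 1 / 2" using m(1) T by (simp_all add: ep_def q_def)
 have Tn: "T = real n * ep" by (simp add: ep_def q_def n_def)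
 define p where "p j = expectation (ps x L (real j * ep))" for j :: nat
 define Q where "Q j om = indicator (AS x L (real j * ep)) om *
   (exp (- lam * (real (Suc j) * ep)) * v (Xb x (real j * ep) om + Yd \<sigma> (real j * ep) (real (Suc j) * ep) om) - exp (- lam * (real j * ep)) * v (Xb x (real j * ep) om))" for j om
 have os': "- v y + ep * (y - \<rho>)\<^sup>2 - 2 * \<eta> * ep \<le> exp (- lam * ep) * expectation (\<lambda>om. - v (y + (\<sigma> * w ep om + N ep om)))" if "y \<in> {a..b}" for y
  using os[OF ep(1,2) that] by simp
 have tj: "0 \<le> real j * ep" "real (Suc j) * ep = real j * ep + ep" for j using ep(1) by (simp_all add: algebra_simps)
 note bs = band_step[where x=x and L=L, OF ep(1,4) vl os' less_imp_le[OF \<eta>] tj]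
 have iQ: "integrable M (Q j)" and EQ: "expectation (Q j) \<le> 2 * \<eta> * ep - ep * p j" for j
  unfolding Q_def p_def using bs(1,2)[of j] by simp_all
 have ips: "integrable M (ps x L (real j * ep))" and p0: "0 \<le> p j" and p1: "p j \<le> \<Psi>" for j
  unfolding p_def \<Psi>_def using bs(3,4,5)[of j] by simp_all
 define W where "W om = h x + (\<Sum>j<n. Q j om) + (B + \<eta>) * (exp (- lam * T) + dl x L om) + (\<Sum>n<L. 2 * \<eta> + 2 * K * er x ep n om)" for om
 note ier = er_expectation[OF ep(1,4)]
 have iS: "integrable M (\<lambda>om. \<Sum>j<n. Q j om)" by (intro Bochner_Integration.integrable_sum iQ)
 have iD: "integrable M (\<lambda>om. (B + \<eta>) * (exp (- lam * T) + dl x L om))"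
  by (intro integrable_mult_right Bochner_Integration.integrable_add dl_integrable integrable_const)
 have iR: "integrable M (\<lambda>om. \<Sum>n<L. 2 * \<eta> + 2 * K * er x ep n om)"
  by (intro Bochner_Integration.integrable_sum Bochner_Integration.integrable_add integrable_mult_right integrable_const ier(1))
 have iW: "integrable M W" unfolding W_def[abs_def] by (intro Bochner_Integration.integrable_add integrable_const iS iD iR)
 have path: "AE om in M. exp (- lam * ep) * GL x L T om \<le> W om"
  using AE_good
 proof eventually_elim
  case (elim om)
  show ?case unfolding W_def Q_def by (rule path_upper[OF elim L vl up(4,5) ep(1) B Tn])
 qed
 have iG: "integrable M (GL x L T)"
 proof (rule Bochner_Integration.integrable_bound)
  show "integrable M (\<lambda>om. exp (lam * ep) * W om)" by (rule integrable_mult_right[OF iW])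
  show "AE om in M. norm (GL x L T om) \<le> norm (exp (lam * ep) * W om)"
   using path
  proof eventually_elim
   case (elim om)
   have "exp (lam * ep) * (exp (- lam * ep) * GL x L T om) \<le> exp (lam * ep) * W om" by (rule mult_left_mono[OF elim]) simp
   moreover have "exp (lam * ep) * (exp (- lam * ep) * GL x L T om) = GL x L T om" by (simp add: exp_minus)
   ultimately show ?case using GL_nonneg[of x L T om] unfolding real_norm_def by linarith
  qed
 qed simp
 have "exp (- lam * ep) * expectation (GL x L T) = expectation (\<lambda>om. exp (- lam * ep) * GL x L T om)" by simp
 also have "\<dots> \<le> expectation W" by (rule integral_mono_AE[OF integrable_mult_right[OF iG] iW path])
 also have "\<dots> = h x + expectation (\<lambda>om. \<Sum>j<n. Q j om) + expectation (\<lambda>om. (B + \<eta>) * (exp (- lam * T) + dl x L om)) + expectation (\<lambda>om. \<Sum>n<L. 2 * \<eta> + 2 * K * er x ep n om)"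
  unfolding W_def[abs_def] using iS iD iR by (simp add: prob_space del: integrable_mult_right_iff)
 also have "expectation (\<lambda>om. (B + \<eta>) * (exp (- lam * T) + dl x L om)) = (B + \<eta>) * (exp (- lam * T) + expectation (dl x L))"
  using dl_integrable[of x L] by (simp add: prob_space)
 also have "expectation (\<lambda>om. \<Sum>j<n. Q j om) = (\<Sum>j<n. expectation (Q j))" by (rule Bochner_Integration.integral_sum[OF iQ])
 also have "expectation (\<lambda>om. \<Sum>n<L. 2 * \<eta> + 2 * K * er x ep n om) = (\<Sum>n<L. 2 * \<eta> + 2 * K * expectation (er x ep n))"
  using ier(1) by (subst Bochner_Integration.integral_sum) (auto simp: prob_space)
 finally have main: "exp (- lam * ep) * expectation (GL x L T) \<le> h x + (\<Sum>j<n. expectation (Q j)) + (B + \<eta>) * (exp (- lam * T) + expectation (dl x L)) + (\<Sum>n<L. 2 * \<eta> + 2 * K * expectation (er x ep n))" .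
 have s1: "(\<Sum>j<n. expectation (Q j)) \<le> 2 * \<eta> * T - (\<Sum>j<n. ep * p j)"
 proof -
  have "(\<Sum>j<n. expectation (Q j)) \<le> (\<Sum>j<n. 2 * \<eta> * ep - ep * p j)" by (intro sum_mono EQ)
  also have "\<dots> = 2 * \<eta> * T - (\<Sum>j<n. ep * p j)" unfolding sum_subtractf Tn by simp
  finally show ?thesis .
 qed
 have dl1: "expectation (dl x L) \<le> 1" "0 \<le> expectation (dl x L)"
 proof -
  have "expectation (dl x L) \<le> expectation (\<lambda>_. 1)" by (rule integral_mono[OF dl_integrable]) (simp_all add: dl_bounds)
  then show "expectation (dl x L) \<le> 1" by (simp add: prob_space)
  show "0 \<le> expectation (dl x L)" by (rule Bochner_Integration.integral_nonneg) (simp add: dl_bounds)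
 qed
 have s2: "(B + \<eta>) * (exp (- lam * T) + expectation (dl x L)) \<le> B * (exp (- lam * T) + expectation (dl x L)) + 2 * \<eta>"
 proof -
  have "exp (- lam * T) \<le> 1" using lam T by simp
  then have "exp (- lam * T) + expectation (dl x L) \<le> 2" using dl1(1) by linarith
  then have "\<eta> * (exp (- lam * T) + expectation (dl x L)) \<le> \<eta> * 2" using \<eta> by (intro mult_left_mono) auto
  then show ?thesis by (simp add: distrib_right)
 qed
 have s3: "(\<Sum>n<L. 2 * \<eta> + 2 * K * expectation (er x ep n)) \<le> 2 * \<eta> * real L + e / 4"
 proof -
  have "(\<Sum>n<L. 2 * \<eta> + 2 * K * expectation (er x ep n)) \<le> (\<Sum>n<L. 2 * \<eta> + 2 * K * \<kappa>)"
   unfolding \<kappa>_def using K0 by (intro sum_mono add_left_mono mult_left_mono ier(2)) simp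
  also have "\<dots> = 2 * \<eta> * real L + 2 * K * real L * \<kappa>" by (simp add: algebra_simps)
  finally show ?thesis using m(2) unfolding \<kappa>_def ep_def by linarith
 qed
 have s4: "(\<Sum>j<n. ep * p (Suc j)) \<le> (\<Sum>j<n. ep * p j) + e / 4"
 proof -
  have "(\<Sum>j<n. ep * p (Suc j) - ep * p j) = ep * p n - ep * p 0" by (rule sum_lessThan_telescope[of "\<lambda>j. ep * p j"])
  moreover have "ep * p n \<le> ep * \<Psi>" using ep(1) by (intro mult_left_mono p1) simp
  moreover have "0 \<le> ep * p 0" using ep(1) p0 by simp
  ultimately show ?thesis using m(3) unfolding sum_subtractf ep_def by linarith
 qed
 have tot: "(\<Sum>j<n. ep * p (Suc j)) + exp (- lam * ep) * expectation (GL x L T) \<le> U"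
  using main s1 s2 s3 s4 \<eta>e unfolding U_def by linarith
 have nn: "0 \<le> (\<Sum>j<n. ep * p (Suc j))" "0 \<le> exp (- lam * ep) * expectation (GL x L T)"
  using ep(1) p0 by (simp_all add: sum_nonneg mult_nonneg_nonneg Bochner_Integration.integral_nonneg GL_nonneg)
 have "(\<integral>\<^sup>+om. rf x L T ep om \<partial>M) = (\<Sum>j<n. \<integral>\<^sup>+om. ennreal ep * ennreal (ps x L (real (Suc j) * ep) om) \<partial>M)"
  unfolding rf_sum[OF ep(1) Tn]
  by (rule nn_integral_sum) (intro borel_measurable_times_ennreal borel_measurable_const measurable_compose[OF ps_measurable measurable_ennreal] tj(1))
 also have "\<dots> = (\<Sum>j<n. ennreal (ep * p (Suc j)))"
 proof (rule sum.cong[OF refl])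
  fix j
  have "(\<integral>\<^sup>+om. ennreal ep * ennreal (ps x L (real (Suc j) * ep) om) \<partial>M) = ennreal ep * (\<integral>\<^sup>+om. ennreal (ps x L (real (Suc j) * ep) om) \<partial>M)"
   by (rule nn_integral_cmult) (intro measurable_compose[OF ps_measurable measurable_ennreal] tj(1))
  also have "(\<integral>\<^sup>+om. ennreal (ps x L (real (Suc j) * ep) om) \<partial>M) = ennreal (p (Suc j))"
   unfolding p_def by (rule nn_integral_eq_integral[OF ips]) (simp add: ps_nonneg)
  finally show "(\<integral>\<^sup>+om. ennreal ep * ennreal (ps x L (real (Suc j) * ep) om) \<partial>M) = ennreal (ep * p (Suc j))"
   using ep(1) by (simp only: ennreal_mult' less_imp_le)
 qed
 also have "\<dots> = ennreal (\<Sum>j<n. ep * p (Suc j))" by (rule sum_ennreal) (use ep(1) p0 in simp)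
 finally have "(\<integral>\<^sup>+om. rf x L T ep om \<partial>M) + ennreal (exp (- lam * ep) * expectation (GL x L T)) \<le> ennreal U"
  using tot nn by (simp only: ennreal_plus[symmetric] ennreal_leI)
 moreover have "0 \<le> U" using tot nn by linarith
 ultimately show ?thesis using ep Tn iG by blast
qed

text \<open>Only finitely many interventions occur up to any time \<open>T\<close>, so for large
  \<open>L\<close> the stopping intervention lies beyond \<open>T\<close> or never happens.\<close>

lemma dl_tendsto:
 assumes g: "good om" shows "(\<lambda>L. dl x L om) \<longlonglongrightarrow> 0"
proof (rule LIMSEQ_I)
 fix r :: real assume r: "0 < r"
 \<comment> \<open>Chosen to give \<open>exp (- lam * T) < r\<close>; the summand 1 makes the
   inequality strict.\<close>
 define T where "T = max 0 (1 - ln r / lam)"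
 have "lam * (1 - ln r / lam) \<le> lam * T" using lam by (intro mult_left_mono) (simp_all add: T_def)
 then have "- lam * T < ln r" using lam by (simp add: right_diff_distrib)
 then have eT: "exp (- lam * T) < r" using r by (metis exp_less_mono exp_ln)
 have "norm (dl x L om - 0) < r" if "mt x T om \<le> L" for L
 proof (cases "tb x L om = \<top>")
  case False
  have "\<not> L < mt x T om" using that by simp
  then have "ennreal T < tb x L om" unfolding tb_le_iff[OF g, symmetric] not_le .
  also have "tb x L om = ennreal (enn2real (tb x L om))" using False by (simp add: less_top[symmetric])
  finally have "T < enn2real (tb x L om)" by (simp only: ennreal_less_iff T_def max.cobounded1)
  then have "exp (- lam * enn2real (tb x L om)) \<le> exp (- lam * T)" using lam by simp
  then have "dl x L om \<le> exp (- lam * T)" using False by (simp add: dl_def)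
  then show ?thesis using eT dl_bounds(1)[of x L om] by simp
 qed (use r in \<open>simp add: dl_def\<close>)
 then show "\<exists>n0. \<forall>L\<ge>n0. norm (dl x L om - 0) < r" by blast
qed

lemma dl_expectation_tendsto: "(\<lambda>L. expectation (dl x L)) \<longlonglongrightarrow> 0"
proof -
 have "(\<lambda>L. expectation (dl x L)) \<longlonglongrightarrow> expectation (\<lambda>_. 0)"
 proof (rule integral_dominated_convergence[where w="\<lambda>_. 1"])
  show "AE om in M. (\<lambda>L. dl x L om) \<longlonglongrightarrow> 0" using AE_good by eventually_elim (rule dl_tendsto)
  show "AE om in M. norm (dl x L om) \<le> 1" for L by (rule AE_I2) (simp add: dl_bounds)
 qed simp_all
 then show ?thesis by simp
qed

text \<open>At a fixed time \<open>t > 0\<close> neither the horizon nor the stopping index is felt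
  once \<open>L\<close> is large, and the rounded time tends to \<open>t\<close> from the right.
  Time 0 is a null set, and Fatou in time finishes.\<close>

lemma rcost_le_liminf:
 assumes g: "good om" and q: "\<And>L. 0 < q L" "q \<longlonglongrightarrow> 0"
 shows "rcost lam \<rho> (Xb x) om \<le> liminf (\<lambda>L. rf x (Suc L) (real (Suc L)) (q L) om)"
proof -
 have sp: "om \<in> space M" using g by (simp add: good_def)
 define \<psi> where "\<psi> t = exp (- lam * t) * (Xb x t om - \<rho>)\<^sup>2" for t
 have rc: "rcont \<psi>" unfolding \<psi>_def by (rule rcont_discounted[OF ctrl_X_rcont[OF g good_cgood[OF g]]])
 define F where "F L t = indicator {0<..real (Suc L)} t * ennreal (ps x (Suc L) (cl (q L) t) om)" for L t
 have Fm: "F L \<in> borel_measurable lborel" for L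
 proof -
  have "(\<lambda>t. ennreal (ps x (Suc L) (cl (q L) t) om)) \<in> borel_measurable borel"
   by (rule measurable_compose[OF cl_measurable measurable_ennreal, of "\<lambda>t. ps x (Suc L) t om"])
  then show ?thesis unfolding F_def[abs_def] by measurable
 qed
 have lim: "indicator {0..} t * ennreal (\<psi> t) \<le> liminf (\<lambda>L. F L t)" if t: "t \<noteq> 0" for t
 proof (cases "0 < t")
  case False then show ?thesis using t by (simp add: indicator_def)
 next
  case True
  have c: "(\<lambda>L. cl (q L) t) \<longlonglongrightarrow> t" by (rule cl_tendsto[OF q])
  have "(\<lambda>L. \<psi> (cl (q L) t)) \<longlonglongrightarrow> \<psi> t" by (rule rcont_seq[OF rc less_imp_le[OF True] c cl_ge[OF q(1)]])
  then have "(\<lambda>L. ennreal (\<psi> (cl (q L) t))) \<longlonglongrightarrow> ennreal (\<psi> t)" by (rule tendsto_ennrealI)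
  moreover have "eventually (\<lambda>L. ennreal (\<psi> (cl (q L) t)) = F L t) sequentially"
  proof -
   obtain L0 where L0: "t \<le> real L0" using real_arch_simple by blast
   have "eventually (\<lambda>L. cl (q L) t < t + 1) sequentially" by (rule order_tendstoD(2)[OF c]) simp
   moreover have "eventually (\<lambda>L. max L0 (mt x (t + 1) om) \<le> L) sequentially" by (rule eventually_ge_at_top)
   ultimately show ?thesis
   proof eventually_elim
    case (elim L)
    have "\<not> Suc L < mt x (t + 1) om" using elim by simp
    then have "ennreal (t + 1) < tb x (Suc L) om" unfolding tb_le_iff[OF g, symmetric] not_le .
    moreover have "ennreal (cl (q L) t) \<le> ennreal (t + 1)" using elim by (intro ennreal_leI) simp
    ultimately have "ennreal (cl (q L) t) < tb x (Suc L) om" by (rule order.strict_trans1[rotated])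
    then have "ps x (Suc L) (cl (q L) t) om = \<psi> (cl (q L) t)" using sp by (simp add: ps_def AS_def \<psi>_def)
    moreover have "t \<le> real (Suc L)" using L0 elim by simp
    ultimately show ?case unfolding F_def using True by simp
   qed
  qed
  ultimately have "(\<lambda>L. F L t) \<longlonglongrightarrow> ennreal (\<psi> t)" by (rule Lim_transform_eventually)
  then have "liminf (\<lambda>L. F L t) = ennreal (\<psi> t)" by (intro lim_imp_Liminf) auto
  then show ?thesis using True by simp
 qed
 have "rcost lam \<rho> (Xb x) om = (\<integral>\<^sup>+t. indicator {0..} t * ennreal (\<psi> t) \<partial>lborel)" by (simp add: rcost_def \<psi>_def)
 also have "\<dots> \<le> (\<integral>\<^sup>+t. liminf (\<lambda>L. F L t) \<partial>lborel)"
  by (rule nn_integral_mono_AE[OF eventually_mono[OF AE_lborel_singleton[of "0::real"] lim]])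
 also have "\<dots> \<le> liminf (\<lambda>L. \<integral>\<^sup>+t. F L t \<partial>lborel)" by (rule nn_integral_liminf[OF Fm])
 finally show ?thesis by (simp only: F_def rf_def)
qed

text \<open>Every finite partial sum of the intervention costs is contained in \<open>GL\<close>
  once \<open>L\<close> exceeds its length and its finite intervention times.\<close>

lemma gcost_le_liminf:
 assumes g: "good om" and q: "q \<longlonglongrightarrow> 0"
 shows "gcost lam g (tb x) (xb x) om \<le> liminf (\<lambda>L. ennreal (exp (- lam * q L) * GL x (Suc L) (real (Suc L)) om))"
proof -
 define s where "s n = (if tb x n om = \<top> then 0 else gb x n om)" for n
 have s0: "0 \<le> s n" for n by (simp add: s_def gb_nonneg)
 have "gcost lam g (tb x) (xb x) om = (\<Sum>n. ennreal (s n))"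
  unfolding gcost_def by (rule suminf_cong) (simp add: s_def gb_def)
 also have "\<dots> = (SUP k. \<Sum>n<k. ennreal (s n))" by (rule suminf_eq_SUP)
 also have "\<dots> \<le> liminf (\<lambda>L. ennreal (exp (- lam * q L) * GL x (Suc L) (real (Suc L)) om))"
 proof (rule SUP_least)
  fix k :: nat
  define S where "S = (\<Sum>n<k. s n)"
  obtain L0 where L0: "(\<Sum>n<k. enn2real (tb x n om)) \<le> real L0" using real_arch_simple by blast
  have le: "S \<le> GL x (Suc L) (real (Suc L)) om" if L: "max L0 k \<le> L" for L
  proof -
   have "S \<le> (\<Sum>n<k. if tb x n om \<le> ennreal (real (Suc L)) then gb x n om else 0)"
    unfolding S_def
   proof (rule sum_mono)
    fix n assume n: "n \<in> {..<k}"
    show "s n \<le> (if tb x n om \<le> ennreal (real (Suc L)) then gb x n om else 0)"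
    proof (cases "tb x n om = \<top>")
     case False
     have "enn2real (tb x n om) \<le> (\<Sum>n<k. enn2real (tb x n om))" by (rule member_le_sum[OF n]) simp_all
     then have "enn2real (tb x n om) \<le> real (Suc L)" using L0 L by simp
     then have "ennreal (enn2real (tb x n om)) \<le> ennreal (real (Suc L))" by (rule ennreal_leI)
     moreover have "ennreal (enn2real (tb x n om)) = tb x n om" using False by (simp add: less_top[symmetric])
     ultimately show ?thesis by (simp add: s_def gb_nonneg del: of_nat_Suc)
    qed (simp add: s_def gb_nonneg)
   qed
   also have "\<dots> \<le> GL x (Suc L) (real (Suc L)) om"
    unfolding GL_def by (rule sum_mono2) (use L in \<open>auto simp: gb_nonneg\<close>)
   finally show ?thesis .
  qed
  have "(\<lambda>L. exp (- lam * q L) * S) \<longlonglongrightarrow> exp (- lam * 0) * S" by (intro tendsto_intros q)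
  then have "(\<lambda>L. exp (- lam * q L) * S) \<longlonglongrightarrow> S" by simp
  then have "(\<lambda>L. ennreal (exp (- lam * q L) * S)) \<longlonglongrightarrow> ennreal S" by (rule tendsto_ennrealI)
  then have "ennreal S = liminf (\<lambda>L. ennreal (exp (- lam * q L) * S))" by (intro lim_imp_Liminf[symmetric]) auto
  also have "\<dots> \<le> liminf (\<lambda>L. ennreal (exp (- lam * q L) * GL x (Suc L) (real (Suc L)) om))"
  proof (rule Liminf_mono)
   have "eventually (\<lambda>L. max L0 k \<le> L) sequentially" by (rule eventually_ge_at_top)
   then show "eventually (\<lambda>L. ennreal (exp (- lam * q L) * S) \<le> ennreal (exp (- lam * q L) * GL x (Suc L) (real (Suc L)) om)) sequentially"
    by eventually_elim (intro ennreal_leI mult_left_mono le, simp_all)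
  qed
  finally show "(\<Sum>n<k. ennreal (s n)) \<le> liminf (\<lambda>L. ennreal (exp (- lam * q L) * GL x (Suc L) (real (Suc L)) om))"
   unfolding S_def using s0 by (simp add: sum_ennreal)
 qed
 finally show ?thesis .
qed

text \<open>Horizon and number of interventions grow together, and Fatou is applied to both cost
  parts. Nonnegativity of \<open>h\<close> comes along, since \<open>h x\<close> is a limit of
  nonnegative upper bounds for costs; it is needed because \<open>ennreal\<close> maps negative
  numbers to 0.\<close>

lemma band_cost_le: "0 \<le> h x" "cost M lam \<rho> g (Yp \<sigma> x) (tb x) (xb x) \<le> ennreal (h x)"
proof -
 obtain B where B: "0 \<le> B" "\<And>z. - B \<le> h z" using h_bounded_below by blast
 define U where "U L = h x + B * (exp (- lam * real (Suc L)) + expectation (dl x (Suc L))) + 1 / real (Suc L)" for L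
 have "\<forall>L. \<exists>ep n. 0 < ep \<and> ep \<le> 1 / real (Suc L) \<and> real (Suc L) = real n * ep \<and> integrable M (GL x (Suc L) (real (Suc L))) \<and> 0 \<le> U L \<and>
  (\<integral>\<^sup>+om. rf x (Suc L) (real (Suc L)) ep om \<partial>M) + ennreal (exp (- lam * ep) * expectation (GL x (Suc L) (real (Suc L)))) \<le> ennreal (U L)"
  unfolding U_def by (intro allI upper_T B) simp_all
 then obtain q n where q: "\<And>L. 0 < q L" "\<And>L. q L \<le> 1 / real (Suc L)" "\<And>L. real (Suc L) = real (n L) * q L"
  and iG: "\<And>L. integrable M (GL x (Suc L) (real (Suc L)))" and U0: "\<And>L. 0 \<le> U L"
  and le: "\<And>L. (\<integral>\<^sup>+om. rf x (Suc L) (real (Suc L)) (q L) om \<partial>M) + ennreal (exp (- lam * q L) * expectation (GL x (Suc L) (real (Suc L)))) \<le> ennreal (U L)"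
  by metis
 have inv: "(\<lambda>L. 1 / real (Suc L)) \<longlonglongrightarrow> 0" by (rule LIMSEQ_Suc[OF lim_const_over_n])
 have q0: "q \<longlonglongrightarrow> 0"
  by (rule tendsto_sandwich[OF _ _ tendsto_const[of 0] inv]) (intro always_eventually allI less_imp_le[OF q(1)] q(2))+
 have Ul: "U \<longlonglongrightarrow> h x"
 proof -
  have "filterlim (\<lambda>L. lam * real (Suc L)) at_top sequentially"
   by (rule filterlim_tendsto_pos_mult_at_top[OF tendsto_const lam]) (rule filterlim_compose[OF filterlim_real_sequentially filterlim_Suc])
  then have "(\<lambda>L. exp (- (lam * real (Suc L)))) \<longlonglongrightarrow> 0"
   by (intro filterlim_compose[OF exp_at_bot] filterlim_compose[OF filterlim_uminus_at_bot_at_top])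
  then have ex: "(\<lambda>L. exp (- lam * real (Suc L))) \<longlonglongrightarrow> 0" by simp
  have "(\<lambda>L. h x + B * (exp (- lam * real (Suc L)) + expectation (dl x (Suc L))) + 1 / real (Suc L)) \<longlonglongrightarrow> h x + B * (0 + 0) + 0"
   by (intro tendsto_intros ex LIMSEQ_Suc[OF dl_expectation_tendsto] inv)
  then show ?thesis by (simp add: U_def[abs_def])
 qed
 show "0 \<le> h x" by (rule LIMSEQ_le_const[OF Ul]) (use U0 in blast)
 have GM: "(\<integral>\<^sup>+om. ennreal (exp (- lam * q L) * GL x (Suc L) (real (Suc L)) om) \<partial>M) = ennreal (exp (- lam * q L) * expectation (GL x (Suc L) (real (Suc L))))" for L
  using nn_integral_eq_integral[OF integrable_mult_right[OF iG[of L]], of "exp (- lam * q L)"] by (simp add: GL_nonneg)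
 have R: "(\<integral>\<^sup>+om. rcost lam \<rho> (Xb x) om \<partial>M) \<le> liminf (\<lambda>L. \<integral>\<^sup>+om. rf x (Suc L) (real (Suc L)) (q L) om \<partial>M)"
 proof -
  have "(\<integral>\<^sup>+om. rcost lam \<rho> (Xb x) om \<partial>M) \<le> (\<integral>\<^sup>+om. liminf (\<lambda>L. rf x (Suc L) (real (Suc L)) (q L) om) \<partial>M)"
   by (rule nn_integral_mono_AE) (use AE_good in \<open>eventually_elim, intro rcost_le_liminf q q0\<close>)
  also have "\<dots> \<le> liminf (\<lambda>L. \<integral>\<^sup>+om. rf x (Suc L) (real (Suc L)) (q L) om \<partial>M)"
   by (rule nn_integral_liminf) (rule rf_measurable[OF q(1,3)])
  finally show ?thesis .
 qed
 have G: "(\<integral>\<^sup>+om. gcost lam g (tb x) (xb x) om \<partial>M) \<le> liminf (\<lambda>L. ennreal (exp (- lam * q L) * expectation (GL x (Suc L) (real (Suc L)))))"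
 proof -
  have "(\<integral>\<^sup>+om. gcost lam g (tb x) (xb x) om \<partial>M) \<le> (\<integral>\<^sup>+om. liminf (\<lambda>L. ennreal (exp (- lam * q L) * GL x (Suc L) (real (Suc L)) om)) \<partial>M)"
   by (rule nn_integral_mono_AE) (use AE_good in \<open>eventually_elim, intro gcost_le_liminf q0\<close>)
  also have "\<dots> \<le> liminf (\<lambda>L. \<integral>\<^sup>+om. ennreal (exp (- lam * q L) * GL x (Suc L) (real (Suc L)) om) \<partial>M)"
   by (rule nn_integral_liminf) measurable
  finally show ?thesis unfolding GM .
 qed
 have "cost M lam \<rho> g (Yp \<sigma> x) (tb x) (xb x) = (\<integral>\<^sup>+om. rcost lam \<rho> (Xb x) om \<partial>M) + (\<integral>\<^sup>+om. gcost lam g (tb x) (xb x) om \<partial>M)"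
  by (rule cost_eq[OF band_impulse]) simp
 also have "\<dots> \<le> liminf (\<lambda>L. (\<integral>\<^sup>+om. rf x (Suc L) (real (Suc L)) (q L) om \<partial>M) + ennreal (exp (- lam * q L) * expectation (GL x (Suc L) (real (Suc L)))))"
  by (rule order_trans[OF add_mono[OF R G] liminf_add_ennreal])
 also have "\<dots> \<le> liminf (\<lambda>L. ennreal (U L))" by (intro Liminf_mono always_eventually allI le)
 also have "\<dots> = ennreal (h x)" by (rule lim_imp_Liminf) (auto intro: tendsto_ennrealI[OF Ul])
 finally show "cost M lam \<rho> g (Yp \<sigma> x) (tb x) (xb x) \<le> ennreal (h x)" .
qed

lemma value_eq: "value_fn M (filt M w N) lam \<rho> g (Yp \<sigma> x) = ennreal (h x)"
 and band_optimal: "cost M lam \<rho> g (Yp \<sigma> x) (tb x) (xb x) = ennreal (h x)"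
proof -
 let ?V = "value_fn M (filt M w N) lam \<rho> g (Yp \<sigma> x)"
 have 1: "?V \<le> cost M lam \<rho> g (Yp \<sigma> x) (tb x) (xb x)"
  unfolding value_fn_def using band_admissible by (intro Inf_lower) blast
 have 2: "ennreal (h x) \<le> ?V" unfolding value_fn_def by (rule Inf_greatest) (use lower_bound in blast)
 show "?V = ennreal (h x)" using 1 2 band_cost_le(2) by (meson antisym order_trans)
 show "cost M lam \<rho> g (Yp \<sigma> x) (tb x) (xb x) = ennreal (h x)" using 1 2 band_cost_le(2) by (meson antisym order_trans)
qed

end

theorem theorem7:
  fixes M :: "'a measure" and w :: "real \<Rightarrow> 'a \<Rightarrow> real" and E J :: "nat \<Rightarrow> 'a \<Rightarrow> real"
    and \<sigma> \<theta> lam \<rho> C D c d L1 L2 L3 a \<alpha> \<beta> b c1 c2 c3 :: real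
    and f h :: "real \<Rightarrow> real"
  assumes model: "noise_model M \<theta> w E J"
    and complete: "complete_space_measure M"
    and lam: "lam > 0" and theta: "\<theta> > 0"
    and CD: "C > 0" "D > 0" "c \<ge> 0" "d \<ge> 0"
    and roots: "\<And>y. y \<in> {c1, c2, c3} \<Longrightarrow>
        1/2 * \<sigma>\<^sup>2 * y ^ 3 + \<sigma>\<^sup>2 * \<theta> * y\<^sup>2 + (1/2 * \<sigma>\<^sup>2 * \<theta>\<^sup>2 - lam - 1) * y - \<theta> = 0"
    and root_order: "c1 < - \<theta>" "- \<theta> < c2" "c2 < 0" "0 < c3"
    and L: "L1 \<le> 0" "L2 \<le> 0" "L3 \<le> 0"
    and band_par: "a < \<alpha>" "\<alpha> \<le> \<beta>" "\<beta> < b"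
    and f_def: "f = (\<lambda>x. (1 / lam) * (x - \<rho>)\<^sup>2 + (2 / (\<theta> * lam\<^sup>2)) * (x - \<rho>)
                  + (2 * lam + 2 + \<theta>\<^sup>2 * lam * \<sigma>\<^sup>2) / (lam ^ 3 * \<theta>\<^sup>2)
                  + L1 * exp ((\<theta> + c1) * x) + L2 * exp ((\<theta> + c2) * x) + L3 * exp ((\<theta> + c3) * x))"
    and eq1: "deriv f a = - c" and eq2: "deriv f \<alpha> = - c"
    and eq3: "deriv f b = d" and eq4: "deriv f \<beta> = d"
    and eq5: "f a = f \<alpha> + C + c * (\<alpha> - a)"
    and eq6: "f b = f \<beta> + D + d * (b - \<beta>)"
    and eq7: "1/2 * \<sigma>\<^sup>2 * deriv (deriv f) b + (b - \<rho>)\<^sup>2 - (1 + lam) * f b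
              + exp (\<theta> * b) * (LBINT z:{b..}. (f b + d * (z - b)) * \<theta> * exp (- \<theta> * z)) = 0"
    and h_def: "h = (\<lambda>x. if x \<le> a then f a - c * (x - a) else if x \<le> b then f x else f b + d * (x - b))"
  shows "(\<forall>x. 0 \<le> h x \<and>
            value_fn M (filt M w (cpoisson E J)) lam \<rho> (imp_cost C c D d)
              (\<lambda>t \<omega>. x + \<sigma> * w t \<omega> + cpoisson E J t \<omega>) = ennreal (h x)) \<and>
         (\<forall>x. admissible M (filt M w (cpoisson E J)) lam (\<lambda>t \<omega>. x + \<sigma> * w t \<omega> + cpoisson E J t \<omega>)
                (band_tau a \<alpha> \<beta> b (\<lambda>t \<omega>. x + \<sigma> * w t \<omega> + cpoisson E J t \<omega>))
                (band_xi a \<alpha> \<beta> b (\<lambda>t \<omega>. x + \<sigma> * w t \<omega> + cpoisson E J t \<omega>)) \<and>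
              cost M lam \<rho> (imp_cost C c D d) (\<lambda>t \<omega>. x + \<sigma> * w t \<omega> + cpoisson E J t \<omega>)
                (band_tau a \<alpha> \<beta> b (\<lambda>t \<omega>. x + \<sigma> * w t \<omega> + cpoisson E J t \<omega>))
                (band_xi a \<alpha> \<beta> b (\<lambda>t \<omega>. x + \<sigma> * w t \<omega> + cpoisson E J t \<omega>))
              = value_fn M (filt M w (cpoisson E J)) lam \<rho> (imp_cost C c D d)
                  (\<lambda>t \<omega>. x + \<sigma> * w t \<omega> + cpoisson E J t \<omega>))"
proof -
  interpret impulse_problem M \<theta> w E J \<sigma> lam \<rho> C D c d L1 L2 L3 a \<alpha> \<beta> b c1 c2 c3 f h
    by unfold_locales (fact assms | erule roots | rule assms)+
  have Y: "(\<lambda>t \<omega>. x + \<sigma> * w t \<omega> + cpoisson E J t \<omega>) = Yp \<sigma> x" for x by (simp add: fun_eq_iff Yp_def)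
  have T: "band_tau a \<alpha> \<beta> b (Yp \<sigma> x) = tb x" "band_xi a \<alpha> \<beta> b (Yp \<sigma> x) = xb x" for x
    by (simp_all add: fun_eq_iff tb_def xb_def)
  show ?thesis unfolding Y T value_eq band_optimal using band_cost_le(1) band_admissible by simp
qed

end
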